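(* Let $C$ be a coalgebra over an algebraically closed field $K$. Then $C$ is tame if and only if every finite dimensional subcoalgebra $H$ of $C$ is tame. (That is, tameness of coalgebras is a local property.)
   Context: Let $(S(i))_{i\in I}$ be representatives of the isomorphism types of simple left $C$-comodules; the dimension vector $\underline{\dim}(M)\in\mathbb{N}^{(I)}$ of a finite dimensional left $C$-comodule $M$ has as $i$-th entry the multiplicity of $S(i)$ in a Jordan–Hölder series of $M$. A coalgebra $C$ is tame if for every $v\in\mathbb{N}^{(I)}$ there are finitely many $K$-spaces $L_1,\dots,L_r$ ($r$ depending on $v$), each being both a left $C$-comodule and a right $K[T]$-module in such a way that the coaction $L_s\to C\otimes L_s$ is $K[T]$-linear, and each finitely generated and free as a $K[T]$-module, such that all but possibly finitely many isomorphism types of indecomposable left $C$-comodules $M$ with $\underline{\dim}(M)=v$ are of the form $M\cong L_s\otimes_{K[T]}K[T]/(T-\lambda)$ for some $1\le s\le r$ and some $\lambda\in K$. *)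

theory Defs
  imports "HOL-Library.Poly_Mapping" "HOL-Computational_Algebra.Computational_Algebra"
begin

section \<open>Formal linear combinations and tensor products\<close>

text \<open>
  The free module on a type \<open>'x\<close> over a commutative ring \<open>'r\<close> is \<open>'x \<Rightarrow>\<^sub>0 'r\<close>.
\<close>

definition fs_scale :: "'r::comm_ring_1 \<Rightarrow> ('x \<Rightarrow>\<^sub>0 'r) \<Rightarrow> ('x \<Rightarrow>\<^sub>0 'r)" where
  "fs_scale r t = Poly_Mapping.map ((*) r) t"

lemma lookup_fs_scale: "Poly_Mapping.lookup (fs_scale r t) x = r * Poly_Mapping.lookup t x"
  by (simp add: fs_scale_def Poly_Mapping.map.rep_eq when_def)

interpretation fs: module fs_scale
  by unfold_locales
    (auto intro!: poly_mapping_eqI simp: lookup_fs_scale lookup_add algebra_simps)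

text \<open>Linear extension of \<open>f\<close> to formal linear combinations; \<open>s\<close> is the scaling of the target.\<close>

definition lin_ext :: "('r::zero \<Rightarrow> 'w \<Rightarrow> 'w) \<Rightarrow> ('x \<Rightarrow> 'w::comm_monoid_add) \<Rightarrow> ('x \<Rightarrow>\<^sub>0 'r) \<Rightarrow> 'w" where
  "lin_ext s f t = (\<Sum>x\<in>Poly_Mapping.keys t. s (Poly_Mapping.lookup t x) (f x))"

text \<open>
  The tensor product of modules with carriers \<open>A\<close> and \<open>B\<close> over a commutative ring is the quotient
  of the module of formal sums supported in \<open>A \<times> B\<close> by \<open>tensor_null\<close>.  Tensors are written
  throughout by representing formal sums, and \<open>tensor_eq\<close> is equality in the tensor product.
\<close>

definition tensor_null ::
  "('r::comm_ring_1 \<Rightarrow> 'a::ab_group_add \<Rightarrow> 'a) \<Rightarrow> 'a set \<Rightarrow> ('r \<Rightarrow> 'b::ab_group_add \<Rightarrow> 'b) \<Rightarrow> 'b set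
    \<Rightarrow> ('a \<times> 'b \<Rightarrow>\<^sub>0 'r) set" where
  "tensor_null sA A sB B = module.span fs_scale
     ({Poly_Mapping.single (a + a', b) 1 - Poly_Mapping.single (a, b) 1 - Poly_Mapping.single (a', b) 1
         | a a' b. a \<in> A \<and> a' \<in> A \<and> b \<in> B} \<union>
      {Poly_Mapping.single (a, b + b') 1 - Poly_Mapping.single (a, b) 1 - Poly_Mapping.single (a, b') 1
         | a b b'. a \<in> A \<and> b \<in> B \<and> b' \<in> B} \<union>
      {Poly_Mapping.single (sA r a, b) 1 - Poly_Mapping.single (a, b) r
         | r a b. a \<in> A \<and> b \<in> B} \<union>
      {Poly_Mapping.single (a, sB r b) 1 - Poly_Mapping.single (a, b) r
         | r a b. a \<in> A \<and> b \<in> B})"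

definition tensor_eq where
  "tensor_eq sA A sB B t t' \<longleftrightarrow> t - t' \<in> tensor_null sA A sB B"

text \<open>The formal sums \<open>t \<otimes> c\<close> and \<open>a \<otimes> u\<close> for formal sums \<open>t\<close> and \<open>u\<close>.\<close>

definition formal_right :: "('a \<times> 'b \<Rightarrow>\<^sub>0 'r) \<Rightarrow> 'd \<Rightarrow> ('a \<times> 'b \<times> 'd \<Rightarrow>\<^sub>0 'r::comm_ring_1)" where
  "formal_right t c = lin_ext fs_scale (\<lambda>(a, b). Poly_Mapping.single (a, b, c) 1) t"

definition formal_left :: "'a \<Rightarrow> ('b \<times> 'd \<Rightarrow>\<^sub>0 'r) \<Rightarrow> ('a \<times> 'b \<times> 'd \<Rightarrow>\<^sub>0 'r::comm_ring_1)" where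
  "formal_left a u = lin_ext fs_scale (\<lambda>(b, c). Poly_Mapping.single (a, b, c) 1) u"

text \<open>
  Threefold tensor products are quotients of formal sums of triples; the span below is the
  submodule of trilinear relations.
\<close>

definition tensor_null3 where
  "tensor_null3 sA A sB B sD D = module.span fs_scale
     ({formal_right t d | t d. t \<in> tensor_null sA A sB B \<and> d \<in> D} \<union>
      {formal_left a u | a u. a \<in> A \<and> u \<in> tensor_null sB B sD D})"

definition tensor_eq3 where
  "tensor_eq3 sA A sB B sD D t t' \<longleftrightarrow> t - t' \<in> tensor_null3 sA A sB B sD D"

text \<open>\<open>f\<close> picks representatives of the values of a linear map \<open>W \<rightarrow> A \<otimes> B\<close>.\<close>

definition tensor_valued_linear where
  "tensor_valued_linear sW W sA A sB B f \<longleftrightarrow>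
     (\<forall>w\<in>W. Poly_Mapping.keys (f w) \<subseteq> A \<times> B) \<and>
     (\<forall>w\<in>W. \<forall>w'\<in>W. tensor_eq sA A sB B (f (w + w')) (f w + f w')) \<and>
     (\<forall>r. \<forall>w\<in>W. tensor_eq sA A sB B (f (sW r w)) (fs_scale r (f w)))"

definition id_tensor :: "('m \<Rightarrow> 'n) \<Rightarrow> ('c \<times> 'm \<Rightarrow>\<^sub>0 'k) \<Rightarrow> ('c \<times> 'n \<Rightarrow>\<^sub>0 'k::comm_ring_1)" where
  "id_tensor f t = lin_ext fs_scale (\<lambda>(c, m). Poly_Mapping.single (c, f m) 1) t"

definition fin_dim :: "('k::field \<Rightarrow> 'v::ab_group_add \<Rightarrow> 'v) \<Rightarrow> 'v set \<Rightarrow> bool" where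
  "fin_dim s V \<longleftrightarrow> (\<exists>B. finite B \<and> module.span s B = V)"

section \<open>Coalgebras\<close>

text \<open>
  Underlying spaces are subspaces of an ambient vector space given by a type and a scaling.  Since
  comultiplications and coactions are given by representing formal sums, structures that differ
  only in the choice of representatives are the same structure.
\<close>

record (overloaded) ('k::field, 'c::ab_group_add) coalg =
  cspace :: "'c set"
  cscale :: "'k \<Rightarrow> 'c \<Rightarrow> 'c"
  comult :: "'c \<Rightarrow> ('c \<times> 'c \<Rightarrow>\<^sub>0 'k)"
  counit :: "'c \<Rightarrow> 'k"

definition coalgebra :: "('k::field, 'c::ab_group_add) coalg \<Rightarrow> bool" where
  "coalgebra C \<longleftrightarrow>
     vector_space (cscale C) \<and> module.subspace (cscale C) (cspace C) \<and>
     tensor_valued_linear (cscale C) (cspace C) (cscale C) (cspace C) (cscale C) (cspace C) (comult C) \<and>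
     (\<forall>c\<in>cspace C. \<forall>d\<in>cspace C. counit C (c + d) = counit C c + counit C d) \<and>
     (\<forall>r. \<forall>c\<in>cspace C. counit C (cscale C r c) = r * counit C c) \<and>
     (\<forall>c\<in>cspace C. tensor_eq3 (cscale C) (cspace C) (cscale C) (cspace C) (cscale C) (cspace C)
        (lin_ext fs_scale (\<lambda>(a, b). formal_right (comult C a) b) (comult C c))
        (lin_ext fs_scale (\<lambda>(a, b). formal_left a (comult C b)) (comult C c))) \<and>
     (\<forall>c\<in>cspace C. lin_ext (cscale C) (\<lambda>(a, b). cscale C (counit C a) b) (comult C c) = c) \<and>
     (\<forall>c\<in>cspace C. lin_ext (cscale C) (\<lambda>(a, b). cscale C (counit C b) a) (comult C c) = c)"

text \<open>A subspace with a coalgebra structure for which the inclusion is a coalgebra map.\<close>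

definition subcoalgebra :: "('k::field, 'c::ab_group_add) coalg \<Rightarrow> ('k, 'c) coalg \<Rightarrow> bool" where
  "subcoalgebra H C \<longleftrightarrow>
     coalgebra H \<and> cspace H \<subseteq> cspace C \<and> cscale H = cscale C \<and>
     (\<forall>h\<in>cspace H. tensor_eq (cscale C) (cspace C) (cscale C) (cspace C) (comult H h) (comult C h)) \<and>
     (\<forall>h\<in>cspace H. counit H h = counit C h)"

section \<open>Left comodules\<close>

record (overloaded) ('k::field, 'c, 'm::ab_group_add) comod =
  mspace :: "'m set"
  mscale :: "'k \<Rightarrow> 'm \<Rightarrow> 'm"
  coact :: "'m \<Rightarrow> ('c \<times> 'm \<Rightarrow>\<^sub>0 'k)"

definition comodule ::
  "('k::field, 'c::ab_group_add) coalg \<Rightarrow> ('k, 'c, 'm::ab_group_add) comod \<Rightarrow> bool" where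
  "comodule C M \<longleftrightarrow>
     vector_space (mscale M) \<and> module.subspace (mscale M) (mspace M) \<and>
     tensor_valued_linear (mscale M) (mspace M) (cscale C) (cspace C) (mscale M) (mspace M) (coact M) \<and>
     (\<forall>m\<in>mspace M. tensor_eq3 (cscale C) (cspace C) (cscale C) (cspace C) (mscale M) (mspace M)
        (lin_ext fs_scale (\<lambda>(c, n). formal_right (comult C c) n) (coact M m))
        (lin_ext fs_scale (\<lambda>(c, n). formal_left c (coact M n)) (coact M m))) \<and>
     (\<forall>m\<in>mspace M. lin_ext (mscale M) (\<lambda>(c, n). mscale M (counit C c) n) (coact M m) = m)"

definition comod_hom ::
  "('k::field, 'c::ab_group_add) coalg \<Rightarrow> ('k, 'c, 'm::ab_group_add) comod
    \<Rightarrow> ('k, 'c, 'n::ab_group_add) comod \<Rightarrow> ('m \<Rightarrow> 'n) \<Rightarrow> bool" where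
  "comod_hom C M N f \<longleftrightarrow>
     f ` mspace M \<subseteq> mspace N \<and>
     (\<forall>x\<in>mspace M. \<forall>y\<in>mspace M. f (x + y) = f x + f y) \<and>
     (\<forall>r. \<forall>x\<in>mspace M. f (mscale M r x) = mscale N r (f x)) \<and>
     (\<forall>x\<in>mspace M. tensor_eq (cscale C) (cspace C) (mscale N) (mspace N)
        (id_tensor f (coact M x)) (coact N (f x)))"

definition comod_iso ::
  "('k::field, 'c::ab_group_add) coalg \<Rightarrow> ('k, 'c, 'm::ab_group_add) comod
    \<Rightarrow> ('k, 'c, 'n::ab_group_add) comod \<Rightarrow> bool" where
  "comod_iso C M N \<longleftrightarrow> (\<exists>f. comod_hom C M N f \<and> bij_betw f (mspace M) (mspace N))"

definition subcomodule ::
  "('k::field, 'c::ab_group_add) coalg \<Rightarrow> ('k, 'c, 'm::ab_group_add) comod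
    \<Rightarrow> ('k, 'c, 'm) comod \<Rightarrow> bool" where
  "subcomodule C N M \<longleftrightarrow>
     comodule C N \<and> mspace N \<subseteq> mspace M \<and> mscale N = mscale M \<and> comod_hom C N M (\<lambda>x. x)"

definition simple_comodule ::
  "('k::field, 'c::ab_group_add) coalg \<Rightarrow> ('k, 'c, 'm::ab_group_add) comod \<Rightarrow> bool" where
  "simple_comodule C M \<longleftrightarrow>
     comodule C M \<and> mspace M \<noteq> {0} \<and>
     (\<forall>N. subcomodule C N M \<longrightarrow> mspace N = {0} \<or> mspace N = mspace M)"

definition indecomposable_comodule ::
  "('k::field, 'c::ab_group_add) coalg \<Rightarrow> ('k, 'c, 'm::ab_group_add) comod \<Rightarrow> bool" where
  "indecomposable_comodule C M \<longleftrightarrow>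
     comodule C M \<and> mspace M \<noteq> {0} \<and>
     (\<forall>N N'. subcomodule C N M \<and> subcomodule C N' M \<and>
        {x + y | x y. x \<in> mspace N \<and> y \<in> mspace N'} = mspace M \<and> mspace N \<inter> mspace N' = {0}
        \<longrightarrow> mspace N = {0} \<or> mspace N' = {0})"

text \<open>\<open>M/N \<cong> Q\<close>, where the isomorphism is given by its composition with the projection \<open>M \<rightarrow> M/N\<close>.\<close>

definition quotient_iso ::
  "('k::field, 'c::ab_group_add) coalg \<Rightarrow> ('k, 'c, 'm::ab_group_add) comod
    \<Rightarrow> ('k, 'c, 'm) comod \<Rightarrow> ('k, 'c, 'n::ab_group_add) comod \<Rightarrow> bool" where
  "quotient_iso C M N Q \<longleftrightarrow>
     subcomodule C N M \<and>
     (\<exists>p. comod_hom C M Q p \<and> p ` mspace M = mspace Q \<and> {x \<in> mspace M. p x = 0} = mspace N)"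

text \<open>A Jordan--Hoelder series \<open>0 = Ms!0 \<subset> \<dots> \<subset> Ms!n = M\<close> with factors \<open>Ss!0, \<dots>, Ss!(n-1)\<close>.\<close>

definition jordan_hoelder_series ::
  "('k::field, 'c::ab_group_add) coalg \<Rightarrow> ('k, 'c, 'm::ab_group_add) comod
    \<Rightarrow> ('k, 'c, 'm) comod list \<Rightarrow> ('k, 'c, 'm) comod list \<Rightarrow> bool" where
  "jordan_hoelder_series C M Ms Ss \<longleftrightarrow>
     length Ms = Suc (length Ss) \<and> mspace (Ms ! 0) = {0} \<and> Ms ! length Ss = M \<and>
     (\<forall>k<length Ss. quotient_iso C (Ms ! Suc k) (Ms ! k) (Ss ! k) \<and> simple_comodule C (Ss ! k))"

section \<open>Dimension vectors and tameness\<close>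

text \<open>
  Every vector space of at most countable dimension over \<open>'k\<close> is isomorphic to a subspace of
  \<open>nat \<Rightarrow>\<^sub>0 'k\<close> with \<open>fs_scale\<close>, so finite dimensional comodules (in particular
  the simple ones) are all represented, up to isomorphism, in the following type.
\<close>

type_synonym ('k, 'c) std_comod = "('k, 'c, nat \<Rightarrow>\<^sub>0 'k) comod"

definition iso_class ::
  "('k::field, 'c::ab_group_add) coalg \<Rightarrow> ('k, 'c) std_comod \<Rightarrow> ('k, 'c) std_comod set" where
  "iso_class C M = {N. comodule C N \<and> comod_iso C M N}"

text \<open>
  The index set \<open>I\<close> of the simple comodules consists of their isomorphism types themselves; a
  dimension vector is a finitely supported function on isomorphism types vanishing off \<open>I\<close>.
\<close>

definition simple_types ::
  "('k::field, 'c::ab_group_add) coalg \<Rightarrow> ('k, 'c) std_comod set set" where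
  "simple_types C = {iso_class C S | S. simple_comodule C S}"

definition has_dim_vector ::
  "('k::field, 'c::ab_group_add) coalg \<Rightarrow> ('k, 'c) std_comod
    \<Rightarrow> (('k, 'c) std_comod set \<Rightarrow>\<^sub>0 nat) \<Rightarrow> bool" where
  "has_dim_vector C M v \<longleftrightarrow>
     Poly_Mapping.keys v \<subseteq> simple_types C \<and>
     (\<exists>Ms Ss. jordan_hoelder_series C M Ms Ss \<and>
        (\<forall>i\<in>simple_types C. Poly_Mapping.lookup v i = card {k. k < length Ss \<and> Ss ! k \<in> i}))"

text \<open>
  A comodule that is also a \<open>K[T]\<close>-module, acting through \<open>act\<close>, with \<open>K[T]\<close>-linear coaction, and
  finitely generated free over \<open>K[T]\<close>; the vector space structure is the restriction of \<open>act\<close> to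
  constant polynomials.
\<close>

definition free_poly_comodule ::
  "('k::field, 'c::ab_group_add) coalg \<Rightarrow> ('k, 'c, 'l::ab_group_add) comod
    \<Rightarrow> ('k poly \<Rightarrow> 'l \<Rightarrow> 'l) \<Rightarrow> bool" where
  "free_poly_comodule C L act \<longleftrightarrow>
     comodule C L \<and> module act \<and> module.subspace act (mspace L) \<and>
     mscale L = (\<lambda>r. act [:r:]) \<and>
     (\<forall>q. \<forall>l\<in>mspace L. tensor_eq (cscale C) (cspace C) (mscale L) (mspace L)
        (coact L (act q l)) (id_tensor (act q) (coact L l))) \<and>
     (\<exists>B. finite B \<and> \<not> module.dependent act B \<and> module.span act B = mspace L)"

text \<open>The module \<open>K[T]/(T - \<lambda>)\<close>, with residue classes represented by remainders.\<close>

definition residue_space :: "'k::field \<Rightarrow> 'k poly set" where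
  "residue_space lam = {p mod [:- lam, 1:] | p. True}"

definition residue_scale :: "'k::field \<Rightarrow> 'k poly \<Rightarrow> 'k poly \<Rightarrow> 'k poly" where
  "residue_scale lam q p = (q * p) mod [:- lam, 1:]"

text \<open>
  \<open>M \<cong> L \<otimes> K[T]/(T - \<lambda>)\<close> (tensor product over \<open>K[T]\<close>) as left \<open>C\<close>-comodules.  The isomorphism is
  given by its lift \<open>\<Phi>\<close> to the \<open>K[T]\<close>-module of formal sums, whose kernel has to be the submodule
  of tensor relations; the coaction on the tensor product sends \<open>l \<otimes> n\<close> to
  \<open>\<Sum> c \<otimes> (l' \<otimes> n)\<close> if \<open>\<Sum> c \<otimes> l'\<close> is the coaction of \<open>l\<close>.
\<close>

definition iso_to_specialization ::
  "('k::field, 'c::ab_group_add) coalg \<Rightarrow> ('k, 'c, 'm::ab_group_add) comod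
    \<Rightarrow> ('k, 'c, 'l::ab_group_add) comod \<Rightarrow> ('k poly \<Rightarrow> 'l \<Rightarrow> 'l) \<Rightarrow> 'k \<Rightarrow> bool" where
  "iso_to_specialization C M L act lam \<longleftrightarrow>
     (let F = {t. Poly_Mapping.keys t \<subseteq> mspace L \<times> residue_space lam} in
      \<exists>\<Phi> :: ('l \<times> 'k poly \<Rightarrow>\<^sub>0 'k poly) \<Rightarrow> 'm.
        (\<forall>t\<in>F. \<forall>u\<in>F. \<Phi> (t + u) = \<Phi> t + \<Phi> u) \<and>
        (\<forall>r. \<forall>t\<in>F. \<Phi> (fs_scale [:r:] t) = mscale M r (\<Phi> t)) \<and>
        \<Phi> ` F = mspace M \<and>
        {t \<in> F. \<Phi> t = 0} = tensor_null act (mspace L) (residue_scale lam) (residue_space lam) \<and>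
        (\<forall>l\<in>mspace L. \<forall>n\<in>residue_space lam.
           tensor_eq (cscale C) (cspace C) (mscale M) (mspace M)
             (id_tensor (\<lambda>l'. \<Phi> (Poly_Mapping.single (l', n) 1)) (coact L l))
             (coact M (\<Phi> (Poly_Mapping.single (l, n) 1)))))"

text \<open>
  Every finitely generated free \<open>K[T]\<close>-module is isomorphic to a submodule of
  \<open>nat \<Rightarrow>\<^sub>0 'k poly\<close>, so the families \<open>L\<close> may be taken there.
\<close>

definition tame :: "('k::field, 'c::ab_group_add) coalg \<Rightarrow> bool" where
  "tame C \<longleftrightarrow>
     (\<forall>v. Poly_Mapping.keys v \<subseteq> simple_types C \<longrightarrow>
       (\<exists>Ls :: (('k, 'c, nat \<Rightarrow>\<^sub>0 'k poly) comod \<times> ('k poly \<Rightarrow> (nat \<Rightarrow>\<^sub>0 'k poly) \<Rightarrow> (nat \<Rightarrow>\<^sub>0 'k poly))) set.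
          finite Ls \<and>
          (\<forall>(L, act)\<in>Ls. free_poly_comodule C L act) \<and>
          finite {iso_class C M | M.
            indecomposable_comodule C M \<and> fin_dim (mscale M) (mspace M) \<and> has_dim_vector C M v \<and>
            \<not> (\<exists>(L, act)\<in>Ls. \<exists>lam. iso_to_specialization C M L act lam)}))"

end

theory Submission
  imports Defs
begin

text \<open>
  A left \<open>C\<close>-comodule is a module over the dual algebra of \<open>C\<close>, and it is a comodule over a
  subcoalgebra \<open>H\<close> if and only if the functionals vanishing on \<open>H\<close> annihilate it.

  Let \<open>C\<close> be tame.  A family \<open>L\<close> that is not an \<open>H\<close>-comodule has an element \<open>l\<close> and a functional \<open>\<phi>\<close>
  vanishing on \<open>H\<close> with \<open>\<phi> l \<noteq> 0\<close>.  If \<open>L \<otimes> K[T]/(T - \<lambda>)\<close> is an \<open>H\<close>-comodule, then \<open>T - \<lambda>\<close> divides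
  \<open>\<phi> l\<close>, which happens for finitely many \<open>\<lambda>\<close> because \<open>L\<close> is free; so such families may be dropped.

  Conversely, let all finite dimensional subcoalgebras be tame.  All comodules of dimension vector
  \<open>v\<close> live over one finite dimensional subcoalgebra: in bases adapted to composition series their
  coefficient matrices are block triangular with finitely many possible diagonal blocks, and the
  comultiplication determines an off-diagonal block from those closer to the diagonal up to the
  solution space \<open>Z\<close> of \<open>\<Delta> Y = A \<otimes> Y + Y \<otimes> B\<close>, with \<open>A\<close> and \<open>B\<close> matrices of simple comodules.
  If the entries of \<open>Z\<close> spanned an infinite dimensional space, the extensions with blocks in a large
  finite dimensional subspace of \<open>Z\<close> would depend on too many parameters for a tame subcoalgebra: a
  suitable functional \<open>\<phi>\<close> is nonzero on all relevant families, hence vanishes on finitely many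
  specializations only, and still annihilates infinitely many pairwise nonisomorphic extensions.
\<close>

section \<open>Tensor products over a field\<close>

text \<open>Tensors are given by formal sums, so every axiom and every comparison is tested on
  functionals, which separate tensors over a field. What remains of a comodule is a space with the
  operators \<open>cact M \<phi>\<close>, and in this form the passage between \<open>H\<close> and
  \<open>C\<close> changes only representatives. The constants of the parameter count: let d = a + b
  be the dimension of an extension whose block has a b entries. Vanishing of \<phi> on the block is
  a system of a b equations, so a b + 1 free coefficients admit a nontrivial solution. From d^2 + 1
  groups of coefficients come d^2 + 1 independent solutions, joined to a polynomial curve in a
  parameter t. The curve is not shown to be injective on isomorphism types. Instead the span of the
  matrix entries, of dimension at most d^2, is an isomorphism invariant, and a type hit for
  infinitely many t would force d^2 + 1 independent elements into it. The functional \<phi> is found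
  before this curve, as it must be nonzero on families that tameness provides; it is a general point
  of another curve \<Sum> u^i f i. Infinity of K is used for u and for t.\<close>

definition lin_on ::
  "('r \<Rightarrow> 'a \<Rightarrow> 'a) \<Rightarrow> ('r \<Rightarrow> 'b \<Rightarrow> 'b) \<Rightarrow> 'a::plus set \<Rightarrow> ('a \<Rightarrow> 'b::plus) \<Rightarrow> bool" where
  "lin_on s s' A f \<longleftrightarrow>
     (\<forall>x\<in>A. \<forall>y\<in>A. f (x + y) = f x + f y) \<and> (\<forall>r. \<forall>x\<in>A. f (s r x) = s' r (f x))"

lemma lin_on_add: "lin_on s s' A f \<Longrightarrow> x \<in> A \<Longrightarrow> y \<in> A \<Longrightarrow> f (x + y) = f x + f y"
  by (simp add: lin_on_def)

lemma lin_on_scale: "lin_on s s' A f \<Longrightarrow> x \<in> A \<Longrightarrow> f (s r x) = s' r (f x)"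
  by (simp add: lin_on_def)

lemma lin_on_subset: "lin_on s s' B f \<Longrightarrow> A \<subseteq> B \<Longrightarrow> lin_on s s' A f"
  unfolding lin_on_def by (meson subsetD)

lemma lin_on_0:
  assumes "lin_on s s' A f" "module s" "module s'" "0 \<in> A"
  shows "f 0 = 0"
proof -
  have "f (s 0 0) = s' 0 (f 0)" using assms by (auto simp: lin_on_def)
  then show ?thesis using assms by (simp add: module.scale_zero_left)
qed

lemma lin_on_sum:
  assumes "lin_on s s' A f" "module s" "module s'" "module.subspace s A" "\<And>i. i \<in> I \<Longrightarrow> x i \<in> A"
  shows "f (\<Sum>i\<in>I. x i) = (\<Sum>i\<in>I. f (x i))"
proof -
  interpret module s by fact
  have "(\<Sum>i\<in>I. x i) \<in> A \<and> f (\<Sum>i\<in>I. x i) = (\<Sum>i\<in>I. f (x i))"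
    using assms(5)
  proof (induction I rule: infinite_finite_induct)
    case (insert i I)
    then show ?case using assms(1,4) by (auto simp: lin_on_add subspace_add)
  qed (use assms lin_on_0[OF assms(1-3)] subspace_0 in auto)
  then show ?thesis by blast
qed

lemma lin_on_lincomb:
  assumes "lin_on s s' A f" "module s" "module s'" "module.subspace s A" "\<And>i. i \<in> I \<Longrightarrow> x i \<in> A"
  shows "f (\<Sum>i\<in>I. s (c i) (x i)) = (\<Sum>i\<in>I. s' (c i) (f (x i)))"
proof -
  interpret module s by fact
  show ?thesis
    by (subst lin_on_sum[OF assms(1-4)]) (use assms in \<open>auto simp: lin_on_scale subspace_scale\<close>)
qed

lemma lin_on_diff:
  assumes "lin_on s s' A f" "module s" "module s'" "module.subspace s A" "x \<in> A" "y \<in> A"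
  shows "f (x - y) = f x - f y"
proof -
  interpret module s by fact
  have "f ((x - y) + y) = f (x - y) + f y"
    by (rule lin_on_add[OF assms(1)]) (use assms subspace_diff in auto)
  then show ?thesis by simp
qed

lemma lin_on_comp:
  assumes "lin_on s s' A f" "lin_on s' s'' B g" "f ` A \<subseteq> B"
  shows "lin_on s s'' A (\<lambda>x. g (f x))"
  using assms by (auto simp: lin_on_def image_subset_iff)

lemma module_times: "module ((*) :: 'k::comm_ring_1 \<Rightarrow> 'k \<Rightarrow> 'k)"
  by unfold_locales (auto simp: algebra_simps)

lemma vector_space_times: "vector_space ((*) :: 'k::field \<Rightarrow> 'k \<Rightarrow> 'k)"
  by unfold_locales (auto simp: algebra_simps)

lemma vector_space_fs_scale: "vector_space (fs_scale :: 'k::field \<Rightarrow> ('x \<Rightarrow>\<^sub>0 'k) \<Rightarrow> _)"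
  by unfold_locales (auto intro!: poly_mapping_eqI simp: lookup_fs_scale lookup_add algebra_simps)

lemma module_vs: "vector_space s \<Longrightarrow> module s"
  by (simp add: vector_space_def module_def)

lemma linear_imp_lin_on: "Vector_Spaces.linear s s' f \<Longrightarrow> lin_on s s' A f"
  by (auto simp: lin_on_def Vector_Spaces.linear_def module_hom_def module_hom_axioms_def)

section \<open>Functionals: extension, separation and dual bases\<close>

lemma independent_dual:
  fixes s :: "'k::field \<Rightarrow> 'a::ab_group_add \<Rightarrow> 'a"
  assumes "vector_space s" "\<not> module.dependent s E"
  shows "\<exists>f. lin_on s (*) UNIV f \<and> (\<forall>e\<in>E. f e = h e)"
proof -
  interpret V: vector_space s by fact
  interpret K: vector_space "(*) :: 'k \<Rightarrow> 'k \<Rightarrow> 'k" by (rule vector_space_times)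
  interpret P: vector_space_pair s "(*) :: 'k \<Rightarrow> 'k \<Rightarrow> 'k" ..
  obtain f where "Vector_Spaces.linear s (*) f" "\<forall>e\<in>E. f e = h e"
    using P.linear_independent_extend[OF assms(2), of h] by auto
  then show ?thesis using linear_imp_lin_on by blast
qed

lemma separating_functional:
  fixes s :: "'k::field \<Rightarrow> 'a::ab_group_add \<Rightarrow> 'a"
  assumes "vector_space s" "module.subspace s W" "x \<notin> W"
  shows "\<exists>f. lin_on s (*) UNIV f \<and> (\<forall>w\<in>W. f w = 0) \<and> f x = 1"
proof -
  interpret V: vector_space s by fact
  obtain B where B: "B \<subseteq> W" "V.independent B" "W \<subseteq> V.span B"
    by (rule V.basis_exists)
  have sp: "V.span B = W" using B assms(2) V.span_minimal by blast
  have "V.independent (insert x B)"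
    using B sp assms(3) by (simp add: V.independent_insert)
  then obtain f where f: "lin_on s (*) UNIV f" "\<forall>e\<in>insert x B. f e = (if e = x then 1 else 0)"
    using independent_dual[OF assms(1), of _ "\<lambda>e. if e = x then 1 else 0"] by blast
  have "f w = 0" if "w \<in> V.span B" for w
    using that
  proof (induction rule: V.span_induct_alt)
    case base
    then show ?case using lin_on_0[OF f(1) V.module_axioms module_times] by simp
  next
    case (step c b y)
    then show ?case using f B assms(3) by (auto simp: lin_on_def)
  qed
  then show ?thesis using f sp by auto
qed

lemma functional_eqI:
  fixes s :: "'k::field \<Rightarrow> 'a::ab_group_add \<Rightarrow> 'a"
  assumes "vector_space s" "\<And>f. lin_on s (*) UNIV f \<Longrightarrow> f x = f y"
  shows "x = y"
proof (rule ccontr)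
  interpret V: vector_space s by fact
  assume "x \<noteq> y"
  then have "x - y \<notin> {0}" by simp
  then obtain f where f: "lin_on s (*) UNIV f" "f (x - y) = 1"
    using separating_functional[OF assms(1), of "{0}" "x - y"] V.subspace_single_0 by blast
  then have "f x - f y = 1"
    using lin_on_diff[OF f(1) V.module_axioms module_times V.subspace_UNIV UNIV_I UNIV_I] by metis
  then show False using assms(2)[OF f(1)] by simp
qed

lemma in_subspace_functional:
  fixes s :: "'k::field \<Rightarrow> 'a::ab_group_add \<Rightarrow> 'a"
  assumes "vector_space s" "module.subspace s W"
    "\<And>f. lin_on s (*) UNIV f \<Longrightarrow> (\<And>w. w \<in> W \<Longrightarrow> f w = 0) \<Longrightarrow> f x = 0"
  shows "x \<in> W"
  using separating_functional[OF assms(1,2), of x] assms(3) by force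

lemma in_span_functional:
  fixes s :: "'k::field \<Rightarrow> 'a::ab_group_add \<Rightarrow> 'a"
  assumes "vector_space s"
    "\<And>f. lin_on s (*) UNIV f \<Longrightarrow> (\<And>w. w \<in> W \<Longrightarrow> f w = 0) \<Longrightarrow> f x = 0"
  shows "x \<in> module.span s W"
proof -
  interpret V: vector_space s by fact
  show ?thesis
    by (rule in_subspace_functional[OF assms(1) V.subspace_span]) (use assms(2) V.span_base in blast)
qed

lemma lin_on_vanish_span:
  assumes "lin_on s s' A f" "module s" "module s'" "module.subspace s A" "W \<subseteq> A"
    "\<And>w. w \<in> W \<Longrightarrow> f w = 0" "x \<in> module.span s W"
  shows "f x = 0"
proof -
  interpret V: module s by fact
  interpret V': module s' by fact
  have "x \<in> A \<and> f x = 0"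
    using assms(7)
  proof (induction rule: V.span_induct_alt)
    case base
    then show ?case using lin_on_0[OF assms(1-3)] assms(4) V.subspace_0 by blast
  next
    case (step c b y)
    then show ?case using assms
      by (auto simp: lin_on_add lin_on_scale V.subspace_add V.subspace_scale subsetD)
  qed
  then show ?thesis by blast
qed

text \<open>Functionals such as \<open>counit C\<close> or \<open>convl C f g\<close> are linear on
  the carrier only, while tests are made with total ones; this passes from the former to the latter.
  The extension prescribes the values on a basis of A.\<close>

lemma lin_on_extend:
  fixes s :: "'k::field \<Rightarrow> 'a::ab_group_add \<Rightarrow> 'a"
  assumes "vector_space s" "module.subspace s A" "lin_on s (*) A f"
  shows "\<exists>f'. lin_on s (*) UNIV f' \<and> (\<forall>x\<in>A. f' x = f x)"
proof -
  interpret V: vector_space s by fact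
  obtain B where B: "B \<subseteq> A" "V.independent B" "A \<subseteq> V.span B"
    by (rule V.basis_exists)
  obtain f' where f': "lin_on s (*) UNIV f'" "\<forall>e\<in>B. f' e = f e"
    using independent_dual[OF assms(1) B(2)] by blast
  have "lin_on s (*) A (\<lambda>x. f' x - f x)"
    using f'(1) assms(3) by (simp add: lin_on_def right_diff_distrib)
  then have "f' x - f x = 0" if "x \<in> A" for x
    using lin_on_vanish_span[OF _ V.module_axioms module_times assms(2) B(1), of "\<lambda>x. f' x - f x" x]
      f' that B by auto
  then show ?thesis using f' by auto
qed

text \<open>The basis is chosen inside F, so that its elements inherit membership in a carrier when
  F consists of the legs of a formal sum.\<close>

lemma finite_dual_basis:
  fixes s :: "'k::field \<Rightarrow> 'a::ab_group_add \<Rightarrow> 'a"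
  assumes "vector_space s" "finite F"
  shows "\<exists>E g. finite E \<and> E \<subseteq> F \<and> (\<forall>e\<in>E. lin_on s (*) UNIV (g e)) \<and>
           (\<forall>e\<in>E. \<forall>e'\<in>E. g e e' = (if e = e' then 1 else 0)) \<and>
           (\<forall>x\<in>module.span s F. x = (\<Sum>e\<in>E. s (g e x) e))"
proof -
  interpret V: vector_space s by fact
  obtain E where E: "E \<subseteq> F" "V.independent E" "F \<subseteq> V.span E"
    by (rule V.maximal_independent_subset)
  have fin: "finite E" using E(1) assms(2) finite_subset by blast
  define g where "g e = (SOME g. lin_on s (*) UNIV g \<and> (\<forall>e'\<in>E. g e' = (if e = e' then 1 else 0)))" for e
  have "lin_on s (*) UNIV (g e) \<and> (\<forall>e'\<in>E. g e e' = (if e = e' then 1 else 0))" for e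
    unfolding g_def by (rule someI_ex[OF independent_dual[OF assms(1) E(2)]])
  then have g: "lin_on s (*) UNIV (g e)" "e' \<in> E \<Longrightarrow> g e e' = (if e = e' then 1 else 0)" for e e'
    by auto
  have "x = (\<Sum>e\<in>E. s (g e x) e)" if "x \<in> V.span E" for x
    using that
  proof (induction rule: V.span_induct_alt)
    case base
    then show ?case using lin_on_0[OF g(1) V.module_axioms module_times] by simp
  next
    case (step c b y)
    have "(\<Sum>e\<in>E. s (g e (s c b + y)) e) = (\<Sum>e\<in>E. s (c * g e b) e) + (\<Sum>e\<in>E. s (g e y) e)"
      by (simp add: lin_on_add[OF g(1)] lin_on_scale[OF g(1)] V.scale_left_distrib sum.distrib)
    also have "(\<Sum>e\<in>E. s (c * g e b) e) = (\<Sum>e\<in>E. if e = b then s c b else 0)"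
      by (intro sum.cong) (use step g in auto)
    also have "\<dots> = s c b" using step fin by simp
    finally show ?case using step by simp
  qed
  moreover have "V.span F = V.span E" 
    using V.span_mono[OF E(1)] V.span_minimal[OF E(3) V.subspace_span] by blast
  ultimately show ?thesis using fin E g
    by (intro exI[of _ E] exI[of _ g]) auto
qed

section \<open>Linear extension of maps to formal sums\<close>

lemma lin_ext_superset:
  assumes "module s" "finite S" "Poly_Mapping.keys t \<subseteq> S"
  shows "lin_ext s f t = (\<Sum>x\<in>S. s (Poly_Mapping.lookup t x) (f x))"
proof -
  interpret module s by fact
  show ?thesis unfolding lin_ext_def
    by (rule sum.mono_neutral_left) (use assms in \<open>auto simp: in_keys_iff\<close>)
qed

lemma lin_ext_add:
  assumes "module s"
  shows "lin_ext s f (t + u) = lin_ext s f t + lin_ext s f u"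
proof -
  interpret module s by fact
  let ?S = "Poly_Mapping.keys t \<union> Poly_Mapping.keys u"
  show ?thesis
    using lin_ext_superset[OF assms, of ?S t f] lin_ext_superset[OF assms, of ?S u f]
      lin_ext_superset[OF assms, of ?S "t + u" f] Poly_Mapping.keys_add[of t u]
    by (simp add: lookup_add scale_left_distrib sum.distrib)
qed

lemma keys_fs_scale: "Poly_Mapping.keys (fs_scale r t) \<subseteq> Poly_Mapping.keys t"
  by (auto simp: in_keys_iff lookup_fs_scale)

lemma lin_ext_fs_scale:
  assumes "module s"
  shows "lin_ext s f (fs_scale r t) = s r (lin_ext s f t)"
proof -
  interpret module s by fact
  show ?thesis
    using lin_ext_superset[OF assms _ keys_fs_scale, of t f r]
    by (simp add: lin_ext_def lookup_fs_scale scale_sum_right)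
qed

lemma lin_ext_zero [simp]: "lin_ext s f 0 = 0"
  by (simp add: lin_ext_def)

lemma lin_ext_diff:
  assumes "module s"
  shows "lin_ext s f (t - u) = lin_ext s f t - lin_ext s f u"
  using lin_ext_add[OF assms, of f "t - u" u] by simp

lemma lin_ext_sum:
  assumes "module s"
  shows "lin_ext s f (\<Sum>i\<in>I. t i) = (\<Sum>i\<in>I. lin_ext s f (t i))"
  by (induction I rule: infinite_finite_induct) (auto simp: lin_ext_add[OF assms])

lemma lin_ext_single:
  assumes "module s"
  shows "lin_ext s f (Poly_Mapping.single x r) = s r (f x)"
proof -
  interpret module s by fact
  show ?thesis by (simp add: lin_ext_def)
qed

lemma lin_ext_cong:
  "(\<And>x. x \<in> Poly_Mapping.keys t \<Longrightarrow> f x = g x) \<Longrightarrow> lin_ext s f t = lin_ext s g t"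
  by (simp add: lin_ext_def)

lemma lin_ext_in:
  assumes "module s" "module.subspace s W" "\<And>x. x \<in> Poly_Mapping.keys t \<Longrightarrow> f x \<in> W"
  shows "lin_ext s f t \<in> W"
  unfolding lin_ext_def
  by (intro module.subspace_sum[OF assms(1,2)] module.subspace_scale[OF assms(1,2)] assms(3))

lemma lin_on_lin_ext:
  assumes "lin_on s s' A \<phi>" "module s" "module s'" "module.subspace s A"
    "\<And>x. x \<in> Poly_Mapping.keys t \<Longrightarrow> f x \<in> A"
  shows "\<phi> (lin_ext s f t) = lin_ext s' (\<lambda>x. \<phi> (f x)) t"
  unfolding lin_ext_def by (rule lin_on_lincomb[OF assms])

lemma fs_eq_lin_ext: "(t :: 'x \<Rightarrow>\<^sub>0 'r::comm_ring_1) = lin_ext fs_scale (\<lambda>x. Poly_Mapping.single x 1) t"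
proof (rule poly_mapping_eqI)
  fix x
  have "Poly_Mapping.lookup (lin_ext fs_scale (\<lambda>x. Poly_Mapping.single x 1) t) x =
      (\<Sum>y\<in>Poly_Mapping.keys t. if y = x then Poly_Mapping.lookup t y else 0)"
    unfolding lin_ext_def
    by (simp add: lookup_sum lookup_fs_scale lookup_single when_def if_distrib cong: if_cong)
  also have "\<dots> = Poly_Mapping.lookup t x" by (simp add: in_keys_iff)
  finally show "Poly_Mapping.lookup t x = Poly_Mapping.lookup (lin_ext fs_scale (\<lambda>x. Poly_Mapping.single x 1) t) x"
    by simp
qed

lemma subspace_keys: "module.subspace (fs_scale :: 'r::comm_ring_1 \<Rightarrow> _) {t. Poly_Mapping.keys t \<subseteq> S}"
proof (rule fs.subspaceI)
  fix x y :: "'a \<Rightarrow>\<^sub>0 'r" and c :: 'r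
  assume "x \<in> {t. Poly_Mapping.keys t \<subseteq> S}" "y \<in> {t. Poly_Mapping.keys t \<subseteq> S}"
  then show "x + y \<in> {t. Poly_Mapping.keys t \<subseteq> S}" "fs_scale c x \<in> {t. Poly_Mapping.keys t \<subseteq> S}"
    using Poly_Mapping.keys_add[of x y] keys_fs_scale[of c x] by auto
qed simp

section \<open>Tensors tested on products of functionals\<close>

definition bilin_on where
  "bilin_on sA A sB B s' \<beta> \<longleftrightarrow>
     (\<forall>a\<in>A. lin_on sB s' B (\<beta> a)) \<and> (\<forall>b\<in>B. lin_on sA s' A (\<lambda>a. \<beta> a b))"

lemma subspace_lin_ext_kernel:
  assumes "module s"
  shows "module.subspace fs_scale {t. lin_ext s f t = 0}"
proof -
  interpret module s by fact
  show ?thesis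
    by (rule fs.subspaceI) (auto simp: lin_ext_add[OF assms] lin_ext_fs_scale[OF assms])
qed

text \<open>The easy half of the universal property: a bilinear map sends every generator of the
  relations to zero. It holds over any commutative ring and is used again over K[T].\<close>

lemma lin_ext_tensor_null:
  fixes t :: "'a::ab_group_add \<times> 'b::ab_group_add \<Rightarrow>\<^sub>0 'r::comm_ring_1"
  assumes "module s'" "bilin_on sA A sB B s' \<beta>" "t \<in> tensor_null sA A sB B"
  shows "lin_ext s' (\<lambda>(a, b). \<beta> a b) t = 0"
proof -
  interpret module s' by fact
  have l: "\<And>a. a \<in> A \<Longrightarrow> lin_on sB s' B (\<beta> a)" "\<And>b. b \<in> B \<Longrightarrow> lin_on sA s' A (\<lambda>a. \<beta> a b)"
    using assms(2) by (auto simp: bilin_on_def)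
  have "tensor_null sA A sB B \<subseteq> {t. lin_ext s' (\<lambda>(a, b). \<beta> a b) t = 0}"
    unfolding tensor_null_def
    by (rule fs.span_minimal[OF _ subspace_lin_ext_kernel[OF assms(1)]])
      (auto simp: lin_ext_diff[OF assms(1)] lin_ext_single[OF assms(1)]
         lin_on_add[OF l(1)] lin_on_scale[OF l(1)] lin_on_add[OF l(2)] lin_on_scale[OF l(2)])
  then show ?thesis using assms(3) by auto
qed

lemma tensor_null_subspace: "module.subspace fs_scale (tensor_null sA A sB B)"
  unfolding tensor_null_def by (rule fs.subspace_span)

lemma tensor_null_gens:
  "a \<in> A \<Longrightarrow> a' \<in> A \<Longrightarrow> b \<in> B \<Longrightarrow>
    Poly_Mapping.single (a + a', b) 1 - Poly_Mapping.single (a, b) 1 - Poly_Mapping.single (a', b) 1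
      \<in> tensor_null sA A sB B"
  "a \<in> A \<Longrightarrow> b \<in> B \<Longrightarrow> b' \<in> B \<Longrightarrow>
    Poly_Mapping.single (a, b + b') 1 - Poly_Mapping.single (a, b) 1 - Poly_Mapping.single (a, b') 1
      \<in> tensor_null sA A sB B"
  "a \<in> A \<Longrightarrow> b \<in> B \<Longrightarrow>
    Poly_Mapping.single (sA r a, b) 1 - Poly_Mapping.single (a, b) r \<in> tensor_null sA A sB B"
  "a \<in> A \<Longrightarrow> b \<in> B \<Longrightarrow>
    Poly_Mapping.single (a, sB r b) 1 - Poly_Mapping.single (a, b) r \<in> tensor_null sA A sB B"
  unfolding tensor_null_def by (rule fs.span_base, blast)+

definition ev :: "('a \<Rightarrow> 'r) \<Rightarrow> ('b \<Rightarrow> 'r) \<Rightarrow> ('a \<times> 'b \<Rightarrow>\<^sub>0 'r::comm_ring_1) \<Rightarrow> 'r" where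
  "ev f g t = lin_ext (*) (\<lambda>(a, b). f a * g b) t"

lemma bilin_on_ev:
  assumes "lin_on sA (*) A f" "lin_on sB (*) B g"
  shows "bilin_on sA A sB B (*) (\<lambda>a b. f a * (g b :: 'r::comm_ring_1))"
  using assms by (auto simp: bilin_on_def lin_on_def algebra_simps)

text \<open>A functional \<open>\<psi>\<close> on formal sums that kills the relations is a bilinear form on \<open>A \<times> B\<close>; in a basis
  of the finitely many second factors it is a sum of products of functionals.\<close>

lemma tensor_null_iff:
  fixes sA :: "'k::field \<Rightarrow> 'a::ab_group_add \<Rightarrow> 'a" and sB :: "'k \<Rightarrow> 'b::ab_group_add \<Rightarrow> 'b"
  assumes A: "vector_space sA" "module.subspace sA A" and B: "vector_space sB" "module.subspace sB B"
    and t: "Poly_Mapping.keys t \<subseteq> A \<times> B"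
  shows "t \<in> tensor_null sA A sB B \<longleftrightarrow>
    (\<forall>f g. lin_on sA (*) UNIV f \<longrightarrow> lin_on sB (*) UNIV g \<longrightarrow> ev f g t = 0)"
proof (intro iffI allI impI)
  fix f g assume *: "t \<in> tensor_null sA A sB B" "lin_on sA (*) UNIV f" "lin_on sB (*) UNIV g"
  have "bilin_on sA A sB B (*) (\<lambda>a b. f a * g b)"
    by (rule bilin_on_ev) (use * lin_on_subset in \<open>blast+\<close>)
  then show "ev f g t = 0"
    unfolding ev_def by (rule lin_ext_tensor_null[OF module_times _ *(1)])
next
  assume H: "\<forall>f g. lin_on sA (*) UNIV f \<longrightarrow> lin_on sB (*) UNIV g \<longrightarrow> ev f g t = 0"
  interpret B: vector_space sB by fact
  show "t \<in> tensor_null sA A sB B"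
  proof (rule in_subspace_functional[OF vector_space_fs_scale tensor_null_subspace])
    fix \<psi> assume \<psi>: "lin_on fs_scale (*) UNIV \<psi>" "\<And>w. w \<in> tensor_null sA A sB B \<Longrightarrow> \<psi> w = 0"
    define \<beta> where "\<beta> a b = \<psi> (Poly_Mapping.single (a, b) 1)" for a b
    have \<psi>d: "\<psi> (x - y) = \<psi> x - \<psi> y" for x y
      by (rule lin_on_diff[OF \<psi>(1) fs.module_axioms module_times]) auto
    have \<psi>s: "\<psi> (Poly_Mapping.single (a, b) r) = r * \<beta> a b" for a b r
    proof -
      have "Poly_Mapping.single (a, b) r = fs_scale r (Poly_Mapping.single (a, b) 1)"
        by (rule poly_mapping_eqI) (simp add: lookup_fs_scale lookup_single when_def)
      then show ?thesis using lin_on_scale[OF \<psi>(1)] by (simp add: \<beta>_def)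
    qed
    note g = tensor_null_gens[THEN \<psi>(2), unfolded \<psi>d \<psi>s mult_1]
    have bil: "bilin_on sA A sB B (*) \<beta>"
      unfolding bilin_on_def lin_on_def using g by (auto simp: algebra_simps)
    have \<psi>t: "\<psi> t = lin_ext (*) (\<lambda>(a, b). \<beta> a b) t"
      using lin_on_lin_ext[OF \<psi>(1) fs.module_axioms module_times, of t "\<lambda>x. Poly_Mapping.single x 1"]
      by (simp add: fs_eq_lin_ext[symmetric] \<beta>_def case_prod_unfold)
    obtain E g where E: "finite E" "E \<subseteq> snd ` Poly_Mapping.keys t" "\<forall>e\<in>E. lin_on sB (*) UNIV (g e)"
      "\<forall>x\<in>B.span (snd ` Poly_Mapping.keys t). x = (\<Sum>e\<in>E. sB (g e x) e)"
      using finite_dual_basis[OF B(1), of "snd ` Poly_Mapping.keys t"] by auto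
    have "snd ` Poly_Mapping.keys t \<subseteq> B" using t by fastforce
    then have EB: "E \<subseteq> B" using E(2) by blast
    have "\<beta> a b = (\<Sum>e\<in>E. \<beta> a e * g e b)" if "(a, b) \<in> Poly_Mapping.keys t" for a b
    proof -
      have "a \<in> A" using that t by auto
      then have l: "lin_on sB (*) B (\<beta> a)" using bil by (auto simp: bilin_on_def)
      have "b = (\<Sum>e\<in>E. sB (g e b) e)" 
        using E(4) imageI[OF that, of snd, THEN B.span_base] by simp
      then have "\<beta> a b = \<beta> a (\<Sum>e\<in>E. sB (g e b) e)" by simp
      also have "\<dots> = (\<Sum>e\<in>E. g e b * \<beta> a e)"
        by (rule lin_on_lincomb[OF l B.module_axioms module_times B(2)]) (use EB in auto)
      finally show ?thesis by (simp add: mult.commute)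
    qed
    then have "\<psi> t = lin_ext (*) (\<lambda>(a, b). \<Sum>e\<in>E. \<beta> a e * g e b) t"
      unfolding \<psi>t by (intro lin_ext_cong) auto
    also have "\<dots> = (\<Sum>e\<in>E. ev (\<lambda>a. \<beta> a e) (g e) t)"
      unfolding ev_def lin_ext_def
      by (subst sum.swap) (simp add: case_prod_unfold sum_distrib_left)
    also have "\<dots> = 0"
    proof (rule sum.neutral, safe)
      fix e assume e: "e \<in> E"
      then have "lin_on sA (*) A (\<lambda>a. \<beta> a e)" using bil EB by (auto simp: bilin_on_def)
      \<comment> \<open>The first factor is not expanded in a basis: \<beta> with e as second
        argument is already a functional there, only a partial one.\<close>
      then obtain f where f: "lin_on sA (*) UNIV f" "\<forall>a\<in>A. f a = \<beta> a e"
        using lin_on_extend[OF A] by blast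
      have "ev (\<lambda>a. \<beta> a e) (g e) t = ev f (g e) t"
        unfolding ev_def by (rule lin_ext_cong) (use f t in auto)
      then show "ev (\<lambda>a. \<beta> a e) (g e) t = 0" using H f E(3) e by simp
    qed
    finally show "\<psi> t = 0" .
  qed
qed

lemma ev_add: "ev f g (t + u) = ev f g t + ev f g u"
  unfolding ev_def by (rule lin_ext_add[OF module_times])
lemma ev_diff: "ev f g (t - u) = ev f g t - ev f g u"
  unfolding ev_def by (rule lin_ext_diff[OF module_times])
lemma ev_fs_scale: "ev f g (fs_scale r t) = r * ev f g t"
  unfolding ev_def by (rule lin_ext_fs_scale[OF module_times])
lemma ev_sum: "ev f g (\<Sum>i\<in>I. t i) = (\<Sum>i\<in>I. ev f g (t i))"
  unfolding ev_def by (rule lin_ext_sum[OF module_times])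
lemma ev_single: "ev f g (Poly_Mapping.single (a, b) r) = r * (f a * g b)"
  unfolding ev_def by (simp add: lin_ext_single[OF module_times])

lemma ev_cong:
  "(\<And>a b. (a, b) \<in> Poly_Mapping.keys t \<Longrightarrow> f a = f' a \<and> g b = g' b) \<Longrightarrow> ev f g t = ev f' g' t"
  unfolding ev_def by (rule lin_ext_cong) auto

lemma tensor_eqD:
  fixes sA :: "'r::comm_ring_1 \<Rightarrow> 'a::ab_group_add \<Rightarrow> 'a" and sB :: "'r \<Rightarrow> 'b::ab_group_add \<Rightarrow> 'b"
  assumes "tensor_eq sA A sB B t u" "lin_on sA (*) A f" "lin_on sB (*) B g"
  shows "ev f g t = ev f g u"
proof -
  have "ev f g (t - u) = 0"
    using lin_ext_tensor_null[OF module_times bilin_on_ev[OF assms(2,3)]] assms(1)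
    unfolding tensor_eq_def ev_def by blast
  then show ?thesis by (simp add: ev_diff)
qed

lemma tensor_eqI:
  fixes sA :: "'k::field \<Rightarrow> 'a::ab_group_add \<Rightarrow> 'a" and sB :: "'k \<Rightarrow> 'b::ab_group_add \<Rightarrow> 'b"
  assumes A: "vector_space sA" "module.subspace sA A" and B: "vector_space sB" "module.subspace sB B"
    and t: "Poly_Mapping.keys t \<subseteq> A \<times> B" "Poly_Mapping.keys u \<subseteq> A \<times> B"
    and "\<And>f g. lin_on sA (*) UNIV f \<Longrightarrow> lin_on sB (*) UNIV g \<Longrightarrow> ev f g t = ev f g u"
  shows "tensor_eq sA A sB B t u"
proof -
  have "Poly_Mapping.keys (t - u) \<subseteq> A \<times> B" using t Poly_Mapping.keys_diff[of t u] by blast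
  then show ?thesis
    using tensor_null_iff[OF A B, of "t - u"] assms(7) by (auto simp: tensor_eq_def ev_diff)
qed

text \<open>The contraction f \<otimes> id with values in the second factor. Applied to a coaction
  it yields the operator of f on the comodule.\<close>

definition slice :: "('r \<Rightarrow> 'b \<Rightarrow> 'b) \<Rightarrow> ('a \<Rightarrow> 'r) \<Rightarrow> ('a \<times> 'b \<Rightarrow>\<^sub>0 'r::comm_ring_1) \<Rightarrow> 'b::ab_group_add" where
  "slice s f t = lin_ext s (\<lambda>(a, b). s (f a) b) t"

lemma slice_in:
  assumes "module s" "module.subspace s B" "Poly_Mapping.keys t \<subseteq> A \<times> B"
  shows "slice s f t \<in> B"
  unfolding slice_def
  by (rule lin_ext_in[OF assms(1,2)]) (use assms(3) module.subspace_scale[OF assms(1,2)] in auto)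

lemma slice_add: "module s \<Longrightarrow> slice s f (t + u) = slice s f t + slice s f u"
  unfolding slice_def by (rule lin_ext_add)
lemma slice_fs_scale: "module s \<Longrightarrow> slice s f (fs_scale r t) = s r (slice s f t)"
  unfolding slice_def by (rule lin_ext_fs_scale)
lemma slice_sum: "module s \<Longrightarrow> slice s f (\<Sum>i\<in>I. t i) = (\<Sum>i\<in>I. slice s f (t i))"
  unfolding slice_def by (rule lin_ext_sum)
lemma slice_single: "module s \<Longrightarrow> slice s f (Poly_Mapping.single (a, b) r) = s (r * f a) b"
  unfolding slice_def by (simp add: lin_ext_single module.scale_scale)
lemma slice_cong:
  "(\<And>a b. (a, b) \<in> Poly_Mapping.keys t \<Longrightarrow> f a = f' a) \<Longrightarrow> slice s f t = slice s f' t"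
  unfolding slice_def by (rule lin_ext_cong) auto

lemma lin_on_slice:
  assumes "lin_on s s' B h" "module s" "module s'" "module.subspace s B" "Poly_Mapping.keys t \<subseteq> A \<times> B"
  shows "h (slice s f t) = lin_ext s' (\<lambda>(a, b). s' (f a) (h b)) t"
  unfolding slice_def
  by (subst lin_on_lin_ext[OF assms(1-4)])
    (use assms module.subspace_scale[OF assms(2,4)] in
      \<open>auto intro!: lin_ext_cong simp: lin_on_scale[OF assms(1)]\<close>)

lemma ev_slice:
  assumes "lin_on s (*) B g" "module s" "module.subspace s B" "Poly_Mapping.keys t \<subseteq> A \<times> B"
  shows "ev f g t = g (slice s f t)"
  unfolding lin_on_slice[OF assms(1,2) module_times assms(3,4)] ev_def by simp

text \<open>Functionals on the second factor turn contractions into values of \<open>ev\<close>, so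
  contractions already separate tensors.\<close>

lemma tensor_eq_slice:
  fixes sA :: "'k::field \<Rightarrow> 'a::ab_group_add \<Rightarrow> 'a" and sB :: "'k \<Rightarrow> 'b::ab_group_add \<Rightarrow> 'b"
  assumes A: "vector_space sA" "module.subspace sA A" and B: "vector_space sB" "module.subspace sB B"
    and t: "Poly_Mapping.keys t \<subseteq> A \<times> B" "Poly_Mapping.keys u \<subseteq> A \<times> B"
  shows "tensor_eq sA A sB B t u \<longleftrightarrow> (\<forall>f. lin_on sA (*) UNIV f \<longrightarrow> slice sB f t = slice sB f u)"
proof (intro iffI allI impI)
  fix f assume *: "tensor_eq sA A sB B t u" "lin_on sA (*) UNIV f"
  show "slice sB f t = slice sB f u"
  proof (rule functional_eqI[OF B(1)])
    fix g assume g: "lin_on sB (*) UNIV g"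
    have "ev f g t = ev f g u"
      by (rule tensor_eqD[OF *(1)]) (use * g lin_on_subset in \<open>blast+\<close>)
    then show "g (slice sB f t) = g (slice sB f u)"
      using ev_slice[OF lin_on_subset[OF g] module_vs[OF B(1)] B(2) t(1)]
        ev_slice[OF lin_on_subset[OF g] module_vs[OF B(1)] B(2) t(2)] by simp
  qed
next
  assume "\<forall>f. lin_on sA (*) UNIV f \<longrightarrow> slice sB f t = slice sB f u"
  then show "tensor_eq sA A sB B t u"
    using ev_slice[OF lin_on_subset module_vs[OF B(1)] B(2) t(1)]
      ev_slice[OF lin_on_subset module_vs[OF B(1)] B(2) t(2)]
    by (intro tensor_eqI[OF A B t]) simp
qed

lemma tensor_eq_sliceD:
  fixes sA :: "'k::field \<Rightarrow> 'a::ab_group_add \<Rightarrow> 'a" and sB :: "'k \<Rightarrow> 'b::ab_group_add \<Rightarrow> 'b"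
  assumes "tensor_eq sA A sB B t u" "vector_space sB" "module.subspace sB B" "lin_on sA (*) A f"
    and t: "Poly_Mapping.keys t \<subseteq> A \<times> B" "Poly_Mapping.keys u \<subseteq> A \<times> B"
  shows "slice sB f t = slice sB f u"
proof (rule functional_eqI[OF assms(2)])
  fix g assume g: "lin_on sB (*) UNIV g"
  have "ev f g t = ev f g u"
    by (rule tensor_eqD[OF assms(1,4)]) (use g lin_on_subset in blast)
  then show "g (slice sB f t) = g (slice sB f u)"
    using ev_slice[OF lin_on_subset[OF g] module_vs[OF assms(2)] assms(3) t(1)]
      ev_slice[OF lin_on_subset[OF g] module_vs[OF assms(2)] assms(3) t(2)] by simp
qed

text \<open>The source of new representatives over a subspace or a subcoalgebra. In a basis E of the
  space of all contractions, t is a sum of c e \<otimes> e. A functional vanishing on A' has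
  contraction zero, hence kills every c e, so c e lies in A'.\<close>

lemma tensor_restrict:
  fixes sA :: "'k::field \<Rightarrow> 'a::ab_group_add \<Rightarrow> 'a" and sB :: "'k \<Rightarrow> 'b::ab_group_add \<Rightarrow> 'b"
  assumes A: "vector_space sA" "module.subspace sA A'" and B: "vector_space sB" "module.subspace sB B'"
    and b: "\<And>f. lin_on sA (*) UNIV f \<Longrightarrow> slice sB f t \<in> B'"
    and a: "\<And>f. lin_on sA (*) UNIV f \<Longrightarrow> (\<And>x. x \<in> A' \<Longrightarrow> f x = 0) \<Longrightarrow> slice sB f t = 0"
  shows "\<exists>t'. Poly_Mapping.keys t' \<subseteq> A' \<times> B' \<and>
    (\<forall>f. lin_on sA (*) UNIV f \<longrightarrow> slice sB f t' = slice sB f t)"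
proof -
  interpret A: vector_space sA by fact
  interpret B: vector_space sB by fact
  have sl: "slice sB f t = (\<Sum>p\<in>Poly_Mapping.keys t. sB (Poly_Mapping.lookup t p) (sB (f (fst p)) (snd p)))" for f
    unfolding slice_def lin_ext_def by (simp add: case_prod_unfold)
  define F where "F = (\<lambda>f. slice sB f t) ` {f. lin_on sA (*) UNIV f}"
  have FS: "F \<subseteq> B.span (snd ` Poly_Mapping.keys t)"
    unfolding F_def sl
    by (intro image_subsetI B.span_sum B.span_scale B.span_base imageI)
  obtain F0 where F0: "F0 \<subseteq> F" "B.independent F0" "F \<subseteq> B.span F0"
    by (rule B.maximal_independent_subset)
  have "finite F0"
    using B.independent_span_bound[OF _ F0(2), of "snd ` Poly_Mapping.keys t"] F0(1) FS by auto
  then obtain E g where E: "finite E" "E \<subseteq> F0" "\<forall>e\<in>E. lin_on sB (*) UNIV (g e)"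
      "\<forall>x\<in>B.span F0. x = (\<Sum>e\<in>E. sB (g e x) e)"
    using finite_dual_basis[OF B(1), of F0] by auto
  have EB: "E \<subseteq> B'" using E(2) F0(1) b by (auto simp: F_def)
  \<comment> \<open>The coefficient of e in t, obtained by contracting the second factor with the
    dual functional g e.\<close>
  define c where "c e = lin_ext sA (\<lambda>(a, b). sA (g e b) a) t" for e
  have fc: "f (c e) = g e (slice sB f t)" if "lin_on sA (*) UNIV f" "e \<in> E" for f e
  proof -
    have "f (c e) = lin_ext (*) (\<lambda>(a, b). g e b * f a) t"
      unfolding c_def
      by (subst lin_on_lin_ext[OF that(1) A.module_axioms module_times])
        (auto intro!: lin_ext_cong simp: lin_on_scale[OF that(1)])
    also have "\<dots> = ev f (g e) t" unfolding ev_def by (simp add: mult.commute)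
    also have "\<dots> = g e (slice sB f t)"
      using ev_slice[OF _ B.module_axioms, of UNIV "g e" t UNIV] E(3) that by auto
    finally show ?thesis .
  qed
  have cA: "c e \<in> A'" if "e \<in> E" for e
  proof (rule in_subspace_functional[OF A])
    fix f assume f: "lin_on sA (*) UNIV f" "\<And>w. w \<in> A' \<Longrightarrow> f w = 0"
    have ge: "g e 0 = 0" using lin_on_0[OF _ B.module_axioms module_times] E(3) that by auto
    show "f (c e) = 0" unfolding fc[OF f(1) that] using a[OF f] ge by simp
  qed
  define t' where "t' = (\<Sum>e\<in>E. Poly_Mapping.single (c e, e) (1::'k))"
  have "t' \<in> {t. Poly_Mapping.keys t \<subseteq> A' \<times> B'}"
    unfolding t'_def by (rule fs.subspace_sum[OF subspace_keys]) (use cA EB in auto)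
  moreover have "slice sB f t' = slice sB f t" if f: "lin_on sA (*) UNIV f" for f
  proof -
    have "slice sB f t' = (\<Sum>e\<in>E. sB (g e (slice sB f t)) e)"
      unfolding t'_def slice_sum[OF B.module_axioms] slice_single[OF B.module_axioms]
      using fc[OF f] by simp
    also have "\<dots> = slice sB f t" using E(4) F0(3) f by (auto simp: F_def)
    finally show ?thesis .
  qed
  ultimately show ?thesis by blast
qed

section \<open>Threefold tensors\<close>

definition ev3 :: "('a \<Rightarrow> 'r) \<Rightarrow> ('b \<Rightarrow> 'r) \<Rightarrow> ('d \<Rightarrow> 'r) \<Rightarrow> ('a \<times> 'b \<times> 'd \<Rightarrow>\<^sub>0 'r::comm_ring_1) \<Rightarrow> 'r" where
  "ev3 f g h t = lin_ext (*) (\<lambda>(a, b, d). f a * g b * h d) t"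

lemma ev3_formal_right: "ev3 f g h (formal_right t d) = ev f g t * h d"
proof -
  have "ev3 f g h (formal_right t d) = (\<Sum>x\<in>Poly_Mapping.keys t. Poly_Mapping.lookup t x * (f (fst x) * g (snd x) * h d))"
    unfolding ev3_def formal_right_def lin_ext_def[of fs_scale]
    by (simp add: lin_ext_sum[OF module_times] lin_ext_fs_scale[OF module_times] case_prod_unfold
        lin_ext_single[OF module_times])
  then show ?thesis by (simp add: ev_def lin_ext_def sum_distrib_right case_prod_unfold mult.assoc)
qed

lemma ev3_formal_left: "ev3 f g h (formal_left a t) = f a * ev g h t"
proof -
  have "ev3 f g h (formal_left a t) = (\<Sum>x\<in>Poly_Mapping.keys t. Poly_Mapping.lookup t x * (f a * g (fst x) * h (snd x)))"
    unfolding ev3_def formal_left_def lin_ext_def[of fs_scale]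
    by (simp add: lin_ext_sum[OF module_times] lin_ext_fs_scale[OF module_times] case_prod_unfold
        lin_ext_single[OF module_times])
  then show ?thesis
    by (simp add: ev_def lin_ext_def sum_distrib_left case_prod_unfold) (simp add: algebra_simps)
qed

lemma formal_right_single: "formal_right (Poly_Mapping.single (a, b) r) d = Poly_Mapping.single (a, b, d) r"
  unfolding formal_right_def lin_ext_single[OF fs.module_axioms]
  by (rule poly_mapping_eqI) (simp add: lookup_fs_scale lookup_single when_def)

lemma formal_left_single: "formal_left a (Poly_Mapping.single (b, d) r) = Poly_Mapping.single (a, b, d) r"
  unfolding formal_left_def lin_ext_single[OF fs.module_axioms]
  by (rule poly_mapping_eqI) (simp add: lookup_fs_scale lookup_single when_def)

lemma formal_right_diff: "formal_right (t - u) d = formal_right t d - formal_right u d"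
  unfolding formal_right_def by (rule lin_ext_diff[OF fs.module_axioms])
lemma formal_left_diff: "formal_left a (t - u) = formal_left a t - formal_left a u"
  unfolding formal_left_def by (rule lin_ext_diff[OF fs.module_axioms])

lemma tensor_null3_subspace: "module.subspace fs_scale (tensor_null3 sA A sB B sD D)"
  unfolding tensor_null3_def by (rule fs.subspace_span)

lemma formal_right_null3: "t \<in> tensor_null sA A sB B \<Longrightarrow> d \<in> D \<Longrightarrow> formal_right t d \<in> tensor_null3 sA A sB B sD D"
  unfolding tensor_null3_def by (rule fs.span_base) blast
lemma formal_left_null3: "t \<in> tensor_null sB B sD D \<Longrightarrow> a \<in> A \<Longrightarrow> formal_left a t \<in> tensor_null3 sA A sB B sD D"
  unfolding tensor_null3_def by (rule fs.span_base) blast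

lemma ev3_tensor_null3:
  assumes "t \<in> tensor_null3 sA A sB B sD D"
    "lin_on sA (*) A f" "lin_on sB (*) B g" "lin_on sD (*) D h"
  shows "ev3 f g h t = 0"
proof -
  have 1: "ev f g u = 0" if "u \<in> tensor_null sA A sB B" for u
    unfolding ev_def by (rule lin_ext_tensor_null[OF module_times bilin_on_ev[OF assms(2,3)] that])
  have 2: "ev g h u = 0" if "u \<in> tensor_null sB B sD D" for u
    unfolding ev_def by (rule lin_ext_tensor_null[OF module_times bilin_on_ev[OF assms(3,4)] that])
  have "tensor_null3 sA A sB B sD D \<subseteq> {t. ev3 f g h t = 0}"
    unfolding tensor_null3_def ev3_def
    by (rule fs.span_minimal[OF _ subspace_lin_ext_kernel[OF module_times]])
      (auto simp: ev3_formal_left[unfolded ev3_def] ev3_formal_right[unfolded ev3_def] 1 2)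
  then show ?thesis using assms(1) by blast
qed

text \<open>The argument for two factors, now for trilinear forms: bases are chosen in the second
  and third factor, and with these arguments fixed at basis vectors the form is a functional of the
  first one.\<close>

lemma tensor_null3I:
  fixes sA :: "'k::field \<Rightarrow> 'a::ab_group_add \<Rightarrow> 'a" and sB :: "'k \<Rightarrow> 'b::ab_group_add \<Rightarrow> 'b"
    and sD :: "'k \<Rightarrow> 'd::ab_group_add \<Rightarrow> 'd"
  assumes A: "vector_space sA" "module.subspace sA A" and B: "vector_space sB" "module.subspace sB B"
    and D: "vector_space sD" "module.subspace sD D"
    and t: "Poly_Mapping.keys t \<subseteq> A \<times> B \<times> D"
    and H: "\<And>f g h. lin_on sA (*) UNIV f \<Longrightarrow> lin_on sB (*) UNIV g \<Longrightarrow> lin_on sD (*) UNIV h \<Longrightarrow> ev3 f g h t = 0"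
  shows "t \<in> tensor_null3 sA A sB B sD D"
proof (rule in_subspace_functional[OF vector_space_fs_scale tensor_null3_subspace])
  interpret A: vector_space sA by fact
  interpret B: vector_space sB by fact
  interpret D: vector_space sD by fact
  fix \<psi> assume \<psi>: "lin_on fs_scale (*) UNIV \<psi>" "\<And>w. w \<in> tensor_null3 sA A sB B sD D \<Longrightarrow> \<psi> w = 0"
  define \<beta> where "\<beta> a b d = \<psi> (Poly_Mapping.single (a, b, d) 1)" for a b d
  have \<psi>d: "\<psi> (x - y) = \<psi> x - \<psi> y" for x y
    by (rule lin_on_diff[OF \<psi>(1) fs.module_axioms module_times]) auto
  have \<psi>s: "\<psi> (Poly_Mapping.single (a, b, d) r) = r * \<beta> a b d" for a b d r
  proof -
    have "Poly_Mapping.single (a, b, d) r = fs_scale r (Poly_Mapping.single (a, b, d) 1)"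
      by (rule poly_mapping_eqI) (simp add: lookup_fs_scale lookup_single when_def)
    then show ?thesis using lin_on_scale[OF \<psi>(1)] by (simp add: \<beta>_def)
  qed
  \<comment> \<open>The relations under \<open>formal_left\<close> fix the first argument and give
    linearity in the other two; those under \<open>formal_right\<close> fix the last
    argument.\<close>
  note gl = tensor_null_gens[THEN formal_left_null3, THEN \<psi>(2),
    unfolded formal_left_diff formal_left_single \<psi>d \<psi>s mult_1]
  note gr = tensor_null_gens[THEN formal_right_null3, THEN \<psi>(2),
    unfolded formal_right_diff formal_right_single \<psi>d \<psi>s mult_1]
  have l1: "lin_on sA (*) A (\<lambda>a. \<beta> a b d)" if "b \<in> B" "d \<in> D" for b d
    unfolding lin_on_def using gr(1,3) that
    by (auto simp: algebra_simps)
  have l2: "lin_on sB (*) B (\<lambda>b. \<beta> a b d)" if "a \<in> A" "d \<in> D" for a d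
    unfolding lin_on_def using gr(2,4) that
    by (auto simp: algebra_simps)
  have l3: "lin_on sD (*) D (\<lambda>d. \<beta> a b d)" if "a \<in> A" "b \<in> B" for a b
    unfolding lin_on_def using gl(2,4) that
    by (auto simp: algebra_simps)
  have \<psi>t: "\<psi> t = lin_ext (*) (\<lambda>(a, b, d). \<beta> a b d) t"
    using lin_on_lin_ext[OF \<psi>(1) fs.module_axioms module_times, of t "\<lambda>x. Poly_Mapping.single x 1"]
    by (simp add: fs_eq_lin_ext[symmetric] \<beta>_def case_prod_unfold)
  obtain E g where E: "finite E" "E \<subseteq> (fst \<circ> snd) ` Poly_Mapping.keys t" "\<forall>e\<in>E. lin_on sB (*) UNIV (g e)"
    "\<forall>x\<in>B.span ((fst \<circ> snd) ` Poly_Mapping.keys t). x = (\<Sum>e\<in>E. sB (g e x) e)"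
    using finite_dual_basis[OF B(1), of "(fst \<circ> snd) ` Poly_Mapping.keys t"] by auto
  obtain E' h where E': "finite E'" "E' \<subseteq> (snd \<circ> snd) ` Poly_Mapping.keys t" "\<forall>e\<in>E'. lin_on sD (*) UNIV (h e)"
    "\<forall>x\<in>D.span ((snd \<circ> snd) ` Poly_Mapping.keys t). x = (\<Sum>e\<in>E'. sD (h e x) e)"
    using finite_dual_basis[OF D(1), of "(snd \<circ> snd) ` Poly_Mapping.keys t"] by auto
  have "(fst \<circ> snd) ` Poly_Mapping.keys t \<subseteq> B" "(snd \<circ> snd) ` Poly_Mapping.keys t \<subseteq> D"
    using t by fastforce+
  then have EB: "E \<subseteq> B" and ED: "E' \<subseteq> D" using E(2) E'(2) by blast+
  have *: "\<beta> a b d = (\<Sum>e\<in>E. \<Sum>e'\<in>E'. \<beta> a e e' * g e b * h e' d)" if k: "(a, b, d) \<in> Poly_Mapping.keys t" for a b d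
  proof -
    have in': "a \<in> A" "b \<in> B" "d \<in> D" using k t by auto
    have b: "b = (\<Sum>e\<in>E. sB (g e b) e)"
      using E(4) imageI[OF k, of "fst \<circ> snd", THEN B.span_base] by simp
    have d: "d = (\<Sum>e\<in>E'. sD (h e d) e)"
      using E'(4) imageI[OF k, of "snd \<circ> snd", THEN D.span_base] by simp
    have "\<beta> a b d = \<beta> a (\<Sum>e\<in>E. sB (g e b) e) d" using b by simp
    also have "\<dots> = (\<Sum>e\<in>E. g e b * \<beta> a e d)"
      by (rule lin_on_lincomb[OF l2[OF in'(1,3)] B.module_axioms module_times B(2)]) (use EB in auto)
    also have "\<dots> = (\<Sum>e\<in>E. \<Sum>e'\<in>E'. \<beta> a e e' * g e b * h e' d)"
    proof (intro sum.cong refl)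
      fix e assume e: "e \<in> E"
      have "\<beta> a e d = \<beta> a e (\<Sum>e\<in>E'. sD (h e d) e)" using d by simp
      also have "\<dots> = (\<Sum>e'\<in>E'. h e' d * \<beta> a e e')"
        by (rule lin_on_lincomb[OF l3 D.module_axioms module_times D(2)]) (use EB ED in' e in auto)
      finally show "g e b * \<beta> a e d = (\<Sum>e'\<in>E'. \<beta> a e e' * g e b * h e' d)"
        by (simp add: sum_distrib_left mult_ac)
    qed
    finally show ?thesis .
  qed
  have "\<psi> t = lin_ext (*) (\<lambda>(a, b, d). \<Sum>p\<in>E \<times> E'. \<beta> a (fst p) (snd p) * g (fst p) b * h (snd p) d) t"
    unfolding \<psi>t by (intro lin_ext_cong) (auto simp: * sum.cartesian_product case_prod_unfold)
  also have "\<dots> = (\<Sum>p\<in>E \<times> E'. lin_ext (*) (\<lambda>(a, b, d). \<beta> a (fst p) (snd p) * g (fst p) b * h (snd p) d) t)"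
    unfolding lin_ext_def
    by (subst sum.swap) (simp add: case_prod_unfold sum_distrib_left)
  also have "\<dots> = (\<Sum>p\<in>E \<times> E'. ev3 (\<lambda>a. \<beta> a (fst p) (snd p)) (g (fst p)) (h (snd p)) t)"
    by (simp add: ev3_def)
  also have "\<dots> = 0"
  proof (rule sum.neutral, safe)
    fix e e' assume e: "e \<in> E" "e' \<in> E'"
    then have "lin_on sA (*) A (\<lambda>a. \<beta> a e e')" using l1 EB ED by auto
    then obtain f where f: "lin_on sA (*) UNIV f" "\<forall>a\<in>A. f a = \<beta> a e e'"
      using lin_on_extend[OF A] by blast
    have "ev3 (\<lambda>a. \<beta> a e e') (g e) (h e') t = ev3 f (g e) (h e') t"
      unfolding ev3_def by (rule lin_ext_cong) (use f t in auto)
    then show "ev3 (\<lambda>a. \<beta> a (fst (e, e')) (snd (e, e'))) (g (fst (e, e'))) (h (snd (e, e'))) t = 0"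
      using H[OF f(1), of "g e" "h e'"] E(3) E'(3) e by simp
  qed
  finally show "\<psi> t = 0" .
qed

section \<open>Coalgebras and comodules through the dual algebra\<close>

abbreviation lfun :: "('k::field \<Rightarrow> 'a::ab_group_add \<Rightarrow> 'a) \<Rightarrow> ('a \<Rightarrow> 'k) \<Rightarrow> bool" where
  "lfun s f \<equiv> lin_on s (*) UNIV f"

text \<open>The action of the dual algebra of \<open>C\<close> on a left \<open>C\<close>-comodule, and the product of the dual
  algebra.\<close>

definition cact :: "('k::field, 'c, 'm::ab_group_add) comod \<Rightarrow> ('c \<Rightarrow> 'k) \<Rightarrow> 'm \<Rightarrow> 'm" where
  "cact M f m = slice (mscale M) f (coact M m)"

definition convl :: "('k::field, 'c::ab_group_add) coalg \<Rightarrow> ('c \<Rightarrow> 'k) \<Rightarrow> ('c \<Rightarrow> 'k) \<Rightarrow> 'c \<Rightarrow> 'k" where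
  "convl C f g c = ev f g (comult C c)"

lemma ev3_lin_ext: "ev3 f g h (lin_ext fs_scale F t) = lin_ext (*) (\<lambda>x. ev3 f g h (F x)) t"
  unfolding ev3_def lin_ext_def[of fs_scale]
  by (simp add: lin_ext_sum[OF module_times] lin_ext_fs_scale[OF module_times] lin_ext_def[of "(*)" _ t])

lemma ev3_diff: "ev3 f g h (t - u) = ev3 f g h t - ev3 f g h u"
  unfolding ev3_def by (rule lin_ext_diff[OF module_times])

lemma keys_lin_ext:
  assumes "\<And>x. x \<in> Poly_Mapping.keys t \<Longrightarrow> Poly_Mapping.keys (F x) \<subseteq> S"
  shows "Poly_Mapping.keys (lin_ext fs_scale F t) \<subseteq> S"
  using lin_ext_in[OF fs.module_axioms subspace_keys[of S], of t F] assms by blast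

lemma keys_formal_right: "Poly_Mapping.keys t \<subseteq> A \<times> B \<Longrightarrow> d \<in> D \<Longrightarrow> Poly_Mapping.keys (formal_right t d) \<subseteq> A \<times> B \<times> D"
  unfolding formal_right_def by (rule keys_lin_ext) auto

lemma keys_formal_left: "Poly_Mapping.keys t \<subseteq> B \<times> D \<Longrightarrow> a \<in> A \<Longrightarrow> Poly_Mapping.keys (formal_left a t) \<subseteq> A \<times> B \<times> D"
  unfolding formal_left_def by (rule keys_lin_ext) auto

text \<open>Under products of functionals the two sides of coassociativity become iterated
  evaluations: the two ways to multiply three functionals, or the action of a product against two
  successive actions.\<close>

lemma ev3_assoc:
  "ev3 f g h (lin_ext fs_scale (\<lambda>(a, b). formal_right (F a) b) t) = ev (\<lambda>a. ev f g (F a)) h t"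
  "ev3 f g h (lin_ext fs_scale (\<lambda>(a, b). formal_left a (G b)) t) = ev f (\<lambda>b. ev g h (G b)) t"
  by (simp_all add: ev3_lin_ext case_prod_unfold ev3_formal_right ev3_formal_left ev_def[of _ _ t])

lemma keys_assoc_right:
  assumes "Poly_Mapping.keys t \<subseteq> X \<times> D" "\<And>a. a \<in> X \<Longrightarrow> Poly_Mapping.keys (F a) \<subseteq> A \<times> B"
  shows "Poly_Mapping.keys (lin_ext fs_scale (\<lambda>(a, b). formal_right (F a) b) t) \<subseteq> A \<times> B \<times> D"
proof (rule keys_lin_ext)
  fix x assume "x \<in> Poly_Mapping.keys t"
  then obtain a b where "x = (a, b)" "a \<in> X" "b \<in> D" using assms(1) by blast
  then show "Poly_Mapping.keys (case x of (a, b) \<Rightarrow> formal_right (F a) b) \<subseteq> A \<times> B \<times> D"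
    using keys_formal_right[OF assms(2)] by simp
qed

lemma keys_assoc_left:
  assumes "Poly_Mapping.keys t \<subseteq> A \<times> Y" "\<And>b. b \<in> Y \<Longrightarrow> Poly_Mapping.keys (G b) \<subseteq> B \<times> D"
  shows "Poly_Mapping.keys (lin_ext fs_scale (\<lambda>(a, b). formal_left a (G b)) t) \<subseteq> A \<times> B \<times> D"
proof (rule keys_lin_ext)
  fix x assume "x \<in> Poly_Mapping.keys t"
  then obtain a b where "x = (a, b)" "a \<in> A" "b \<in> Y" using assms(1) by blast
  then show "Poly_Mapping.keys (case x of (a, b) \<Rightarrow> formal_left a (G b)) \<subseteq> A \<times> B \<times> D"
    using keys_formal_left[OF assms(2)] by simp
qed

section \<open>The dual algebra of a coalgebra\<close>

lemma coalgebra_basic: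
  assumes "coalgebra C"
  shows "vector_space (cscale C)" "module (cscale C)" "module.subspace (cscale C) (cspace C)"
    "c \<in> cspace C \<Longrightarrow> Poly_Mapping.keys (comult C c) \<subseteq> cspace C \<times> cspace C"
    "lin_on (cscale C) (*) (cspace C) (counit C)"
  using assms module_vs unfolding coalgebra_def tensor_valued_linear_def lin_on_def by blast+

lemma lin_on_convl:
  assumes "coalgebra C" "lin_on (cscale C) (*) (cspace C) f" "lin_on (cscale C) (*) (cspace C) g"
  shows "lin_on (cscale C) (*) (cspace C) (convl C f g)"
proof -
  have t: "tensor_valued_linear (cscale C) (cspace C) (cscale C) (cspace C) (cscale C) (cspace C) (comult C)"
    using assms(1) by (simp add: coalgebra_def)
  show ?thesis
    unfolding lin_on_def convl_def
  proof (intro conjI ballI allI)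
    fix x y assume "x \<in> cspace C" "y \<in> cspace C"
    then have "tensor_eq (cscale C) (cspace C) (cscale C) (cspace C) (comult C (x + y)) (comult C x + comult C y)"
      using t by (auto simp: tensor_valued_linear_def)
    from tensor_eqD[OF this assms(2,3)]
    show "ev f g (comult C (x + y)) = ev f g (comult C x) + ev f g (comult C y)" by (simp add: ev_add)
  next
    fix r x assume "x \<in> cspace C"
    then have "tensor_eq (cscale C) (cspace C) (cscale C) (cspace C) (comult C (cscale C r x)) (fs_scale r (comult C x))"
      using t by (auto simp: tensor_valued_linear_def)
    from tensor_eqD[OF this assms(2,3)]
    show "ev f g (comult C (cscale C r x)) = r * ev f g (comult C x)" by (simp add: ev_fs_scale)
  qed
qed

lemma convl_assoc:
  assumes "coalgebra C" "lin_on (cscale C) (*) (cspace C) f" "lin_on (cscale C) (*) (cspace C) g"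
    "lin_on (cscale C) (*) (cspace C) h" "c \<in> cspace C"
  shows "convl C (convl C f g) h c = convl C f (convl C g h) c"
proof -
  have "tensor_eq3 (cscale C) (cspace C) (cscale C) (cspace C) (cscale C) (cspace C)
        (lin_ext fs_scale (\<lambda>(a, b). formal_right (comult C a) b) (comult C c))
        (lin_ext fs_scale (\<lambda>(a, b). formal_left a (comult C b)) (comult C c))"
    using assms(1,5) by (simp add: coalgebra_def)
  from ev3_tensor_null3[OF this[unfolded tensor_eq3_def] assms(2,3,4)]
  show ?thesis unfolding ev3_diff ev3_assoc convl_def[abs_def] by simp
qed

lemma slice_counit:
  assumes "coalgebra C" "c \<in> cspace C"
  shows "slice (cscale C) (counit C) (comult C c) = c"
  using assms by (simp add: coalgebra_def slice_def)

lemma convl_counit: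
  assumes "coalgebra C" "lin_on (cscale C) (*) (cspace C) f" "c \<in> cspace C"
  shows "convl C (counit C) f c = f c" "convl C f (counit C) c = f c"
proof -
  note b = coalgebra_basic[OF assms(1)]
  show "convl C (counit C) f c = f c"
    unfolding convl_def
    using ev_slice[OF assms(2) b(2,3) b(4)[OF assms(3)]] slice_counit[OF assms(1,3)] by simp
  have "f c = f (lin_ext (cscale C) (\<lambda>(a, b). cscale C (counit C b) a) (comult C c))"
    using assms by (simp add: coalgebra_def)
  also have "\<dots> = lin_ext (*) (\<lambda>p. f (case p of (a, b) \<Rightarrow> cscale C (counit C b) a)) (comult C c)"
    by (rule lin_on_lin_ext[OF assms(2) b(2) module_times b(3)])
      (use b(4)[OF assms(3)] module.subspace_scale[OF b(2,3)] in auto)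
  also have "\<dots> = ev f (counit C) (comult C c)"
    unfolding ev_def
    by (rule lin_ext_cong) (use b(4)[OF assms(3)] lin_on_scale[OF assms(2)] in auto)
  finally show "convl C f (counit C) c = f c" by (simp add: convl_def)
qed

text \<open>Converse of the preceding facts: as functionals separate tensors, the coalgebra axioms
  follow from associativity of \<open>convl\<close> and the unit laws for \<open>counit C\<close>,
  tested on total functionals.\<close>

lemma coalgebraI:
  assumes vs: "vector_space (cscale C)" and sub: "module.subspace (cscale C) (cspace C)"
    and keys: "\<And>c. c \<in> cspace C \<Longrightarrow> Poly_Mapping.keys (comult C c) \<subseteq> cspace C \<times> cspace C"
    and counit: "lin_on (cscale C) (*) (cspace C) (counit C)"
    and lin: "\<And>f g. lfun (cscale C) f \<Longrightarrow> lfun (cscale C) g \<Longrightarrow> lin_on (cscale C) (*) (cspace C) (convl C f g)"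
    and assoc: "\<And>f g h c. lfun (cscale C) f \<Longrightarrow> lfun (cscale C) g \<Longrightarrow> lfun (cscale C) h \<Longrightarrow> c \<in> cspace C \<Longrightarrow>
        convl C (convl C f g) h c = convl C f (convl C g h) c"
    and counit1: "\<And>f c. lfun (cscale C) f \<Longrightarrow> c \<in> cspace C \<Longrightarrow> convl C (counit C) f c = f c"
    and counit2: "\<And>f c. lfun (cscale C) f \<Longrightarrow> c \<in> cspace C \<Longrightarrow> convl C f (counit C) c = f c"
  shows "coalgebra C"
proof -
  interpret V: vector_space "cscale C" by fact
  let ?s = "cscale C" and ?S = "cspace C"
  have k: "Poly_Mapping.keys (x + y) \<subseteq> S" if "Poly_Mapping.keys x \<subseteq> S" "Poly_Mapping.keys y \<subseteq> S"
    for x y :: "('c \<times> 'c) \<Rightarrow>\<^sub>0 'a" and S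
    using Poly_Mapping.keys_add[of x y] that by blast
  have "tensor_valued_linear ?s ?S ?s ?S ?s ?S (comult C)"
    unfolding tensor_valued_linear_def
  proof (intro conjI ballI allI keys tensor_eqI[OF vs sub vs sub] k)
    fix x y f g assume "x \<in> ?S" "y \<in> ?S" "lfun ?s f" "lfun ?s g"
    then show "ev f g (comult C (x + y)) = ev f g (comult C x + comult C y)"
      using lin_on_add[OF lin] by (simp add: convl_def[symmetric] ev_add)
  next
    fix x r f g assume "x \<in> ?S" "lfun ?s f" "lfun ?s g"
    then show "ev f g (comult C (?s r x)) = ev f g (fs_scale r (comult C x))"
      using lin_on_scale[OF lin] by (simp add: convl_def[symmetric] ev_fs_scale)
  qed (auto intro!: keys V.subspace_add[OF sub] V.subspace_scale[OF sub] order_trans[OF keys_fs_scale])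
  moreover have "tensor_eq3 ?s ?S ?s ?S ?s ?S
        (lin_ext fs_scale (\<lambda>(a, b). formal_right (comult C a) b) (comult C c))
        (lin_ext fs_scale (\<lambda>(a, b). formal_left a (comult C b)) (comult C c))" (is "tensor_eq3 _ _ _ _ _ _ ?t ?u")
    if c: "c \<in> ?S" for c
    unfolding tensor_eq3_def
  proof (rule tensor_null3I[OF vs sub vs sub vs sub])
    have "Poly_Mapping.keys ?t \<subseteq> ?S \<times> ?S \<times> ?S" "Poly_Mapping.keys ?u \<subseteq> ?S \<times> ?S \<times> ?S"
      by (rule keys_assoc_right[OF keys[OF c]], erule keys)
        (rule keys_assoc_left[OF keys[OF c]], erule keys)
    then show "Poly_Mapping.keys (?t - ?u) \<subseteq> ?S \<times> ?S \<times> ?S"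
      using Poly_Mapping.keys_diff[of ?t ?u] by blast
    fix f g h assume *: "lfun ?s f" "lfun ?s g" "lfun ?s h"
    show "ev3 f g h (?t - ?u) = 0"
      unfolding ev3_diff ev3_assoc using assoc[OF * c] by (simp add: convl_def[abs_def])
  qed
  moreover have "lin_ext ?s (\<lambda>(a, b). ?s (counit C a) b) (comult C c) = c" if c: "c \<in> ?S" for c
  proof (rule functional_eqI[OF vs])
    fix f assume f: "lfun ?s f"
    show "f (lin_ext ?s (\<lambda>(a, b). ?s (counit C a) b) (comult C c)) = f c"
      using ev_slice[OF f V.module_axioms V.subspace_UNIV, of "comult C c" UNIV "counit C"]
        counit1[OF f c] by (simp add: slice_def convl_def)
  qed
  moreover have "lin_ext ?s (\<lambda>(a, b). ?s (counit C b) a) (comult C c) = c" if c: "c \<in> ?S" for c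
  proof (rule functional_eqI[OF vs])
    fix f assume f: "lfun ?s f"
    have "f (lin_ext ?s (\<lambda>(a, b). ?s (counit C b) a) (comult C c)) =
        lin_ext (*) (\<lambda>p. f (case p of (a, b) \<Rightarrow> ?s (counit C b) a)) (comult C c)"
      by (rule lin_on_lin_ext[OF f V.module_axioms module_times V.subspace_UNIV]) auto
    also have "\<dots> = ev f (counit C) (comult C c)"
      unfolding ev_def by (rule lin_ext_cong) (auto simp: lin_on_scale[OF f])
    finally show "f (lin_ext ?s (\<lambda>(a, b). ?s (counit C b) a) (comult C c)) = f c"
      using counit2[OF f c] by (simp add: convl_def)
  qed
  ultimately show ?thesis
    using vs sub counit unfolding coalgebra_def by (simp add: lin_on_def)
qed

section \<open>The action of functionals on a comodule\<close>

lemma comodule_basic: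
  assumes "comodule C M"
  shows "vector_space (mscale M)" "module (mscale M)" "module.subspace (mscale M) (mspace M)"
    "m \<in> mspace M \<Longrightarrow> Poly_Mapping.keys (coact M m) \<subseteq> cspace C \<times> mspace M"
  using assms module_vs unfolding comodule_def tensor_valued_linear_def by blast+

lemma cact_in:
  assumes "comodule C M" "m \<in> mspace M"
  shows "cact M f m \<in> mspace M"
  unfolding cact_def
  by (rule slice_in[OF comodule_basic(2,3)[OF assms(1)] comodule_basic(4)[OF assms]])

lemma cact_cong:
  assumes "comodule C M" "m \<in> mspace M" "\<And>c. c \<in> cspace C \<Longrightarrow> f c = g c"
  shows "cact M f m = cact M g m"
  unfolding cact_def
  by (rule slice_cong) (use comodule_basic(4)[OF assms(1,2)] assms(3) in auto)

lemma cact_zero: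
  assumes "comodule C M" "m \<in> mspace M" "\<And>c. c \<in> cspace C \<Longrightarrow> f c = 0"
  shows "cact M f m = 0"
proof -
  interpret V: vector_space "mscale M" by (rule comodule_basic(1)[OF assms(1)])
  have "cact M f m = cact M (\<lambda>_. 0) m" using assms by (rule cact_cong)
  then show ?thesis by (simp add: cact_def slice_def lin_ext_def case_prod_unfold)
qed

lemma lin_on_cact:
  assumes "coalgebra C" "comodule C M" "lin_on (cscale C) (*) (cspace C) f"
  shows "lin_on (mscale M) (mscale M) (mspace M) (cact M f)"
proof -
  note c = coalgebra_basic[OF assms(1)] and b = comodule_basic[OF assms(2)]
  interpret V: vector_space "mscale M" by (rule b(1))
  have t: "tensor_valued_linear (mscale M) (mspace M) (cscale C) (cspace C) (mscale M) (mspace M) (coact M)"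
    using assms(2) by (simp add: comodule_def)
  show ?thesis unfolding lin_on_def
  proof (intro conjI ballI allI)
    fix x y assume xy: "x \<in> mspace M" "y \<in> mspace M"
    then have t1: "tensor_eq (cscale C) (cspace C) (mscale M) (mspace M) (coact M (x + y)) (coact M x + coact M y)"
      using t unfolding tensor_valued_linear_def by blast
    have "Poly_Mapping.keys (coact M x + coact M y) \<subseteq> cspace C \<times> mspace M"
      by (rule order_trans[OF Poly_Mapping.keys_add Un_least[OF b(4)[OF xy(1)] b(4)[OF xy(2)]]])
    from tensor_eq_sliceD[OF t1 b(1,3) assms(3) b(4)[OF V.subspace_add[OF b(3) xy]] this]
    show "cact M f (x + y) = cact M f x + cact M f y"
      by (simp add: cact_def slice_add[OF b(2)])
  next
    fix r x assume x: "x \<in> mspace M"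
    then have t1: "tensor_eq (cscale C) (cspace C) (mscale M) (mspace M) (coact M (mscale M r x)) (fs_scale r (coact M x))"
      using t unfolding tensor_valued_linear_def by blast
    have "Poly_Mapping.keys (fs_scale r (coact M x)) \<subseteq> cspace C \<times> mspace M"
      by (rule order_trans[OF keys_fs_scale b(4)[OF x]])
    from tensor_eq_sliceD[OF t1 b(1,3) assms(3) b(4)[OF V.subspace_scale[OF b(3) x]] this]
    show "cact M f (mscale M r x) = mscale M r (cact M f x)"
      by (simp add: cact_def slice_fs_scale[OF b(2)])
  qed
qed

lemma ev_cact:
  assumes "comodule C M" "m \<in> mspace M" "lin_on (mscale M) (*) (mspace M) h"
  shows "ev f h (coact M m) = h (cact M f m)"
  unfolding cact_def
  by (rule ev_slice[OF assms(3) comodule_basic(2,3)[OF assms(1)] comodule_basic(4)[OF assms(1,2)]])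

lemma ev_cact2:
  assumes "coalgebra C" "comodule C M" "m \<in> mspace M" "lfun (mscale M) h"
    "lin_on (cscale C) (*) (cspace C) g"
  shows "ev f (\<lambda>b. ev g h (coact M b)) (coact M m) = h (cact M g (cact M f m))"
proof -
  note b = comodule_basic[OF assms(2)]
  have "ev f (\<lambda>b. ev g h (coact M b)) (coact M m) = ev f (\<lambda>b. h (cact M g b)) (coact M m)"
    by (rule ev_cong) (use b(4)[OF assms(3)] ev_cact[OF assms(2) _ lin_on_subset[OF assms(4)]] in auto)
  also have "\<dots> = h (cact M g (cact M f m))"
    by (rule ev_cact[OF assms(2,3)])
      (rule lin_on_comp[OF lin_on_cact[OF assms(1,2,5)] assms(4)], simp)
  finally show ?thesis .
qed

text \<open>The factors act in reversed order: f contracts the first leg of the iterated coaction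
  and is applied first, so a left comodule is a right module over the dual algebra.\<close>

lemma cact_convl:
  assumes "coalgebra C" "comodule C M" "m \<in> mspace M"
    "lin_on (cscale C) (*) (cspace C) f" "lin_on (cscale C) (*) (cspace C) g"
  shows "cact M (convl C f g) m = cact M g (cact M f m)"
proof (rule functional_eqI[OF comodule_basic(1)[OF assms(2)]])
  fix h assume h: "lfun (mscale M) h"
  then have h': "lin_on (mscale M) (*) (mspace M) h" using lin_on_subset by blast
  have "tensor_eq3 (cscale C) (cspace C) (cscale C) (cspace C) (mscale M) (mspace M)
        (lin_ext fs_scale (\<lambda>(c, n). formal_right (comult C c) n) (coact M m))
        (lin_ext fs_scale (\<lambda>(c, n). formal_left c (coact M n)) (coact M m))"
    using assms(2,3) by (simp add: comodule_def)
  from ev3_tensor_null3[OF this[unfolded tensor_eq3_def] assms(4,5) h']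
  have "ev (convl C f g) h (coact M m) = ev f (\<lambda>b. ev g h (coact M b)) (coact M m)"
    unfolding ev3_diff ev3_assoc convl_def[abs_def] by simp
  then show "h (cact M (convl C f g) m) = h (cact M g (cact M f m))"
    unfolding ev_cact2[OF assms(1-3) h assms(5)] ev_cact[OF assms(2,3) h'] .
qed

lemma cact_counit:
  assumes "comodule C M" "m \<in> mspace M"
  shows "cact M (counit C) m = m"
  using assms by (simp add: comodule_def cact_def slice_def)

text \<open>The analogue of \<open>coalgebraI\<close>. It produces comodules over a larger
  coalgebra, restrictions to invariant subspaces and comodules with a prescribed matrix.\<close>

lemma comoduleI:
  assumes C: "coalgebra C" and vs: "vector_space (mscale M)" and sub: "module.subspace (mscale M) (mspace M)"
    and keys: "\<And>m. m \<in> mspace M \<Longrightarrow> Poly_Mapping.keys (coact M m) \<subseteq> cspace C \<times> mspace M"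
    and lin: "\<And>f. lfun (cscale C) f \<Longrightarrow> lin_on (mscale M) (mscale M) (mspace M) (cact M f)"
    and assoc: "\<And>f g m. lfun (cscale C) f \<Longrightarrow> lfun (cscale C) g \<Longrightarrow> m \<in> mspace M \<Longrightarrow>
        cact M (convl C f g) m = cact M g (cact M f m)"
    and counit: "\<And>m. m \<in> mspace M \<Longrightarrow> cact M (counit C) m = m"
  shows "comodule C M"
proof -
  note c = coalgebra_basic[OF C]
  interpret V: vector_space "mscale M" by fact
  let ?s = "cscale C" and ?S = "cspace C" and ?sM = "mscale M" and ?M = "mspace M"
  have k: "Poly_Mapping.keys (x + y) \<subseteq> S" if "Poly_Mapping.keys x \<subseteq> S" "Poly_Mapping.keys y \<subseteq> S"
    for x y :: "('b \<times> 'c) \<Rightarrow>\<^sub>0 'a" and S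
    using Poly_Mapping.keys_add[of x y] that by blast
  have e: "ev f h (coact M m) = h (cact M f m)" if "m \<in> ?M" "lin_on ?sM (*) ?M h" for f h m
    unfolding cact_def by (rule ev_slice[OF that(2) V.module_axioms sub keys[OF that(1)]])
  have ks: "Poly_Mapping.keys (fs_scale r (coact M x)) \<subseteq> ?S \<times> ?M" if "x \<in> ?M" for r x
    by (rule order_trans[OF keys_fs_scale keys[OF that]])
  have "tensor_valued_linear ?sM ?M ?s ?S ?sM ?M (coact M)"
    unfolding tensor_valued_linear_def
  proof (intro conjI ballI allI keys)
    fix x y assume xy: "x \<in> ?M" "y \<in> ?M"
    show "tensor_eq ?s ?S ?sM ?M (coact M (x + y)) (coact M x + coact M y)"
      unfolding tensor_eq_slice[OF c(1,3) vs sub keys[OF V.subspace_add[OF sub xy]] k[OF keys[OF xy(1)] keys[OF xy(2)]]]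
      using lin_on_add[OF lin xy] by (simp add: cact_def slice_add[OF V.module_axioms])
  next
    fix r x assume x: "x \<in> ?M"
    show "tensor_eq ?s ?S ?sM ?M (coact M (?sM r x)) (fs_scale r (coact M x))"
      unfolding tensor_eq_slice[OF c(1,3) vs sub keys[OF V.subspace_scale[OF sub x]] ks[OF x]]
      using lin_on_scale[OF lin x] by (simp add: cact_def slice_fs_scale[OF V.module_axioms])
  qed
  moreover have "tensor_eq3 ?s ?S ?s ?S ?sM ?M
        (lin_ext fs_scale (\<lambda>(c, n). formal_right (comult C c) n) (coact M m))
        (lin_ext fs_scale (\<lambda>(c, n). formal_left c (coact M n)) (coact M m))" (is "tensor_eq3 _ _ _ _ _ _ ?t ?u")
    if m: "m \<in> ?M" for m
    unfolding tensor_eq3_def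
  proof (rule tensor_null3I[OF c(1,3) c(1,3) vs sub])
    have "Poly_Mapping.keys ?t \<subseteq> ?S \<times> ?S \<times> ?M" "Poly_Mapping.keys ?u \<subseteq> ?S \<times> ?S \<times> ?M"
      by (rule keys_assoc_right[OF keys[OF m]], erule c(4))
        (rule keys_assoc_left[OF keys[OF m]], erule keys)
    then show "Poly_Mapping.keys (?t - ?u) \<subseteq> ?S \<times> ?S \<times> ?M"
      using Poly_Mapping.keys_diff[of ?t ?u] by blast
    fix f g h assume *: "lfun ?s f" "lfun ?s g" "lfun ?sM h"
    have h: "lin_on ?sM (*) ?M h" using lin_on_subset[OF *(3)] by simp
    have 1: "ev (convl C f g) h (coact M m) = h (cact M g (cact M f m))"
      using e[OF m h] assoc[OF *(1,2) m] by simp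
    have "ev f (\<lambda>b. ev g h (coact M b)) (coact M m) = ev f (\<lambda>b. h (cact M g b)) (coact M m)"
      by (rule ev_cong) (use keys[OF m] e[OF _ h] in auto)
    also have "\<dots> = h (cact M g (cact M f m))"
      by (rule e[OF m lin_on_comp[OF lin[OF *(2)] *(3)]]) simp
    finally show "ev3 f g h (?t - ?u) = 0"
      unfolding ev3_diff ev3_assoc using 1 by (simp add: convl_def[abs_def])
  qed
  moreover have "lin_ext ?sM (\<lambda>(c, n). ?sM (counit C c) n) (coact M m) = m" if "m \<in> ?M" for m
    using counit[OF that] by (simp add: cact_def slice_def)
  ultimately show ?thesis using vs sub unfolding comodule_def by simp
qed

lemma slice_id_tensor:
  assumes "module s'"
  shows "slice s' \<phi> (id_tensor f t) = lin_ext s' (\<lambda>(c, m). s' (\<phi> c) (f m)) t"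
  unfolding slice_def id_tensor_def lin_ext_def[of fs_scale]
  by (simp add: lin_ext_sum[OF assms] lin_ext_fs_scale[OF assms] lin_ext_single[OF assms]
      module.scale_one[OF assms] case_prod_unfold lin_ext_def[of _ _ t])

lemma keys_id_tensor:
  assumes "Poly_Mapping.keys t \<subseteq> A \<times> B" "f ` B \<subseteq> D"
  shows "Poly_Mapping.keys (id_tensor f t) \<subseteq> A \<times> D"
  unfolding id_tensor_def by (rule keys_lin_ext) (use assms in \<open>auto simp: image_subset_iff dest!: subsetD\<close>)

text \<open>Replaces compatibility with coactions by commutation with contractions. Homomorphisms,
  K[T]-linearity of a coaction and specializations are all treated through it.\<close>

lemma tensor_eq_id_tensor:
  assumes "vector_space sC" "module.subspace sC C" "module sA" "module.subspace sA A"
    "vector_space sB" "module.subspace sB B"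
    "Poly_Mapping.keys t \<subseteq> C \<times> A" "Poly_Mapping.keys u \<subseteq> C \<times> B" "f ` A \<subseteq> B" "lin_on sA sB A f"
  shows "tensor_eq sC C sB B (id_tensor f t) u \<longleftrightarrow>
    (\<forall>\<phi>. lfun sC \<phi> \<longrightarrow> f (slice sA \<phi> t) = slice sB \<phi> u)"
  unfolding tensor_eq_slice[OF assms(1,2,5,6) keys_id_tensor[OF assms(7,9)] assms(8)]
    slice_id_tensor[OF module_vs[OF assms(5)]]
    lin_on_slice[OF assms(10,3) module_vs[OF assms(5)] assms(4,7)] ..

lemma comod_hom_iff:
  assumes "coalgebra C" "comodule C M" "comodule C N"
  shows "comod_hom C M N f \<longleftrightarrow> f ` mspace M \<subseteq> mspace N \<and> lin_on (mscale M) (mscale N) (mspace M) f \<and>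
    (\<forall>\<phi>. lfun (cscale C) \<phi> \<longrightarrow> (\<forall>x\<in>mspace M. f (cact M \<phi> x) = cact N \<phi> (f x)))"
proof -
  note c = coalgebra_basic[OF assms(1)] and m = comodule_basic[OF assms(2)] and n = comodule_basic[OF assms(3)]
  have "tensor_eq (cscale C) (cspace C) (mscale N) (mspace N) (id_tensor f (coact M x)) (coact N (f x)) \<longleftrightarrow>
    (\<forall>\<phi>. lfun (cscale C) \<phi> \<longrightarrow> f (cact M \<phi> x) = cact N \<phi> (f x))"
    if "f ` mspace M \<subseteq> mspace N" "lin_on (mscale M) (mscale N) (mspace M) f" "x \<in> mspace M" for x
    unfolding cact_def
    by (rule tensor_eq_id_tensor[OF c(1,3) m(2,3) n(1,3) m(4)[OF that(3)] n(4) that(1,2)])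
      (use that in auto)
  then show ?thesis unfolding comod_hom_def lin_on_def by (safe; simp)
qed

lemma subcomodule_iff:
  assumes "coalgebra C" "comodule C M"
  shows "subcomodule C N M \<longleftrightarrow> comodule C N \<and> mspace N \<subseteq> mspace M \<and> mscale N = mscale M \<and>
    (\<forall>\<phi>. lfun (cscale C) \<phi> \<longrightarrow> (\<forall>x\<in>mspace N. cact N \<phi> x = cact M \<phi> x))"
proof -
  have "lin_on s s A (\<lambda>x. x)" for s :: "'a \<Rightarrow> 'c \<Rightarrow> 'c" and A by (simp add: lin_on_def)
  then show ?thesis
    unfolding subcomodule_def using comod_hom_iff[OF assms(1) _ assms(2), of N "\<lambda>x. x"] by auto
qed

section \<open>Change of coalgebra\<close>

text \<open>Equality of comodules up to the choice of the formal sums representing the coaction.\<close>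

definition same :: "('k::field \<Rightarrow> 'c::ab_group_add \<Rightarrow> 'c) \<Rightarrow> ('k, 'c, 'm::ab_group_add) comod \<Rightarrow> ('k, 'c, 'm) comod \<Rightarrow> bool" where
  "same s M M' \<longleftrightarrow> mspace M' = mspace M \<and> mscale M' = mscale M \<and>
     (\<forall>\<phi>. lfun s \<phi> \<longrightarrow> (\<forall>m\<in>mspace M. cact M' \<phi> m = cact M \<phi> m))"

definition invariant :: "('k::field \<Rightarrow> 'c::ab_group_add \<Rightarrow> 'c) \<Rightarrow> ('k, 'c, 'm::ab_group_add) comod \<Rightarrow> 'm set \<Rightarrow> bool" where
  "invariant s M N \<longleftrightarrow> module.subspace (mscale M) N \<and> N \<subseteq> mspace M \<and>
     (\<forall>\<phi>. lfun s \<phi> \<longrightarrow> (\<forall>m\<in>N. cact M \<phi> m \<in> N))"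

definition supported_on :: "('k::field, 'c::ab_group_add) coalg \<Rightarrow> ('k, 'c, 'm::ab_group_add) comod \<Rightarrow> bool" where
  "supported_on H M \<longleftrightarrow> (\<forall>\<phi>. lfun (cscale H) \<phi> \<longrightarrow> (\<forall>h\<in>cspace H. \<phi> h = 0) \<longrightarrow> (\<forall>m\<in>mspace M. cact M \<phi> m = 0))"

lemma same_refl: "same s M M" by (simp add: same_def)
lemma same_sym: "same s M M' \<Longrightarrow> same s M' M" by (simp add: same_def)

lemma invariant_same: "same s M M' \<Longrightarrow> invariant s M' N \<longleftrightarrow> invariant s M N"
  unfolding same_def invariant_def by (metis subsetD)

lemma subcoalgebra_basic:
  assumes "subcoalgebra H C"
  shows "coalgebra H" "cspace H \<subseteq> cspace C" "cscale H = cscale C" "h \<in> cspace H \<Longrightarrow> counit H h = counit C h"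
  using assms by (simp_all add: subcoalgebra_def)

lemma subcoalgebra_refl: "coalgebra C \<Longrightarrow> subcoalgebra C C"
  by (simp add: subcoalgebra_def tensor_eq_def module.subspace_0[OF fs.module_axioms tensor_null_subspace])

lemma subcoalgebra_convl:
  assumes "subcoalgebra H C" "lin_on (cscale C) (*) (cspace C) f" "lin_on (cscale C) (*) (cspace C) g"
    "h \<in> cspace H"
  shows "convl H f g h = convl C f g h"
proof -
  have "tensor_eq (cscale C) (cspace C) (cscale C) (cspace C) (comult H h) (comult C h)"
    using assms(1,4) by (simp add: subcoalgebra_def)
  from tensor_eqD[OF this assms(2,3)] show ?thesis by (simp add: convl_def)
qed

text \<open>The record stays the same: formal sums over \<open>H\<close> are formal sums over
  \<open>C\<close>, and on \<open>H\<close> the two products of functionals agree.\<close>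

lemma comodule_lift:
  assumes "coalgebra C" "subcoalgebra H C" "comodule H M"
  shows "comodule C M"
proof -
  note h = subcoalgebra_basic[OF assms(2)] and m = comodule_basic[OF assms(3)]
  show ?thesis
  proof (rule comoduleI[OF assms(1) m(1,3)])
    fix x assume "x \<in> mspace M"
    from m(4)[OF this] show "Poly_Mapping.keys (coact M x) \<subseteq> cspace C \<times> mspace M"
      using h(2) by (meson Sigma_mono order_trans subset_refl)
  next
    fix f assume "lfun (cscale C) f"
    then have "lin_on (cscale H) (*) (cspace H) f" unfolding h(3) by (rule lin_on_subset) simp
    then show "lin_on (mscale M) (mscale M) (mspace M) (cact M f)" by (rule lin_on_cact[OF h(1) assms(3)])
  next
    fix f g x assume fg: "lfun (cscale C) f" "lfun (cscale C) g" and x: "x \<in> mspace M"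
    have "cact M (convl C f g) x = cact M (convl H f g) x"
      by (rule cact_cong[OF assms(3) x], rule subcoalgebra_convl[OF assms(2), symmetric])
        (use fg in \<open>auto intro: lin_on_subset\<close>)
    also have "\<dots> = cact M g (cact M f x)"
      by (rule cact_convl[OF h(1) assms(3) x]) (use fg in \<open>auto intro: lin_on_subset simp: h(3)\<close>)
    finally show "cact M (convl C f g) x = cact M g (cact M f x)" .
  next
    fix x assume x: "x \<in> mspace M"
    have "cact M (counit C) x = cact M (counit H) x"
      by (rule cact_cong[OF assms(3) x]) (simp add: h(4))
    then show "cact M (counit C) x = x" using cact_counit[OF assms(3) x] by simp
  qed
qed

text \<open>Serves two purposes: with \<open>C\<close> in the place of \<open>H\<close> it makes an
  invariant subspace a subcomodule, with \<open>mspace M\<close> in the place of \<open>N\<close> it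
  turns M into an H-comodule. The formal sums are chosen anew by \<open>tensor_restrict\<close>;
  what is preserved are the operators.\<close>

lemma restrict_comodule:
  assumes C: "coalgebra C" and H: "subcoalgebra H C" and M: "comodule C M"
    and inv: "invariant (cscale C) M N"
    and supp: "\<And>\<phi> m. lfun (cscale C) \<phi> \<Longrightarrow> (\<And>h. h \<in> cspace H \<Longrightarrow> \<phi> h = 0) \<Longrightarrow> m \<in> N \<Longrightarrow> cact M \<phi> m = 0"
  shows "\<exists>N'. comodule H N' \<and> mspace N' = N \<and> mscale N' = mscale M \<and>
    (\<forall>\<phi>. lfun (cscale C) \<phi> \<longrightarrow> (\<forall>m\<in>N. cact N' \<phi> m = cact M \<phi> m))"
proof -
  note h = subcoalgebra_basic[OF H] and m = comodule_basic[OF M] and c = coalgebra_basic[OF C]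
  note b = coalgebra_basic[OF h(1)]
  have inv': "module.subspace (mscale M) N" "N \<subseteq> mspace M" "\<And>\<phi> x. lfun (cscale C) \<phi> \<Longrightarrow> x \<in> N \<Longrightarrow> cact M \<phi> x \<in> N"
    using inv by (auto simp: invariant_def)
  have "\<exists>t. Poly_Mapping.keys t \<subseteq> cspace H \<times> N \<and>
      (\<forall>f. lfun (cscale C) f \<longrightarrow> slice (mscale M) f t = cact M f x)" if x: "x \<in> N" for x
    unfolding cact_def
    by (rule tensor_restrict[OF c(1) b(3)[unfolded h(3)] m(1) inv'(1)])
      (use inv'(3)[OF _ x] supp[OF _ _ x] in \<open>auto simp: cact_def\<close>)
  then obtain T where T: "\<And>x. x \<in> N \<Longrightarrow> Poly_Mapping.keys (T x) \<subseteq> cspace H \<times> N"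
    "\<And>x f. x \<in> N \<Longrightarrow> lfun (cscale C) f \<Longrightarrow> slice (mscale M) f (T x) = cact M f x"
    by metis
  define N' where "N' = \<lparr>mspace = N, mscale = mscale M, coact = T\<rparr>"
  have N': "mspace N' = N" "mscale N' = mscale M" "coact N' = T" by (simp_all add: N'_def)
  have act: "cact N' f x = cact M f x" if "x \<in> N" "lfun (cscale C) f" for f x
    using T(2)[OF that] by (simp add: cact_def N')
  have cong: "cact N' f x = cact N' g x" if "x \<in> N" "\<And>c. c \<in> cspace H \<Longrightarrow> f c = g c" for f g x
    unfolding cact_def N' by (rule slice_cong) (use T(1)[OF that(1)] that(2) in auto)
  \<comment> \<open>Meant for \<open>counit\<close> and \<open>convl\<close>, which are linear on
    the carrier only: they are extended to total functionals before M and the new comodule are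
    compared.\<close>
  have ext: "cact N' f x = cact M g x" if x: "x \<in> N" and g: "lin_on (cscale C) (*) (cspace C) g"
    and fg: "\<And>c. c \<in> cspace H \<Longrightarrow> f c = g c" for f g x
  proof -
    obtain g' where g': "lfun (cscale C) g'" "\<forall>x\<in>cspace C. g' x = g x"
      using lin_on_extend[OF c(1,3) g] by blast
    have "cact N' f x = cact N' g' x" by (rule cong[OF x]) (use fg g' h(2) in auto)
    also have "\<dots> = cact M g' x" by (rule act[OF x g'(1)])
    also have "\<dots> = cact M g x" by (rule cact_cong[OF M]) (use x inv'(2) g'(2) in auto)
    finally show ?thesis .
  qed
  have sub: "lin_on (cscale C) (*) (cspace C) f" if "lfun (cscale C) f" for f
    by (rule lin_on_subset[OF that]) simp
  have "comodule H N'"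
  proof (rule comoduleI[OF h(1)], unfold N' h(3))
    fix f assume f: "lfun (cscale C) f"
    have "lin_on (mscale M) (mscale M) N (cact M f)"
      by (rule lin_on_subset[OF lin_on_cact[OF C M sub[OF f]] inv'(2)])
    then show "lin_on (mscale M) (mscale M) N (cact N' f)"
      using act[OF _ f] module.subspace_add[OF m(2) inv'(1)] module.subspace_scale[OF m(2) inv'(1)]
      by (simp add: lin_on_def)
  next
    fix f g x assume fg: "lfun (cscale C) f" "lfun (cscale C) g" and x: "x \<in> N"
    have "cact N' (convl H f g) x = cact M (convl C f g) x"
      by (rule ext[OF x lin_on_convl[OF C sub[OF fg(1)] sub[OF fg(2)]]])
        (rule subcoalgebra_convl[OF H sub[OF fg(1)] sub[OF fg(2)]])
    also have "\<dots> = cact M g (cact M f x)"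
      by (rule cact_convl[OF C M _ sub[OF fg(1)] sub[OF fg(2)]]) (use x inv'(2) in auto)
    also have "\<dots> = cact N' g (cact N' f x)"
      using act fg x inv'(3) by simp
    finally show "cact N' (convl H f g) x = cact N' g (cact N' f x)" .
  next
    fix x assume x: "x \<in> N"
    have "cact N' (counit H) x = cact M (counit C) x"
      by (rule ext[OF x c(5)]) (rule h(4))
    then show "cact N' (counit H) x = x" using cact_counit[OF M] x inv'(2) by auto
  qed (use m(1) inv'(1) T(1) in auto)
  then show ?thesis using N' act by metis
qed

lemma invariant_mspace: "comodule C M \<Longrightarrow> invariant s M (mspace M)"
  using comodule_basic cact_in by (auto simp: invariant_def)

text \<open>\<open>M\<close> with representing formal sums over \<open>H\<close>; meaningless unless \<open>supported_on H M\<close>.\<close>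

definition conv :: "('k::field, 'c::ab_group_add) coalg \<Rightarrow> ('k, 'c, 'm::ab_group_add) comod \<Rightarrow> ('k, 'c, 'm) comod" where
  "conv H M = (SOME M'. comodule H M' \<and> same (cscale H) M M')"

lemma conv:
  assumes "coalgebra C" "subcoalgebra H C" "comodule C M" "supported_on H M"
  shows "comodule H (conv H M)" "same (cscale H) M (conv H M)"
proof -
  note h = subcoalgebra_basic[OF assms(2)]
  have "\<And>\<phi> m. lfun (cscale C) \<phi> \<Longrightarrow> (\<And>h. h \<in> cspace H \<Longrightarrow> \<phi> h = 0) \<Longrightarrow> m \<in> mspace M \<Longrightarrow> cact M \<phi> m = 0"
    using assms(4) unfolding supported_on_def h(3) by simp
  from restrict_comodule[OF assms(1-3) invariant_mspace[OF assms(3)] this]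
  have "\<exists>M'. comodule H M' \<and> same (cscale H) M M'" unfolding same_def h(3) .
  from someI_ex[OF this] show "comodule H (conv H M)" "same (cscale H) M (conv H M)"
    by (simp_all add: conv_def)
qed

section \<open>Invariant subspaces in place of subcomodules\<close>

lemma subcomodule_invariant:
  assumes "coalgebra C" "comodule C M" "subcomodule C N M"
  shows "invariant (cscale C) M (mspace N)"
proof -
  have N: "comodule C N" "mspace N \<subseteq> mspace M" "mscale N = mscale M"
    "\<And>\<phi> x. lfun (cscale C) \<phi> \<Longrightarrow> x \<in> mspace N \<Longrightarrow> cact N \<phi> x = cact M \<phi> x"
    using assms(3) unfolding subcomodule_iff[OF assms(1,2)] by auto
  show ?thesis
    unfolding invariant_def using N(2,3) comodule_basic(3)[OF N(1)] cact_in[OF N(1)] N(4)[symmetric] by simp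
qed

lemma invariant_subcomodule:
  assumes "coalgebra C" "comodule C M" "invariant (cscale C) M N"
  shows "\<exists>N'. subcomodule C N' M \<and> mspace N' = N"
proof -
  have sub: "N \<subseteq> mspace M" using assms(3) by (simp add: invariant_def)
  have "cact M \<phi> m = 0" if "\<And>h. h \<in> cspace C \<Longrightarrow> \<phi> h = 0" "m \<in> N" for \<phi> m
    by (rule cact_zero[OF assms(2) _ that(1)]) (use sub that(2) in auto)
  then obtain N' where "comodule C N'" "mspace N' = N" "mscale N' = mscale M"
    "\<And>\<phi> m. lfun (cscale C) \<phi> \<Longrightarrow> m \<in> N \<Longrightarrow> cact N' \<phi> m = cact M \<phi> m"
    using restrict_comodule[OF assms(1) subcoalgebra_refl[OF assms(1)] assms(2,3)] by metis
  then show ?thesis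
    unfolding subcomodule_iff[OF assms(1,2)] using sub by (intro exI[of _ N']) simp
qed

lemma subcomodule_ex_iff:
  assumes "coalgebra C" "comodule C M"
  shows "(\<exists>N'. subcomodule C N' M \<and> mspace N' = N) \<longleftrightarrow> invariant (cscale C) M N"
  using subcomodule_invariant[OF assms] invariant_subcomodule[OF assms] by blast

text \<open>Invariance depends on the operators alone, so in this form simplicity does not see
  whether M is regarded over \<open>C\<close> or over \<open>H\<close>.\<close>

lemma simple_iff:
  assumes "coalgebra C" "comodule C M"
  shows "simple_comodule C M \<longleftrightarrow> mspace M \<noteq> {0} \<and>
    (\<forall>N. invariant (cscale C) M N \<longrightarrow> N = {0} \<or> N = mspace M)"
proof -
  have "(\<forall>N'. subcomodule C N' M \<longrightarrow> P (mspace N')) \<longleftrightarrow>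
      (\<forall>N. (\<exists>N'. subcomodule C N' M \<and> mspace N' = N) \<longrightarrow> P N)" for P
    by blast
  from this[of "\<lambda>N. N = {0} \<or> N = mspace M"] show ?thesis
    unfolding simple_comodule_def subcomodule_ex_iff[OF assms] using assms(2) by simp
qed

lemma indecomposable_iff:
  assumes "coalgebra C" "comodule C M"
  shows "indecomposable_comodule C M \<longleftrightarrow> mspace M \<noteq> {0} \<and>
    (\<forall>N N'. invariant (cscale C) M N \<and> invariant (cscale C) M N' \<and>
      {x + y | x y. x \<in> N \<and> y \<in> N'} = mspace M \<and> N \<inter> N' = {0} \<longrightarrow> N = {0} \<or> N' = {0})"
proof -
  have "(\<forall>U U'. subcomodule C U M \<and> subcomodule C U' M \<and> Q (mspace U) (mspace U') \<longrightarrow> P (mspace U) (mspace U')) \<longleftrightarrow>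
      (\<forall>N N'. (\<exists>U. subcomodule C U M \<and> mspace U = N) \<and> (\<exists>U. subcomodule C U M \<and> mspace U = N') \<and> Q N N' \<longrightarrow> P N N')" for P Q
    by blast
  from this[of "\<lambda>N N'. {x + y | x y. x \<in> N \<and> y \<in> N'} = mspace M \<and> N \<inter> N' = {0}" "\<lambda>N N'. N = {0} \<or> N' = {0}"]
  show ?thesis
    unfolding indecomposable_comodule_def subcomodule_ex_iff[OF assms] using assms(2) by simp
qed

lemma simple_same:
  assumes "coalgebra C" "comodule C M" "coalgebra H" "comodule H M'" "cscale H = cscale C" "same (cscale C) M M'"
  shows "simple_comodule H M' \<longleftrightarrow> simple_comodule C M"
  unfolding simple_iff[OF assms(1,2)] simple_iff[OF assms(3,4)] assms(5) invariant_same[OF assms(6)]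
  using assms(6) by (simp add: same_def)

lemma indecomposable_same:
  assumes "coalgebra C" "comodule C M" "coalgebra H" "comodule H M'" "cscale H = cscale C" "same (cscale C) M M'"
  shows "indecomposable_comodule H M' \<longleftrightarrow> indecomposable_comodule C M"
  unfolding indecomposable_iff[OF assms(1,2)] indecomposable_iff[OF assms(3,4)] assms(5) invariant_same[OF assms(6)]
  using assms(6) by (simp add: same_def)

text \<open>Isomorphism of spaces with operators. Of the coalgebra only the scaling s enters, so the
  same map serves over \<open>C\<close> and over every subcoalgebra.\<close>

definition iso_by where
  "iso_by s M N f \<longleftrightarrow> bij_betw f (mspace M) (mspace N) \<and> lin_on (mscale M) (mscale N) (mspace M) f \<and>
     (\<forall>\<phi>. lfun s \<phi> \<longrightarrow> (\<forall>x\<in>mspace M. f (cact M \<phi> x) = cact N \<phi> (f x)))"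

lemma comod_iso_iff:
  assumes "coalgebra C" "comodule C M" "comodule C N"
  shows "comod_iso C M N \<longleftrightarrow> (\<exists>f. iso_by (cscale C) M N f)"
  unfolding comod_iso_def comod_hom_iff[OF assms] iso_by_def bij_betw_def by auto

lemma iso_by_same:
  assumes "same s M M'" "same s N N'" "iso_by s M N f" "comodule C M" "comodule C N"
  shows "iso_by s M' N' f"
proof -
  have "f x \<in> mspace N" if "x \<in> mspace M" for x
    using assms(3) that by (auto simp: iso_by_def bij_betw_def)
  then show ?thesis using assms unfolding iso_by_def same_def by simp
qed

lemma iso_by_refl: "same s M M' \<Longrightarrow> comodule C M \<Longrightarrow> iso_by s M M' (\<lambda>x. x)"
  using cact_in by (auto simp: iso_by_def same_def bij_betw_def lin_on_def)

lemma iso_by_trans: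
  assumes "iso_by s M N f" "iso_by s N Q g"
  shows "iso_by s M Q (\<lambda>x. g (f x))"
proof -
  have "f x \<in> mspace N" if "x \<in> mspace M" for x
    using assms(1) that by (auto simp: iso_by_def bij_betw_def)
  moreover have "lin_on (mscale M) (mscale Q) (mspace M) (\<lambda>x. g (f x))"
    by (rule lin_on_comp[of _ "mscale N" _ _ _ "mspace N"]) (use assms in \<open>auto simp: iso_by_def bij_betw_def\<close>)
  ultimately show ?thesis
    using assms bij_betw_trans[of f "mspace M" "mspace N" g "mspace Q"]
    unfolding iso_by_def by (simp add: o_def)
qed

lemma iso_by_sym:
  assumes "iso_by s M N f" "comodule C M"
  shows "iso_by s N M (inv_into (mspace M) f)"
proof -
  note m = comodule_basic[OF assms(2)]
  let ?g = "inv_into (mspace M) f"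
  have bij: "bij_betw f (mspace M) (mspace N)" and inj: "inj_on f (mspace M)"
    and lin: "lin_on (mscale M) (mscale N) (mspace M) f"
    using assms(1) by (auto simp: iso_by_def bij_betw_def)
  have g: "?g y \<in> mspace M" "f (?g y) = y" if "y \<in> mspace N" for y
    using that bij by (auto simp: bij_betw_def inv_into_into f_inv_into_f)
  have gf: "?g (f x) = x" if "x \<in> mspace M" for x using inj that by simp
  have "?g (x + y) = ?g x + ?g y" if "x \<in> mspace N" "y \<in> mspace N" for x y
  proof -
    have "f (?g x + ?g y) = x + y" using lin_on_add[OF lin] g that by simp
    then show ?thesis using gf[OF module.subspace_add[OF m(2,3)]] g that by metis
  qed
  moreover have "?g (mscale N r x) = mscale M r (?g x)" if "x \<in> mspace N" for x r
  proof -
    have "f (mscale M r (?g x)) = mscale N r x" using lin_on_scale[OF lin] g that by simp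
    then show ?thesis using gf[OF module.subspace_scale[OF m(2,3)]] g that by metis
  qed
  moreover have "?g (cact N \<phi> x) = cact M \<phi> (?g x)" if "lfun s \<phi>" "x \<in> mspace N" for \<phi> x
  proof -
    have "f (cact M \<phi> (?g x)) = cact N \<phi> x" using assms(1) g that by (simp add: iso_by_def)
    then show ?thesis using gf[OF cact_in[OF assms(2) g(1)]] that by metis
  qed
  ultimately show ?thesis using bij_betw_inv_into[OF bij] by (simp add: iso_by_def lin_on_def)
qed

lemma comod_iso_same:
  assumes "coalgebra C" "coalgebra H" "cscale H = cscale C" "comodule C M" "comodule C N"
    "comodule H M'" "comodule H N'" "same (cscale C) M M'" "same (cscale C) N N'"
  shows "comod_iso H M' N' \<longleftrightarrow> comod_iso C M N"
  unfolding comod_iso_iff[OF assms(1,4,5)] comod_iso_iff[OF assms(2,6,7)] assms(3)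
  using iso_by_same assms(4-9) same_sym by metis

section \<open>Isomorphism classes\<close>

lemma iso_class_self:
  assumes "coalgebra C" "comodule C M"
  shows "M \<in> iso_class C M"
  using comod_iso_iff[OF assms assms(2)] iso_by_refl[OF same_refl assms(2)] assms(2)
  unfolding iso_class_def by blast

lemma iso_class_eq_iff:
  assumes "coalgebra C" "comodule C M" "comodule C N"
  shows "iso_class C M = iso_class C N \<longleftrightarrow> comod_iso C M N"
proof
  assume "iso_class C M = iso_class C N"
  then have "N \<in> iso_class C M" using iso_class_self[OF assms(1,3)] by simp
  then show "comod_iso C M N" by (simp add: iso_class_def)
next
  assume "comod_iso C M N"
  then obtain f where f: "iso_by (cscale C) M N f" using comod_iso_iff[OF assms] by blast
  show "iso_class C M = iso_class C N"
    unfolding iso_class_def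
    using comod_iso_iff[OF assms(1,2)] comod_iso_iff[OF assms(1,3)] f iso_by_sym[OF f assms(2)]
      iso_by_trans by (smt (verit) Collect_cong)
qed

lemma iso_class_memD:
  assumes "coalgebra C" "comodule C M" "N \<in> iso_class C M"
  shows "comodule C N" "iso_class C N = iso_class C M"
  using assms iso_class_eq_iff[of C M N] by (auto simp: iso_class_def)

lemma iso_class_mem_iff:
  assumes "coalgebra C" "comodule C M" "comodule C N"
  shows "N \<in> iso_class C M \<longleftrightarrow> iso_class C N = iso_class C M"
  using iso_class_memD(2)[OF assms(1,2)] iso_class_self[OF assms(1,3)] by blast

lemma iso_class_same:
  assumes "coalgebra C" "comodule C M" "comodule C M'" "same (cscale C) M M'"
  shows "iso_class C M' = iso_class C M"
  using iso_class_eq_iff[OF assms(1-3)] comod_iso_iff[OF assms(1-3)] iso_by_refl[OF assms(4,2)] by auto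

text \<open>A class over \<open>C\<close> may also contain comodules whose formal sums leave
  \<open>H\<close>. Classes over \<open>H\<close> are therefore enlarged by \<open>up_class\<close>
  and recovered by \<open>down_class\<close>.\<close>

definition up_class ::
  "('k::field, 'c::ab_group_add) coalg \<Rightarrow> ('k, 'c) std_comod set \<Rightarrow> ('k, 'c) std_comod set" where
  "up_class C X = {N. comodule C N \<and> (\<exists>M\<in>X. comod_iso C M N)}"

definition down_class ::
  "('k::field, 'c::ab_group_add) coalg \<Rightarrow> ('k, 'c) std_comod set \<Rightarrow> ('k, 'c) std_comod set" where
  "down_class H Y = {N \<in> Y. comodule H N}"

context
  fixes C H :: "('k::field, 'c::ab_group_add) coalg"
  assumes C: "coalgebra C" and H: "subcoalgebra H C"
begin

lemma comod_iso_lift: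
  assumes "comodule H M" "comodule H N"
  shows "comod_iso C M N \<longleftrightarrow> comod_iso H M N"
  using comod_iso_same[OF C subcoalgebra_basic(1,3)[OF H] comodule_lift[OF C H assms(1)]
      comodule_lift[OF C H assms(2)] assms same_refl same_refl] ..

lemma down_iso_class:
  assumes "comodule H M"
  shows "down_class H (iso_class C M) = iso_class H M"
proof (rule set_eqI)
  fix N
  show "N \<in> down_class H (iso_class C M) \<longleftrightarrow> N \<in> iso_class H M"
    using comod_iso_lift[OF assms, of N] comodule_lift[OF C H, of N]
    unfolding down_class_def iso_class_def by blast
qed

lemma up_iso_class:
  assumes "comodule H M"
  shows "up_class C (iso_class H M) = iso_class C M"
proof -
  have "iso_class C M' = iso_class C M" if "M' \<in> iso_class H M" for M'
  proof -
    have M': "comodule H M'" "comod_iso C M M'"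
      using that comod_iso_lift[OF assms, of M'] unfolding iso_class_def by blast+
    then show ?thesis
      using iso_class_eq_iff[OF C comodule_lift[OF C H assms] comodule_lift[OF C H M'(1)]] by simp
  qed
  moreover have "up_class C (iso_class H M) = (\<Union>M'\<in>iso_class H M. iso_class C M')"
    unfolding up_class_def iso_class_def[of C] by blast
  ultimately show ?thesis using iso_class_self[OF subcoalgebra_basic(1)[OF H] assms] by blast
qed

lemma simple_lift:
  assumes "comodule H M"
  shows "simple_comodule C M \<longleftrightarrow> simple_comodule H M"
  using simple_same[OF C comodule_lift[OF C H assms] subcoalgebra_basic(1)[OF H] assms
      subcoalgebra_basic(3)[OF H] same_refl] ..

text \<open>Embeds the simple types of \<open>H\<close> into those of \<open>C\<close>, with
  \<open>down_class H\<close> as a left inverse; dimension vectors are transported along this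
  embedding.\<close>

lemma simple_types_down_up:
  assumes "X \<in> simple_types H"
  shows "up_class C X \<in> simple_types C" "down_class H (up_class C X) = X"
proof -
  obtain S where S: "simple_comodule H S" "X = iso_class H S" using assms unfolding simple_types_def by blast
  have c: "comodule H S" using S(1) by (simp add: simple_comodule_def)
  have u: "up_class C X = iso_class C S" unfolding S(2) by (rule up_iso_class[OF c])
  then show "down_class H (up_class C X) = X" unfolding S(2) using down_iso_class[OF c] by simp
  show "up_class C X \<in> simple_types C"
    unfolding u simple_types_def using simple_lift[OF c] S(1) by blast
qed

end

section \<open>Composition series over a coalgebra and a subcoalgebra\<close>

lemma quotient_iso_iff:
  assumes "coalgebra C" "comodule C M" "comodule C N" "comodule C Q"
  shows "quotient_iso C M N Q \<longleftrightarrow> mspace N \<subseteq> mspace M \<and> mscale N = mscale M \<and>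
    (\<forall>\<phi>. lfun (cscale C) \<phi> \<longrightarrow> (\<forall>x\<in>mspace N. cact N \<phi> x = cact M \<phi> x)) \<and>
    (\<exists>p. p ` mspace M = mspace Q \<and> lin_on (mscale M) (mscale Q) (mspace M) p \<and>
      (\<forall>\<phi>. lfun (cscale C) \<phi> \<longrightarrow> (\<forall>x\<in>mspace M. p (cact M \<phi> x) = cact Q \<phi> (p x))) \<and>
      {x \<in> mspace M. p x = 0} = mspace N)"
proof -
  have "(\<exists>p. (p ` mspace M \<subseteq> mspace Q \<and> l p \<and> c p) \<and> p ` mspace M = mspace Q \<and> k p) \<longleftrightarrow>
      (\<exists>p. p ` mspace M = mspace Q \<and> l p \<and> c p \<and> k p)" for l c k
    by (rule ex_cong1) auto
  then show ?thesis
    unfolding quotient_iso_def subcomodule_iff[OF assms(1,2)] comod_hom_iff[OF assms(1,2,4)]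
    using assms(3) by simp
qed

lemma quotient_iso_same:
  assumes "coalgebra C" "comodule C M" "comodule C N" "comodule C Q"
    "coalgebra H" "comodule H M'" "comodule H N'" "comodule H Q'" "cscale H = cscale C"
    "same (cscale C) M M'" "same (cscale C) N N'" "same (cscale C) Q Q'" "quotient_iso C M N Q"
  shows "quotient_iso H M' N' Q'"
proof -
  have *: "(\<forall>\<phi>. lfun (cscale C) \<phi> \<longrightarrow> (\<forall>x\<in>mspace M. p (cact M' \<phi> x) = cact Q' \<phi> (p x))) \<longleftrightarrow>
      (\<forall>\<phi>. lfun (cscale C) \<phi> \<longrightarrow> (\<forall>x\<in>mspace M. p (cact M \<phi> x) = cact Q \<phi> (p x)))"
    if "p ` mspace M = mspace Q" for p
  proof -
    have "p x \<in> mspace Q" if "x \<in> mspace M" for x using that \<open>p ` mspace M = mspace Q\<close> by auto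
    then show ?thesis using assms(10,12) unfolding same_def by simp
  qed
  have "mspace M' = mspace M" "mscale M' = mscale M" "mspace N' = mspace N" "mscale N' = mscale N"
    "mspace Q' = mspace Q" "mscale Q' = mscale Q" using assms(10-12) by (auto simp: same_def)
  moreover have "cact N' \<phi> x = cact M' \<phi> x" if "lfun (cscale C) \<phi>" "x \<in> mspace N" for \<phi> x
  proof -
    have "cact N \<phi> x = cact M \<phi> x" "x \<in> mspace M"
      using assms(13) that unfolding quotient_iso_iff[OF assms(1-4)] by auto
    then show ?thesis using assms(10,11) that by (simp add: same_def)
  qed
  moreover obtain p where "p ` mspace M = mspace Q" "lin_on (mscale M) (mscale Q) (mspace M) p"
    "\<forall>\<phi>. lfun (cscale C) \<phi> \<longrightarrow> (\<forall>x\<in>mspace M. p (cact M' \<phi> x) = cact Q' \<phi> (p x))"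
    "{x \<in> mspace M. p x = 0} = mspace N" "mspace N \<subseteq> mspace M" "mscale N = mscale M"
    using assms(13) unfolding quotient_iso_iff[OF assms(1-4)] by (elim conjE exE) (simp add: *)
  ultimately show ?thesis
    unfolding quotient_iso_iff[OF assms(5-8)] assms(9) by (intro conjI exI[of _ p]) simp_all
qed

lemma jordan_hoelder_comodules:
  assumes "comodule C M" "jordan_hoelder_series C M Ms Ss"
  shows "k \<le> length Ss \<Longrightarrow> comodule C (Ms ! k)" "k < length Ss \<Longrightarrow> comodule C (Ss ! k)"
proof -
  show "comodule C (Ms ! k)" if "k \<le> length Ss"
  proof (cases "k < length Ss")
    case True
    then have "subcomodule C (Ms ! k) (Ms ! Suc k)"
      using assms(2) by (simp add: jordan_hoelder_series_def quotient_iso_def)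
    then show ?thesis by (simp add: subcomodule_def)
  next
    case False
    then show ?thesis using that assms by (simp add: jordan_hoelder_series_def)
  qed
  show "comodule C (Ss ! k)" if "k < length Ss"
    using that assms(2) by (simp add: jordan_hoelder_series_def simple_comodule_def)
qed

lemma jordan_hoelder_same:
  assumes C: "coalgebra C" and M: "comodule C M" and jh: "jordan_hoelder_series C M Ms Ss"
    and H: "coalgebra H" "cscale H = cscale C"
    and Ms: "length Ms' = Suc (length Ss)" "\<And>k. k \<le> length Ss \<Longrightarrow> comodule H (Ms' ! k)"
      "\<And>k. k \<le> length Ss \<Longrightarrow> same (cscale C) (Ms ! k) (Ms' ! k)"
    and Ss: "length Ss' = length Ss" "\<And>k. k < length Ss \<Longrightarrow> comodule H (Ss' ! k)"
      "\<And>k. k < length Ss \<Longrightarrow> same (cscale C) (Ss ! k) (Ss' ! k)"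
  shows "jordan_hoelder_series H (Ms' ! length Ss) Ms' Ss'"
proof -
  note c = jordan_hoelder_comodules[OF M jh]
  have "quotient_iso H (Ms' ! Suc k) (Ms' ! k) (Ss' ! k)" "simple_comodule H (Ss' ! k)" if k: "k < length Ss" for k
  proof -
    have q: "quotient_iso C (Ms ! Suc k) (Ms ! k) (Ss ! k)" "simple_comodule C (Ss ! k)"
      using jh k by (simp_all add: jordan_hoelder_series_def)
    show "quotient_iso H (Ms' ! Suc k) (Ms' ! k) (Ss' ! k)"
      by (rule quotient_iso_same[OF C _ _ _ H(1) _ _ _ H(2) _ _ _ q(1)]) (use k c Ms Ss in auto)
    show "simple_comodule H (Ss' ! k)"
      using simple_same[OF C c(2)[OF k] H(1) Ss(2)[OF k] H(2) Ss(3)[OF k]] q(2) by simp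
  qed
  then show ?thesis
    using jh Ms(1) Ms(3)[of 0] Ss(1) by (simp add: jordan_hoelder_series_def same_def)
qed

lemma jordan_hoelder_chain:
  assumes C: "coalgebra C" and M: "comodule C M" and jh: "jordan_hoelder_series C M Ms Ss" and "k \<le> length Ss"
  shows "mscale (Ms ! k) = mscale M \<and> mspace (Ms ! k) \<subseteq> mspace M \<and>
    (\<forall>f. lfun (cscale C) f \<longrightarrow> (\<forall>x\<in>mspace (Ms ! k). cact (Ms ! k) f x = cact M f x))"
  using \<open>k \<le> length Ss\<close>
\<comment> \<open>Downwards from the top term of the series, which is M itself.\<close>
proof (induction k rule: inc_induct)
  case base
  then show ?case using jh by (simp add: jordan_hoelder_series_def)
next
  case (step k)
  note c = jordan_hoelder_comodules[OF M jh]
  have q: "quotient_iso C (Ms ! Suc k) (Ms ! k) (Ss ! k)" using jh step by (simp add: jordan_hoelder_series_def)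
  have "comodule C (Ms ! Suc k)" "comodule C (Ms ! k)" "comodule C (Ss ! k)" using c step by simp_all
  from q[unfolded quotient_iso_iff[OF C this]]
  have "mscale (Ms ! k) = mscale (Ms ! Suc k)" "mspace (Ms ! k) \<subseteq> mspace (Ms ! Suc k)"
    "\<And>f x. lfun (cscale C) f \<Longrightarrow> x \<in> mspace (Ms ! k) \<Longrightarrow> cact (Ms ! k) f x = cact (Ms ! Suc k) f x"
    by blast+
  then show ?case using step.IH by (simp add: subset_eq)
qed

lemma jordan_hoelder_quotient:
  assumes C: "coalgebra C" and M: "comodule C M" and jh: "jordan_hoelder_series C M Ms Ss" and k: "k < length Ss"
  shows "mspace (Ms ! k) \<subseteq> mspace (Ms ! Suc k) \<and> (\<exists>p. p ` mspace (Ms ! Suc k) = mspace (Ss ! k) \<and>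
    lin_on (mscale M) (mscale (Ss ! k)) (mspace (Ms ! Suc k)) p \<and>
    (\<forall>f. lfun (cscale C) f \<longrightarrow> (\<forall>x\<in>mspace (Ms ! Suc k). p (cact M f x) = cact (Ss ! k) f (p x))) \<and>
    {x \<in> mspace (Ms ! Suc k). p x = 0} = mspace (Ms ! k))"
proof -
  note c = jordan_hoelder_comodules[OF M jh]
  have q: "quotient_iso C (Ms ! Suc k) (Ms ! k) (Ss ! k)" using jh k by (simp add: jordan_hoelder_series_def)
  have cc: "comodule C (Ms ! Suc k)" "comodule C (Ms ! k)" "comodule C (Ss ! k)" using c k by simp_all
  have ch: "mscale (Ms ! Suc k) = mscale M"
    "\<And>f x. lfun (cscale C) f \<Longrightarrow> x \<in> mspace (Ms ! Suc k) \<Longrightarrow> cact (Ms ! Suc k) f x = cact M f x"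
    using jordan_hoelder_chain[OF C M jh, of "Suc k"] k by auto
  from q[unfolded quotient_iso_iff[OF C cc]]
  obtain p where p: "p ` mspace (Ms ! Suc k) = mspace (Ss ! k)"
    "lin_on (mscale (Ms ! Suc k)) (mscale (Ss ! k)) (mspace (Ms ! Suc k)) p"
    "\<forall>f. lfun (cscale C) f \<longrightarrow> (\<forall>x\<in>mspace (Ms ! Suc k). p (cact (Ms ! Suc k) f x) = cact (Ss ! k) f (p x))"
    "{x \<in> mspace (Ms ! Suc k). p x = 0} = mspace (Ms ! k)" and sub: "mspace (Ms ! k) \<subseteq> mspace (Ms ! Suc k)"
    by (elim exE conjE)
  show ?thesis
    by (intro conjI sub exI[of _ p] p(1,4)) (use p(2,3) ch in simp_all)
qed

text \<open>An operator that is zero on M is zero on its subcomodules and, through the surjections,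
  on the factors.\<close>

lemma jordan_hoelder_supported_on:
  assumes C: "coalgebra C" and M: "comodule C M" and jh: "jordan_hoelder_series C M Ms Ss"
    and H: "cscale H = cscale C" and supp: "supported_on H M"
  shows "k \<le> length Ss \<Longrightarrow> supported_on H (Ms ! k)" "k < length Ss \<Longrightarrow> supported_on H (Ss ! k)"
proof -
  have Ms: "cact M \<phi> x = 0"
    if "k \<le> length Ss" "lfun (cscale C) \<phi>" "\<forall>h\<in>cspace H. \<phi> h = 0" "x \<in> mspace (Ms ! k)" for k \<phi> x
    using supp that jordan_hoelder_chain[OF C M jh that(1)] unfolding supported_on_def H by blast
  then show "supported_on H (Ms ! k)" if "k \<le> length Ss"
    using that jordan_hoelder_chain[OF C M jh that] unfolding supported_on_def H by simp
  show "supported_on H (Ss ! k)" if k: "k < length Ss"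
  proof -
    have cc: "comodule C (Ms ! Suc k)" "comodule C (Ss ! k)" using jordan_hoelder_comodules[OF M jh] k by simp_all
    note m = comodule_basic[OF cc(1)] and s = comodule_basic[OF cc(2)]
    have sc: "mscale (Ms ! Suc k) = mscale M" using jordan_hoelder_chain[OF C M jh, of "Suc k"] k by simp
    obtain p where p: "p ` mspace (Ms ! Suc k) = mspace (Ss ! k)"
      "lin_on (mscale M) (mscale (Ss ! k)) (mspace (Ms ! Suc k)) p"
      "\<forall>f. lfun (cscale C) f \<longrightarrow> (\<forall>x\<in>mspace (Ms ! Suc k). p (cact M f x) = cact (Ss ! k) f (p x))"
      using jordan_hoelder_quotient[OF C M jh k] by (elim conjE exE)
    have p0: "p 0 = 0"
      by (rule lin_on_0[OF p(2) m(2)[unfolded sc] s(2)]) (rule module.subspace_0[OF m(2,3)])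
    show ?thesis unfolding supported_on_def H
    proof (intro allI impI ballI)
      fix \<phi> y assume \<phi>: "lfun (cscale C) \<phi>" "\<forall>h\<in>cspace H. \<phi> h = 0" and y: "y \<in> mspace (Ss ! k)"
      obtain x where x: "x \<in> mspace (Ms ! Suc k)" "y = p x" using y p(1) by blast
      have "cact M \<phi> x = 0" using Ms[of "Suc k", OF _ \<phi> x(1)] k by simp
      then show "cact (Ss ! k) \<phi> y = 0" using p(3) \<phi>(1) x p0 by metis
    qed
  qed
qed

text \<open>Extension by zero along the embedding of simple types; \<open>down_vec\<close> is the
  restriction. \<open>Abs_poly_mapping\<close> has the intended values only for finite support,
  which the two lookup lemmas establish.\<close>

definition up_vec where
  "up_vec C H v = Abs_poly_mapping (\<lambda>Y. if Y \<in> up_class C ` simple_types H then Poly_Mapping.lookup v (down_class H Y) else 0)"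

definition down_vec where
  "down_vec C H w = Abs_poly_mapping (\<lambda>X. if X \<in> simple_types H then Poly_Mapping.lookup w (up_class C X) else 0)"

context
  fixes C H :: "('k::field, 'c::ab_group_add) coalg"
  assumes C: "coalgebra C" and H: "subcoalgebra H C"
begin

lemma lookup_up_vec:
  "Poly_Mapping.lookup (up_vec C H v) Y = (if Y \<in> up_class C ` simple_types H then Poly_Mapping.lookup v (down_class H Y) else 0)"
proof -
  have "{Y. (if Y \<in> up_class C ` simple_types H then Poly_Mapping.lookup v (down_class H Y) else 0) \<noteq> 0}
      \<subseteq> up_class C ` Poly_Mapping.keys v"
    using simple_types_down_up[OF C H] by (auto simp: in_keys_iff intro!: imageI)
  then have "finite {Y. (if Y \<in> up_class C ` simple_types H then Poly_Mapping.lookup v (down_class H Y) else 0) \<noteq> 0}"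
    by (rule finite_subset) simp
  then show ?thesis unfolding up_vec_def by (simp add: lookup_Abs_poly_mapping)
qed

lemma lookup_down_vec:
  "Poly_Mapping.lookup (down_vec C H w) X = (if X \<in> simple_types H then Poly_Mapping.lookup w (up_class C X) else 0)"
proof -
  have "{X. (if X \<in> simple_types H then Poly_Mapping.lookup w (up_class C X) else 0) \<noteq> 0}
      \<subseteq> down_class H ` Poly_Mapping.keys w"
  proof
    fix X assume "X \<in> {X. (if X \<in> simple_types H then Poly_Mapping.lookup w (up_class C X) else 0) \<noteq> 0}"
    then have "X \<in> simple_types H" "up_class C X \<in> Poly_Mapping.keys w" by (auto simp: in_keys_iff split: if_splits)
    then show "X \<in> down_class H ` Poly_Mapping.keys w"
      using simple_types_down_up(2)[OF C H] by (metis image_eqI)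
  qed
  then have "finite {X. (if X \<in> simple_types H then Poly_Mapping.lookup w (up_class C X) else 0) \<noteq> 0}"
    by (rule finite_subset) simp
  then show ?thesis unfolding down_vec_def by (simp add: lookup_Abs_poly_mapping)
qed

lemma keys_up_vec: "Poly_Mapping.keys (up_vec C H v) \<subseteq> simple_types C"
  using simple_types_down_up(1)[OF C H] by (auto simp: in_keys_iff lookup_up_vec split: if_splits)

lemma keys_down_vec: "Poly_Mapping.keys (down_vec C H w) \<subseteq> simple_types H"
  by (auto simp: in_keys_iff lookup_down_vec split: if_splits)

lemma has_dim_vector_up:
  assumes M: "comodule H M" and v: "has_dim_vector H M v"
  shows "has_dim_vector C M (up_vec C H v)"
proof -
  note h = subcoalgebra_basic[OF H] and l = comodule_lift[OF C H]
  obtain Ms Ss where jh: "jordan_hoelder_series H M Ms Ss"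
    and d: "\<And>i. i \<in> simple_types H \<Longrightarrow> Poly_Mapping.lookup v i = card {k. k < length Ss \<and> Ss ! k \<in> i}"
    using v by (auto simp: has_dim_vector_def)
  note c = jordan_hoelder_comodules[OF M jh]
  have len: "length Ms = Suc (length Ss)" "Ms ! length Ss = M"
    using jh by (auto simp: jordan_hoelder_series_def)
  have "jordan_hoelder_series C (Ms ! length Ss) Ms Ss"
    by (rule jordan_hoelder_same[OF h(1) M jh C h(3)[symmetric]])
      (use c l len in \<open>auto intro: same_refl\<close>)
  then have "jordan_hoelder_series C M Ms Ss" by (simp add: len)
  moreover have "Poly_Mapping.lookup (up_vec C H v) Y = card {k. k < length Ss \<and> Ss ! k \<in> Y}"
    if Y: "Y \<in> simple_types C" for Y
  proof (cases "Y \<in> up_class C ` simple_types H")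
    case True
    then obtain X where X: "X \<in> simple_types H" "Y = up_class C X" by blast
    then have dX: "down_class H Y = X" using simple_types_down_up[OF C H] by simp
    have "{k. k < length Ss \<and> Ss ! k \<in> Y} = {k. k < length Ss \<and> Ss ! k \<in> X}"
      using c(2) unfolding dX[symmetric] down_class_def by auto
    then show ?thesis using True X dX d by (simp add: lookup_up_vec)
  next
    case False
    \<comment> \<open>A factor of M is itself a simple H-comodule, so its type over \<open>C\<close>
      comes from \<open>H\<close>; all other types have multiplicity zero.\<close>
    have "Ss ! k \<notin> Y" if k: "k < length Ss" for k
    proof
      assume "Ss ! k \<in> Y"
      then have "Y = iso_class C (Ss ! k)"
        using Y iso_class_memD(2)[OF C] unfolding simple_types_def simple_comodule_def by blast
      then have "Y = up_class C (iso_class H (Ss ! k))" using up_iso_class[OF C H c(2)[OF k]] by simp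
      moreover have "simple_comodule H (Ss ! k)" using jh k by (simp add: jordan_hoelder_series_def)
      ultimately show False using False unfolding simple_types_def by blast
    qed
    then have "{k. k < length Ss \<and> Ss ! k \<in> Y} = {}" by auto
    then show ?thesis using False by (simp add: lookup_up_vec)
  qed
  ultimately show ?thesis unfolding has_dim_vector_def using keys_up_vec by blast
qed

text \<open>\<open>conv\<close> is applied to a whole series. A factor and its conversion have the
  same operators, hence the same class over \<open>C\<close>, so multiplicities can be counted on
  either side.\<close>

lemma has_dim_vector_down:
  assumes M: "comodule C M" and v: "has_dim_vector C M w" and supp: "supported_on H M"
  shows "has_dim_vector H (conv H M) (down_vec C H w)"
proof -
  note h = subcoalgebra_basic[OF H]
  obtain Ms Ss where jh: "jordan_hoelder_series C M Ms Ss"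
    and d: "\<And>i. i \<in> simple_types C \<Longrightarrow> Poly_Mapping.lookup w i = card {k. k < length Ss \<and> Ss ! k \<in> i}"
    using v by (auto simp: has_dim_vector_def)
  note c = jordan_hoelder_comodules[OF M jh]
  note s = jordan_hoelder_supported_on[OF C M jh h(3) supp]
  note cv = conv[OF C H, unfolded h(3)]
  have len: "length Ms = Suc (length Ss)" "Ms ! length Ss = M"
    using jh by (auto simp: jordan_hoelder_series_def)
  have "jordan_hoelder_series H (map (conv H) Ms ! length Ss) (map (conv H) Ms) (map (conv H) Ss)"
    by (rule jordan_hoelder_same[OF C M jh h(1,3)])
      (simp_all add: len(1) less_Suc_eq_le cv c s)
  then have "jordan_hoelder_series H (conv H M) (map (conv H) Ms) (map (conv H) Ss)" by (simp add: len)
  moreover have "Poly_Mapping.lookup (down_vec C H w) X = card {k. k < length (map (conv H) Ss) \<and> map (conv H) Ss ! k \<in> X}"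
    if X: "X \<in> simple_types H" for X
  proof -
    have "Ss ! k \<in> up_class C X \<longleftrightarrow> conv H (Ss ! k) \<in> X" if k: "k < length Ss" for k
    proof -
      note cH = cv[OF c(2)[OF k] s(2)[OF k]]
      have i: "iso_class C (conv H (Ss ! k)) = iso_class C (Ss ! k)"
        by (rule iso_class_same[OF C c(2)[OF k] comodule_lift[OF C H cH(1)] cH(2)])
      obtain S where S: "comodule H S" "X = iso_class H S"
        using X unfolding simple_types_def simple_comodule_def by blast
      have uX: "up_class C X = iso_class C S" using up_iso_class[OF C H S(1)] S(2) by simp
      have lS: "comodule C S" by (rule comodule_lift[OF C H S(1)])
      have "Ss ! k \<in> iso_class C S \<longleftrightarrow> conv H (Ss ! k) \<in> iso_class C S"
        unfolding iso_class_mem_iff[OF C lS c(2)[OF k]]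
          iso_class_mem_iff[OF C lS comodule_lift[OF C H cH(1)]] i ..
      also have "\<dots> \<longleftrightarrow> conv H (Ss ! k) \<in> iso_class H S"
        unfolding down_iso_class[OF C H S(1), symmetric] down_class_def using cH(1) by simp
      finally show ?thesis using uX S(2) by simp
    qed
    then have "{k. k < length Ss \<and> Ss ! k \<in> up_class C X} = {k. k < length (map (conv H) Ss) \<and> map (conv H) Ss ! k \<in> X}"
      by auto
    then show ?thesis
      using d[OF simple_types_down_up(1)[OF C H X]] X by (simp add: lookup_down_vec)
  qed
  ultimately show ?thesis unfolding has_dim_vector_def using keys_down_vec by blast
qed

end

section \<open>Specializations of families\<close>

text \<open>\<open>iso_to_specialization\<close> equates the whole relation module with a kernel
  inside the formal sums supported in the carriers, so the relations have to be supported there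
  too.\<close>

lemma tensor_null_keys:
  fixes A :: "'a::ab_group_add set" and B :: "'b::ab_group_add set" and t :: "'a \<times> 'b \<Rightarrow>\<^sub>0 'r::comm_ring_1"
  assumes "\<And>x y. x \<in> A \<Longrightarrow> y \<in> A \<Longrightarrow> x + y \<in> A" "\<And>r x. x \<in> A \<Longrightarrow> sA r x \<in> A"
    "\<And>x y. x \<in> B \<Longrightarrow> y \<in> B \<Longrightarrow> x + y \<in> B" "\<And>r x. x \<in> B \<Longrightarrow> sB r x \<in> B"
    "t \<in> tensor_null sA A sB B"
  shows "Poly_Mapping.keys t \<subseteq> A \<times> B"
proof -
  have sg: "Poly_Mapping.single (a, b) r \<in> {t. Poly_Mapping.keys t \<subseteq> A \<times> B}" if "a \<in> A" "b \<in> B"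
    for a b and r :: 'r
    using that by auto
  have "tensor_null sA A sB B \<subseteq> {t. Poly_Mapping.keys t \<subseteq> A \<times> B}"
    unfolding tensor_null_def
    apply (rule fs.span_minimal[OF _ subspace_keys])
    apply (intro Un_least subsetI; elim CollectE exE conjE; hypsubst)
       apply (intro fs.subspace_diff[OF subspace_keys] sg assms(1-4); assumption)+
    done
  then show ?thesis using assms(5) by blast
qed

section \<open>Tensoring with K[T]/(T - \<lambda>)\<close>

lemma mod_linear_poly: "(p :: 'k::field poly) mod [:- a, 1:] = [:poly p a:]"
proof -
  have "[:- a, 1:] dvd p - [:poly p a:]" by (simp add: poly_eq_0_iff_dvd[symmetric])
  then have "p mod [:- a, 1:] = [:poly p a:] mod [:- a, 1:]" by (simp add: mod_eq_dvd_iff)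
  also have "\<dots> = [:poly p a:]" by (rule mod_poly_less) simp
  finally show ?thesis .
qed

lemma residue_space_eq: "residue_space lam = range (\<lambda>c. [:c:])"
proof -
  have "[:c:] = [:poly [:c:] lam:]" for c by simp
  then show ?thesis unfolding residue_space_def mod_linear_poly full_SetCompr_eq by blast
qed

lemma residue_scale_const: "residue_scale lam q [:c:] = [:c * poly q lam:]"
  by (simp add: residue_scale_def mod_linear_poly)

lemma free_module_coordinates:
  assumes "module act" "\<not> module.dependent act B" "finite B" "module.span act B = L"
  shows "\<exists>\<kappa>. (\<forall>b\<in>B. lin_on act (*) L (\<kappa> b)) \<and> (\<forall>x\<in>L. x = (\<Sum>b\<in>B. act (\<kappa> b x) b))"
proof -
  interpret module act by fact
  have "lin_on act (*) L (\<lambda>x. representation B x b)" for b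
    unfolding lin_on_def using representation_add[OF assms(2)] representation_scale[OF assms(2)] assms(4) by auto
  moreover have "x = (\<Sum>b\<in>B. act (representation B x b) b)" if "x \<in> L" for x
    using sum_representation_eq[OF assms(2), of x B] that assms(3,4) by auto
  ultimately show ?thesis by (intro exI[of _ "\<lambda>b x. representation B x b"]) auto
qed

lemma free_poly_basic:
  assumes "free_poly_comodule C L act"
  shows "comodule C L" "module act" "module.subspace act (mspace L)" "mscale L = (\<lambda>r. act [:r:])"
    "\<exists>B. finite B \<and> \<not> module.dependent act B \<and> module.span act B = mspace L"
  using assms by (simp_all add: free_poly_comodule_def)

lemma lin_on_act:
  assumes "module act" "mscale L = (\<lambda>r. act [:r:])"
  shows "lin_on (mscale L) (mscale L) A (act q)"
  unfolding lin_on_def assms(2) using assms(1) by (simp add: module_def mult.commute)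

lemma free_poly_iff:
  assumes "coalgebra C" "comodule C L"
  shows "free_poly_comodule C L act \<longleftrightarrow>
    module act \<and> module.subspace act (mspace L) \<and> mscale L = (\<lambda>r. act [:r:]) \<and>
    (\<forall>q. \<forall>l\<in>mspace L. \<forall>\<phi>. lfun (cscale C) \<phi> \<longrightarrow> cact L \<phi> (act q l) = act q (cact L \<phi> l)) \<and>
    (\<exists>B. finite B \<and> \<not> module.dependent act B \<and> module.span act B = mspace L)"
proof -
  note c = coalgebra_basic[OF assms(1)] and b = comodule_basic[OF assms(2)]
  have "tensor_eq (cscale C) (cspace C) (mscale L) (mspace L) (coact L (act q l)) (id_tensor (act q) (coact L l)) \<longleftrightarrow>
      (\<forall>\<phi>. lfun (cscale C) \<phi> \<longrightarrow> cact L \<phi> (act q l) = act q (cact L \<phi> l))"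
    if m: "module act" "module.subspace act (mspace L)" "mscale L = (\<lambda>r. act [:r:])" and l: "l \<in> mspace L" for q l
  proof -
    have im: "act q ` mspace L \<subseteq> mspace L" using module.subspace_scale[OF m(1,2)] by blast
    then have ql: "act q l \<in> mspace L" using l by blast
    \<comment> \<open>\<open>tensor_eq_id_tensor\<close> expects the transported tensor on the left,
      hence the exchange of sides.\<close>
    have "tensor_eq (cscale C) (cspace C) (mscale L) (mspace L) (coact L (act q l)) (id_tensor (act q) (coact L l)) \<longleftrightarrow>
        tensor_eq (cscale C) (cspace C) (mscale L) (mspace L) (id_tensor (act q) (coact L l)) (coact L (act q l))"
      unfolding tensor_eq_slice[OF c(1,3) b(1,3) b(4)[OF ql] keys_id_tensor[OF b(4)[OF l] im]]
        tensor_eq_slice[OF c(1,3) b(1,3) keys_id_tensor[OF b(4)[OF l] im] b(4)[OF ql]] by metis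
    also have "\<dots> \<longleftrightarrow> (\<forall>\<phi>. lfun (cscale C) \<phi> \<longrightarrow> act q (cact L \<phi> l) = cact L \<phi> (act q l))"
      unfolding cact_def
      by (rule tensor_eq_id_tensor[OF c(1,3) b(2,3) b(1,3) b(4)[OF l] b(4)[OF ql] im lin_on_act[OF m(1,3)]])
    finally show ?thesis by metis
  qed
  then show ?thesis unfolding free_poly_comodule_def using assms(2) by blast
qed

text \<open>\<open>\<pi>\<close> presents \<open>M\<close> as the comodule \<open>L/(T - \<lambda>)L\<close>.\<close>

definition spec_map ::
  "('k::field \<Rightarrow> 'c \<Rightarrow> 'c) \<Rightarrow> ('k, 'c::ab_group_add, 'm::ab_group_add) comod \<Rightarrow> ('k, 'c, 'l::ab_group_add) comod
    \<Rightarrow> ('k poly \<Rightarrow> 'l \<Rightarrow> 'l) \<Rightarrow> 'k \<Rightarrow> ('l \<Rightarrow> 'm) \<Rightarrow> bool" where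
  "spec_map s M L act lam \<pi> \<longleftrightarrow>
     lin_on act (\<lambda>q. mscale M (poly q lam)) (mspace L) \<pi> \<and> \<pi> ` mspace L = mspace M \<and>
     {l \<in> mspace L. \<pi> l = 0} = act [:- lam, 1:] ` mspace L \<and>
     (\<forall>\<phi>. lfun s \<phi> \<longrightarrow> (\<forall>l\<in>mspace L. \<pi> (cact L \<phi> l) = cact M \<phi> (\<pi> l)))"

lemma module_poly_eval:
  assumes "module s"
  shows "module (\<lambda>q. s (poly (q :: 'k::field poly) lam))"
  using assms by (simp add: module_def)

lemma tensor_null_trans:
  "t - u \<in> tensor_null sA A sB B \<Longrightarrow> u - w \<in> tensor_null sA A sB B \<Longrightarrow> t - w \<in> tensor_null sA A sB B"
  using fs.subspace_add[OF tensor_null_subspace, of "t - u" sA A sB B "u - w"] by simp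

lemma tensor_null_sym: "t - u \<in> tensor_null sA A sB B \<Longrightarrow> u - t \<in> tensor_null sA A sB B"
  using fs.subspace_neg[OF tensor_null_subspace, of "t - u" sA A sB B] by simp

lemma sum_single: "(\<Sum>x\<in>Poly_Mapping.keys t. Poly_Mapping.single x (Poly_Mapping.lookup t x)) = (t :: 'x \<Rightarrow>\<^sub>0 'r::comm_ring_1)"
proof -
  have "fs_scale r (Poly_Mapping.single x 1) = Poly_Mapping.single x r" for x :: 'x and r :: 'r
    by (rule poly_mapping_eqI) (simp add: lookup_fs_scale lookup_single when_def)
  then show ?thesis using fs_eq_lin_ext[of t] by (simp add: lin_ext_def)
qed

text \<open>K[T]/(T - \<lambda>) is generated by 1, so scalars and second factors can be moved to
  the left until every tensor has the form l \<otimes> 1.\<close>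

lemma residue_tensor_normal:
  assumes "module act" "module.subspace act L" "Poly_Mapping.keys t \<subseteq> L \<times> residue_space lam"
  shows "\<exists>l\<in>L. t - Poly_Mapping.single (l, 1) 1 \<in> tensor_null act L (residue_scale lam) (residue_space lam)"
    (is "\<exists>l\<in>L. _ \<in> ?N")
proof -
  interpret module act by fact
  have one: "1 \<in> residue_space lam" unfolding residue_space_eq one_pCons by blast
  have sg: "\<exists>l'\<in>L. Poly_Mapping.single (l, n) r - Poly_Mapping.single (l', 1) 1 \<in> ?N"
    if l: "l \<in> L" and n: "n \<in> residue_space lam" for l n r
  proof -
    obtain c where c: "n = [:c:]" using n by (auto simp: residue_space_eq)
    have rn: "residue_scale lam n 1 = n" unfolding c one_pCons residue_scale_const by simp
    have 1: "Poly_Mapping.single (act r l, n) 1 - Poly_Mapping.single (l, n) r \<in> ?N"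
      by (rule tensor_null_gens(3)[OF l n])
    have rl: "act r l \<in> L" by (rule subspace_scale[OF assms(2) l])
    have 2: "Poly_Mapping.single (act r l, residue_scale lam n 1) 1 - Poly_Mapping.single (act r l, 1) n \<in> ?N"
      by (rule tensor_null_gens(4)[OF rl one])
    have 3: "Poly_Mapping.single (act n (act r l), 1) 1 - Poly_Mapping.single (act r l, 1) n \<in> ?N"
      by (rule tensor_null_gens(3)[OF rl one])
    have "Poly_Mapping.single (l, n) r - Poly_Mapping.single (act n (act r l), 1) 1 \<in> ?N"
      using tensor_null_trans[OF tensor_null_sym[OF 1] tensor_null_trans[OF 2[unfolded rn] tensor_null_sym[OF 3]]] .
    then show ?thesis using subspace_scale[OF assms(2) rl] by blast
  qed
  have "\<exists>l\<in>L. (\<Sum>x\<in>K. Poly_Mapping.single x (r x)) - Poly_Mapping.single (l, 1) 1 \<in> ?N"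
    if "finite K" "K \<subseteq> L \<times> residue_space lam" for K r
    using that
  proof (induction K rule: finite_induct)
    case empty
    have "Poly_Mapping.single (act 0 0, 1) 1 - Poly_Mapping.single (0, 1) 0 \<in> ?N"
      by (rule tensor_null_gens(3)[OF subspace_0[OF assms(2)] one])
    then have "0 - Poly_Mapping.single (0, 1) 1 \<in> ?N" using tensor_null_sym by fastforce
    then show ?case using subspace_0[OF assms(2)] by auto
  next
    case (insert x K)
    obtain l where l: "l \<in> L" "(\<Sum>x\<in>K. Poly_Mapping.single x (r x)) - Poly_Mapping.single (l, 1) 1 \<in> ?N"
      using insert by auto
    obtain l' where l': "l' \<in> L" "Poly_Mapping.single x (r x) - Poly_Mapping.single (l', 1) 1 \<in> ?N"
      using insert.prems sg[of "fst x" "snd x" "r x"] by auto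
    have 1: "Poly_Mapping.single (l' + l, 1) 1 - Poly_Mapping.single (l', 1) 1 - Poly_Mapping.single (l, 1) 1 \<in> ?N"
      by (rule tensor_null_gens(1)[OF l'(1) l(1) one])
    have "(\<Sum>x\<in>insert x K. Poly_Mapping.single x (r x)) - Poly_Mapping.single (l' + l, 1) 1 =
      (Poly_Mapping.single x (r x) - Poly_Mapping.single (l', 1) 1) +
      ((\<Sum>x\<in>K. Poly_Mapping.single x (r x)) - Poly_Mapping.single (l, 1) 1) -
      (Poly_Mapping.single (l' + l, 1) 1 - Poly_Mapping.single (l', 1) 1 - Poly_Mapping.single (l, 1) 1)"
      using insert by simp
    also have "\<dots> \<in> ?N"
      by (rule fs.subspace_diff[OF tensor_null_subspace fs.subspace_add[OF tensor_null_subspace l'(2) l(2)] 1])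
    finally show ?case using subspace_add[OF assms(2) l'(1) l(1)] by blast
  qed
  from this[of "Poly_Mapping.keys t" "Poly_Mapping.lookup t"] assms(3)
  show ?thesis using sum_single[of t] by simp
qed

text \<open>(T - \<lambda>) l \<otimes> 1 = l \<otimes> (T - \<lambda>) 1 = l \<otimes> 0.\<close>

lemma residue_tensor_zero:
  assumes "module act" "module.subspace act L" "l \<in> L"
  shows "Poly_Mapping.single (act [:- lam, 1:] l, 1) 1 \<in> tensor_null act L (residue_scale lam) (residue_space lam)"
    (is "_ \<in> ?N")
proof -
  have one: "1 \<in> residue_space lam" and zero: "0 \<in> residue_space lam"
    unfolding residue_space_eq one_pCons by (blast, force)
  have z: "residue_scale lam [:- lam, 1:] 1 = 0" "residue_scale lam 0 1 = 0"
    unfolding one_pCons residue_scale_const by simp_all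
  have 1: "Poly_Mapping.single (act [:- lam, 1:] l, 1) 1 - Poly_Mapping.single (l, 1) [:- lam, 1:] \<in> ?N"
    by (rule tensor_null_gens(3)[OF assms(3) one])
  have 2: "Poly_Mapping.single (l, residue_scale lam [:- lam, 1:] 1) 1 - Poly_Mapping.single (l, 1) [:- lam, 1:] \<in> ?N"
    by (rule tensor_null_gens(4)[OF assms(3) one])
  \<comment> \<open>The formal sum l \<otimes> 0 is not literally zero; the relation for the scalar
    0 identifies it with zero.\<close>
  have "Poly_Mapping.single (l, residue_scale lam 0 1) 1 - Poly_Mapping.single (l, 1) 0 \<in> ?N"
    by (rule tensor_null_gens(4)[OF assms(3) one])
  then have 3: "Poly_Mapping.single (l, 0) 1 - 0 \<in> ?N" by (simp add: z)
  show ?thesis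
    using tensor_null_trans[OF tensor_null_trans[OF 1 tensor_null_sym[OF 2[unfolded z]]] 3] by simp
qed

text \<open>Freeness enters here. Each coordinate followed by evaluation at \<lambda> gives a
  bilinear form that kills the relations, so all coordinates of l vanish at \<lambda> and are
  divisible by T - \<lambda>.\<close>

lemma residue_tensor_zeroD:
  assumes "module act" "\<not> module.dependent act B" "finite B" "module.span act B = L" "l \<in> L"
    "Poly_Mapping.single (l, 1) 1 \<in> tensor_null act L (residue_scale lam) (residue_space lam)"
  shows "l \<in> act [:- lam, 1:] ` L"
proof -
  interpret module act by fact
  obtain \<kappa> where \<kappa>: "\<And>b. b \<in> B \<Longrightarrow> lin_on act (*) L (\<kappa> b)" "\<And>x. x \<in> L \<Longrightarrow> x = (\<Sum>b\<in>B. act (\<kappa> b x) b)"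
    using free_module_coordinates[OF assms(1-4)] by auto
  \<comment> \<open>K as a K[T]-module through evaluation at \<lambda>, the target of the bilinear
    forms.\<close>
  let ?s = "\<lambda>q. (*) (poly q lam)"
  have ms: "module ?s" by (rule module_poly_eval[OF module_times])
  have "poly (\<kappa> b l) lam = 0" if b: "b \<in> B" for b
  proof -
    have "bilin_on act L (residue_scale lam) (residue_space lam) ?s (\<lambda>x n. poly (\<kappa> b x) lam * poly n lam)"
      unfolding bilin_on_def lin_on_def residue_space_eq
      using \<kappa>(1)[OF b] by (auto simp: lin_on_def residue_scale_const algebra_simps)
    from lin_ext_tensor_null[OF ms this assms(6)] show ?thesis by (simp add: lin_ext_single[OF ms])
  qed
  then have "\<forall>b\<in>B. \<exists>q. \<kappa> b l = [:- lam, 1:] * q" by (auto simp: poly_eq_0_iff_dvd dvd_def)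
  then obtain q where q: "\<And>b. b \<in> B \<Longrightarrow> \<kappa> b l = [:- lam, 1:] * q b" by metis
  have "l = (\<Sum>b\<in>B. act ([:- lam, 1:] * q b) b)" using \<kappa>(2)[OF assms(5)] q by simp
  also have "\<dots> = act [:- lam, 1:] (\<Sum>b\<in>B. act (q b) b)" by (simp only: scale_sum_right scale_scale)
  finally have "l = act [:- lam, 1:] (\<Sum>b\<in>B. act (q b) b)" .
  moreover have "(\<Sum>b\<in>B. act (q b) b) \<in> L" unfolding assms(4)[symmetric]
    by (intro span_sum span_scale span_base)
  ultimately show ?thesis by blast
qed

lemma spec_map_if_iso_to_specialization:
  fixes C :: "('k::field, 'c::ab_group_add) coalg" and L :: "('k, 'c, 'l::ab_group_add) comod"
  assumes "coalgebra C" "comodule C M" "free_poly_comodule C L act" "iso_to_specialization C M L act lam"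
  shows "\<exists>\<pi>. spec_map (cscale C) M L act lam \<pi>"
proof -
  note f = free_poly_basic[OF assms(3)] and c = coalgebra_basic[OF assms(1)]
  note m = comodule_basic[OF assms(2)] and b = comodule_basic[OF f(1)]
  interpret L: module act by (rule f(2))
  interpret M: vector_space "mscale M" by (rule m(1))
  obtain B where B: "finite B" "\<not> module.dependent act B" "module.span act B = mspace L" using f(5) by auto
  define F where "F = {t :: ('l \<times> 'k poly) \<Rightarrow>\<^sub>0 'k poly. Poly_Mapping.keys t \<subseteq> mspace L \<times> residue_space lam}"
  let ?N = "tensor_null act (mspace L) (residue_scale lam) (residue_space lam)"
  from assms(4)[unfolded iso_to_specialization_def Let_def, folded F_def]
  obtain \<Phi> where \<Phi>: "\<forall>t\<in>F. \<forall>u\<in>F. \<Phi> (t + u) = \<Phi> t + \<Phi> u"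
    "\<forall>r. \<forall>t\<in>F. \<Phi> (fs_scale [:r:] t) = mscale M r (\<Phi> t)"
    and im: "\<Phi> ` F = mspace M" and ker: "{t \<in> F. \<Phi> t = 0} = ?N"
    and co: "\<forall>l\<in>mspace L. \<forall>n\<in>residue_space lam.
      tensor_eq (cscale C) (cspace C) (mscale M) (mspace M)
        (id_tensor (\<lambda>l'. \<Phi> (Poly_Mapping.single (l', n) 1)) (coact L l))
        (coact M (\<Phi> (Poly_Mapping.single (l, n) 1)))"
    by (elim exE conjE)
  note add = \<Phi>(1)[rule_format] and sc = \<Phi>(2)[rule_format]
  have F: "module.subspace fs_scale F" unfolding F_def by (rule subspace_keys)
  have one: "1 \<in> residue_space lam" unfolding residue_space_eq one_pCons by blast
  have sgF: "Poly_Mapping.single (l, n) r \<in> F" if "l \<in> mspace L" "n \<in> residue_space lam" for l n r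
    using that by (auto simp: F_def)
  have cong: "\<Phi> t = \<Phi> u" if "t \<in> F" "u \<in> F" "t - u \<in> ?N" for t u
  proof -
    have "t - u \<in> F" "\<Phi> (t - u) = 0" using that(3) ker by auto
    then have "\<Phi> ((t - u) + u) = 0 + \<Phi> u" using add[of "t - u" u] that by simp
    then show ?thesis by simp
  qed
  \<comment> \<open>Every tensor has the form l \<otimes> 1, so the restriction of \<Phi> to these
    carries all information.\<close>
  define \<pi> where "\<pi> l = \<Phi> (Poly_Mapping.single (l, 1) 1)" for l
  have lin: "lin_on act (\<lambda>q. mscale M (poly q lam)) (mspace L) \<pi>"
    unfolding lin_on_def
  proof (intro conjI ballI allI)
    fix x y assume xy: "x \<in> mspace L" "y \<in> mspace L"
    have "\<pi> (x + y) = \<Phi> (Poly_Mapping.single (x, 1) 1 + Poly_Mapping.single (y, 1) 1)"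
      unfolding \<pi>_def
      by (rule cong) (use tensor_null_gens(1)[OF xy one] in
        \<open>auto intro!: sgF one xy L.subspace_add[OF f(3)] fs.subspace_add[OF F] simp: diff_diff_eq\<close>)
    then show "\<pi> (x + y) = \<pi> x + \<pi> y" unfolding \<pi>_def using add[OF sgF sgF] xy one by simp
  next
    fix q x assume x: "x \<in> mspace L"
    define r where "r = [:poly q lam:]"
    have rF: "r \<in> residue_space lam" by (auto simp: r_def residue_space_eq)
    have rq: "residue_scale lam q 1 = r" "residue_scale lam r 1 = r"
      unfolding one_pCons residue_scale_const r_def by simp_all
    have 1: "Poly_Mapping.single (act q x, 1) 1 - Poly_Mapping.single (x, 1) q \<in> ?N"
      by (rule tensor_null_gens(3)[OF x one])
    have 2: "Poly_Mapping.single (x, residue_scale lam q 1) 1 - Poly_Mapping.single (x, 1) q \<in> ?N"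
      by (rule tensor_null_gens(4)[OF x one])
    have 3: "Poly_Mapping.single (x, residue_scale lam r 1) 1 - Poly_Mapping.single (x, 1) r \<in> ?N"
      by (rule tensor_null_gens(4)[OF x one])
    have "\<pi> (act q x) = \<Phi> (Poly_Mapping.single (x, 1) r)"
      unfolding \<pi>_def
      by (rule cong[OF sgF[OF L.subspace_scale[OF f(3) x] one] sgF[OF x one]
            tensor_null_trans[OF tensor_null_trans[OF 1 tensor_null_sym[OF 2[unfolded rq]]] 3[unfolded rq]]])
    also have "Poly_Mapping.single (x, 1) r = fs_scale [:poly q lam:] (Poly_Mapping.single (x, 1) 1)"
      by (rule poly_mapping_eqI) (simp add: lookup_fs_scale lookup_single when_def r_def)
    finally show "\<pi> (act q x) = mscale M (poly q lam) (\<pi> x)"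
      unfolding \<pi>_def using sc[OF sgF[OF x one]] by simp
  qed
  have normal: "\<exists>l\<in>mspace L. \<Phi> t = \<pi> l" if tF: "t \<in> F" for t
  proof -
    obtain l where l: "l \<in> mspace L" "t - Poly_Mapping.single (l, 1) 1 \<in> ?N"
      using residue_tensor_normal[OF f(2,3), of t lam] tF unfolding F_def by blast
    then show ?thesis using cong[OF tF sgF[OF l(1) one] l(2)] unfolding \<pi>_def by blast
  qed
  have img: "\<pi> ` mspace L = mspace M"
  proof
    show "\<pi> ` mspace L \<subseteq> mspace M" unfolding im[symmetric] \<pi>_def using sgF[OF _ one] by blast
    show "mspace M \<subseteq> \<pi> ` mspace L" unfolding im[symmetric] using normal by blast
  qed
  have "{l \<in> mspace L. \<pi> l = 0} = act [:- lam, 1:] ` mspace L"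
  proof (intro set_eqI iffI)
    fix l assume "l \<in> {l \<in> mspace L. \<pi> l = 0}"
    then have l: "l \<in> mspace L" "Poly_Mapping.single (l, 1) 1 \<in> ?N" using ker sgF[OF _ one] by (auto simp: \<pi>_def)
    then show "l \<in> act [:- lam, 1:] ` mspace L" by (rule residue_tensor_zeroD[OF f(2) B(2,1,3)])
  next
    fix l assume "l \<in> act [:- lam, 1:] ` mspace L"
    then obtain l' where "l' \<in> mspace L" "l = act [:- lam, 1:] l'" by blast
    then show "l \<in> {l \<in> mspace L. \<pi> l = 0}"
      using lin_on_scale[OF lin] L.subspace_scale[OF f(3)] by auto
  qed
  moreover have "\<pi> (cact L \<phi> l) = cact M \<phi> (\<pi> l)" if "lfun (cscale C) \<phi>" "l \<in> mspace L" for \<phi> l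
  proof -
    have \<pi>l: "\<pi> l \<in> mspace M" using img that by auto
    have lin': "lin_on (mscale L) (mscale M) (mspace L) \<pi>"
      using lin unfolding lin_on_def f(4) by simp
    have "tensor_eq (cscale C) (cspace C) (mscale M) (mspace M) (id_tensor \<pi> (coact L l)) (coact M (\<pi> l))"
      using co that(2) one unfolding \<pi>_def[abs_def] by blast
    then show ?thesis
      using tensor_eq_id_tensor[OF c(1,3) b(2,3) m(1,3) b(4)[OF that(2)] m(4)[OF \<pi>l] equalityD1[OF img] lin'] that(1)
      unfolding cact_def by simp
  qed
  ultimately show ?thesis unfolding spec_map_def using lin img by blast
qed

lemma iso_to_specialization_if_spec_map:
  fixes C :: "('k::field, 'c::ab_group_add) coalg" and L :: "('k, 'c, 'l::ab_group_add) comod"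
  assumes "coalgebra C" "comodule C M" "free_poly_comodule C L act" "spec_map (cscale C) M L act lam \<pi>"
  shows "iso_to_specialization C M L act lam"
proof -
  note f = free_poly_basic[OF assms(3)] and c = coalgebra_basic[OF assms(1)]
  note m = comodule_basic[OF assms(2)] and b = comodule_basic[OF f(1)]
  interpret L: module act by (rule f(2))
  interpret M: vector_space "mscale M" by (rule m(1))
  have lin: "lin_on act (\<lambda>q. mscale M (poly q lam)) (mspace L) \<pi>"
    and img: "\<pi> ` mspace L = mspace M"
    and ker: "{l \<in> mspace L. \<pi> l = 0} = act [:- lam, 1:] ` mspace L"
    and act: "\<And>\<phi> l. lfun (cscale C) \<phi> \<Longrightarrow> l \<in> mspace L \<Longrightarrow> \<pi> (cact L \<phi> l) = cact M \<phi> (\<pi> l)"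
    using assms(4) unfolding spec_map_def by blast+
  have \<pi>M: "\<pi> l \<in> mspace M" if "l \<in> mspace L" for l using img that by blast
  define F where "F = {t :: ('l \<times> 'k poly) \<Rightarrow>\<^sub>0 'k poly. Poly_Mapping.keys t \<subseteq> mspace L \<times> residue_space lam}"
  let ?N = "tensor_null act (mspace L) (residue_scale lam) (residue_space lam)"
  let ?s = "\<lambda>q. mscale M (poly q lam)"
  have ms: "module ?s" by (rule module_poly_eval[OF m(2)])
  have one: "1 \<in> residue_space lam" unfolding residue_space_eq one_pCons by blast
  \<comment> \<open>In the residue space n is the constant n(\<lambda>), so \<Phi> must send l
    \<otimes> n to n(\<lambda>) times \<pi> l.\<close>
  define \<Phi> where "\<Phi> = lin_ext ?s (\<lambda>(l, n). mscale M (poly n lam) (\<pi> l))"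
  have \<Phi>s: "\<Phi> (Poly_Mapping.single (l, n) 1) = mscale M (poly n lam) (\<pi> l)" for l n
    unfolding \<Phi>_def by (simp add: lin_ext_single[OF ms])
  have bil: "bilin_on act (mspace L) (residue_scale lam) (residue_space lam) ?s (\<lambda>l n. mscale M (poly n lam) (\<pi> l))"
    unfolding bilin_on_def lin_on_def residue_space_eq
    by (auto simp: residue_scale_const lin_on_add[OF lin] lin_on_scale[OF lin] M.scale_right_distrib
        M.scale_left_distrib mult.commute)
  have null: "\<Phi> t = 0" if "t \<in> ?N" for t
    unfolding \<Phi>_def by (rule lin_ext_tensor_null[OF ms bil that])
  have subM: "module.subspace ?s (mspace M)"
    by (rule module.subspaceI[OF ms])
      (use M.subspace_0[OF m(3)] M.subspace_add[OF m(3)] M.subspace_scale[OF m(3)] in auto)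
  have NF: "?N \<subseteq> F"
  proof
    fix t assume t: "t \<in> ?N"
    show "t \<in> F" unfolding F_def mem_Collect_eq
      by (rule tensor_null_keys[OF _ _ _ _ t])
        (use L.subspace_add[OF f(3)] L.subspace_scale[OF f(3)] in \<open>auto simp: residue_space_eq residue_scale_const\<close>)
  qed
  have "\<Phi> ` F = mspace M"
  proof
    show "\<Phi> ` F \<subseteq> mspace M"
    proof
      fix y assume "y \<in> \<Phi> ` F"
      then obtain t where t: "Poly_Mapping.keys t \<subseteq> mspace L \<times> residue_space lam" "y = \<Phi> t" by (auto simp: F_def)
      show "y \<in> mspace M" unfolding t(2) \<Phi>_def
        by (rule lin_ext_in[OF ms subM]) (use t(1) \<pi>M M.subspace_scale[OF m(3)] in auto)
    qed
    show "mspace M \<subseteq> \<Phi> ` F"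
    proof
      fix y assume "y \<in> mspace M"
      then obtain l where l: "l \<in> mspace L" "y = \<pi> l" using img by auto
      then have "y = \<Phi> (Poly_Mapping.single (l, 1) 1)" by (simp add: \<Phi>s)
      moreover have "Poly_Mapping.single (l, 1) 1 \<in> F" using l one by (simp add: F_def)
      ultimately show "y \<in> \<Phi> ` F" by blast
    qed
  qed
  moreover have "{t \<in> F. \<Phi> t = 0} = ?N"
  proof (intro set_eqI iffI)
    fix t assume "t \<in> {t \<in> F. \<Phi> t = 0}"
    then have t: "Poly_Mapping.keys t \<subseteq> mspace L \<times> residue_space lam" "\<Phi> t = 0" by (auto simp: F_def)
    \<comment> \<open>Reduces the kernel of \<Phi> to tensors l \<otimes> 1, where it is given by
      the kernel of \<pi>.\<close>
    obtain l where l: "l \<in> mspace L" "t - Poly_Mapping.single (l, 1) 1 \<in> ?N"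
      using residue_tensor_normal[OF f(2,3) t(1)] by blast
    have "\<Phi> (t - Poly_Mapping.single (l, 1) 1) = \<Phi> t - \<pi> l"
      using \<Phi>s[of l 1] unfolding \<Phi>_def by (simp add: lin_ext_diff[OF ms])
    then have "\<pi> l = 0" using null[OF l(2)] t(2) by simp
    then obtain l' where l': "l' \<in> mspace L" "l = act [:- lam, 1:] l'" using l(1) ker by blast
    have "Poly_Mapping.single (l, 1) 1 \<in> ?N" unfolding l'(2) by (rule residue_tensor_zero[OF f(2,3) l'(1)])
    then show "t \<in> ?N" using fs.subspace_add[OF tensor_null_subspace l(2)] by fastforce
  qed (use null NF in blast)
  moreover have "tensor_eq (cscale C) (cspace C) (mscale M) (mspace M)
      (id_tensor (\<lambda>l'. \<Phi> (Poly_Mapping.single (l', n) 1)) (coact L l)) (coact M (\<Phi> (Poly_Mapping.single (l, n) 1)))"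
    if l: "l \<in> mspace L" for l n
  proof -
    define r where "r = poly n lam"
    have rM: "mscale M r (\<pi> x) \<in> mspace M" if "x \<in> mspace L" for x by (rule M.subspace_scale[OF m(3) \<pi>M[OF that]])
    have lin': "lin_on (mscale L) (mscale M) (mspace L) (\<lambda>x. mscale M r (\<pi> x))"
      using lin unfolding lin_on_def f(4) by (simp add: M.scale_right_distrib mult.commute)
    have "mscale M r (\<pi> (cact L \<phi> l)) = cact M \<phi> (mscale M r (\<pi> l))" if \<phi>: "lfun (cscale C) \<phi>" for \<phi>
    proof -
      have "lin_on (cscale C) (*) (cspace C) \<phi>" by (rule lin_on_subset[OF \<phi>]) simp
      from lin_on_scale[OF lin_on_cact[OF assms(1,2) this] \<pi>M[OF l]] show ?thesis using act[OF \<phi> l] by simp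
    qed
    moreover have "(\<lambda>x. mscale M r (\<pi> x)) ` mspace L \<subseteq> mspace M" using rM by auto
    ultimately show ?thesis unfolding \<Phi>s r_def[symmetric]
      using tensor_eq_id_tensor[OF c(1,3) b(2,3) m(1,3) b(4)[OF l] m(4)[OF rM[OF l]] _ lin']
      unfolding cact_def by simp
  qed
  moreover have "\<Phi> (t + u) = \<Phi> t + \<Phi> u" for t u unfolding \<Phi>_def by (rule lin_ext_add[OF ms])
  moreover have "\<Phi> (fs_scale [:r:] t) = mscale M r (\<Phi> t)" for r t
    unfolding \<Phi>_def lin_ext_fs_scale[OF ms] by simp
  ultimately show ?thesis
    unfolding iso_to_specialization_def Let_def F_def[symmetric] by (intro exI[of _ \<Phi>]) simp
qed

lemma iso_to_specialization_iff:
  assumes "coalgebra C" "comodule C M" "free_poly_comodule C L act"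
  shows "iso_to_specialization C M L act lam \<longleftrightarrow> (\<exists>\<pi>. spec_map (cscale C) M L act lam \<pi>)"
  using spec_map_if_iso_to_specialization[OF assms] iso_to_specialization_if_spec_map[OF assms] by blast

lemma spec_map_same:
  assumes "same s M M'" "same s L L'" "spec_map s M L act lam \<pi>"
  shows "spec_map s M' L' act lam \<pi>"
proof -
  have "\<pi> l \<in> mspace M" if "l \<in> mspace L" for l
    using assms(3) that unfolding spec_map_def by blast
  then show ?thesis using assms unfolding same_def spec_map_def by simp
qed

text \<open>Both maps have the kernel (T - \<lambda>) L, so each factors through the other.\<close>

lemma spec_map_iso:
  assumes "module act" "module.subspace act (mspace L)" "comodule C M" "comodule C M'" "comodule C L"
    "spec_map s M L act lam \<pi>" "spec_map s M' L act lam \<pi>'"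
  shows "\<exists>f. iso_by s M M' f"
proof -
  interpret L: module act by fact
  note m = comodule_basic[OF assms(3)] and m' = comodule_basic[OF assms(4)]
  interpret M: vector_space "mscale M" by (rule m(1))
  note ms = module_poly_eval[OF m(2)] and ms' = module_poly_eval[OF m'(2)]
  have \<pi>: "lin_on act (\<lambda>q. mscale M (poly q lam)) (mspace L) \<pi>" "\<pi> ` mspace L = mspace M"
    "{l \<in> mspace L. \<pi> l = 0} = act [:- lam, 1:] ` mspace L"
    "\<And>\<phi> l. lfun s \<phi> \<Longrightarrow> l \<in> mspace L \<Longrightarrow> \<pi> (cact L \<phi> l) = cact M \<phi> (\<pi> l)"
    using assms(6) unfolding spec_map_def by simp_all
  have \<pi>': "lin_on act (\<lambda>q. mscale M' (poly q lam)) (mspace L) \<pi>'" "\<pi>' ` mspace L = mspace M'"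
    "{l \<in> mspace L. \<pi>' l = 0} = act [:- lam, 1:] ` mspace L"
    "\<And>\<phi> l. lfun s \<phi> \<Longrightarrow> l \<in> mspace L \<Longrightarrow> \<pi>' (cact L \<phi> l) = cact M' \<phi> (\<pi>' l)"
    using assms(7) unfolding spec_map_def by simp_all
  have eq: "\<pi> x = \<pi> y \<longleftrightarrow> \<pi>' x = \<pi>' y" if "x \<in> mspace L" "y \<in> mspace L" for x y
  proof -
    have d: "x - y \<in> mspace L" by (rule L.subspace_diff[OF assms(2) that])
    have "\<pi> x = \<pi> y \<longleftrightarrow> \<pi> (x - y) = 0"
      using lin_on_diff[OF \<pi>(1) L.module_axioms ms assms(2) that] by simp
    also have "\<dots> \<longleftrightarrow> \<pi>' (x - y) = 0" using \<pi>(3) \<pi>'(3) d by blast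
    also have "\<dots> \<longleftrightarrow> \<pi>' x = \<pi>' y"
      using lin_on_diff[OF \<pi>'(1) L.module_axioms ms' assms(2) that] by simp
    finally show ?thesis .
  qed
  define f where "f y = \<pi>' (inv_into (mspace L) \<pi> y)" for y
  have f: "f (\<pi> l) = \<pi>' l" if l: "l \<in> mspace L" for l
  proof -
    have "inv_into (mspace L) \<pi> (\<pi> l) \<in> mspace L" "\<pi> (inv_into (mspace L) \<pi> (\<pi> l)) = \<pi> l"
      using l by (auto intro: inv_into_into f_inv_into_f)
    then show ?thesis unfolding f_def using eq l by blast
  qed
  have "bij_betw f (mspace M) (mspace M')"
    unfolding bij_betw_def
  proof
    show "inj_on f (mspace M)"
      unfolding \<pi>(2)[symmetric] by (rule inj_onI) (use f eq in auto)
    show "f ` mspace M = mspace M'"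
      unfolding \<pi>(2)[symmetric] \<pi>'(2)[symmetric] image_image by (rule image_cong) (simp_all add: f)
  qed
  moreover have "lin_on (mscale M) (mscale M') (mspace M) f"
    unfolding lin_on_def \<pi>(2)[symmetric]
  proof (intro conjI ballI allI; elim imageE; hypsubst)
    fix x y assume "x \<in> mspace L" "y \<in> mspace L"
    then show "f (\<pi> x + \<pi> y) = f (\<pi> x) + f (\<pi> y)"
      using f[OF L.subspace_add[OF assms(2)]] by (simp add: f lin_on_add[OF \<pi>(1)] lin_on_add[OF \<pi>'(1)])
  next
    fix r x assume x: "x \<in> mspace L"
    show "f (mscale M r (\<pi> x)) = mscale M' r (f (\<pi> x))"
      using f[OF L.subspace_scale[OF assms(2) x, of "[:r:]"]] x
      by (simp add: f lin_on_scale[OF \<pi>(1)] lin_on_scale[OF \<pi>'(1)])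
  qed
  moreover have "f (cact M \<phi> y) = cact M' \<phi> (f y)" if \<phi>: "lfun s \<phi>" and y: "y \<in> mspace M" for \<phi> y
  proof -
    obtain l where l: "l \<in> mspace L" "y = \<pi> l" using y \<pi>(2) by blast
    have "f (cact M \<phi> y) = f (\<pi> (cact L \<phi> l))" unfolding l(2) \<pi>(4)[OF \<phi> l(1)] ..
    also have "\<dots> = cact M' \<phi> (f y)"
      unfolding f[OF cact_in[OF assms(5) l(1)]] \<pi>'(4)[OF \<phi> l(1)] l(2) f[OF l(1)] ..
    finally show ?thesis .
  qed
  ultimately show ?thesis unfolding iso_by_def by blast
qed

text \<open>Some coordinate of x in the free module is a nonzero polynomial, and \<lambda> must be
  one of its roots.\<close>

lemma finite_spec_vanishing:
  assumes "free_poly_comodule C L act" "x \<in> mspace L" "x \<noteq> 0"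
  shows "finite {lam. x \<in> act [:- lam, 1:] ` mspace L}"
proof -
  note f = free_poly_basic[OF assms(1)]
  interpret L: module act by (rule f(2))
  obtain B where B: "finite B" "\<not> module.dependent act B" "module.span act B = mspace L" using f(5) by auto
  obtain \<kappa> where \<kappa>: "\<And>b. b \<in> B \<Longrightarrow> lin_on act (*) (mspace L) (\<kappa> b)"
    "\<And>x. x \<in> mspace L \<Longrightarrow> x = (\<Sum>b\<in>B. act (\<kappa> b x) b)"
    using free_module_coordinates[OF f(2) B(2,1,3)] by auto
  have "\<exists>b\<in>B. \<kappa> b x \<noteq> 0"
  proof (rule ccontr)
    assume "\<not> ?thesis"
    then have "(\<Sum>b\<in>B. act (\<kappa> b x) b) = 0" by (intro sum.neutral) simp
    then show False using \<kappa>(2)[OF assms(2)] assms(3) by simp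
  qed
  then obtain b where b: "b \<in> B" "\<kappa> b x \<noteq> 0" by blast
  have "poly (\<kappa> b x) lam = 0" if lam: "x \<in> act [:- lam, 1:] ` mspace L" for lam
  proof -
    obtain y where "y \<in> mspace L" "x = act [:- lam, 1:] y" using lam by blast
    then have "\<kappa> b x = [:- lam, 1:] * \<kappa> b y" using lin_on_scale[OF \<kappa>(1)[OF b(1)]] by simp
    then show ?thesis by simp
  qed
  then have "{lam. x \<in> act [:- lam, 1:] ` mspace L} \<subseteq> {lam. poly (\<kappa> b x) lam = 0}" by blast
  then show ?thesis using poly_roots_finite[OF b(2)] finite_subset by blast
qed

lemma spec_map_vanishing:
  assumes "spec_map s M L act lam \<pi>" "lfun s \<phi>" "l \<in> mspace L" "comodule C L"
    "\<And>m. m \<in> mspace M \<Longrightarrow> cact M \<phi> m = 0"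
  shows "cact L \<phi> l \<in> act [:- lam, 1:] ` mspace L"
proof -
  have "\<pi> l \<in> mspace M" using assms(1,3) unfolding spec_map_def by blast
  then have "\<pi> (cact L \<phi> l) = 0" using assms unfolding spec_map_def by simp
  then have "cact L \<phi> l \<in> {l \<in> mspace L. \<pi> l = 0}" using cact_in[OF assms(4,3)] by simp
  then show ?thesis using assms(1) unfolding spec_map_def by simp
qed

text \<open>The finiteness on which both directions rest. A functional that is nonzero on the family
  L and annihilates the specialization confines \<lambda> to finitely many values, and by
  \<open>spec_map_iso\<close> each \<lambda> contributes at most one class.\<close>

lemma finite_spec_classes:
  assumes C: "coalgebra C" and L: "free_poly_comodule C L act" and \<phi>: "lfun (cscale C) \<phi>"
    and l: "l \<in> mspace L" "cact L \<phi> l \<noteq> 0"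
  shows "finite {iso_class C M | M. comodule C M \<and> (\<forall>m\<in>mspace M. cact M \<phi> m = 0) \<and>
    (\<exists>lam. iso_to_specialization C M L act lam)}"
proof -
  note f = free_poly_basic[OF L]
  let ?\<Lambda> = "{lam. cact L \<phi> l \<in> act [:- lam, 1:] ` mspace L}"
  define Cl where "Cl lam = {iso_class C M | M. comodule C M \<and> iso_to_specialization C M L act lam}" for lam
  have fin: "finite ?\<Lambda>" by (rule finite_spec_vanishing[OF L cact_in[OF f(1) l(1)] l(2)])
  have one: "finite (Cl lam)" for lam
  proof -
    have "X = Y" if XY: "X \<in> Cl lam" "Y \<in> Cl lam" for X Y
    proof -
      obtain M where M: "X = iso_class C M" "comodule C M" "iso_to_specialization C M L act lam"
        using XY(1) unfolding Cl_def by blast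
      obtain N where N: "Y = iso_class C N" "comodule C N" "iso_to_specialization C N L act lam"
        using XY(2) unfolding Cl_def by blast
      obtain \<pi> \<pi>' where "spec_map (cscale C) M L act lam \<pi>" "spec_map (cscale C) N L act lam \<pi>'"
        using M(3) N(3) unfolding iso_to_specialization_iff[OF C M(2) L]
          iso_to_specialization_iff[OF C N(2) L] by blast
      from spec_map_iso[OF f(2,3) M(2) N(2) f(1) this] show ?thesis
        unfolding M(1) N(1) iso_class_eq_iff[OF C M(2) N(2)] comod_iso_iff[OF C M(2) N(2)] .
    qed
    then have "Cl lam = {} \<or> (\<exists>X. Cl lam = {X})" by blast
    then show ?thesis by auto
  qed
  have "{iso_class C M | M. comodule C M \<and> (\<forall>m\<in>mspace M. cact M \<phi> m = 0) \<and>
    (\<exists>lam. iso_to_specialization C M L act lam)} \<subseteq> (\<Union>lam\<in>?\<Lambda>. Cl lam)"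
  proof
    fix X assume "X \<in> {iso_class C M | M. comodule C M \<and> (\<forall>m\<in>mspace M. cact M \<phi> m = 0) \<and>
      (\<exists>lam. iso_to_specialization C M L act lam)}"
    then obtain M lam where M: "X = iso_class C M" "comodule C M" "\<forall>m\<in>mspace M. cact M \<phi> m = 0"
      "iso_to_specialization C M L act lam" by blast
    obtain \<pi> where \<pi>: "spec_map (cscale C) M L act lam \<pi>"
      using M(4) unfolding iso_to_specialization_iff[OF C M(2) L] by blast
    have "lam \<in> ?\<Lambda>" using spec_map_vanishing[OF \<pi> \<phi> l(1) f(1)] M(3) by simp
    moreover have "X \<in> Cl lam" unfolding Cl_def using M by blast
    ultimately show "X \<in> (\<Union>lam\<in>?\<Lambda>. Cl lam)" by blast
  qed
  then show ?thesis by (rule finite_subset) (use fin one in blast)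
qed

lemma free_poly_same:
  assumes "coalgebra C" "free_poly_comodule C L act" "coalgebra H" "cscale H = cscale C" "comodule H L'"
    "same (cscale C) L L'"
  shows "free_poly_comodule H L' act"
proof -
  note f = free_poly_basic[OF assms(2)]
  have "cact L \<phi> (act q l) = act q (cact L \<phi> l)" if "l \<in> mspace L" "lfun (cscale C) \<phi>" for q l \<phi>
    using assms(2) that unfolding free_poly_iff[OF assms(1) f(1)] by blast
  then have "cact L' \<phi> (act q l) = act q (cact L' \<phi> l)" if "l \<in> mspace L" "lfun (cscale C) \<phi>" for q l \<phi>
    using that assms(6) module.subspace_scale[OF f(2,3)] by (simp add: same_def)
  moreover have "mspace L' = mspace L" "mscale L' = mscale L" using assms(6) by (simp_all add: same_def)
  ultimately show ?thesis
    unfolding free_poly_iff[OF assms(3,5)] assms(4) using f by simp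
qed

lemma iso_to_specialization_same:
  assumes "coalgebra C" "comodule C M" "free_poly_comodule C L act"
    "coalgebra H" "comodule H M'" "comodule H L'" "cscale H = cscale C"
    "same (cscale C) M M'" "same (cscale C) L L'"
  shows "iso_to_specialization H M' L' act lam \<longleftrightarrow> iso_to_specialization C M L act lam"
  unfolding iso_to_specialization_iff[OF assms(1-3)]
    iso_to_specialization_iff[OF assms(4,5) free_poly_same[OF assms(1,3,4,7,6,9)]] assms(7)
  using spec_map_same[OF assms(8,9)] spec_map_same[OF same_sym[OF assms(8)] same_sym[OF assms(9)]] by blast

section \<open>Tameness passes to subcoalgebras\<close>

definition exceptional ::
  "('k::field, 'c::ab_group_add) coalg \<Rightarrow> (('k, 'c) std_comod set \<Rightarrow>\<^sub>0 nat) \<Rightarrow>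
    (('k, 'c, nat \<Rightarrow>\<^sub>0 'k poly) comod \<times> ('k poly \<Rightarrow> (nat \<Rightarrow>\<^sub>0 'k poly) \<Rightarrow> (nat \<Rightarrow>\<^sub>0 'k poly))) set \<Rightarrow>
    ('k, 'c) std_comod set set" where
  "exceptional C v Ls = {iso_class C M | M.
     indecomposable_comodule C M \<and> fin_dim (mscale M) (mspace M) \<and> has_dim_vector C M v \<and>
     \<not> (\<exists>(L, act)\<in>Ls. \<exists>lam. iso_to_specialization C M L act lam)}"

lemma tame_iff:
  "tame C \<longleftrightarrow> (\<forall>v. Poly_Mapping.keys v \<subseteq> simple_types C \<longrightarrow>
     (\<exists>Ls. finite Ls \<and> (\<forall>(L, act)\<in>Ls. free_poly_comodule C L act) \<and> finite (exceptional C v Ls)))"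
  unfolding tame_def exceptional_def ..

lemma indecomposable_comodule: "indecomposable_comodule C M \<Longrightarrow> comodule C M"
  by (simp add: indecomposable_comodule_def)

lemma tame_subcoalgebra:
  fixes C H :: "('k::field, 'c::ab_group_add) coalg"
  assumes C: "coalgebra C" and H: "subcoalgebra H C" and tame: "tame C"
  shows "tame H"
  unfolding tame_iff[of H]
proof (intro allI impI)
  fix v
  note h = subcoalgebra_basic[OF H]
  obtain Ls where fin: "finite Ls" and free: "\<forall>(L, act)\<in>Ls. free_poly_comodule C L act"
    and ex: "finite (exceptional C (up_vec C H v) Ls)"
    using tame keys_up_vec[OF C H, of v] unfolding tame_iff by blast
  have free: "free_poly_comodule C L act" if "(L, act) \<in> Ls" for L act using free that by blast
  \<comment> \<open>The families that are H-comodules are kept after conversion. Each remaining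
    family accounts for finitely many classes of H-comodules, collected in \<open>Cl\<close>
    below.\<close>
  define Good where "Good = {(L, act) \<in> Ls. supported_on H L}"
  define Ls' where "Ls' = (\<lambda>(L, act). (conv H L, act)) ` Good"
  have fin': "finite Ls'" unfolding Ls'_def Good_def using fin by (auto intro: finite_subset[OF _ fin])
  have free': "\<forall>(L, act)\<in>Ls'. free_poly_comodule H L act"
  proof clarify
    fix L' act assume "(L', act) \<in> Ls'"
    then obtain L where L: "(L, act) \<in> Ls" "supported_on H L" "L' = conv H L"
      unfolding Ls'_def Good_def by auto
    note f = free_poly_basic[OF free[OF L(1)]]
    note cv = conv[OF C H f(1) L(2), unfolded h(3)]
    show "free_poly_comodule H L' act"
      unfolding L(3) by (rule free_poly_same[OF C free[OF L(1)] h(1,3) cv])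
  qed
  define Cl where "Cl L act = {iso_class H M | M. comodule H M \<and> (\<exists>lam. iso_to_specialization C M L act lam)}"
    for L :: "('k, 'c, nat \<Rightarrow>\<^sub>0 'k poly) comod" and act
  have Cl: "finite (Cl L act)" if L: "(L, act) \<in> Ls" and bad: "\<not> supported_on H L" for L act
  proof -
    obtain \<phi> l where \<phi>: "lfun (cscale C) \<phi>" "\<And>c. c \<in> cspace H \<Longrightarrow> \<phi> c = 0" "l \<in> mspace L" "cact L \<phi> l \<noteq> 0"
      using bad unfolding supported_on_def h(3) by blast
    let ?E = "{iso_class C M | M. comodule C M \<and> (\<forall>m\<in>mspace M. cact M \<phi> m = 0) \<and>
      (\<exists>lam. iso_to_specialization C M L act lam)}"
    have "Cl L act \<subseteq> down_class H ` ?E"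
    proof
      fix X assume "X \<in> Cl L act"
      then obtain M where M: "X = iso_class H M" "comodule H M" "\<exists>lam. iso_to_specialization C M L act lam"
        unfolding Cl_def by blast
      have "cact M \<phi> m = 0" if "m \<in> mspace M" for m by (rule cact_zero[OF M(2) that \<phi>(2)])
      then have "iso_class C M \<in> ?E" using comodule_lift[OF C H M(2)] M(3) by blast
      then show "X \<in> down_class H ` ?E" using down_iso_class[OF C H M(2)] M(1) by blast
    qed
    then show ?thesis
      using finite_spec_classes[OF C free[OF L] \<phi>(1,3,4)] by (meson finite_imageI finite_subset)
  qed
  \<comment> \<open>A class that is exceptional over \<open>H\<close> is exceptional over
    \<open>C\<close> or is represented over \<open>C\<close> by a dropped family.\<close>
  have "exceptional H v Ls' \<subseteq> down_class H ` exceptional C (up_vec C H v) Ls \<union>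
      (\<Union>(L, act)\<in>Ls - Good. Cl L act)"
  proof
    fix X assume "X \<in> exceptional H v Ls'"
    then obtain M where M: "X = iso_class H M" "indecomposable_comodule H M" "fin_dim (mscale M) (mspace M)"
      "has_dim_vector H M v" "\<not> (\<exists>(L, act)\<in>Ls'. \<exists>lam. iso_to_specialization H M L act lam)"
      unfolding exceptional_def by blast
    have cM: "comodule H M" by (rule indecomposable_comodule[OF M(2)])
    have lM: "comodule C M" by (rule comodule_lift[OF C H cM])
    show "X \<in> down_class H ` exceptional C (up_vec C H v) Ls \<union> (\<Union>(L, act)\<in>Ls - Good. Cl L act)"
    proof (cases "\<exists>(L, act)\<in>Ls. \<exists>lam. iso_to_specialization C M L act lam")
      case True
      then obtain L act lam where L: "(L, act) \<in> Ls" "iso_to_specialization C M L act lam" by blast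
      note f = free_poly_basic[OF free[OF L(1)]]
      have "(L, act) \<notin> Good"
      proof
        assume "(L, act) \<in> Good"
        then have s: "supported_on H L" and L': "(conv H L, act) \<in> Ls'" unfolding Good_def Ls'_def by auto
        note cv = conv[OF C H f(1) s, unfolded h(3)]
        have "iso_to_specialization H M (conv H L) act lam"
          using iso_to_specialization_same[OF C lM free[OF L(1)] h(1) cM cv(1) h(3) same_refl cv(2)] L(2) by blast
        then show False using M(5) L' by blast
      qed
      moreover have "X \<in> Cl L act" unfolding Cl_def using M(1) cM L(2) by blast
      ultimately show ?thesis using L(1) by blast
    next
      case False
      have "indecomposable_comodule C M"
        using indecomposable_same[OF C lM h(1) cM h(3) same_refl] M(2) by blast
      then have "iso_class C M \<in> exceptional C (up_vec C H v) Ls"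
        unfolding exceptional_def using M(3) has_dim_vector_up[OF C H cM M(4)] False by blast
      then show ?thesis using down_iso_class[OF C H cM] M(1) by blast
    qed
  qed
  moreover have "finite (\<Union>(L, act)\<in>Ls - Good. Cl L act)"
    using fin Cl by (auto simp: Good_def)
  ultimately have "finite (exceptional H v Ls')" using ex by (meson finite_UnI finite_imageI finite_subset)
  then show "\<exists>Ls. finite Ls \<and> (\<forall>(L, act)\<in>Ls. free_poly_comodule H L act) \<and> finite (exceptional H v Ls)"
    using fin' free' by blast
qed

section \<open>Coefficient matrices\<close>

text \<open>The indices label rows and columns of matrices: numbers for simple comodules, pairs of a
  position in a series and a number for adapted bases.\<close>

definition basis_fam :: "('k::field \<Rightarrow> 'a::ab_group_add \<Rightarrow> 'a) \<Rightarrow> 'i set \<Rightarrow> ('i \<Rightarrow> 'a) \<Rightarrow> 'a set \<Rightarrow> bool" where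
  "basis_fam s I e V \<longleftrightarrow> finite I \<and> e ` I \<subseteq> V \<and> (\<forall>x\<in>V. \<exists>c. x = (\<Sum>i\<in>I. s (c i) (e i))) \<and>
     (\<forall>c. (\<Sum>i\<in>I. s (c i) (e i)) = 0 \<longrightarrow> (\<forall>i\<in>I. c i = 0))"

lemma basis_fam_unique:
  assumes "basis_fam s I e V" "module s" "(\<Sum>i\<in>I. s (c i) (e i)) = (\<Sum>i\<in>I. s (d i) (e i))" "i \<in> I"
  shows "c i = d i"
proof -
  interpret module s by fact
  have "(\<Sum>i\<in>I. s (c i - d i) (e i)) = 0"
    using assms(3) by (simp add: scale_left_diff_distrib sum_subtractf)
  then show ?thesis using assms(1,4) unfolding basis_fam_def by fastforce
qed

lemma basis_fam_coordinates:
  assumes "basis_fam s I e V" "vector_space s" "module.subspace s V"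
  shows "\<exists>\<kappa>. (\<forall>i\<in>I. lin_on s (*) V (\<kappa> i)) \<and> (\<forall>x\<in>V. x = (\<Sum>i\<in>I. s (\<kappa> i x) (e i)))"
proof -
  interpret vector_space s by fact
  obtain k where k: "\<And>x. x \<in> V \<Longrightarrow> x = (\<Sum>i\<in>I. s (k x i) (e i))"
    using assms(1) unfolding basis_fam_def by metis
  have "k (x + y) i = k x i + k y i" if "x \<in> V" "y \<in> V" "i \<in> I" for x y i
  proof (rule basis_fam_unique[OF assms(1) module_axioms _ that(3)])
    have "(\<Sum>i\<in>I. s (k (x + y) i) (e i)) = x + y"
      using k[OF subspace_add[OF assms(3) that(1,2)]] by simp
    also have "\<dots> = (\<Sum>i\<in>I. s (k x i) (e i)) + (\<Sum>i\<in>I. s (k y i) (e i))"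
      using k that by simp
    also have "\<dots> = (\<Sum>i\<in>I. s (k x i + k y i) (e i))" by (simp add: scale_left_distrib sum.distrib)
    finally show "(\<Sum>i\<in>I. s (k (x + y) i) (e i)) = (\<Sum>i\<in>I. s (k x i + k y i) (e i))" .
  qed
  moreover have "k (s r x) i = r * k x i" if "x \<in> V" "i \<in> I" for x r i
  proof (rule basis_fam_unique[OF assms(1) module_axioms _ that(2)])
    have "(\<Sum>i\<in>I. s (k (s r x) i) (e i)) = s r x"
      using k[OF subspace_scale[OF assms(3) that(1)]] by simp
    also have "\<dots> = s r (\<Sum>i\<in>I. s (k x i) (e i))" using k that by simp
    also have "\<dots> = (\<Sum>i\<in>I. s (r * k x i) (e i))" by (simp add: scale_sum_right)
    finally show "(\<Sum>i\<in>I. s (k (s r x) i) (e i)) = (\<Sum>i\<in>I. s (r * k x i) (e i))" .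
  qed
  ultimately show ?thesis
    using k by (intro exI[of _ "\<lambda>i x. k x i"]) (simp add: lin_on_def)
qed

lemma fin_dim_basis_fam:
  assumes "vector_space s" "fin_dim s V"
  shows "\<exists>d e. basis_fam s {..<d::nat} e V"
proof -
  interpret V: vector_space s by fact
  obtain F where F: "finite F" "V.span F = V" using assms(2) unfolding fin_dim_def by auto
  obtain E where E: "E \<subseteq> F" "V.independent E" "F \<subseteq> V.span E" by (rule V.maximal_independent_subset)
  have fin: "finite E" using E(1) F(1) finite_subset by blast
  have sp: "V.span E = V" using V.span_mono[OF E(1)] V.span_minimal[OF E(3) V.subspace_span] F(2) by blast
  obtain e where e: "bij_betw e {..<card E} E"
    using ex_bij_betw_nat_finite[OF fin] unfolding atLeast0LessThan by blast
  have re: "(\<Sum>i<card E. s (c i) (e i)) = (\<Sum>b\<in>E. s (c (inv_into {..<card E} e b)) b)" for c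
    using sum.reindex_bij_betw[OF e, of "\<lambda>b. s (c (inv_into {..<card E} e b)) b"]
      bij_betw_inv_into_left[OF e] by simp
  have "basis_fam s {..<card E} e V"
    unfolding basis_fam_def
  proof (intro conjI ballI allI impI)
    show "e ` {..<card E} \<subseteq> V" using e V.span_superset[of E] sp by (auto simp: bij_betw_def)
    fix x assume "x \<in> V"
    then have "x \<in> V.span E" using sp by simp
    then obtain u where "x = (\<Sum>b\<in>E. s (u b) b)" unfolding V.span_finite[OF fin] by blast
    then have "x = (\<Sum>i<card E. s (u (e i)) (e i))"
      using sum.reindex_bij_betw[OF e, of "\<lambda>b. s (u b) b"] by simp
    then show "\<exists>c. x = (\<Sum>i<card E. s (c i) (e i))" by (intro exI[of _ "\<lambda>i. u (e i)"])
  next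
    fix c i assume "(\<Sum>i<card E. s (c i) (e i)) = 0" and i: "i \<in> {..<card E}"
    then have "(\<Sum>b\<in>E. s (c (inv_into {..<card E} e b)) b) = 0" using re by simp
    then have "c (inv_into {..<card E} e (e i)) = 0"
      using V.independentD[OF E(2) fin subset_refl] e i by (meson bij_betwE)
    then show "c i = 0" using bij_betw_inv_into_left[OF e i] by simp
  qed simp
  then show ?thesis by blast
qed

definition matrix_of where
  "matrix_of C M I e X \<longleftrightarrow> (\<forall>i\<in>I. \<forall>j\<in>I. X i j \<in> cspace C) \<and>
     (\<forall>f. lin_on (cscale C) (*) (cspace C) f \<longrightarrow>
       (\<forall>i\<in>I. cact M f (e i) = (\<Sum>j\<in>I. mscale M (f (X i j)) (e j))))"

lemma comodule_matrix:
  assumes "coalgebra C" "comodule C M" "basis_fam (mscale M) I e (mspace M)"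
  shows "\<exists>X. matrix_of C M I e X"
proof -
  note c = coalgebra_basic[OF assms(1)] and m = comodule_basic[OF assms(2)]
  obtain \<kappa> where \<kappa>: "\<And>i. i \<in> I \<Longrightarrow> lin_on (mscale M) (*) (mspace M) (\<kappa> i)"
    "\<And>x. x \<in> mspace M \<Longrightarrow> x = (\<Sum>i\<in>I. mscale M (\<kappa> i x) (e i))"
    using basis_fam_coordinates[OF assms(3) m(1,3)] by auto
  have eM: "e i \<in> mspace M" if "i \<in> I" for i using assms(3) that unfolding basis_fam_def by blast
  \<comment> \<open>The contraction of the coaction of e i with the coordinate \<kappa> j in the
    second factor.\<close>
  define X where "X i j = lin_ext (cscale C) (\<lambda>(a, b). cscale C (\<kappa> j b) a) (coact M (e i))" for i j
  have kk: "cscale C (\<kappa> j (snd p)) (fst p) \<in> cspace C" if "i \<in> I" "p \<in> Poly_Mapping.keys (coact M (e i))" for i j p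
    using m(4)[OF eM[OF that(1)]] that(2) module.subspace_scale[OF c(2,3)] by auto
  have XC: "X i j \<in> cspace C" if "i \<in> I" for i j
    unfolding X_def by (rule lin_ext_in[OF c(2,3)]) (use kk[OF that] in \<open>auto simp: case_prod_unfold\<close>)
  have fX: "f (X i j) = \<kappa> j (cact M f (e i))"
    if f: "lin_on (cscale C) (*) (cspace C) f" and ij: "i \<in> I" "j \<in> I" for f i j
  proof -
    have "f (X i j) = lin_ext (*) (\<lambda>p. f (case p of (a, b) \<Rightarrow> cscale C (\<kappa> j b) a)) (coact M (e i))"
      unfolding X_def
      by (rule lin_on_lin_ext[OF f c(2) module_times c(3)]) (use kk[OF ij(1)] in \<open>auto simp: case_prod_unfold\<close>)
    also have "\<dots> = ev f (\<kappa> j) (coact M (e i))"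
      unfolding ev_def
      by (rule lin_ext_cong) (use m(4)[OF eM[OF ij(1)]] lin_on_scale[OF f] in auto)
    also have "\<dots> = \<kappa> j (cact M f (e i))" by (rule ev_cact[OF assms(2) eM[OF ij(1)] \<kappa>(1)[OF ij(2)]])
    finally show ?thesis .
  qed
  have "cact M f (e i) = (\<Sum>j\<in>I. mscale M (f (X i j)) (e j))"
    if f: "lin_on (cscale C) (*) (cspace C) f" and i: "i \<in> I" for f i
    using \<kappa>(2)[OF cact_in[OF assms(2) eM[OF i], of f]] fX[OF f i] by simp
  then show ?thesis unfolding matrix_of_def using XC by blast
qed

text \<open>The comatrix identities: \<Delta> (X i j) is the sum of X i k \<otimes> X k j, and the
  counit sends X to the identity matrix.\<close>

definition matrix_coalg :: "('k::field, 'c::ab_group_add) coalg \<Rightarrow> 'i set \<Rightarrow> ('i \<Rightarrow> 'i \<Rightarrow> 'c) \<Rightarrow> bool" where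
  "matrix_coalg C I X \<longleftrightarrow> (\<forall>i\<in>I. \<forall>j\<in>I. X i j \<in> cspace C) \<and>
     (\<forall>i\<in>I. \<forall>j\<in>I. counit C (X i j) = (if i = j then 1 else 0)) \<and>
     (\<forall>f g. lfun (cscale C) f \<longrightarrow> lfun (cscale C) g \<longrightarrow>
       (\<forall>i\<in>I. \<forall>j\<in>I. convl C f g (X i j) = (\<Sum>k\<in>I. f (X i k) * g (X k j))))"

lemma cact_lincomb:
  assumes "coalgebra C" "comodule C M" "lin_on (cscale C) (*) (cspace C) f" "\<And>i. i \<in> I \<Longrightarrow> x i \<in> mspace M"
  shows "cact M f (\<Sum>i\<in>I. mscale M (c i) (x i)) = (\<Sum>i\<in>I. mscale M (c i) (cact M f (x i)))"
  by (rule lin_on_lincomb[OF lin_on_cact[OF assms(1-3)]])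
    (use comodule_basic[OF assms(2)] assms(4) in auto)

text \<open>Comparison of coefficients in the counit axiom and in the action of a product of two
  functionals.\<close>

lemma matrix_of_coalg:
  assumes C: "coalgebra C" and M: "comodule C M" and b: "basis_fam (mscale M) I e (mspace M)"
    and X: "matrix_of C M I e X"
  shows "matrix_coalg C I X"
  unfolding matrix_coalg_def
proof (intro conjI ballI allI impI)
  note m = comodule_basic[OF M] and c = coalgebra_basic[OF C]
  interpret M: vector_space "mscale M" by (rule m(1))
  have eM: "e i \<in> mspace M" if "i \<in> I" for i using b that unfolding basis_fam_def by blast
  have fin: "finite I" using b by (simp add: basis_fam_def)
  have act: "cact M f (e i) = (\<Sum>j\<in>I. mscale M (f (X i j)) (e j))"
    if "lin_on (cscale C) (*) (cspace C) f" "i \<in> I" for f i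
    using X that unfolding matrix_of_def by blast
  fix i j assume ij: "i \<in> I" "j \<in> I"
  show "X i j \<in> cspace C" using X ij unfolding matrix_of_def by blast
  have "(\<Sum>j\<in>I. mscale M (counit C (X i j)) (e j)) = e i"
    using act[OF c(5) ij(1)] cact_counit[OF M eM[OF ij(1)]] by simp
  also have "e i = (\<Sum>j\<in>I. mscale M (if i = j then 1 else 0) (e j))"
    using fin ij(1) by (simp add: if_distrib[of "\<lambda>r. mscale M r _"] cong: if_cong)
  finally show "counit C (X i j) = (if i = j then 1 else 0)"
    by (rule basis_fam_unique[OF b m(2) _ ij(2)])
  fix f g assume "lfun (cscale C) f" "lfun (cscale C) g"
  then have f: "lin_on (cscale C) (*) (cspace C) f" and g: "lin_on (cscale C) (*) (cspace C) g"
    by (auto intro: lin_on_subset)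
  have "(\<Sum>j\<in>I. mscale M (convl C f g (X i j)) (e j)) = cact M g (cact M f (e i))"
    using act[OF lin_on_convl[OF C f g] ij(1)] cact_convl[OF C M eM[OF ij(1)] f g] by simp
  also have "\<dots> = (\<Sum>k\<in>I. mscale M (f (X i k)) (\<Sum>j\<in>I. mscale M (g (X k j)) (e j)))"
    using act[OF f ij(1)] act[OF g] cact_lincomb[OF C M g, of I e "\<lambda>k. f (X i k)"] eM by simp
  also have "\<dots> = (\<Sum>j\<in>I. mscale M (\<Sum>k\<in>I. f (X i k) * g (X k j)) (e j))"
    by (simp add: M.scale_sum_right M.scale_sum_left) (rule sum.swap)
  finally show "convl C f g (X i j) = (\<Sum>k\<in>I. f (X i k) * g (X k j))"
    by (rule basis_fam_unique[OF b m(2) _ ij(2)])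
qed

text \<open>The elements of the span whose comultiplication is representable over the span form a
  subspace, so generators suffice. The axioms are inherited from \<open>C\<close> by testing on
  functionals.\<close>

lemma subcoalgebra_span:
  assumes C: "coalgebra C" and G: "G \<subseteq> cspace C"
    and ex: "\<And>x. x \<in> G \<Longrightarrow> \<exists>t. Poly_Mapping.keys t \<subseteq> module.span (cscale C) G \<times> module.span (cscale C) G \<and>
      (\<forall>f g. lfun (cscale C) f \<longrightarrow> lfun (cscale C) g \<longrightarrow> ev f g t = convl C f g x)"
  shows "\<exists>H. subcoalgebra H C \<and> cspace H = module.span (cscale C) G"
proof -
  note c = coalgebra_basic[OF C]
  interpret V: vector_space "cscale C" by (rule c(1))
  let ?V = "V.span G"
  have VC: "?V \<subseteq> cspace C" by (rule V.span_minimal[OF G c(3)])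
  have sub: "lin_on (cscale C) (*) (cspace C) f" if "lfun (cscale C) f" for f
    by (rule lin_on_subset[OF that]) simp
  define P where "P x t \<longleftrightarrow> Poly_Mapping.keys t \<subseteq> ?V \<times> ?V \<and>
      (\<forall>f g. lfun (cscale C) f \<longrightarrow> lfun (cscale C) g \<longrightarrow> ev f g t = convl C f g x)" for x t
  have "x \<in> ?V \<and> (\<exists>t. P x t)" if "x \<in> ?V" for x
    using that
  proof (induction rule: V.span_induct_alt)
    case base
    have "convl C f g 0 = 0" if "lfun (cscale C) f" "lfun (cscale C) g" for f g
      by (rule lin_on_0[OF lin_on_convl[OF C sub[OF that(1)] sub[OF that(2)]] c(2) module_times V.subspace_0[OF c(3)]])
    then have "P 0 0" by (simp add: P_def ev_def)
    then show ?case using V.span_zero by blast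
  next
    case (step r x y)
    obtain t where t: "P y t" using step by blast
    obtain u where u: "P x u" using ex[OF step(1)] unfolding P_def by blast
    have xC: "x \<in> cspace C" "cscale C r x \<in> cspace C" "y \<in> cspace C"
      using step VC G V.subspace_scale[OF c(3)] by auto
    have "P (cscale C r x + y) (fs_scale r u + t)"
      unfolding P_def
    proof (intro conjI allI impI)
      show "Poly_Mapping.keys (fs_scale r u + t) \<subseteq> ?V \<times> ?V"
        using t u keys_fs_scale[of r u] Poly_Mapping.keys_add[of "fs_scale r u" t] unfolding P_def by blast
      fix f g assume fg: "lfun (cscale C) f" "lfun (cscale C) g"
      note l = lin_on_convl[OF C sub[OF fg(1)] sub[OF fg(2)]]
      have "ev f g (fs_scale r u + t) = r * convl C f g x + convl C f g y"
        using t u fg unfolding P_def by (simp add: ev_add ev_fs_scale)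
      then show "ev f g (fs_scale r u + t) = convl C f g (cscale C r x + y)"
        using lin_on_add[OF l xC(2,3)] lin_on_scale[OF l xC(1)] by simp
    qed
    moreover have "cscale C r x + y \<in> ?V" using step by (simp add: V.span_add V.span_scale V.span_base)
    ultimately show ?case by blast
  qed
  then obtain T where T: "\<And>x. x \<in> ?V \<Longrightarrow> P x (T x)" by metis
  have Tk: "Poly_Mapping.keys (T x) \<subseteq> ?V \<times> ?V" if "x \<in> ?V" for x using T[OF that] by (simp add: P_def)
  define H where "H = \<lparr>cspace = ?V, cscale = cscale C, comult = T, counit = counit C\<rparr>"
  have H: "cspace H = ?V" "cscale H = cscale C" "comult H = T" "counit H = counit C" by (simp_all add: H_def)
  have cv: "convl H f g x = convl C f g x" if "x \<in> ?V" "lfun (cscale C) f" "lfun (cscale C) g" for f g x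
    using T[OF that(1)] that unfolding P_def convl_def[of H] H by blast
  have ext: "convl H f g x = convl C f' g' x"
    if x: "x \<in> ?V" and f': "lin_on (cscale C) (*) (cspace C) f'" and g': "lin_on (cscale C) (*) (cspace C) g'"
      and eq: "\<And>y. y \<in> ?V \<Longrightarrow> f y = f' y" "\<And>y. y \<in> ?V \<Longrightarrow> g y = g' y" for f g f' g' x
  proof -
    obtain f'' where f'': "lfun (cscale C) f''" "\<forall>x\<in>cspace C. f'' x = f' x"
      using lin_on_extend[OF c(1,3) f'] by blast
    obtain g'' where g'': "lfun (cscale C) g''" "\<forall>x\<in>cspace C. g'' x = g' x"
      using lin_on_extend[OF c(1,3) g'] by blast
    have "convl H f g x = convl H f'' g'' x"
      unfolding convl_def H by (rule ev_cong) (use Tk[OF x] eq f'' g'' subsetD[OF VC] in auto)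
    also have "\<dots> = convl C f'' g'' x" by (rule cv[OF x f''(1) g''(1)])
    also have "\<dots> = convl C f' g' x"
      unfolding convl_def by (rule ev_cong) (use c(4)[OF subsetD[OF VC x]] f'' g'' in auto)
    finally show ?thesis .
  qed
  have "coalgebra H"
  proof (rule coalgebraI, unfold H)
    show "lin_on (cscale C) (*) ?V (counit C)" by (rule lin_on_subset[OF c(5) VC])
    fix f g assume fg: "lfun (cscale C) f" "lfun (cscale C) g"
    have "lin_on (cscale C) (*) ?V (convl C f g)"
      by (rule lin_on_subset[OF lin_on_convl[OF C sub[OF fg(1)] sub[OF fg(2)]] VC])
    then show "lin_on (cscale C) (*) ?V (convl H f g)"
      using cv[OF _ fg] by (simp add: lin_on_def V.span_add V.span_scale)
    fix h x assume h: "lfun (cscale C) h" and x: "x \<in> ?V"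
    have "convl H (convl H f g) h x = convl C (convl C f g) h x"
      by (rule ext[OF x lin_on_convl[OF C sub[OF fg(1)] sub[OF fg(2)]] sub[OF h]]) (simp_all add: cv[OF _ fg])
    also have "\<dots> = convl C f (convl C g h) x"
      by (rule convl_assoc[OF C sub[OF fg(1)] sub[OF fg(2)] sub[OF h]]) (use x VC in blast)
    also have "\<dots> = convl H f (convl H g h) x"
      by (rule ext[OF x sub[OF fg(1)] lin_on_convl[OF C sub[OF fg(2)] sub[OF h]], symmetric])
        (simp_all add: cv[OF _ fg(2) h])
    finally show "convl H (convl H f g) h x = convl H f (convl H g h) x" .
  next
    fix f x assume f: "lfun (cscale C) f" and x: "x \<in> ?V"
    have xC: "x \<in> cspace C" using x VC by blast
    show "convl H (counit C) f x = f x"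
      using ext[OF x c(5) sub[OF f], of "counit C" f] convl_counit(1)[OF C sub[OF f] xC] by simp
    show "convl H f (counit C) x = f x"
      using ext[OF x sub[OF f] c(5), of f "counit C"] convl_counit(2)[OF C sub[OF f] xC] by simp
  qed (use c(1) V.subspace_span Tk in auto)
  moreover have "tensor_eq (cscale C) (cspace C) (cscale C) (cspace C) (T x) (comult C x)" if x: "x \<in> ?V" for x
  proof (rule tensor_eqI[OF c(1,3) c(1,3)])
    show "Poly_Mapping.keys (T x) \<subseteq> cspace C \<times> cspace C" using Tk[OF x] VC by blast
    show "Poly_Mapping.keys (comult C x) \<subseteq> cspace C \<times> cspace C" using c(4) x VC by blast
    fix f g assume "lfun (cscale C) f" "lfun (cscale C) g"
    then show "ev f g (T x) = ev f g (comult C x)"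
      using cv[OF x] unfolding convl_def H by blast
  qed
  ultimately have "subcoalgebra H C" unfolding subcoalgebra_def H using VC by blast
  then show ?thesis using H(1) by blast
qed

section \<open>Linear relations, dual sequences and a Vandermonde argument\<close>

lemma nontrivial_relation:
  fixes s :: "'i \<Rightarrow> 'q \<Rightarrow> 'k::field"
  assumes "finite Q" "finite I" "card Q < card I"
  shows "\<exists>c. (\<exists>i\<in>I. c i \<noteq> 0) \<and> (\<forall>q\<in>Q. (\<Sum>i\<in>I. c i * s i q) = 0)"
  using assms
proof (induction Q arbitrary: I s rule: finite_induct)
  case empty
  then obtain i where "i \<in> I" by fastforce
  then show ?case by (intro exI[of _ "\<lambda>_. 1"]) auto
next
  case (insert q Q)
  show ?case
  proof (cases "\<forall>i\<in>I. s i q = 0")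
    case True
    have "card Q < card I" using insert by simp
    from insert.IH[OF insert.prems(1) this] True show ?thesis by auto
  next
    case False
    then obtain a where a: "a \<in> I" "s a q \<noteq> 0" by blast
    \<comment> \<open>Elimination: equation q, with pivot a, removes the unknown of index a from the
      other equations. The value \<open>d a\<close> below solves equation q for this
      unknown.\<close>
    define t where "t i p = s i p - s i q / s a q * s a p" for i p
    have "card Q < card (I - {a})" using insert a by simp
    then obtain c where c: "\<exists>i\<in>I - {a}. c i \<noteq> 0" "\<forall>p\<in>Q. (\<Sum>i\<in>I - {a}. c i * t i p) = 0"
      using insert.IH[of "I - {a}" t] insert.prems(1) by blast
    define d where "d i = (if i = a then - (\<Sum>i\<in>I - {a}. c i * s i q / s a q) else c i)" for i
    have sd: "(\<Sum>i\<in>I. d i * s i p) = (\<Sum>i\<in>I - {a}. c i * t i p)" for p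
    proof -
      have "c i * t i p = c i * s i p - c i * s i q / s a q * s a p" for i
        by (simp add: t_def algebra_simps)
      moreover have "(\<Sum>i\<in>I. d i * s i p) = d a * s a p + (\<Sum>i\<in>I - {a}. d i * s i p)"
        by (rule sum.remove[OF insert.prems(1) a(1)])
      moreover have "(\<Sum>i\<in>I - {a}. d i * s i p) = (\<Sum>i\<in>I - {a}. c i * s i p)"
        by (rule sum.cong) (auto simp: d_def)
      moreover have "d a * s a p = (\<Sum>i\<in>I - {a}. - (c i * s i q / s a q * s a p))"
        by (simp add: d_def sum_distrib_right sum_negf)
      ultimately show ?thesis by (simp add: sum_subtractf sum_negf)
    qed
    have "t i q = 0" for i using a(2) by (simp add: t_def)
    then have "\<forall>p\<in>insert q Q. (\<Sum>i\<in>I. d i * s i p) = 0" using sd c(2) by simp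
    moreover have "\<exists>i\<in>I. d i \<noteq> 0" using c(1) unfolding d_def by auto
    ultimately show ?thesis by blast
  qed
qed

text \<open>Coordinates with respect to W turn the relation into \<open>card W\<close> equations for
  the coefficients.\<close>

lemma dependent_in_span:
  fixes s :: "'k::field \<Rightarrow> 'a::ab_group_add \<Rightarrow> 'a"
  assumes "vector_space s" "finite W" "finite I" "card W < card I" "\<And>i. i \<in> I \<Longrightarrow> y i \<in> module.span s W"
  shows "\<exists>c. (\<exists>i\<in>I. c i \<noteq> 0) \<and> (\<Sum>i\<in>I. s (c i) (y i)) = 0"
proof -
  interpret V: vector_space s by fact
  have "\<forall>i\<in>I. \<exists>a. y i = (\<Sum>w\<in>W. s (a w) w)" using assms(5) unfolding V.span_finite[OF assms(2)] by blast
  then obtain a where a: "\<And>i. i \<in> I \<Longrightarrow> y i = (\<Sum>w\<in>W. s (a i w) w)" by metis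
  obtain c where c: "\<exists>i\<in>I. c i \<noteq> 0" "\<forall>w\<in>W. (\<Sum>i\<in>I. c i * a i w) = 0"
    using nontrivial_relation[OF assms(2-4), of a] by blast
  have "(\<Sum>i\<in>I. s (c i) (y i)) = (\<Sum>w\<in>W. s (\<Sum>i\<in>I. c i * a i w) w)"
    by (simp add: a V.scale_sum_right V.scale_sum_left) (rule sum.swap)
  also have "\<dots> = 0" using c(2) by simp
  finally show ?thesis using c(1) by blast
qed

text \<open>Inductively, z is taken in S outside the span of D and the earlier vectors, with a
  functional g that vanishes on those and is 1 at z. The earlier functionals are corrected by
  multiples of g so that they vanish at z.\<close>

lemma dual_sequence:
  fixes s :: "'k::field \<Rightarrow> 'a::ab_group_add \<Rightarrow> 'a" and m :: nat
  assumes "vector_space s" "finite D" "\<And>W. finite W \<Longrightarrow> \<not> S \<subseteq> module.span s W"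
  shows "\<exists>y f. (\<forall>i<m. y i \<in> S \<and> lfun s (f i) \<and> (\<forall>x\<in>D. f i x = 0) \<and> (\<forall>j<m. f i (y j) = (if i = j then 1 else 0)))"
proof (induct m)
  case 0
  show ?case by simp
next
  case (Suc m)
  interpret V: vector_space s by fact
  obtain y f where yf: "\<And>i. i < m \<Longrightarrow> y i \<in> S" "\<And>i. i < m \<Longrightarrow> lfun s (f i)"
    "\<And>i x. i < m \<Longrightarrow> x \<in> D \<Longrightarrow> f i x = 0"
    "\<And>i j. i < m \<Longrightarrow> j < m \<Longrightarrow> f i (y j) = (if i = j then 1 else 0)"
    using Suc by blast
  let ?W = "D \<union> y ` {..<m}"
  obtain z where z: "z \<in> S" "z \<notin> V.span ?W" using assms(3)[of ?W] assms(2) by auto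
  obtain g where g: "lfun s g" "\<forall>w\<in>V.span ?W. g w = 0" "g z = 1"
    using separating_functional[OF assms(1) V.subspace_span z(2)] by blast
  have g0: "g x = 0" if "x \<in> D \<or> (\<exists>i<m. x = y i)" for x
    using g(2) V.span_base[of x ?W] that by auto
  define y' where "y' = y(m := z)"
  define f' where "f' i = (if i = m then g else (\<lambda>x. f i x - f i z * g x))" for i
  have "lfun s (f' i)" if "i < Suc m" for i
  proof (cases "i = m")
    case False
    then have "lfun s (f i)" using yf(2) that by simp
    then show ?thesis using g(1) False unfolding f'_def lin_on_def by (simp add: algebra_simps)
  qed (simp add: f'_def g(1))
  moreover have "y' i \<in> S" if "i < Suc m" for i using that yf(1) z(1) by (auto simp: y'_def)
  moreover have "f' i x = 0" if "i < Suc m" "x \<in> D" for i x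
    using that yf(3) g0 by (auto simp: f'_def)
  moreover have "f' i (y' j) = (if i = j then 1 else 0)" if "i < Suc m" "j < Suc m" for i j
  proof -
    have "g (y j) = 0" if "j < m" for j using g0 that by blast
    then show ?thesis using that yf(4) g(3) by (auto simp: f'_def y'_def less_Suc_eq)
  qed
  ultimately show ?case by (intro exI[of _ y'] exI[of _ f']) simp
qed

text \<open>A functional vanishing on W turns the curve \<Sum> u^i v i into a polynomial in u with
  infinitely many roots, whose coefficients must be zero. This replaces the inversion of a
  Vandermonde matrix.\<close>

lemma vandermonde_subspace:
  fixes s :: "'k::field \<Rightarrow> 'a::ab_group_add \<Rightarrow> 'a"
  assumes "vector_space s" "module.subspace s W" "infinite T"
    "\<And>u. u \<in> T \<Longrightarrow> (\<Sum>i<m. s (u ^ i) (v i)) \<in> W" "i < m"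
  shows "v i \<in> W"
proof (rule in_subspace_functional[OF assms(1,2)])
  interpret V: vector_space s by fact
  fix f assume f: "lfun s f" "\<And>w. w \<in> W \<Longrightarrow> f w = 0"
  define p where "p = (\<Sum>i<m. monom (f (v i)) i)"
  have "poly p u = 0" if "u \<in> T" for u
  proof -
    have "poly p u = (\<Sum>i<m. u ^ i * f (v i))" by (simp add: p_def poly_sum poly_monom mult.commute)
    also have "\<dots> = f (\<Sum>i<m. s (u ^ i) (v i))"
      using lin_on_lincomb[OF f(1) V.module_axioms module_times V.subspace_UNIV, of "{..<m}" v "\<lambda>i. u ^ i"] by simp
    also have "\<dots> = 0" by (rule f(2)[OF assms(4)[OF that]])
    finally show ?thesis .
  qed
  then have "T \<subseteq> {u. poly p u = 0}" by blast
  then have "p = 0" using assms(3) poly_roots_finite[of p] finite_subset by blast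
  then have "coeff p i = 0" by simp
  then show "f (v i) = 0" using assms(5) by (simp add: p_def coeff_sum)
qed

section \<open>Extensions of simple comodules\<close>

lemma cact_lincomb_fun:
  assumes "module (mscale M)"
  shows "cact M (\<lambda>c. \<Sum>i\<in>I. u i * f i c) x = (\<Sum>i\<in>I. mscale M (u i) (cact M (f i) x))"
proof -
  interpret M: module "mscale M" by fact
  show ?thesis
    unfolding cact_def slice_def lin_ext_def
    by (simp add: case_prod_unfold M.scale_sum_left M.scale_sum_right sum_distrib_left)
      (subst sum.swap, simp add: mult.left_commute)
qed

lemma lfun_lincomb:
  assumes "\<And>i. i \<in> I \<Longrightarrow> lfun s (f i)"
  shows "lfun s (\<lambda>c. \<Sum>i\<in>I. u i * f i c)"
  unfolding lin_on_def
proof (intro conjI ballI allI)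
  fix x y
  have "(\<Sum>i\<in>I. u i * f i (x + y)) = (\<Sum>i\<in>I. u i * f i x + u i * f i y)"
    by (rule sum.cong) (simp_all add: lin_on_add[OF assms] distrib_left)
  then show "(\<Sum>i\<in>I. u i * f i (x + y)) = (\<Sum>i\<in>I. u i * f i x) + (\<Sum>i\<in>I. u i * f i y)"
    by (simp add: sum.distrib)
next
  fix r x
  have "(\<Sum>i\<in>I. u i * f i (s r x)) = (\<Sum>i\<in>I. r * (u i * f i x))"
    by (rule sum.cong) (simp_all add: lin_on_scale[OF assms] mult.left_commute)
  then show "(\<Sum>i\<in>I. u i * f i (s r x)) = r * (\<Sum>i\<in>I. u i * f i x)"
    by (simp add: sum_distrib_left)
qed

lemma basis_fam_fin_dim:
  assumes "basis_fam s I e V" "module s" "module.subspace s V"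
  shows "fin_dim s V"
proof -
  interpret module s by fact
  have "span (e ` I) = V"
  proof
    show "span (e ` I) \<subseteq> V" by (rule span_minimal) (use assms in \<open>auto simp: basis_fam_def\<close>)
    show "V \<subseteq> span (e ` I)"
    proof
      fix x assume "x \<in> V"
      then obtain c where "x = (\<Sum>i\<in>I. s (c i) (e i))" using assms(1) unfolding basis_fam_def by blast
      then show "x \<in> span (e ` I)" by (simp only:) (intro span_sum span_scale span_base imageI)
    qed
  qed
  then show ?thesis using assms(1) unfolding fin_dim_def basis_fam_def by blast
qed

section \<open>Comodules with a prescribed matrix\<close>

definition std_space :: "nat set \<Rightarrow> (nat \<Rightarrow>\<^sub>0 'k::field) set" where
  "std_space I = {v. Poly_Mapping.keys v \<subseteq> I}"

text \<open>Dimension vectors and tameness concern comodules of type \<open>std_comod\<close>, so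
  comodules with a given matrix are built there, on the first d coordinates.\<close>

definition mat_comod :: "nat \<Rightarrow> (nat \<Rightarrow> nat \<Rightarrow> 'c) \<Rightarrow> ('k::field, 'c) std_comod" where
  "mat_comod d X = \<lparr>mspace = std_space {..<d}, mscale = fs_scale,
     coact = (\<lambda>v. \<Sum>j<d. \<Sum>i<d. Poly_Mapping.single (X j i, Poly_Mapping.single i 1) (Poly_Mapping.lookup v j))\<rparr>"

lemma mat_comod_simps:
  "mspace (mat_comod d X) = std_space {..<d}" "mscale (mat_comod d X) = fs_scale"
  "coact (mat_comod d X) v = (\<Sum>j<d. \<Sum>i<d. Poly_Mapping.single (X j i, Poly_Mapping.single i 1) (Poly_Mapping.lookup v j))"
  by (simp_all add: mat_comod_def)

lemma lookup_std: "v \<in> std_space I \<Longrightarrow> i \<notin> I \<Longrightarrow> Poly_Mapping.lookup v i = 0"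
  by (auto simp: std_space_def in_keys_iff)

lemma cact_mat_comod:
  "Poly_Mapping.lookup (cact (mat_comod d X) f v) i =
     (if i < d then \<Sum>j<d. Poly_Mapping.lookup v j * f (X j i) else 0)"
proof -
  have "cact (mat_comod d X) f v = (\<Sum>j<d. \<Sum>i<d. fs_scale (Poly_Mapping.lookup v j * f (X j i)) (Poly_Mapping.single i 1))"
    unfolding cact_def mat_comod_simps by (simp add: slice_sum[OF fs.module_axioms] slice_single[OF fs.module_axioms])
  then show ?thesis
    by (simp add: lookup_sum lookup_fs_scale lookup_single when_def if_distrib sum.If_cases cong: if_cong)
qed

lemma std_space_subspace: "module.subspace fs_scale (std_space I)"
  unfolding std_space_def by (rule subspace_keys)

lemma cact_mat_comod_in: "cact (mat_comod d X) f v \<in> std_space {..<d}"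
  unfolding std_space_def by (auto simp: in_keys_iff cact_mat_comod split: if_splits)

lemma mat_comod_comodule:
  assumes "coalgebra C" "matrix_coalg C {..<d} X"
  shows "comodule C (mat_comod d X)"
proof (rule comoduleI[OF assms(1)], unfold mat_comod_simps(1,2))
  show "vector_space fs_scale" by (rule vector_space_fs_scale)
  show "module.subspace fs_scale (std_space {..<d})" by (rule std_space_subspace)
  have X: "\<And>i j. i < d \<Longrightarrow> j < d \<Longrightarrow> X i j \<in> cspace C"
    "\<And>i j. i < d \<Longrightarrow> j < d \<Longrightarrow> counit C (X i j) = (if i = j then 1 else 0)"
    "\<And>f g i j. lfun (cscale C) f \<Longrightarrow> lfun (cscale C) g \<Longrightarrow> i < d \<Longrightarrow> j < d \<Longrightarrow>
      convl C f g (X i j) = (\<Sum>k<d. f (X i k) * g (X k j))"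
    using assms(2) unfolding matrix_coalg_def by auto
  fix m :: "nat \<Rightarrow>\<^sub>0 'a" assume m: "m \<in> std_space {..<d}"
  have "coact (mat_comod d X) m \<in> {t. Poly_Mapping.keys t \<subseteq> cspace C \<times> std_space {..<d}}"
    unfolding mat_comod_simps
    by (intro fs.subspace_sum[OF subspace_keys]) (auto simp: X(1) std_space_def)
  then show "Poly_Mapping.keys (coact (mat_comod d X) m) \<subseteq> cspace C \<times> std_space {..<d}" by simp
  show "cact (mat_comod d X) (counit C) m = m"
  proof (rule poly_mapping_eqI)
    fix i
    show "Poly_Mapping.lookup (cact (mat_comod d X) (counit C) m) i = Poly_Mapping.lookup m i"
      using lookup_std[OF m, of i] by (simp add: cact_mat_comod X(2) if_distrib sum.If_cases cong: if_cong)
  qed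
  fix f g assume fg: "lfun (cscale C) f" "lfun (cscale C) g"
  show "cact (mat_comod d X) (convl C f g) m = cact (mat_comod d X) g (cact (mat_comod d X) f m)"
  proof (rule poly_mapping_eqI)
    fix i
    show "Poly_Mapping.lookup (cact (mat_comod d X) (convl C f g) m) i =
        Poly_Mapping.lookup (cact (mat_comod d X) g (cact (mat_comod d X) f m)) i"
    proof (cases "i < d")
      case True
      have "(\<Sum>j<d. Poly_Mapping.lookup m j * convl C f g (X j i)) =
          (\<Sum>j<d. \<Sum>k<d. Poly_Mapping.lookup m j * f (X j k) * g (X k i))"
        using X(3)[OF fg _ True] by (simp add: sum_distrib_left mult.assoc)
      also have "\<dots> = (\<Sum>k<d. (\<Sum>j<d. Poly_Mapping.lookup m j * f (X j k)) * g (X k i))"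
        by (subst sum.swap) (simp add: sum_distrib_right)
      finally show ?thesis using True by (simp add: cact_mat_comod)
    qed (simp add: cact_mat_comod)
  qed
next
  fix f assume "lfun (cscale C) f"
  show "lin_on fs_scale fs_scale (std_space {..<d}) (cact (mat_comod d X) f)"
    unfolding lin_on_def
    by (auto intro!: poly_mapping_eqI simp: cact_mat_comod lookup_add lookup_fs_scale distrib_right sum.distrib
        sum_distrib_left mult.assoc)
qed

lemma std_sum: "v \<in> std_space {..<d} \<Longrightarrow> v = (\<Sum>i<d. fs_scale (Poly_Mapping.lookup v i) (Poly_Mapping.single i 1))"
  by (rule poly_mapping_eqI)
    (auto simp: lookup_sum lookup_fs_scale lookup_single when_def if_distrib sum.If_cases lookup_std cong: if_cong)

lemma basis_fam_std: "basis_fam fs_scale {..<d} (\<lambda>i. Poly_Mapping.single i (1::'k::field)) (std_space {..<d})"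
  unfolding basis_fam_def
proof (intro conjI ballI allI impI)
  show "(\<lambda>i. Poly_Mapping.single i (1::'k)) ` {..<d} \<subseteq> std_space {..<d}" by (auto simp: std_space_def)
next
  fix x :: "nat \<Rightarrow>\<^sub>0 'k" assume "x \<in> std_space {..<d}"
  then show "\<exists>c. x = (\<Sum>i<d. fs_scale (c i) (Poly_Mapping.single i 1))" using std_sum by blast
next
  fix c :: "nat \<Rightarrow> 'k" and i assume *: "(\<Sum>i<d. fs_scale (c i) (Poly_Mapping.single i 1)) = 0" and i: "i \<in> {..<d}"
  have "Poly_Mapping.lookup (\<Sum>i<d. fs_scale (c i) (Poly_Mapping.single i 1)) i = c i"
    using i by (simp add: lookup_sum lookup_fs_scale lookup_single when_def if_distrib sum.If_cases cong: if_cong)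
  then show "c i = 0" using * by simp
qed simp

text \<open>\<open>Y\<close> is the off-diagonal block of an extension of comodules with matrices \<open>A\<close> (quotient) and
  \<open>B\<close> (subcomodule).\<close>

definition extension ::
  "('k::field, 'c::ab_group_add) coalg \<Rightarrow> nat \<Rightarrow> (nat \<Rightarrow> nat \<Rightarrow> 'c) \<Rightarrow> nat \<Rightarrow> (nat \<Rightarrow> nat \<Rightarrow> 'c) \<Rightarrow> (nat \<Rightarrow> nat \<Rightarrow> 'c) \<Rightarrow> bool"
  where
  "extension C a A b B Y \<longleftrightarrow> (\<forall>i<a. \<forall>j<b. Y i j \<in> cspace C \<and> counit C (Y i j) = 0 \<and>
     (\<forall>f g. lfun (cscale C) f \<longrightarrow> lfun (cscale C) g \<longrightarrow>
        convl C f g (Y i j) = (\<Sum>k<a. f (A i k) * g (Y k j)) + (\<Sum>k<b. f (Y i k) * g (B k j))))"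

text \<open>Rows below b have nonzero entries only in columns below b, so the first b basis vectors
  span the subcomodule; those of the quotient come after them.\<close>

definition block :: "nat \<Rightarrow> (nat \<Rightarrow> nat \<Rightarrow> 'c) \<Rightarrow> (nat \<Rightarrow> nat \<Rightarrow> 'c) \<Rightarrow> (nat \<Rightarrow> nat \<Rightarrow> 'c) \<Rightarrow> nat \<Rightarrow> nat \<Rightarrow> 'c::zero" where
  "block b A B Y i j = (if i < b then (if j < b then B i j else 0)
     else if j < b then Y (i - b) j else A (i - b) (j - b))"

lemma sum_lessThan_add: "(\<Sum>k<b + a. h k) = (\<Sum>k<b. h k) + (\<Sum>k<a. h (b + k))" for h :: "nat \<Rightarrow> 'x::comm_monoid_add"
  by (induction a) (simp_all add: add.assoc)

text \<open>The equation in \<open>extension\<close> is the comatrix identity for the lower left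
  block. For fixed A and B it is linear in Y, which is what makes combinations of extensions
  available.\<close>

lemma block_coalg:
  assumes C: "coalgebra C" and A: "matrix_coalg C {..<a} A" and B: "matrix_coalg C {..<b} B"
    and Y: "extension C a A b B Y"
  shows "matrix_coalg C {..<b + a} (block b A B Y)"
proof -
  note c = coalgebra_basic[OF C]
  have f0: "f 0 = 0" if "lin_on (cscale C) (*) (cspace C) f" for f
    by (rule lin_on_0[OF that c(2) module_times module.subspace_0[OF c(2,3)]])
  have sub: "lin_on (cscale C) (*) (cspace C) f" if "lfun (cscale C) f" for f
    by (rule lin_on_subset[OF that]) simp
  have z: "0 \<in> cspace C" by (rule module.subspace_0[OF c(2,3)])
  show ?thesis
    unfolding matrix_coalg_def
  proof (intro conjI ballI allI impI)
    fix i j assume ij: "i \<in> {..<b + a}" "j \<in> {..<b + a}"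
    show "block b A B Y i j \<in> cspace C"
      using ij A B Y z unfolding block_def matrix_coalg_def extension_def by auto
    show "counit C (block b A B Y i j) = (if i = j then 1 else 0)"
      using ij A B Y f0[OF c(5)] unfolding block_def matrix_coalg_def extension_def by auto
    fix f g assume fg: "lfun (cscale C) f" "lfun (cscale C) g"
    have fg0: "f 0 = 0" "g 0 = 0" "convl C f g 0 = 0"
      using f0[OF sub[OF fg(1)]] f0[OF sub[OF fg(2)]] f0[OF lin_on_convl[OF C sub[OF fg(1)] sub[OF fg(2)]]] by auto
    have cA: "convl C f g (A i j) = (\<Sum>k<a. f (A i k) * g (A k j))" if "i < a" "j < a" for i j
      using A that fg unfolding matrix_coalg_def by auto
    have cB: "convl C f g (B i j) = (\<Sum>k<b. f (B i k) * g (B k j))" if "i < b" "j < b" for i j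
      using B that fg unfolding matrix_coalg_def by auto
    have cY: "convl C f g (Y i j) = (\<Sum>k<a. f (A i k) * g (Y k j)) + (\<Sum>k<b. f (Y i k) * g (B k j))"
      if "i < a" "j < b" for i j
      using Y that fg unfolding extension_def by auto
    show "convl C f g (block b A B Y i j) = (\<Sum>k<b + a. f (block b A B Y i k) * g (block b A B Y k j))"
      unfolding sum_lessThan_add using ij
      by (auto simp: block_def fg0 cA cB cY)
  qed
qed

text \<open>By the comatrix identities \<Delta> of an entry is a sum of tensors of entries of the
  same matrix. In the last application R collects all adapted matrices of bounded length.\<close>

lemma subcoalgebra_of_matrices:
  fixes C :: "('k::field, 'c::ab_group_add) coalg"
  assumes C: "coalgebra C" and X: "\<And>r. r \<in> R \<Longrightarrow> matrix_coalg C (I r) (X r)" "\<And>r. r \<in> R \<Longrightarrow> finite (I r)"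
    and G: "G = (\<Union>r\<in>R. \<Union>i\<in>I r. \<Union>j\<in>I r. {X r i j})"
  shows "\<exists>H. subcoalgebra H C \<and> cspace H = module.span (cscale C) G"
proof (rule subcoalgebra_span[OF C])
  note c = coalgebra_basic[OF C]
  interpret V: vector_space "cscale C" by (rule c(1))
  show "G \<subseteq> cspace C" using X(1) unfolding G matrix_coalg_def by blast
  fix x assume "x \<in> G"
  then obtain r i j where ij: "r \<in> R" "i \<in> I r" "j \<in> I r" "x = X r i j" unfolding G by blast
  let ?t = "\<Sum>k\<in>I r. Poly_Mapping.single (X r i k, X r k j) (1::'k)"
  have "?t \<in> {t. Poly_Mapping.keys t \<subseteq> V.span G \<times> V.span G}"
  proof (rule fs.subspace_sum[OF subspace_keys])
    fix k assume "k \<in> I r"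
    then have "X r i k \<in> G" "X r k j \<in> G" using ij unfolding G by blast+
    then show "Poly_Mapping.single (X r i k, X r k j) 1 \<in> {t. Poly_Mapping.keys t \<subseteq> V.span G \<times> V.span G}"
      using V.span_base by auto
  qed
  moreover have "ev f g ?t = convl C f g x" if "lfun (cscale C) f" "lfun (cscale C) g" for f g
    using X(1)[OF ij(1)] ij that unfolding matrix_coalg_def by (simp add: ev_sum ev_single)
  ultimately show "\<exists>t. Poly_Mapping.keys t \<subseteq> V.span G \<times> V.span G \<and>
      (\<forall>f g. lfun (cscale C) f \<longrightarrow> lfun (cscale C) g \<longrightarrow> ev f g t = convl C f g x)" by blast
qed

lemma matrix_of_zero:
  assumes "coalgebra C" "comodule C M" "basis_fam (mscale M) I e (mspace M)" "matrix_of C M I e X"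
    "lin_on (cscale C) (*) (cspace C) f" "\<And>i j. i \<in> I \<Longrightarrow> j \<in> I \<Longrightarrow> f (X i j) = 0" "m \<in> mspace M"
  shows "cact M f m = 0"
proof -
  note b = comodule_basic[OF assms(2)]
  interpret M: vector_space "mscale M" by (rule b(1))
  obtain c where c: "m = (\<Sum>i\<in>I. mscale M (c i) (e i))" using assms(3,7) unfolding basis_fam_def by blast
  have e: "e i \<in> mspace M" if "i \<in> I" for i using assms(3) that unfolding basis_fam_def by blast
  have "cact M f (e i) = 0" if "i \<in> I" for i
    using assms(4,5,6) that unfolding matrix_of_def by simp
  then show ?thesis unfolding c using cact_lincomb[OF assms(1,2,5), of I e c] e by simp
qed

lemma matrix_supported_on:
  assumes C: "coalgebra C" and H: "subcoalgebra H C" and M: "comodule C M"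
    and b: "basis_fam (mscale M) I e (mspace M)" and X: "matrix_of C M I e X"
    and XH: "\<And>i j. i \<in> I \<Longrightarrow> j \<in> I \<Longrightarrow> X i j \<in> cspace H"
  shows "supported_on H M"
  unfolding supported_on_def subcoalgebra_basic(3)[OF H]
proof (intro allI impI ballI)
  fix \<phi> m assume \<phi>: "lfun (cscale C) \<phi>" "\<forall>h\<in>cspace H. \<phi> h = 0" and m: "m \<in> mspace M"
  have "lin_on (cscale C) (*) (cspace C) \<phi>" by (rule lin_on_subset[OF \<phi>(1)]) simp
  then show "cact M \<phi> m = 0" by (rule matrix_of_zero[OF C M b X _ _ m]) (use \<phi> XH in auto)
qed

lemma matrix_of_conv:
  assumes C: "coalgebra C" and H: "subcoalgebra H C" and M: "comodule C M" "supported_on H M"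
    and b: "basis_fam (mscale M) I e (mspace M)" and X: "matrix_of C M I e X"
    and XH: "\<And>i j. i \<in> I \<Longrightarrow> j \<in> I \<Longrightarrow> X i j \<in> cspace H"
  shows "matrix_of H (conv H M) I e X" "basis_fam (mscale (conv H M)) I e (mspace (conv H M))"
proof -
  note h = subcoalgebra_basic[OF H]
  note cv = conv[OF C H M]
  have sp: "mspace (conv H M) = mspace M" "mscale (conv H M) = mscale M" using cv(2) by (simp_all add: same_def)
  show "basis_fam (mscale (conv H M)) I e (mspace (conv H M))" using b sp by simp
  show "matrix_of H (conv H M) I e X"
    unfolding matrix_of_def
  proof (intro conjI ballI allI impI XH)
    fix f i assume f: "lin_on (cscale H) (*) (cspace H) f" and i: "i \<in> I"
    have ei: "e i \<in> mspace M" using b i unfolding basis_fam_def by blast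
    obtain f' where f': "lfun (cscale H) f'" "\<forall>x\<in>cspace H. f' x = f x"
      using lin_on_extend[OF coalgebra_basic(1,3)[OF h(1)] f] by blast
    have f'': "lin_on (cscale C) (*) (cspace C) f'" using f'(1) unfolding h(3) by (rule lin_on_subset) simp
    have "cact (conv H M) f (e i) = cact (conv H M) f' (e i)"
      by (rule cact_cong[OF cv(1)]) (use ei sp f' in auto)
    also have "\<dots> = cact M f' (e i)" using cv(2) f'(1) ei by (simp add: same_def)
    also have "\<dots> = (\<Sum>j\<in>I. mscale M (f' (X i j)) (e j))" using X f'' i unfolding matrix_of_def by blast
    also have "\<dots> = (\<Sum>j\<in>I. mscale (conv H M) (f (X i j)) (e j))"
      unfolding sp by (rule sum.cong) (use f' XH[OF i] in auto)
    finally show "cact (conv H M) f (e i) = (\<Sum>j\<in>I. mscale (conv H M) (f (X i j)) (e j))" .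
  qed
qed

text \<open>If both summands of a decomposition were nonzero, one of them would meet the simple subcomodule
  \<open>N\<close> trivially and hence be a complement of it; then \<open>\<phi>\<close> would annihilate \<open>M\<close>.\<close>

lemma nonsplit_indecomposable:
  assumes C: "coalgebra C" and M: "comodule C M" and N: "invariant (cscale C) M N" "N \<noteq> {0}"
    and s1: "\<And>U. invariant (cscale C) M U \<Longrightarrow> U \<subseteq> N \<Longrightarrow> U = {0} \<or> U = N"
    and s2: "\<And>U. invariant (cscale C) M U \<Longrightarrow> N \<subseteq> U \<Longrightarrow> U = N \<or> U = mspace M"
    and \<phi>: "lfun (cscale C) \<phi>" "\<And>n. n \<in> N \<Longrightarrow> cact M \<phi> n = 0" "\<And>x. x \<in> mspace M \<Longrightarrow> cact M \<phi> x \<in> N"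
      "x0 \<in> mspace M" "cact M \<phi> x0 \<noteq> 0"
  shows "indecomposable_comodule C M"
proof -
  note m = comodule_basic[OF M]
  interpret M: vector_space "mscale M" by (rule m(1))
  have sub: "lin_on (cscale C) (*) (cspace C) f" if "lfun (cscale C) f" for f
    by (rule lin_on_subset[OF that]) simp
  note lin = lin_on_cact[OF C M sub]
  have NM: "N \<subseteq> mspace M" "M.subspace N" using N(1) by (simp_all add: invariant_def)
  have key: "U = {0}" if U: "invariant (cscale C) M U" "U \<inter> N = {0}" for U
  proof (rule ccontr)
    assume U0: "U \<noteq> {0}"
    have UM: "U \<subseteq> mspace M" "M.subspace U" using U(1) by (simp_all add: invariant_def)
    let ?W = "{u + n | u n. u \<in> U \<and> n \<in> N}"
    have UW: "U \<subseteq> ?W"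
    proof
      fix u assume "u \<in> U"
      then have "u + 0 \<in> ?W" using M.subspace_0[OF NM(2)] by blast
      then show "u \<in> ?W" by simp
    qed
    have NW: "N \<subseteq> ?W"
    proof
      fix n assume "n \<in> N"
      then have "0 + n \<in> ?W" using M.subspace_0[OF UM(2)] by blast
      then show "n \<in> ?W" by simp
    qed
    have "invariant (cscale C) M ?W"
      unfolding invariant_def
    proof (intro conjI allI impI ballI)
      show "M.subspace ?W" using M.subspace_sums[OF UM(2) NM(2)] .
      show "?W \<subseteq> mspace M" using UM(1) NM(1) by (auto intro!: M.subspace_add[OF m(3)])
      fix f x assume f: "lfun (cscale C) f" and "x \<in> ?W"
      then obtain u n where un: "u \<in> U" "n \<in> N" "x = u + n" by blast
      have "cact M f x = cact M f u + cact M f n"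
        unfolding un(3) by (rule lin_on_add[OF lin[OF f]]) (use un UM NM in auto)
      moreover have "cact M f u \<in> U" "cact M f n \<in> N" using U(1) N(1) f un unfolding invariant_def by auto
      ultimately show "cact M f x \<in> ?W" by blast
    qed
    from s2[OF this NW] have "?W = mspace M"
    proof
      assume "?W = N"
      then have "U = U \<inter> N" using UW by blast
      then show ?thesis using U0 U(2) by simp
    qed
    then obtain u n where un: "u \<in> U" "n \<in> N" "x0 = u + n" using \<phi>(4) by blast
    \<comment> \<open>\<phi> sends u into U and into N, hence to zero, and it kills n; so it kills
      x0.\<close>
    have "cact M \<phi> u \<in> U" using U(1) \<phi>(1) un(1) unfolding invariant_def by blast
    moreover have "cact M \<phi> u \<in> N" using \<phi>(3) subsetD[OF UM(1) un(1)] by simp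
    ultimately have "cact M \<phi> u = 0" using U(2) by blast
    moreover have "cact M \<phi> x0 = cact M \<phi> u + cact M \<phi> n"
      unfolding un(3) by (rule lin_on_add[OF lin[OF \<phi>(1)]]) (use un UM NM in auto)
    ultimately show False using \<phi>(2)[OF un(2)] \<phi>(5) by simp
  qed
  have cap: "invariant (cscale C) M (U \<inter> N)" if "invariant (cscale C) M U" for U
    using that N(1) M.subspace_inter[of U N] unfolding invariant_def by (simp add: le_infI1)
  have M0: "mspace M \<noteq> {0}" using NM(1) N(2) M.subspace_0[OF NM(2)] by (metis empty_iff subset_singletonD)
  show ?thesis
    unfolding indecomposable_iff[OF C M]
  proof (intro conjI M0 allI impI; elim conjE)
    fix U U' assume U: "invariant (cscale C) M U" "invariant (cscale C) M U'" "U \<inter> U' = {0}"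
    show "U = {0} \<or> U' = {0}"
    proof (cases "U \<inter> N = {0}")
      case True
      then show ?thesis using key[OF U(1)] by blast
    next
      case False
      \<comment> \<open>A summand that meets N nontrivially contains it, and then the other summand
        meets N trivially.\<close>
      then have "N \<subseteq> U" using s1[OF cap[OF U(1)]] by blast
      then have "U' \<inter> N \<subseteq> {0}" using U(3) by blast
      moreover have "0 \<in> U' \<inter> N" using cap[OF U(2)] M.subspace_0[of "U' \<inter> N"] unfolding invariant_def by simp
      ultimately show ?thesis using key[OF U(2)] by blast
    qed
  qed
qed

lemma invariant_image:
  assumes "invariant s M U" "lin_on (mscale M) (mscale S) V p" "U \<subseteq> V" "module (mscale M)" "module (mscale S)"
    "p ` V \<subseteq> mspace S" "\<And>f x. lfun s f \<Longrightarrow> x \<in> V \<Longrightarrow> p (cact M f x) = cact S f (p x)"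
  shows "invariant s S (p ` U)"
proof -
  interpret M: module "mscale M" by fact
  interpret S: module "mscale S" by fact
  have U: "M.subspace U" "\<And>f x. lfun s f \<Longrightarrow> x \<in> U \<Longrightarrow> cact M f x \<in> U"
    using assms(1) unfolding invariant_def by auto
  have p: "\<And>x y. x \<in> U \<Longrightarrow> y \<in> U \<Longrightarrow> p x + p y = p (x + y)" "\<And>r x. x \<in> U \<Longrightarrow> mscale S r (p x) = p (mscale M r x)"
    using assms(2,3) by (auto simp: lin_on_def subset_eq)
  have p0: "p 0 = 0"
    by (rule lin_on_0[OF lin_on_subset[OF assms(2,3)] assms(4,5) M.subspace_0[OF U(1)]])
  have "S.subspace (p ` U)"
  proof (rule S.subspaceI)
    show "0 \<in> p ` U" using p0 M.subspace_0[OF U(1)] by (metis imageI)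
  qed (auto simp: p intro!: imageI M.subspace_add[OF U(1)] M.subspace_scale[OF U(1)])
  moreover have "cact S f y \<in> p ` U" if f: "lfun s f" and y: "y \<in> p ` U" for f y
  proof -
    obtain x where x: "x \<in> U" "y = p x" using y by blast
    then have "cact S f y = p (cact M f x)" using assms(3,7) f by auto
    then show ?thesis using U(2)[OF f x(1)] by blast
  qed
  ultimately show ?thesis using assms(3,6) unfolding invariant_def by blast
qed

text \<open>The multiplicities depend on the list of factors alone, so all extensions of the same
  two simple comodules share one vector, to which tameness can be applied.\<close>

lemma ex_dim_vector:
  assumes C: "coalgebra C" and Ss: "\<And>S. S \<in> set Ss \<Longrightarrow> simple_comodule C S"
  shows "\<exists>v. Poly_Mapping.keys v \<subseteq> simple_types C \<and>
    (\<forall>M Ms. jordan_hoelder_series C M Ms Ss \<longrightarrow> has_dim_vector C M v)"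
proof -
  let ?f = "\<lambda>i. if i \<in> simple_types C then card {k. k < length Ss \<and> Ss ! k \<in> i} else 0"
  have "{i. ?f i \<noteq> 0} \<subseteq> iso_class C ` set Ss"
  proof
    fix i assume "i \<in> {i. ?f i \<noteq> 0}"
    then have i: "i \<in> simple_types C" and "\<exists>k<length Ss. Ss ! k \<in> i"
      by (auto split: if_splits simp: card_gt_0_iff)
    then obtain k where k: "k < length Ss" "Ss ! k \<in> i" by blast
    obtain S where S: "simple_comodule C S" "i = iso_class C S" using i unfolding simple_types_def by blast
    have cS: "comodule C S" using S(1) by (simp add: simple_comodule_def)
    have "i = iso_class C (Ss ! k)" using iso_class_memD(2)[OF C cS] k(2) S(2) by simp
    then show "i \<in> iso_class C ` set Ss" using k(1) by simp
  qed
  then have fin: "finite {i. ?f i \<noteq> 0}" by (rule finite_subset) simp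
  let ?v = "Abs_poly_mapping ?f"
  have l: "Poly_Mapping.lookup ?v = ?f" using fin by (simp add: lookup_Abs_poly_mapping)
  have "Poly_Mapping.keys ?v \<subseteq> simple_types C" by (auto simp: in_keys_iff l split: if_splits)
  then show ?thesis unfolding has_dim_vector_def using l by (intro exI[of _ ?v]) auto
qed

text \<open>Reads the coordinates from position r on in the basis e. With r = 0 it identifies the
  subcomodule of an extension with S', with r = b it is the projection onto S.\<close>

definition coord_map :: "('k::field \<Rightarrow> 'a::ab_group_add \<Rightarrow> 'a) \<Rightarrow> nat \<Rightarrow> (nat \<Rightarrow> 'a) \<Rightarrow> nat \<Rightarrow> (nat \<Rightarrow>\<^sub>0 'k) \<Rightarrow> 'a" where
  "coord_map s n e r v = (\<Sum>i<n. s (Poly_Mapping.lookup v (r + i)) (e i))"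

lemma lin_on_coord_map:
  assumes "module s"
  shows "lin_on fs_scale s T (coord_map s n e r)"
proof -
  interpret module s by fact
  show ?thesis
    unfolding lin_on_def coord_map_def
    by (simp add: lookup_add lookup_fs_scale scale_left_distrib sum.distrib scale_sum_right)
qed

lemma coord_map_eq_0:
  assumes "module s" "basis_fam s {..<n} e V"
  shows "coord_map s n e r v = 0 \<longleftrightarrow> (\<forall>i<n. Poly_Mapping.lookup v (r + i) = 0)"
proof -
  interpret module s by fact
  show ?thesis using assms(2) unfolding coord_map_def basis_fam_def by auto
qed

lemma coord_map_image:
  assumes "module s" "module.subspace s V" "basis_fam s {..<n} e V" "\<And>i. i < n \<Longrightarrow> r + i \<in> J"
  shows "coord_map s n e r ` std_space J = V"
proof -
  interpret module s by fact
  show ?thesis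
  proof
    show "coord_map s n e r ` std_space J \<subseteq> V"
      using assms(3) unfolding coord_map_def basis_fam_def
      by (auto intro!: subspace_sum[OF assms(2)] subspace_scale[OF assms(2)])
    show "V \<subseteq> coord_map s n e r ` std_space J"
    proof
      fix x assume "x \<in> V"
      then obtain c where c: "x = (\<Sum>i<n. s (c i) (e i))" using assms(3) unfolding basis_fam_def by blast
      define v where "v = (\<Sum>i<n. Poly_Mapping.single (r + i) (c i))"
      have "v \<in> std_space J"
        unfolding v_def by (rule fs.subspace_sum[OF std_space_subspace]) (use assms(4) in \<open>auto simp: std_space_def\<close>)
      moreover have "Poly_Mapping.lookup v (r + i) = c i" if "i < n" for i
        using that by (simp add: v_def lookup_sum lookup_single when_def sum.If_cases cong: if_cong)
      ultimately show "x \<in> coord_map s n e r ` std_space J"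
        unfolding c by (intro image_eqI[of _ _ v]) (simp_all add: coord_map_def)
    qed
  qed
qed

text \<open>Correspondence of invariant subspaces above the kernel with those of the simple image.
  It is applied with zero kernel to the subcomodule of an extension and with the subcomodule as
  kernel to the whole extension.\<close>

lemma simple_injective_preimage:
  assumes C: "coalgebra C" and M: "comodule C M" and S: "simple_comodule C S"
    and V: "invariant (cscale C) M V" and p: "lin_on (mscale M) (mscale S) V p" "p ` V = mspace S"
      "\<And>f x. lfun (cscale C) f \<Longrightarrow> x \<in> V \<Longrightarrow> p (cact M f x) = cact S f (p x)"
    and U: "invariant (cscale C) M U" "U \<subseteq> V" "{x \<in> V. p x = 0} \<subseteq> U"
  shows "U = {x \<in> V. p x = 0} \<or> U = V"
proof -
  have cS: "comodule C S" using S by (simp add: simple_comodule_def)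
  note m = comodule_basic[OF M] and s = comodule_basic[OF cS]
  interpret M: vector_space "mscale M" by (rule m(1))
  have sV: "M.subspace V" and sU: "M.subspace U" using V U(1) by (simp_all add: invariant_def)
  have "invariant (cscale C) S (p ` U)"
    by (rule invariant_image[OF U(1) p(1) U(2) m(2) s(2)]) (use p(2,3) in auto)
  then consider "p ` U = {0}" | "p ` U = mspace S" using S unfolding simple_iff[OF C cS] by blast
  then show ?thesis
  proof cases
    case 1
    then have "U \<subseteq> {x \<in> V. p x = 0}" using U(2) by auto
    then show ?thesis using U(3) by blast
  next
    case 2
    have "V \<subseteq> U"
    proof
      fix x assume x: "x \<in> V"
      then obtain u where u: "u \<in> U" "p x = p u" using 2 p(2) by (metis imageE imageI)
      have "p (x - u) = 0"
        using lin_on_diff[OF p(1) m(2) s(2) sV x] u U(2) by auto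
      then have "x - u \<in> U" using U(2,3) M.subspace_diff[OF sV x] u(1) by blast
      then have "(x - u) + u \<in> U" using M.subspace_add[OF sU] u(1) by blast
      then show "x \<in> U" by simp
    qed
    then show ?thesis using U(2) by blast
  qed
qed

text \<open>In the application \<open>C\<close> is a finite dimensional subcoalgebra, S and S' are
  conversions to it, and Y is a varying combination of fixed extensions.\<close>

locale extension_data =
  fixes C :: "('k::field, 'c::ab_group_add) coalg" and S S' :: "('k, 'c) std_comod"
    and a b :: nat and e e' :: "nat \<Rightarrow> (nat \<Rightarrow>\<^sub>0 'k)" and A B Y :: "nat \<Rightarrow> nat \<Rightarrow> 'c"
  assumes C: "coalgebra C" and S: "simple_comodule C S" and S': "simple_comodule C S'"
    and e: "basis_fam (mscale S) {..<a} e (mspace S)" and e': "basis_fam (mscale S') {..<b} e' (mspace S')"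
    and A: "matrix_of C S {..<a} e A" and B: "matrix_of C S' {..<b} e' B"
    and Y: "extension C a A b B Y"
begin

abbreviation "M \<equiv> mat_comod (b + a) (block b A B Y) :: ('k, 'c) std_comod"
abbreviation "p \<equiv> coord_map (mscale S') b e' 0"
abbreviation "q \<equiv> coord_map (mscale S) a e b"

lemma comodS: "comodule C S" "comodule C S'"
  using S S' by (simp_all add: simple_comodule_def)

lemma comodM: "comodule C M"
  by (rule mat_comod_comodule[OF C block_coalg[OF C matrix_of_coalg[OF C comodS(1) e A]
          matrix_of_coalg[OF C comodS(2) e' B] Y]])

lemma lfun_0: "lfun (cscale C) f \<Longrightarrow> f 0 = 0"
  using lin_on_0[of "cscale C" "(*)" UNIV f] coalgebra_basic(2)[OF C] module_times by blast

lemma lfun_lin: "lfun (cscale C) f \<Longrightarrow> lin_on (cscale C) (*) (cspace C) f"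
  by (rule lin_on_subset) auto

lemma p_cact:
  assumes f: "lfun (cscale C) f" and v: "v \<in> std_space {..<b}"
  shows "p (cact M f v) = cact S' f (p v)"
proof -
  note s = comodule_basic[OF comodS(2)]
  interpret S': vector_space "mscale S'" by (rule s(1))
  have eM: "e' i \<in> mspace S'" if "i < b" for i using e' that unfolding basis_fam_def by auto
  have l: "Poly_Mapping.lookup (cact M f v) i = (\<Sum>j<b. Poly_Mapping.lookup v j * f (B j i))" if "i < b" for i
    using that lookup_std[OF v] by (simp add: cact_mat_comod sum_lessThan_add block_def)
  have "cact S' f (p v) = (\<Sum>j<b. mscale S' (Poly_Mapping.lookup v j) (cact S' f (e' j)))"
    unfolding coord_map_def using cact_lincomb[OF C comodS(2) lfun_lin[OF f], of "{..<b}" e'] eM by simp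
  also have "\<dots> = (\<Sum>j<b. \<Sum>i<b. mscale S' (Poly_Mapping.lookup v j * f (B j i)) (e' i))"
    using B lfun_lin[OF f] unfolding matrix_of_def by (simp add: S'.scale_sum_right)
  also have "\<dots> = (\<Sum>i<b. mscale S' (\<Sum>j<b. Poly_Mapping.lookup v j * f (B j i)) (e' i))"
    by (subst sum.swap) (simp add: S'.scale_sum_left)
  also have "\<dots> = p (cact M f v)" unfolding coord_map_def using l by simp
  finally show ?thesis by simp
qed

lemma q_cact:
  assumes f: "lfun (cscale C) f"
  shows "q (cact M f v) = cact S f (q v)"
proof -
  note s = comodule_basic[OF comodS(1)]
  interpret S: vector_space "mscale S" by (rule s(1))
  have eM: "e i \<in> mspace S" if "i < a" for i using e that unfolding basis_fam_def by auto
  have l: "Poly_Mapping.lookup (cact M f v) (b + i) = (\<Sum>j<a. Poly_Mapping.lookup v (b + j) * f (A j i))" if "i < a" for i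
    using that lfun_0[OF f] by (simp add: cact_mat_comod sum_lessThan_add block_def)
  have "cact S f (q v) = (\<Sum>j<a. mscale S (Poly_Mapping.lookup v (b + j)) (cact S f (e j)))"
    unfolding coord_map_def using cact_lincomb[OF C comodS(1) lfun_lin[OF f], of "{..<a}" e] eM by simp
  also have "\<dots> = (\<Sum>j<a. \<Sum>i<a. mscale S (Poly_Mapping.lookup v (b + j) * f (A j i)) (e i))"
    using A lfun_lin[OF f] unfolding matrix_of_def by (simp add: S.scale_sum_right)
  also have "\<dots> = (\<Sum>i<a. mscale S (\<Sum>j<a. Poly_Mapping.lookup v (b + j) * f (A j i)) (e i))"
    by (subst sum.swap) (simp add: S.scale_sum_left)
  also have "\<dots> = q (cact M f v)" unfolding coord_map_def using l by simp
  finally show ?thesis by simp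
qed

lemma p_zero: "v \<in> std_space {..<b} \<Longrightarrow> p v = 0 \<longleftrightarrow> v = 0"
  unfolding coord_map_eq_0[OF comodule_basic(2)[OF comodS(2)] e']
  using lookup_std[of v "{..<b}"] by (auto intro!: poly_mapping_eqI) metis

lemma p_image: "p ` std_space {..<b} = mspace S'"
  using coord_map_image[OF comodule_basic(2,3)[OF comodS(2)] e'] by simp

lemma q_image: "q ` std_space {..<b + a} = mspace S"
  using coord_map_image[OF comodule_basic(2,3)[OF comodS(1)] e] by simp

lemma q_kernel: "{v \<in> std_space {..<b + a}. q v = 0} = std_space {..<b}"
proof (intro set_eqI iffI)
  fix v :: "nat \<Rightarrow>\<^sub>0 'k" assume "v \<in> {v \<in> std_space {..<b + a}. q v = 0}"
  then have v: "v \<in> std_space {..<b + a}" "\<And>i. i < a \<Longrightarrow> Poly_Mapping.lookup v (b + i) = 0"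
    using coord_map_eq_0[OF comodule_basic(2)[OF comodS(1)] e] by auto
  have "i < b" if "i \<in> Poly_Mapping.keys v" for i
  proof (rule ccontr)
    assume "\<not> i < b"
    then have "i = b + (i - b)" by simp
    moreover have "i - b < a" using v(1) that \<open>\<not> i < b\<close> by (auto simp: std_space_def)
    ultimately have "Poly_Mapping.lookup v i = 0" using v(2) by metis
    then show False using that by (simp add: in_keys_iff)
  qed
  then show "v \<in> std_space {..<b}" by (auto simp: std_space_def)
next
  fix v :: "nat \<Rightarrow>\<^sub>0 'k" assume v: "v \<in> std_space {..<b}"
  then have "v \<in> std_space {..<b + a}" by (auto simp: std_space_def)
  moreover have "q v = 0"
    using coord_map_eq_0[OF comodule_basic(2)[OF comodS(1)] e] lookup_std[OF v] by auto
  ultimately show "v \<in> {v \<in> std_space {..<b + a}. q v = 0}" by blast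
qed

lemma zero_in_std: "0 \<in> std_space I"
  by (simp add: std_space_def)

lemma sub_invariant: "invariant (cscale C) M (std_space {..<b})" "invariant (cscale C) M {0}"
proof -
  have "cact M f v \<in> std_space {..<b}" if f: "lfun (cscale C) f" and v: "v \<in> std_space {..<b}" for f v
  proof -
    have "q v = 0" using v q_kernel by blast
    then have "q (cact M f v) = cact S f 0" using q_cact[OF f] by simp
    also have "\<dots> = 0"
      by (rule lin_on_0[OF lin_on_cact[OF C comodS(1) lfun_lin[OF f]]])
        (use comodule_basic[OF comodS(1)] module.subspace_0 in blast)+
    finally show ?thesis using q_kernel cact_mat_comod_in by blast
  qed
  then show "invariant (cscale C) M (std_space {..<b})"
    unfolding invariant_def mat_comod_simps using std_space_subspace by (auto simp: std_space_def)
  have "cact M f 0 = 0" for f by (rule poly_mapping_eqI) (simp add: cact_mat_comod)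
  then show "invariant (cscale C) M {0}"
    unfolding invariant_def mat_comod_simps using zero_in_std fs.subspace_single_0 by simp
qed

lemma jordan_hoelder: "\<exists>Ms. jordan_hoelder_series C M Ms [S', S]"
proof -
  obtain N where N: "subcomodule C N M" "mspace N = std_space {..<b}"
    using invariant_subcomodule[OF C comodM sub_invariant(1)] by blast
  obtain Z where Z: "subcomodule C Z M" "mspace Z = {0}"
    using invariant_subcomodule[OF C comodM sub_invariant(2)] by blast
  have N': "comodule C N" "mscale N = fs_scale" "\<And>f x. lfun (cscale C) f \<Longrightarrow> x \<in> std_space {..<b} \<Longrightarrow> cact N f x = cact M f x"
    using N unfolding subcomodule_iff[OF C comodM] mat_comod_simps by auto
  have Z': "comodule C Z" "mscale Z = fs_scale" "\<And>f x. lfun (cscale C) f \<Longrightarrow> x = 0 \<Longrightarrow> cact Z f x = cact M f x"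
    using Z unfolding subcomodule_iff[OF C comodM] mat_comod_simps by auto
  note lp = lin_on_coord_map[OF comodule_basic(2)[OF comodS(2)]]
  note lq = lin_on_coord_map[OF comodule_basic(2)[OF comodS(1)]]
  have "quotient_iso C N Z S'"
    unfolding quotient_iso_iff[OF C N'(1) Z'(1) comodS(2)] N(2) Z(2) N'(2) Z'(2)
  proof (intro conjI exI[of _ p] allI impI ballI lp p_image)
    show "{0} \<subseteq> std_space {..<b}" using zero_in_std by simp
    show "cact Z f x = cact N f x" if "lfun (cscale C) f" "x \<in> {0}" for f x
      using that Z'(3) N'(3)[OF _ zero_in_std] by simp
    show "p (cact N f x) = cact S' f (p x)" if "lfun (cscale C) f" "x \<in> std_space {..<b}" for f x
      using that N'(3) p_cact by simp
    show "{x \<in> std_space {..<b}. p x = 0} = {0}" using p_zero zero_in_std by blast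
  qed simp
  moreover have "quotient_iso C M N S"
    unfolding quotient_iso_iff[OF C comodM N'(1) comodS(1)] N(2) N'(2) mat_comod_simps(1,2)
  proof (intro conjI exI[of _ q] allI impI ballI lq q_image q_kernel)
    show "std_space {..<b} \<subseteq> std_space {..<b + a}" by (auto simp: std_space_def)
  qed (simp_all add: N'(3) q_cact)
  ultimately have "jordan_hoelder_series C M [Z, N, M] [S', S]"
    unfolding jordan_hoelder_series_def using Z(2) S S' by (auto simp: less_Suc_eq nth_Cons')
  then show ?thesis by blast
qed

text \<open>The functionals annihilating M determine the span of the matrix entries. Isomorphic
  extensions therefore have the same coefficient space, of dimension at most (a + b)^2.\<close>

lemma cact_zero_iff:
  assumes f: "lfun (cscale C) f"
  shows "(\<forall>m\<in>mspace M. cact M f m = 0) \<longleftrightarrow> (\<forall>i<b + a. \<forall>j<b + a. f (block b A B Y i j) = 0)"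
proof
  assume *: "\<forall>m\<in>mspace M. cact M f m = 0"
  show "\<forall>i<b + a. \<forall>j<b + a. f (block b A B Y i j) = 0"
  proof (intro allI impI)
    fix i j assume ij: "i < b + a" "j < b + a"
    have "Poly_Mapping.single i 1 \<in> mspace M" using ij by (simp add: mat_comod_simps std_space_def)
    then have "Poly_Mapping.lookup (cact M f (Poly_Mapping.single i 1)) j = 0" using * by simp
    then show "f (block b A B Y i j) = 0"
      using ij by (simp add: cact_mat_comod lookup_single when_def if_distrib[of "\<lambda>x. x * _"] sum.If_cases cong: if_cong)
  qed
next
  assume "\<forall>i<b + a. \<forall>j<b + a. f (block b A B Y i j) = 0"
  then show "\<forall>m\<in>mspace M. cact M f m = 0"
    by (auto intro!: poly_mapping_eqI simp: cact_mat_comod)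
qed

lemma cact_zero_iff':
  assumes f: "lfun (cscale C) f" and "\<And>i j. i < a \<Longrightarrow> j < a \<Longrightarrow> f (A i j) = 0" "\<And>i j. i < b \<Longrightarrow> j < b \<Longrightarrow> f (B i j) = 0"
  shows "(\<forall>m\<in>mspace M. cact M f m = 0) \<longleftrightarrow> (\<forall>i<a. \<forall>j<b. f (Y i j) = 0)"
proof -
  have 1: "f (block b A B Y (b + i) j) = f (Y i j)" if "j < b" for i j
    using that by (simp add: block_def)
  have "f (block b A B Y i j) = 0" if Y0: "\<forall>i<a. \<forall>j<b. f (Y i j) = 0" and ij: "i < b + a" "j < b + a" for i j
    using ij assms(2,3) Y0 lfun_0[OF f] by (simp add: block_def)
  moreover have "f (Y i j) = 0" if "\<forall>i<b + a. \<forall>j<b + a. f (block b A B Y i j) = 0" "i < a" "j < b" for i j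
    using that(1)[rule_format, of "b + i" j] that(2,3) 1 by simp
  ultimately show ?thesis unfolding cact_zero_iff[OF f] by blast
qed

lemma fin_dim: "fin_dim (mscale M) (mspace M)"
  unfolding mat_comod_simps
  by (rule basis_fam_fin_dim[OF basis_fam_std fs.module_axioms std_space_subspace])

text \<open>The functional f is zero on the subcomodule and on the quotient but not on the
  extension; this certifies that the extension does not split.\<close>

lemma indecomposable:
  assumes f: "lfun (cscale C) f" "\<And>i j. i < a \<Longrightarrow> j < a \<Longrightarrow> f (A i j) = 0" "\<And>i j. i < b \<Longrightarrow> j < b \<Longrightarrow> f (B i j) = 0"
    and Yf: "i < a" "j < b" "f (Y i j) \<noteq> 0"
  shows "indecomposable_comodule C M"
proof -
  note s = comodule_basic[OF comodS(1)] and s' = comodule_basic[OF comodS(2)]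
  have S0: "cact S f y = 0" if "y \<in> mspace S" for y
    by (rule matrix_of_zero[OF C comodS(1) e A lfun_lin[OF f(1)] _ that]) (use f(2) in auto)
  have S'0: "cact S' f y = 0" if "y \<in> mspace S'" for y
    by (rule matrix_of_zero[OF C comodS(2) e' B lfun_lin[OF f(1)] _ that]) (use f(3) in auto)
  obtain x0 where x0: "x0 \<in> mspace M" "cact M f x0 \<noteq> 0"
    using cact_zero_iff'[OF f] Yf by auto
  note lp = lin_on_coord_map[OF s'(2)] and lq = lin_on_coord_map[OF s(2)]
  show ?thesis
  proof (rule nonsplit_indecomposable[OF C comodM sub_invariant(1) _ _ _ f(1) _ _ x0])
    show "std_space {..<b} \<noteq> {0 :: nat \<Rightarrow>\<^sub>0 'k}"
    proof
      assume "std_space {..<b} = {0 :: nat \<Rightarrow>\<^sub>0 'k}"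
      then have "mspace S' = {p 0}" unfolding p_image[symmetric] by simp
      also have "p 0 = 0" using p_zero[OF zero_in_std] by simp
      finally show False using S' by (simp add: simple_comodule_def)
    qed
  next
    fix U assume U: "invariant (cscale C) M U" "U \<subseteq> std_space {..<b}"
    have k: "{x \<in> std_space {..<b}. p x = 0} = {0}" using p_zero zero_in_std by blast
    have "0 \<in> U" using U(1) fs.subspace_0[of U] unfolding invariant_def mat_comod_simps by simp
    then have kU: "{x \<in> std_space {..<b}. p x = 0} \<subseteq> U" unfolding k by simp
    have lpM: "lin_on (mscale M) (mscale S') (std_space {..<b}) p" unfolding mat_comod_simps by (rule lp)
    have "U = {x \<in> std_space {..<b}. p x = 0} \<or> U = std_space {..<b}"
      by (rule simple_injective_preimage[OF C comodM S' sub_invariant(1) lpM p_image p_cact U kU])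
    then show "U = {0} \<or> U = std_space {..<b}" unfolding k .
  next
    fix U assume U: "invariant (cscale C) M U" "std_space {..<b} \<subseteq> U"
    have "invariant (cscale C) M (mspace M)" by (rule invariant_mspace[OF comodM])
    moreover have "U \<subseteq> mspace M" using U(1) by (simp add: invariant_def)
    moreover have "{x \<in> mspace M. q x = 0} \<subseteq> U" "q ` mspace M = mspace S"
      using q_kernel q_image U(2) by (simp_all add: mat_comod_simps)
    moreover have "lin_on (mscale M) (mscale S) (mspace M) q" unfolding mat_comod_simps by (rule lq)
    ultimately have "U = {x \<in> mspace M. q x = 0} \<or> U = mspace M"
      using simple_injective_preimage[OF C comodM S _ _ _ q_cact U(1)] by blast
    then show "U = std_space {..<b} \<or> U = mspace M" using q_kernel by (simp add: mat_comod_simps)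
  next
    fix n :: "nat \<Rightarrow>\<^sub>0 'k" assume n: "n \<in> std_space {..<b}"
    have "cact M f n \<in> std_space {..<b}" using sub_invariant(1) f(1) n unfolding invariant_def by blast
    moreover have "p (cact M f n) = 0" using p_cact[OF f(1) n] S'0[of "p n"] imageI[OF n, of p] p_image by simp
    ultimately show "cact M f n = 0" using p_zero by blast
  next
    fix x assume x: "x \<in> mspace M"
    then have "q x \<in> mspace S" unfolding q_image[symmetric] mat_comod_simps by (rule imageI)
    then have "q (cact M f x) = 0" using q_cact[OF f(1)] S0 by simp
    then show "cact M f x \<in> std_space {..<b}" using q_kernel cact_mat_comod_in by blast
  qed
qed

end

section \<open>Parameter count for extensions of simple comodules\<close>

lemma block_relations:
  fixes s :: "nat \<Rightarrow> 'q \<Rightarrow> 'k::field"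
  assumes "finite Q" "card Q < N"
  shows "\<exists>\<gamma>. \<forall>j<M. (\<exists>r<M * N. \<gamma> j r \<noteq> 0 \<and> (\<forall>j'<M. j' \<noteq> j \<longrightarrow> \<gamma> j' r = 0)) \<and>
    (\<forall>q\<in>Q. (\<Sum>r<M * N. \<gamma> j r * s r q) = 0)"
proof -
  \<comment> \<open>The unknowns are cut into M groups of N consecutive ones, each with more
    unknowns than equations. Solutions from different groups have disjoint supports, which gives
    every solution a private index.\<close>
  have "\<exists>c. (\<exists>i\<in>{j * N..<j * N + N}. c i \<noteq> 0) \<and> (\<forall>q\<in>Q. (\<Sum>i\<in>{j * N..<j * N + N}. c i * s i q) = 0)" for j
    by (rule nontrivial_relation[OF assms(1)]) (use assms(2) in auto)
  then obtain c where c: "\<And>j. \<exists>i\<in>{j * N..<j * N + N}. c j i \<noteq> 0"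
    "\<And>j q. q \<in> Q \<Longrightarrow> (\<Sum>i\<in>{j * N..<j * N + N}. c j i * s i q) = 0" by metis
  define \<gamma> where "\<gamma> j r = (if r \<in> {j * N..<j * N + N} then c j r else 0)" for j r
  have sub: "{j * N..<j * N + N} \<subseteq> {..<M * N}" if "j < M" for j
  proof -
    have "Suc j * N \<le> M * N" using that by (intro mult_le_mono1) simp
    then show ?thesis by (auto simp: algebra_simps)
  qed
  have disj: "j' = j" if "r \<in> {j * N..<j * N + N}" "r \<in> {j' * N..<j' * N + N}" for r j j'
  proof -
    have "r div N = k" if "r \<in> {k * N..<k * N + N}" for k
      using that by (intro div_nat_eqI) (auto simp: algebra_simps)
    then show ?thesis using that by metis
  qed
  have "(\<exists>r<M * N. \<gamma> j r \<noteq> 0 \<and> (\<forall>j'<M. j' \<noteq> j \<longrightarrow> \<gamma> j' r = 0)) \<and> (\<forall>q\<in>Q. (\<Sum>r<M * N. \<gamma> j r * s r q) = 0)"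
    if j: "j < M" for j
  proof
    obtain r where r: "r \<in> {j * N..<j * N + N}" "c j r \<noteq> 0" using c(1) by blast
    have "\<gamma> j' r = 0" if "j' \<noteq> j" for j' using disj[OF r(1)] that unfolding \<gamma>_def by auto
    then show "\<exists>r<M * N. \<gamma> j r \<noteq> 0 \<and> (\<forall>j'<M. j' \<noteq> j \<longrightarrow> \<gamma> j' r = 0)"
      using r sub[OF j] unfolding \<gamma>_def by (intro exI[of _ r]) auto
    show "\<forall>q\<in>Q. (\<Sum>r<M * N. \<gamma> j r * s r q) = 0"
    proof
      fix q assume q: "q \<in> Q"
      have "(\<Sum>r<M * N. \<gamma> j r * s r q) = (\<Sum>r\<in>{j * N..<j * N + N}. \<gamma> j r * s r q)"
        by (rule sum.mono_neutral_right) (use sub[OF j] in \<open>auto simp: \<gamma>_def\<close>)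
      also have "\<dots> = (\<Sum>r\<in>{j * N..<j * N + N}. c j r * s r q)" by (rule sum.cong) (auto simp: \<gamma>_def)
      finally show "(\<Sum>r<M * N. \<gamma> j r * s r q) = 0" using c(2)[OF q] by simp
    qed
  qed
  then show ?thesis by blast
qed

text \<open>The equation \<Delta> Y = A \<otimes> Y + Y \<otimes> B with an additional term from W
  \<otimes> W, whose coefficients at the entry (i, j) are s i j. A block of an adapted matrix
  satisfies it once the blocks closer to the diagonal have entries in the span of W.\<close>

definition rel_extension ::
  "('k::field, 'c::ab_group_add) coalg \<Rightarrow> nat \<Rightarrow> (nat \<Rightarrow> nat \<Rightarrow> 'c) \<Rightarrow> nat \<Rightarrow> (nat \<Rightarrow> nat \<Rightarrow> 'c) \<Rightarrow>
    'c set \<Rightarrow> (nat \<Rightarrow> nat \<Rightarrow> 'c \<times> 'c \<Rightarrow> 'k) \<Rightarrow> (nat \<Rightarrow> nat \<Rightarrow> 'c) \<Rightarrow> bool" where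
  "rel_extension C a A b B W s Y \<longleftrightarrow> (\<forall>i<a. \<forall>j<b. Y i j \<in> cspace C \<and> counit C (Y i j) = 0 \<and>
     (\<forall>f g. lfun (cscale C) f \<longrightarrow> lfun (cscale C) g \<longrightarrow>
        convl C f g (Y i j) = (\<Sum>k<a. f (A i k) * g (Y k j)) + (\<Sum>k<b. f (Y i k) * g (B k j)) +
          (\<Sum>w\<in>W \<times> W. s i j w * (f (fst w) * g (snd w)))))"

lemma extension_iff_rel: "extension C a A b B Y \<longleftrightarrow> rel_extension C a A b B {} s Y"
  by (simp add: extension_def rel_extension_def)

text \<open>The equation is linear in the pair (s, Y), so a combination whose additional terms
  cancel is an honest extension.\<close>

lemma rel_extension_lincomb:
  assumes C: "coalgebra C" and Y: "\<And>r. r \<in> R \<Longrightarrow> rel_extension C a A b B W (s r) (Y r)"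
  shows "rel_extension C a A b B W (\<lambda>i j w. \<Sum>r\<in>R. c r * s r i j w) (\<lambda>i j. \<Sum>r\<in>R. cscale C (c r) (Y r i j))"
  unfolding rel_extension_def
proof (intro allI impI conjI)
  note cb = coalgebra_basic[OF C]
  interpret V: vector_space "cscale C" by (rule cb(1))
  fix i j assume ij: "i < a" "j < b"
  have YC: "Y r i j \<in> cspace C" "counit C (Y r i j) = 0" if "r \<in> R" "i < a" "j < b" for r i j
    using Y[OF that(1)] that(2,3) unfolding rel_extension_def by auto
  show "(\<Sum>r\<in>R. cscale C (c r) (Y r i j)) \<in> cspace C"
    by (intro V.subspace_sum[OF cb(3)] V.subspace_scale[OF cb(3)] YC ij)
  show "counit C (\<Sum>r\<in>R. cscale C (c r) (Y r i j)) = 0"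
    using lin_on_lincomb[OF cb(5,2) module_times cb(3), of R "\<lambda>r. Y r i j" c] YC ij by simp
  fix f g assume fg: "lfun (cscale C) f" "lfun (cscale C) g"
  then have fg': "lin_on (cscale C) (*) (cspace C) f" "lin_on (cscale C) (*) (cspace C) g"
    by (auto intro: lin_on_subset)
  have f: "f (\<Sum>r\<in>R. cscale C (c r) (w r)) = (\<Sum>r\<in>R. c r * f (w r))" for w
    by (rule lin_on_lincomb[OF fg(1) cb(2) module_times V.subspace_UNIV]) simp
  have g: "g (\<Sum>r\<in>R. cscale C (c r) (w r)) = (\<Sum>r\<in>R. c r * g (w r))" for w
    by (rule lin_on_lincomb[OF fg(2) cb(2) module_times V.subspace_UNIV]) simp
  have "(\<Sum>r\<in>R. c r * (\<Sum>k<a. f (A i k) * g (Y r k j))) = (\<Sum>r\<in>R. \<Sum>k<a. f (A i k) * (c r * g (Y r k j)))"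
    by (simp add: sum_distrib_left mult.left_commute)
  also have "\<dots> = (\<Sum>k<a. f (A i k) * (\<Sum>r\<in>R. c r * g (Y r k j)))"
    by (subst sum.swap) (simp add: sum_distrib_left)
  finally have 1: "(\<Sum>r\<in>R. c r * (\<Sum>k<a. f (A i k) * g (Y r k j))) = (\<Sum>k<a. f (A i k) * (\<Sum>r\<in>R. c r * g (Y r k j)))" .
  have "(\<Sum>r\<in>R. c r * (\<Sum>k<b. f (Y r i k) * g (B k j))) = (\<Sum>r\<in>R. \<Sum>k<b. c r * f (Y r i k) * g (B k j))"
    by (simp add: sum_distrib_left mult.assoc)
  also have "\<dots> = (\<Sum>k<b. (\<Sum>r\<in>R. c r * f (Y r i k)) * g (B k j))"
    by (subst sum.swap) (simp add: sum_distrib_right)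
  finally have 2: "(\<Sum>r\<in>R. c r * (\<Sum>k<b. f (Y r i k) * g (B k j))) = (\<Sum>k<b. (\<Sum>r\<in>R. c r * f (Y r i k)) * g (B k j))" .
  have "(\<Sum>r\<in>R. c r * (\<Sum>w\<in>W \<times> W. s r i j w * (f (fst w) * g (snd w)))) =
      (\<Sum>r\<in>R. \<Sum>w\<in>W \<times> W. c r * s r i j w * (f (fst w) * g (snd w)))"
    by (simp add: sum_distrib_left mult.assoc)
  also have "\<dots> = (\<Sum>w\<in>W \<times> W. (\<Sum>r\<in>R. c r * s r i j w) * (f (fst w) * g (snd w)))"
    by (subst sum.swap) (simp add: sum_distrib_right)
  finally have 3: "(\<Sum>r\<in>R. c r * (\<Sum>w\<in>W \<times> W. s r i j w * (f (fst w) * g (snd w)))) =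
      (\<Sum>w\<in>W \<times> W. (\<Sum>r\<in>R. c r * s r i j w) * (f (fst w) * g (snd w)))" .
  have "convl C f g (\<Sum>r\<in>R. cscale C (c r) (Y r i j)) = (\<Sum>r\<in>R. c r * convl C f g (Y r i j))"
    by (rule lin_on_lincomb[OF lin_on_convl[OF C fg'] cb(2) module_times cb(3)]) (use YC ij in auto)
  also have "\<dots> = (\<Sum>r\<in>R. c r * ((\<Sum>k<a. f (A i k) * g (Y r k j)) + (\<Sum>k<b. f (Y r i k) * g (B k j)) +
      (\<Sum>w\<in>W \<times> W. s r i j w * (f (fst w) * g (snd w)))))"
    using Y fg ij unfolding rel_extension_def by simp
  also have "\<dots> = (\<Sum>k<a. f (A i k) * (\<Sum>r\<in>R. c r * g (Y r k j))) + (\<Sum>k<b. (\<Sum>r\<in>R. c r * f (Y r i k)) * g (B k j)) +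
      (\<Sum>w\<in>W \<times> W. (\<Sum>r\<in>R. c r * s r i j w) * (f (fst w) * g (snd w)))"
    unfolding distrib_left sum.distrib 1 2 3 ..
  finally show "convl C f g (\<Sum>r\<in>R. cscale C (c r) (Y r i j)) =
      (\<Sum>k<a. f (A i k) * g (\<Sum>r\<in>R. cscale C (c r) (Y r k j))) +
      (\<Sum>k<b. f (\<Sum>r\<in>R. cscale C (c r) (Y r i k)) * g (B k j)) +
      (\<Sum>w\<in>W \<times> W. (\<Sum>r\<in>R. c r * s r i j w) * (f (fst w) * g (snd w)))" unfolding f g .
qed

lemma extension_lincomb:
  assumes C: "coalgebra C" and Y: "\<And>r. r \<in> R \<Longrightarrow> extension C a A b B (Y r)"
  shows "extension C a A b B (\<lambda>i j. \<Sum>r\<in>R. cscale C (c r) (Y r i j))"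
proof -
  have "rel_extension C a A b B {} (\<lambda>_ _ _. 0) (Y r)" if "r \<in> R" for r
    using Y[OF that] unfolding extension_iff_rel[where s = "\<lambda>_ _ _. 0"] .
  from rel_extension_lincomb[OF C this, of R "\<lambda>r. r" c] show ?thesis
    unfolding extension_iff_rel[where s = "\<lambda>i j w. \<Sum>r\<in>R. c r * 0"] by simp
qed

text \<open>There are finitely many positions (i, j), and finite bounds for each of them would
  combine to a common one.\<close>

lemma unbounded_entry:
  fixes s :: "'k::field \<Rightarrow> 'c::ab_group_add \<Rightarrow> 'c" and a b :: nat
  assumes "vector_space s" "\<not> (\<exists>W. finite W \<and> (\<forall>Y. P Y \<longrightarrow> (\<forall>i<a. \<forall>j<b. Y i j \<in> module.span s W)))"
  shows "\<exists>i<a. \<exists>j<b. \<forall>W. finite W \<longrightarrow> \<not> {Y i j | Y. P Y} \<subseteq> module.span s W"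
proof (rule ccontr)
  interpret V: vector_space s by fact
  define R where "R i j = {Y i j | Y. P Y}" for i j
  assume "\<not> ?thesis"
  then have "\<forall>i. \<forall>j. \<exists>W. i < a \<longrightarrow> j < b \<longrightarrow> finite W \<and> R i j \<subseteq> V.span W" unfolding R_def[symmetric] by blast
  then obtain W where W: "\<forall>i j. i < a \<longrightarrow> j < b \<longrightarrow> finite (W i j) \<and> R i j \<subseteq> V.span (W i j)"
    unfolding choice_iff by blast
  let ?W = "\<Union>i<a. \<Union>j<b. W i j"
  have "finite ?W" using W by simp
  moreover have "Y i j \<in> V.span ?W" if Yij: "P Y" "i < a" "j < b" for Y i j
  proof -
    have "W i j \<subseteq> ?W" using Yij(2,3) by blast
    moreover have "Y i j \<in> R i j" using Yij(1) unfolding R_def by blast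
    ultimately show ?thesis using V.span_mono[of "W i j" ?W] W Yij(2,3) by blast
  qed
  ultimately show False using assms(2) by blast
qed

lemma extension_sub:
  assumes "subcoalgebra H C" "extension C a A b B Y" "\<And>i j. i < a \<Longrightarrow> j < b \<Longrightarrow> Y i j \<in> cspace H"
  shows "extension H a A b B Y"
proof -
  note h = subcoalgebra_basic[OF assms(1)]
  have "convl H f g (Y i j) = convl C f g (Y i j)"
    if "lfun (cscale C) f" "lfun (cscale C) g" "i < a" "j < b" for f g i j
    by (rule subcoalgebra_convl[OF assms(1) _ _ assms(3)[OF that(3,4)]]) (use that in \<open>auto intro: lin_on_subset\<close>)
  then show ?thesis using assms(2,3) h(4) unfolding extension_def h(3) by simp
qed

lemma cact_zero_iso:
  assumes "iso_by s M N f" "lfun s g" "comodule C M" "comodule C N" "\<And>n. n \<in> mspace N \<Longrightarrow> cact N g n = 0" "m \<in> mspace M"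
  shows "cact M g m = 0"
proof -
  note m = comodule_basic[OF assms(3)] and n = comodule_basic[OF assms(4)]
  have bij: "bij_betw f (mspace M) (mspace N)" and lin: "lin_on (mscale M) (mscale N) (mspace M) f"
    and co: "f (cact M g m) = cact N g (f m)"
    using assms(1,2,6) unfolding iso_by_def by auto
  have z: "0 \<in> mspace M" by (rule module.subspace_0[OF m(2,3)])
  have "f m \<in> mspace N" using bij assms(6) by (auto simp: bij_betw_def)
  then have "f (cact M g m) = f 0" using co assms(5) lin_on_0[OF lin m(2) n(2) z] by simp
  then show ?thesis
    using bij cact_in[OF assms(3,6)] z unfolding bij_betw_def inj_on_def by blast
qed

text \<open>An unbounded entry supplies as many independent extensions as wanted. A curve of
  combinations of them over one finite dimensional \<open>H\<close> is annihilated by a functional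
  that is nonzero on every relevant family, so it meets finitely many classes; but each class occurs
  for finitely many parameters only.\<close>

lemma extension_bounded:
  fixes C :: "('k::field, 'c::ab_group_add) coalg" and S S' :: "('k, 'c) std_comod"
  assumes inf: "infinite (UNIV :: 'k set)" and C: "coalgebra C"
    and tame: "\<And>H. subcoalgebra H C \<Longrightarrow> fin_dim (cscale H) (cspace H) \<Longrightarrow> tame H"
    and S: "simple_comodule C S" and S': "simple_comodule C S'"
    and e: "basis_fam (mscale S) {..<a} e (mspace S)" and e': "basis_fam (mscale S') {..<b} e' (mspace S')"
    and A: "matrix_of C S {..<a} e A" and B: "matrix_of C S' {..<b} e' B"
  shows "\<exists>W. finite W \<and> (\<forall>Y. extension C a A b B Y \<longrightarrow> (\<forall>i<a. \<forall>j<b. Y i j \<in> module.span (cscale C) W))"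
proof (rule ccontr)
  assume contra: "\<not> ?thesis"
  note cb = coalgebra_basic[OF C]
  interpret V: vector_space "cscale C" by (rule cb(1))
  have comS: "comodule C S" "comodule C S'" using S S' by (simp_all add: simple_comodule_def)
  define R where "R i j = {Y i j | Y. extension C a A b B Y}" for i j
  have "\<exists>i<a. \<exists>j<b. \<forall>W. finite W \<longrightarrow> \<not> R i j \<subseteq> V.span W"
    unfolding R_def by (rule unbounded_entry[OF cb(1) contra])
  then obtain i0 j0 where ij0: "i0 < a" "j0 < b"
    and unb: "\<And>W. finite W \<Longrightarrow> \<not> R i0 j0 \<subseteq> V.span W" by blast
  define d where "d = b + a"
  \<comment> \<open>One more than the number of equations expressing that a functional vanishes on
    the block.\<close>
  define N where "N = Suc (a * b)"
  \<comment> \<open>One more than the number of entries of an extension, which bounds the dimension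
    of its coefficient space.\<close>
  define Mn where "Mn = Suc (d * d)"
  define m where "m = Mn * N"
  have m0: "0 < m" by (simp add: m_def Mn_def N_def)
  \<comment> \<open>Functionals vanishing on D see the off-diagonal block only, as
    \<open>indecomposable\<close> and \<open>cact_zero_iff'\<close> require.\<close>
  define D where "D = (\<lambda>(i, j). A i j) ` ({..<a} \<times> {..<a}) \<union> (\<lambda>(i, j). B i j) ` ({..<b} \<times> {..<b})"
  have finD: "finite D" by (simp add: D_def)
  have "\<exists>y f. \<forall>r<m. y r \<in> R i0 j0 \<and> lfun (cscale C) (f r) \<and> (\<forall>x\<in>D. f r x = 0) \<and>
      (\<forall>r'<m. f r (y r') = (if r = r' then 1 else 0))"
    by (rule dual_sequence[OF cb(1) finD]) (rule unb)
  then obtain y f where yf: "\<forall>r<m. y r \<in> R i0 j0 \<and> lfun (cscale C) (f r) \<and> (\<forall>x\<in>D. f r x = 0) \<and>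
      (\<forall>r'<m. f r (y r') = (if r = r' then 1 else 0))"
    by (elim exE)
  then have yS: "\<And>r. r < m \<Longrightarrow> y r \<in> R i0 j0"
    and f: "\<And>r. r < m \<Longrightarrow> lfun (cscale C) (f r)" and fD: "\<And>r x. r < m \<Longrightarrow> x \<in> D \<Longrightarrow> f r x = 0"
    and fy: "\<And>r r'. r < m \<Longrightarrow> r' < m \<Longrightarrow> f r (y r') = (if r = r' then 1 else 0)"
    by auto
  have "\<forall>r. \<exists>Y. r < m \<longrightarrow> extension C a A b B Y \<and> y r = Y i0 j0" using yS unfolding R_def by blast
  then obtain Ys where "\<forall>r. r < m \<longrightarrow> extension C a A b B (Ys r) \<and> y r = Ys r i0 j0" unfolding choice_iff by blast
  then have Ys: "\<And>r. r < m \<Longrightarrow> extension C a A b B (Ys r)" "\<And>r. r < m \<Longrightarrow> y r = Ys r i0 j0" by blast+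
  have AD: "A i j \<in> D" if "i < a" "j < a" for i j using that unfolding D_def by force
  have BD: "B i j \<in> D" if "i < b" "j < b" for i j using that unfolding D_def by force
  define comb where "comb c i j = (\<Sum>r<m. cscale C (c r) (Ys r i j))" for c i j
  have ext: "extension C a A b B (comb c)" for c
    using extension_lincomb[OF C, of "{..<m}" a A b B Ys c] Ys(1) unfolding comb_def by simp
  have Acoalg: "matrix_coalg C {..<a} A" and Bcoalg: "matrix_coalg C {..<b} B"
    using matrix_of_coalg[OF C comS(1) e A] matrix_of_coalg[OF C comS(2) e' B] by auto
  \<comment> \<open>\<open>H\<close> is fixed before any coefficients are chosen, so that all
    combinations live over the same tame coalgebra.\<close>
  define G where "G = (\<Union>r\<in>{..<m}. \<Union>i\<in>{..<d}. \<Union>j\<in>{..<d}. {block b A B (Ys r) i j})"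
  have finG: "finite G" by (simp add: G_def)
  have "\<exists>H. subcoalgebra H C \<and> cspace H = V.span G"
    by (rule subcoalgebra_of_matrices[OF C _ _ G_def])
      (use block_coalg[OF C Acoalg Bcoalg Ys(1)] in \<open>simp_all add: d_def\<close>)
  then obtain H where H: "subcoalgebra H C" "cspace H = V.span G" by blast
  note h = subcoalgebra_basic[OF H(1)] and hb = coalgebra_basic[OF subcoalgebra_basic(1)[OF H(1)]]
  have blH: "block b A B (Ys r) i j \<in> cspace H" if "r < m" "i < d" "j < d" for r i j
    unfolding H(2) by (rule V.span_base) (use that in \<open>unfold G_def, blast\<close>)
  have AH: "A i j \<in> cspace H" if "i < a" "j < a" for i j
    using blH[OF m0, of "b + i" "b + j"] that by (simp add: block_def d_def)
  have BH: "B i j \<in> cspace H" if "i < b" "j < b" for i j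
    using blH[OF m0, of i j] that by (simp add: block_def d_def)
  have YH: "Ys r i j \<in> cspace H" if "r < m" "i < a" "j < b" for r i j
    using blH[OF that(1), of "b + i" j] that by (simp add: block_def d_def)
  have cH: "comb c i j \<in> cspace H" if "i < a" "j < b" for c i j
    unfolding comb_def H(2) by (intro V.span_sum V.span_scale) (use YH that H(2) in auto)
  define S1 where "S1 = conv H S"
  define S1' where "S1' = conv H S'"
  have suppS: "supported_on H S" by (rule matrix_supported_on[OF C H(1) comS(1) e A]) (use AH in auto)
  have suppS': "supported_on H S'" by (rule matrix_supported_on[OF C H(1) comS(2) e' B]) (use BH in auto)
  note cvS = conv[OF C H(1) comS(1) suppS, unfolded h(3)] and cvS' = conv[OF C H(1) comS(2) suppS', unfolded h(3)]
  have simS: "simple_comodule H S1" unfolding S1_def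
    using simple_same[OF C comS(1) h(1) cvS(1) h(3) cvS(2)] S by simp
  have simS': "simple_comodule H S1'" unfolding S1'_def
    using simple_same[OF C comS(2) h(1) cvS'(1) h(3) cvS'(2)] S' by simp
  have ED: "extension_data H S1 S1' a b e e' A B (comb c)" for c
  proof
    show "coalgebra H" by (rule h(1))
    show "simple_comodule H S1" "simple_comodule H S1'" by (rule simS, rule simS')
    show "basis_fam (mscale S1) {..<a} e (mspace S1)" "matrix_of H S1 {..<a} e A"
      unfolding S1_def using matrix_of_conv[OF C H(1) comS(1) suppS e A] AH by auto
    show "basis_fam (mscale S1') {..<b} e' (mspace S1')" "matrix_of H S1' {..<b} e' B"
      unfolding S1'_def using matrix_of_conv[OF C H(1) comS(2) suppS' e' B] BH by auto
    show "extension H a A b B (comb c)" by (rule extension_sub[OF H(1) ext cH])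
  qed
  define X where "X c = (mat_comod (b + a) (block b A B (comb c)) :: ('k, 'c) std_comod)" for c
  note lemmas_X = extension_data.comodM[OF ED, folded X_def] extension_data.jordan_hoelder[OF ED, folded X_def]
    extension_data.fin_dim[OF ED, folded X_def]
  have indX: "indecomposable_comodule H (X c)"
    if "lfun (cscale C) g" "\<And>x. x \<in> D \<Longrightarrow> g x = 0" "g (comb c i0 j0) \<noteq> 0" for c g
    using extension_data.indecomposable[OF ED, folded X_def, unfolded h(3), OF that(1) _ _ ij0 that(3)] that(2) AD BD
    by blast
  have zeroX: "(\<forall>x\<in>mspace (X c). cact (X c) g x = 0) \<longleftrightarrow> (\<forall>i<a. \<forall>j<b. g (comb c i j) = 0)"
    if "lfun (cscale C) g" "\<And>x. x \<in> D \<Longrightarrow> g x = 0" for c g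
    using extension_data.cact_zero_iff'[OF ED, folded X_def, unfolded h(3), OF that(1), of c] that(2) AD BD
    by blast
  \<comment> \<open>All extensions have the factors S1' and S1, hence one dimension vector and one
    finite set of families.\<close>
  have "simple_comodule H U" if "U \<in> set [S1', S1]" for U using that simS simS' by auto
  from ex_dim_vector[OF h(1) this] obtain v where v: "Poly_Mapping.keys v \<subseteq> simple_types H"
    "\<And>M Ms. jordan_hoelder_series H M Ms [S1', S1] \<Longrightarrow> has_dim_vector H M v"
    by blast
  have "tame H"
    by (rule tame[OF H(1)]) (use finG H(2) h(3) in \<open>auto simp: fin_dim_def\<close>)
  then obtain Ls where Ls: "finite Ls" "\<forall>(L, act)\<in>Ls. free_poly_comodule H L act" "finite (exceptional H v Ls)"
    using v(1) unfolding tame_iff by blast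
  have free: "free_poly_comodule H L act" if "(L, act) \<in> Ls" for L act using Ls(2) that by blast
  \<comment> \<open>A polynomial curve of functionals: a family on which some f i is nonzero can be
    annihilated by \<phi> u for finitely many u only.\<close>
  define \<phi> where "\<phi> u x = (\<Sum>i<m. u ^ i * f i x)" for u x
  have \<phi>: "lfun (cscale C) (\<phi> u)" for u
    unfolding \<phi>_def[abs_def] by (rule lfun_lincomb) (use f in auto)
  have \<phi>D: "\<phi> u x = 0" if "x \<in> D" for u x using fD[OF _ that] by (simp add: \<phi>_def)
  \<comment> \<open>A family on which every f i acts as zero cannot specialize to an extension that
    one of them detects, so the others are the relevant ones.\<close>
  define rel where "rel L \<longleftrightarrow> (\<exists>i<m. \<exists>l\<in>mspace L. cact L (f i) l \<noteq> 0)" for L :: "('k, 'c, nat \<Rightarrow>\<^sub>0 'k poly) comod"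
  have badu: "finite {u. \<forall>l\<in>mspace L. cact L (\<phi> u) l = 0}" if L: "(L, act) \<in> Ls" "rel L" for L act
  proof (rule ccontr)
    assume inf': "infinite {u. \<forall>l\<in>mspace L. cact L (\<phi> u) l = 0}"
    obtain i l where il: "i < m" "l \<in> mspace L" "cact L (f i) l \<noteq> 0" using L(2) unfolding rel_def by blast
    note lb = comodule_basic[OF free_poly_basic(1)[OF free[OF L(1)]]]
    interpret L: vector_space "mscale L" by (rule lb(1))
    have "cact L (f i) l \<in> {0}"
    proof (rule vandermonde_subspace[OF lb(1) L.subspace_single_0 inf' _ il(1)])
      fix u assume "u \<in> {u. \<forall>l\<in>mspace L. cact L (\<phi> u) l = 0}"
      then have "cact L (\<phi> u) l = 0" using il(2) by blast
      then show "(\<Sum>i<m. mscale L (u ^ i) (cact L (f i) l)) \<in> {0}"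
        unfolding \<phi>_def[abs_def] cact_lincomb_fun[OF lb(2)] by simp
    qed
    then show False using il(3) by simp
  qed
  define RL where "RL = {x \<in> Ls. rel (fst x)}"
  have finRL: "finite RL" using Ls(1) by (simp add: RL_def)
  have RL: "(fst x, snd x) \<in> Ls" "rel (fst x)" if "x \<in> RL" for x using that by (auto simp: RL_def)
  have "finite (\<Union>x\<in>RL. {u. \<forall>l\<in>mspace (fst x). cact (fst x) (\<phi> u) l = 0})"
    by (rule finite_UN_I[OF finRL]) (rule badu[OF RL])
  then obtain u where "u \<notin> (\<Union>x\<in>RL. {u. \<forall>l\<in>mspace (fst x). cact (fst x) (\<phi> u) l = 0})"
    using ex_new_if_finite[OF inf] by blast
  then have u: "\<exists>l\<in>mspace (fst x). cact (fst x) (\<phi> u) l \<noteq> 0" if "x \<in> RL" for x using that by blast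
  \<comment> \<open>One equation for each position of the block: \<phi> u vanishes there on the
    combination.\<close>
  have "card ({..<a} \<times> {..<b}) < N" by (simp add: N_def)
  from block_relations[OF _ this, of Mn "\<lambda>r (p, q). \<phi> u (Ys r p q)", folded m_def]
  obtain \<gamma> where \<gamma>: "\<forall>j<Mn. (\<exists>r<m. \<gamma> j r \<noteq> 0 \<and> (\<forall>j'<Mn. j' \<noteq> j \<longrightarrow> \<gamma> j' r = 0)) \<and>
      (\<forall>q\<in>{..<a} \<times> {..<b}. (\<Sum>r<m. \<gamma> j r * (case q of (p, q) \<Rightarrow> \<phi> u (Ys r p q))) = 0)"
    by auto
  have \<gamma>1: "\<exists>r<m. \<gamma> j r \<noteq> 0 \<and> (\<forall>j'<Mn. j' \<noteq> j \<longrightarrow> \<gamma> j' r = 0)" if "j < Mn" for j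
    using \<gamma> that by simp
  have \<gamma>2: "(\<Sum>r<m. \<gamma> j r * \<phi> u (Ys r p q)) = 0" if "j < Mn" "p < a" "q < b" for j p q
    using \<gamma>[rule_format, OF that(1), THEN conjunct2, THEN bspec, of "(p, q)"] that(2,3) by simp
  \<comment> \<open>A polynomial curve through the solutions; each of its points solves the
    equations again.\<close>
  define cc where "cc t r = (\<Sum>j<Mn. t ^ j * \<gamma> j r)" for t r
  \<comment> \<open>The entry at the distinguished position for the j-th solution, which is the
    coefficient of t^j along the curve.\<close>
  define z where "z j = (\<Sum>r<m. cscale C (\<gamma> j r) (y r))" for j
  have lc: "g (\<Sum>r<m. cscale C (c r) (w r)) = (\<Sum>r<m. c r * g (w r))" if "lfun (cscale C) g" for g c w
    by (rule lin_on_lincomb[OF that cb(2) module_times V.subspace_UNIV]) simp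
  have comb_z: "comb (cc t) i0 j0 = (\<Sum>j<Mn. cscale C (t ^ j) (z j))" for t
  proof -
    have "comb (cc t) i0 j0 = (\<Sum>r<m. \<Sum>j<Mn. cscale C (t ^ j * \<gamma> j r) (y r))"
      unfolding comb_def cc_def using Ys(2) by (simp add: V.scale_sum_left)
    also have "\<dots> = (\<Sum>j<Mn. cscale C (t ^ j) (z j))"
      unfolding z_def by (subst sum.swap) (simp add: V.scale_sum_right)
    finally show ?thesis .
  qed
  have \<phi>comb: "\<phi> u (comb (cc t) p q) = 0" if "p < a" "q < b" for t p q
  proof -
    have "\<phi> u (comb (cc t) p q) = (\<Sum>r<m. \<Sum>j<Mn. t ^ j * (\<gamma> j r * \<phi> u (Ys r p q)))"
      unfolding comb_def lc[OF \<phi>] cc_def by (simp add: sum_distrib_right mult.assoc)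
    also have "\<dots> = (\<Sum>j<Mn. t ^ j * (\<Sum>r<m. \<gamma> j r * \<phi> u (Ys r p q)))"
      by (subst sum.swap) (simp add: sum_distrib_left)
    also have "\<dots> = 0" using \<gamma>2[OF _ that] by simp
    finally show ?thesis .
  qed
  have fcomb: "f r (comb c i0 j0) = c r" if r: "r < m" for r c
  proof -
    have "f r (comb c i0 j0) = (\<Sum>r'<m. c r' * (if r = r' then 1 else 0))"
      unfolding comb_def lc[OF f[OF r]] using Ys(2) fy[OF r] by (intro sum.cong) auto
    also have "\<dots> = c r" using r by (simp add: if_distrib[of "\<lambda>x. _ * x"] sum.If_cases cong: if_cong)
    finally show ?thesis .
  qed
  \<comment> \<open>r0 belongs to the support of \<gamma> 0 alone, so this coordinate of
    \<open>cc t\<close> is a nonzero constant and f r0 detects every member of the curve.\<close>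
  obtain r0 where r0: "r0 < m" "\<gamma> 0 r0 \<noteq> 0" "\<And>j. j < Mn \<Longrightarrow> j \<noteq> 0 \<Longrightarrow> \<gamma> j r0 = 0"
    using \<gamma>1[of 0] by (auto simp: Mn_def)
  have "cc t r0 = (\<Sum>j<Mn. if j = 0 then \<gamma> 0 r0 else 0)" for t
    unfolding cc_def by (rule sum.cong) (use r0(3) in auto)
  then have cc0: "cc t r0 \<noteq> 0" for t using r0(2) by (simp add: Mn_def)
  define K where "K t = iso_class H (X (cc t))" for t
  define E where "E L act = {iso_class H M | M. comodule H M \<and> (\<forall>x\<in>mspace M. cact M (\<phi> u) x = 0) \<and>
    (\<exists>lam. iso_to_specialization H M L act lam)}" for L :: "('k, 'c, nat \<Rightarrow>\<^sub>0 'k poly) comod" and act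
  have finE: "finite (E (fst x) (snd x))" if x: "x \<in> RL" for x
  proof -
    obtain l where "l \<in> mspace (fst x)" "cact (fst x) (\<phi> u) l \<noteq> 0" using u[OF x] by blast
    from finite_spec_classes[OF h(1) free[OF RL(1)[OF x]], unfolded h(3), OF \<phi> this]
    show ?thesis unfolding E_def .
  qed
  \<comment> \<open>Every member is indecomposable by f r0. If it is a specialization, then of a
    relevant family, where \<phi> u leaves finitely many classes.\<close>
  have "K t \<in> exceptional H v Ls \<union> (\<Union>x\<in>RL. E (fst x) (snd x))" for t
  proof (cases "\<exists>(L, act)\<in>Ls. \<exists>lam. iso_to_specialization H (X (cc t)) L act lam")
    case False
    have "indecomposable_comodule H (X (cc t))"
      by (rule indX[OF f[OF r0(1)] fD[OF r0(1)]]) (use fcomb[OF r0(1)] cc0 in auto)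
    moreover obtain Ms where "jordan_hoelder_series H (X (cc t)) Ms [S1', S1]" using lemmas_X(2) by blast
    ultimately have "K t \<in> exceptional H v Ls"
      unfolding exceptional_def K_def using lemmas_X(3) v(2) False by blast
    then show ?thesis by blast
  next
    case True
    then obtain L act lam where L: "(L, act) \<in> Ls" "iso_to_specialization H (X (cc t)) L act lam" by blast
    \<comment> \<open>Otherwise f r0 would act as zero on L and hence on its quotient, although it
      is nonzero on an entry of the block.\<close>
    have "rel L"
    proof (rule ccontr)
      assume nrel: "\<not> rel L"
      obtain \<pi> where \<pi>: "spec_map (cscale C) (X (cc t)) L act lam \<pi>"
        using L(2) unfolding iso_to_specialization_iff[OF h(1) lemmas_X(1) free[OF L(1)]] h(3) by blast
      have \<pi>': "\<pi> ` mspace L = mspace (X (cc t))"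
        "\<And>l. l \<in> mspace L \<Longrightarrow> \<pi> (cact L (f r0) l) = cact (X (cc t)) (f r0) (\<pi> l)"
        "lin_on act (\<lambda>q. mscale (X (cc t)) (poly q lam)) (mspace L) \<pi>"
        using \<pi> f[OF r0(1)] unfolding spec_map_def by blast+
      note fl = free_poly_basic[OF free[OF L(1)]]
      have "\<pi> 0 = 0"
        by (rule lin_on_0[OF \<pi>'(3) fl(2) module_poly_eval[OF comodule_basic(2)[OF lemmas_X(1)]] module.subspace_0[OF fl(2,3)]])
      then have "cact (X (cc t)) (f r0) x = 0" if "x \<in> mspace (X (cc t))" for x
        using that \<pi>'(1,2) nrel r0(1) unfolding rel_def by (metis imageE)
      then have "f r0 (comb (cc t) i0 j0) = 0"
        using zeroX[OF f[OF r0(1)] fD[OF r0(1)], of "cc t"] ij0 by blast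
      then show False using fcomb[OF r0(1)] cc0 by simp
    qed
    moreover have "\<forall>x\<in>mspace (X (cc t)). cact (X (cc t)) (\<phi> u) x = 0"
      using zeroX[OF \<phi> \<phi>D, of "cc t"] \<phi>comb by blast
    ultimately have "K t \<in> E L act" "(L, act) \<in> RL"
      using L lemmas_X(1) unfolding K_def E_def RL_def by (blast, simp)
    then show ?thesis by force
  qed
  then have "range K \<subseteq> exceptional H v Ls \<union> (\<Union>x\<in>RL. E (fst x) (snd x))" by blast
  moreover have "finite (\<Union>x\<in>RL. E (fst x) (snd x))"
    by (rule finite_UN_I[OF finRL finE])
  ultimately have "finite (range K)" using Ls(3) by (meson finite_UnI finite_subset)
  \<comment> \<open>Finitely many classes and infinitely many parameters: one class is hit
    infinitely often.\<close>
  then obtain t0 where "infinite {t \<in> UNIV. K t = K t0}" using pigeonhole_infinite[OF inf, of K] by blast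
  then have T: "infinite {t. K t = K t0}" by simp
  define W0 where "W0 = (\<lambda>(i, j). block b A B (comb (cc t0)) i j) ` ({..<d} \<times> {..<d})"
  have finW: "finite W0" and cardW: "card W0 < Mn"
    using card_image_le[of "{..<d} \<times> {..<d}" "\<lambda>(i, j). block b A B (comb (cc t0)) i j"]
    unfolding W0_def Mn_def by auto
  \<comment> \<open>A functional killing all entries at t0 annihilates that comodule, hence every
    isomorphic one, hence its entries.\<close>
  have inW: "comb (cc t) i0 j0 \<in> V.span W0" if t: "K t = K t0" for t
  proof (rule in_span_functional[OF cb(1)])
    fix g assume g: "lfun (cscale C) g" "\<And>w. w \<in> W0 \<Longrightarrow> g w = 0"
    have "\<forall>i<b + a. \<forall>j<b + a. g (block b A B (comb (cc t0)) i j) = 0"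
      using g(2) unfolding W0_def d_def by auto
    then have z0: "\<And>x. x \<in> mspace (X (cc t0)) \<Longrightarrow> cact (X (cc t0)) g x = 0"
      using extension_data.cact_zero_iff[OF ED, folded X_def, unfolded h(3), OF g(1), of "cc t0"] by blast
    have "comod_iso H (X (cc t)) (X (cc t0))"
      using t iso_class_eq_iff[OF h(1) lemmas_X(1) lemmas_X(1)] unfolding K_def by blast
    then obtain F where F: "iso_by (cscale C) (X (cc t)) (X (cc t0)) F"
      unfolding comod_iso_iff[OF h(1) lemmas_X(1) lemmas_X(1)] h(3) by blast
    have "\<forall>x\<in>mspace (X (cc t)). cact (X (cc t)) g x = 0"
      using cact_zero_iso[OF F g(1) lemmas_X(1) lemmas_X(1) z0] by blast
    then have "g (block b A B (comb (cc t)) (b + i0) j0) = 0"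
      using extension_data.cact_zero_iff[OF ED, folded X_def, unfolded h(3), OF g(1), of "cc t"] ij0 by auto
    then show "g (comb (cc t) i0 j0) = 0" using ij0 by (simp add: block_def)
  qed
  \<comment> \<open>Infinitely many points of the curve lie in this span, so its Mn coefficients do;
    there are more of them than elements of W0.\<close>
  have "z j \<in> V.span W0" if "j < Mn" for j
    by (rule vandermonde_subspace[OF cb(1) V.subspace_span T _ that]) (use inW comb_z in auto)
  then obtain c where c: "\<exists>j<Mn. c j \<noteq> 0" "(\<Sum>j<Mn. cscale C (c j) (z j)) = 0"
    using dependent_in_span[OF cb(1) finW, of "{..<Mn}" z] cardW by auto
  obtain j where j: "j < Mn" "c j \<noteq> 0" using c(1) by blast
  obtain r where r: "r < m" "\<gamma> j r \<noteq> 0" "\<And>j'. j' < Mn \<Longrightarrow> j' \<noteq> j \<Longrightarrow> \<gamma> j' r = 0" using \<gamma>1[OF j(1)] by blast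
  \<comment> \<open>f r reads off the coefficient at index r. For the private index of the j-th
    solution, only the term with \<gamma> j survives in the relation.\<close>
  have fz: "f r (z j') = \<gamma> j' r" for j'
    unfolding z_def lc[OF f[OF r(1)]] using fy[OF r(1)] r(1)
    by (simp add: if_distrib[of "\<lambda>x. _ * x"] sum.If_cases cong: if_cong)
  have "(\<Sum>j'<Mn. c j' * f r (z j')) = f r (\<Sum>j'<Mn. cscale C (c j') (z j'))"
    using lin_on_lincomb[OF f[OF r(1)] cb(2) module_times V.subspace_UNIV, of "{..<Mn}" z c] by simp
  also have "\<dots> = 0" unfolding c(2) using lin_on_0[OF f[OF r(1)] cb(2) module_times] by simp
  finally have "(\<Sum>j'<Mn. c j' * \<gamma> j' r) = 0" unfolding fz .
  moreover have "(\<Sum>j'<Mn. c j' * \<gamma> j' r) = (\<Sum>j'<Mn. if j' = j then c j * \<gamma> j r else 0)"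
    by (rule sum.cong) (use r(3) in auto)
  ultimately show False using j r(2) by simp
qed

section \<open>Adapted matrices\<close>

text \<open>The additional terms have a * b * (card W)^2 coefficients. Among more solutions than
  that, some nontrivial combination is an honest extension and hence has its entries in the span of
  Z; but functionals dual to the solutions and zero on Z detect it.\<close>

lemma rel_extension_bounded:
  fixes C :: "('k::field, 'c::ab_group_add) coalg"
  assumes C: "coalgebra C" and W: "finite W" and Z: "finite Z"
    "\<forall>Y. extension C a A b B Y \<longrightarrow> (\<forall>i<a. \<forall>j<b. Y i j \<in> module.span (cscale C) Z)"
  shows "\<exists>W'. finite W' \<and> (\<forall>Y. (\<exists>s. rel_extension C a A b B W s Y) \<longrightarrow>
    (\<forall>i<a. \<forall>j<b. Y i j \<in> module.span (cscale C) W'))"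
proof (rule ccontr)
  assume contra: "\<not> ?thesis"
  note cb = coalgebra_basic[OF C]
  interpret V: vector_space "cscale C" by (rule cb(1))
  define R where "R i j = {Y i j | Y. \<exists>s. rel_extension C a A b B W s Y}" for i j
  have "\<exists>i<a. \<exists>j<b. \<forall>W. finite W \<longrightarrow> \<not> R i j \<subseteq> V.span W"
    unfolding R_def by (rule unbounded_entry[OF cb(1) contra])
  then obtain i0 j0 where ij0: "i0 < a" "j0 < b"
    and unb: "\<And>W. finite W \<Longrightarrow> \<not> R i0 j0 \<subseteq> V.span W" by blast
  let ?Q = "{..<a} \<times> {..<b} \<times> W \<times> W"
  define m where "m = Suc (card ?Q)"
  have "\<exists>y f. \<forall>r<m. y r \<in> R i0 j0 \<and> lfun (cscale C) (f r) \<and> (\<forall>x\<in>Z. f r x = 0) \<and>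
      (\<forall>r'<m. f r (y r') = (if r = r' then 1 else 0))"
    by (rule dual_sequence[OF cb(1) Z(1)]) (rule unb)
  then obtain y f where yf: "\<forall>r<m. y r \<in> R i0 j0 \<and> lfun (cscale C) (f r) \<and> (\<forall>x\<in>Z. f r x = 0) \<and>
      (\<forall>r'<m. f r (y r') = (if r = r' then 1 else 0))"
    by (elim exE)
  have "\<forall>r. \<exists>Y. \<exists>s. r < m \<longrightarrow> rel_extension C a A b B W s Y \<and> y r = Y i0 j0" using yf unfolding R_def by blast
  then obtain Y s where Y: "\<And>r. r < m \<Longrightarrow> rel_extension C a A b B W (s r) (Y r)" "\<And>r. r < m \<Longrightarrow> y r = Y r i0 j0"
    unfolding choice_iff by blast
  obtain c where c: "\<exists>r\<in>{..<m}. c r \<noteq> 0"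
    "\<forall>q\<in>?Q. (\<Sum>r\<in>{..<m}. c r * (case q of (i, j, w) \<Rightarrow> s r i j w)) = 0"
    using nontrivial_relation[of ?Q "{..<m}" "\<lambda>r (i, j, w). s r i j w"] W unfolding m_def by auto
  define Yc where "Yc i j = (\<Sum>r<m. cscale C (c r) (Y r i j))" for i j
  have "rel_extension C a A b B W (\<lambda>i j w. \<Sum>r<m. c r * s r i j w) Yc"
    unfolding Yc_def[abs_def] by (rule rel_extension_lincomb[OF C]) (use Y in simp)
  moreover have "(\<Sum>r<m. c r * s r i j w) = 0" if "i < a" "j < b" "w \<in> W \<times> W" for i j w
    using c(2)[rule_format, of "(i, j, w)"] that by simp
  ultimately have "extension C a A b B Yc" unfolding extension_def rel_extension_def by simp
  then have Yz: "Yc i0 j0 \<in> V.span Z" using Z(2) ij0 by blast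
  obtain r where r: "r < m" "c r \<noteq> 0" using c(1) by blast
  have fr: "lfun (cscale C) (f r)" using yf r(1) by blast
  have "f r (Yc i0 j0) = (\<Sum>r'<m. c r' * f r (Y r' i0 j0))"
    unfolding Yc_def by (rule lin_on_lincomb[OF fr cb(2) module_times V.subspace_UNIV]) simp
  also have "\<dots> = (\<Sum>r'<m. if r' = r then c r else 0)"
    by (rule sum.cong) (use yf r(1) Y(2) in auto)
  also have "\<dots> = c r" using r(1) by simp
  finally have "f r (Yc i0 j0) = c r" .
  moreover have "f r (Yc i0 j0) = 0"
    by (rule lin_on_vanish_span[OF fr cb(2) module_times V.subspace_UNIV subset_UNIV _ Yz]) (use yf r(1) in blast)
  ultimately show False using r(2) by simp
qed

definition index_set :: "(nat \<Rightarrow> nat) \<Rightarrow> (nat \<Rightarrow> nat) \<Rightarrow> nat \<Rightarrow> (nat \<times> nat) set" where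
  "index_set a \<sigma> n = Sigma {..<n} (\<lambda>p. {..<a (\<sigma> p)})"

text \<open>Matrices of comodules with a composition series whose \<open>p\<close>-th factor has the matrix
  \<open>A (\<sigma> p)\<close>, written in a basis adapted to the series.\<close>

definition adapted ::
  "('k::field, 'c::ab_group_add) coalg \<Rightarrow> nat \<Rightarrow> (nat \<Rightarrow> nat) \<Rightarrow> (nat \<Rightarrow> nat \<Rightarrow> nat \<Rightarrow> 'c) \<Rightarrow>
    nat \<Rightarrow> (nat \<Rightarrow> nat) \<Rightarrow> (nat \<times> nat \<Rightarrow> nat \<times> nat \<Rightarrow> 'c) \<Rightarrow> bool" where
  "adapted C n0 a A n \<sigma> X \<longleftrightarrow> matrix_coalg C (index_set a \<sigma> n) X \<and> (\<forall>p<n. \<sigma> p < n0) \<and>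
     (\<forall>p<n. \<forall>q<n. \<forall>i<a (\<sigma> p). \<forall>j<a (\<sigma> q). p < q \<longrightarrow> X (p, i) (q, j) = 0) \<and>
     (\<forall>p<n. \<forall>i<a (\<sigma> p). \<forall>j<a (\<sigma> p). X (p, i) (p, j) = A (\<sigma> p) i j)"

lemma sum_index_set: "(\<Sum>k\<in>index_set a \<sigma> n. h k) = (\<Sum>p<n. \<Sum>i<a (\<sigma> p). h (p, i))"
  unfolding index_set_def by (subst sum.Sigma) (auto simp: case_prod_unfold)

text \<open>Triangularity leaves in \<Delta> of the entry only summands with positions r from q to
  p. Those with r = p and r = q form the linear part of the equation; those strictly between are
  tensors of entries closer to the diagonal, which lie in the span of W.\<close>

lemma adapted_rel_extension:
  assumes C: "coalgebra C" and X: "adapted C n0 a A n \<sigma> X" and W: "finite W"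
    and pq: "q < p" "p < n"
    and inW: "\<And>r i j. q < r \<Longrightarrow> r < p \<Longrightarrow> i < a (\<sigma> p) \<Longrightarrow> j < a (\<sigma> r) \<Longrightarrow> X (p, i) (r, j) \<in> module.span (cscale C) W"
      "\<And>r i j. q < r \<Longrightarrow> r < p \<Longrightarrow> i < a (\<sigma> r) \<Longrightarrow> j < a (\<sigma> q) \<Longrightarrow> X (r, i) (q, j) \<in> module.span (cscale C) W"
  shows "\<exists>s. rel_extension C (a (\<sigma> p)) (A (\<sigma> p)) (a (\<sigma> q)) (A (\<sigma> q)) W s (\<lambda>i j. X (p, i) (q, j))"
proof -
  note cb = coalgebra_basic[OF C]
  interpret V: vector_space "cscale C" by (rule cb(1))
  have "\<forall>x\<in>V.span W. \<exists>c. x = (\<Sum>w\<in>W. cscale C (c w) w)" unfolding V.span_finite[OF W] by blast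
  then obtain cf where cf: "\<And>x. x \<in> V.span W \<Longrightarrow> x = (\<Sum>w\<in>W. cscale C (cf x w) w)" by metis
  have fcf: "f x = (\<Sum>w\<in>W. cf x w * f w)" if "lfun (cscale C) f" "x \<in> V.span W" for f x
  proof -
    have "f x = f (\<Sum>w\<in>W. cscale C (cf x w) w)" using cf[OF that(2)] by simp
    also have "\<dots> = (\<Sum>w\<in>W. cf x w * f w)"
      by (rule lin_on_lincomb[OF that(1) cb(2) module_times V.subspace_UNIV]) simp
    finally show ?thesis .
  qed
  \<comment> \<open>The coefficients of the middle summands after both factors are expanded in
    W.\<close>
  define s where "s i j w = (\<Sum>r\<in>{q<..<p}. \<Sum>k<a (\<sigma> r). cf (X (p, i) (r, k)) (fst w) * cf (X (r, k) (q, j)) (snd w))" for i j w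
  have mc: "matrix_coalg C (index_set a \<sigma> n) X"
    and tri: "\<And>p q i j. p < n \<Longrightarrow> q < n \<Longrightarrow> i < a (\<sigma> p) \<Longrightarrow> j < a (\<sigma> q) \<Longrightarrow> p < q \<Longrightarrow> X (p, i) (q, j) = 0"
    and diag: "\<And>p i j. p < n \<Longrightarrow> i < a (\<sigma> p) \<Longrightarrow> j < a (\<sigma> p) \<Longrightarrow> X (p, i) (p, j) = A (\<sigma> p) i j"
    using X unfolding adapted_def by blast+
  have idx: "(p, i) \<in> index_set a \<sigma> n \<longleftrightarrow> p < n \<and> i < a (\<sigma> p)" for p i by (auto simp: index_set_def)
  have qn: "q < n" using pq by simp
  have "rel_extension C (a (\<sigma> p)) (A (\<sigma> p)) (a (\<sigma> q)) (A (\<sigma> q)) W s (\<lambda>i j. X (p, i) (q, j))"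
    unfolding rel_extension_def
  proof (intro allI impI conjI)
    fix i j assume ij: "i < a (\<sigma> p)" "j < a (\<sigma> q)"
    have I: "(p, i) \<in> index_set a \<sigma> n" "(q, j) \<in> index_set a \<sigma> n" using idx ij pq qn by auto
    show "X (p, i) (q, j) \<in> cspace C" using mc I unfolding matrix_coalg_def by blast
    show "counit C (X (p, i) (q, j)) = 0" using mc I pq unfolding matrix_coalg_def by auto
    fix f g assume fg: "lfun (cscale C) f" "lfun (cscale C) g"
    have f0: "f 0 = 0" "g 0 = 0" using lin_on_0[OF fg(1) cb(2) module_times] lin_on_0[OF fg(2) cb(2) module_times] by auto
    define h where "h r = (\<Sum>k<a (\<sigma> r). f (X (p, i) (r, k)) * g (X (r, k) (q, j)))" for r
    have "convl C f g (X (p, i) (q, j)) = (\<Sum>r<n. h r)"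
      using mc fg I unfolding matrix_coalg_def h_def by (simp add: sum_index_set)
    also have "\<dots> = (\<Sum>r\<in>{q..p}. h r)"
    proof (rule sum.mono_neutral_right)
      show "\<forall>r\<in>{..<n} - {q..p}. h r = 0"
      proof
        fix r assume r: "r \<in> {..<n} - {q..p}"
        show "h r = 0" unfolding h_def
          by (rule sum.neutral) (use r tri ij pq qn f0 in auto)
      qed
    qed (use pq in auto)
    also have "{q..p} = insert p (insert q {q<..<p})" using pq(1) by auto
    also have "(\<Sum>r\<in>insert p (insert q {q<..<p}). h r) = h p + h q + (\<Sum>r\<in>{q<..<p}. h r)"
      using pq(1) by (simp add: add.assoc)
    also have "h p = (\<Sum>k<a (\<sigma> p). f (A (\<sigma> p) i k) * g (X (p, k) (q, j)))"
      unfolding h_def by (rule sum.cong) (use diag[OF pq(2) ij(1)] in auto)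
    also have "h q = (\<Sum>k<a (\<sigma> q). f (X (p, i) (q, k)) * g (A (\<sigma> q) k j))"
      unfolding h_def by (rule sum.cong) (use diag[OF qn _ ij(2)] in auto)
    also have "(\<Sum>r\<in>{q<..<p}. h r) = (\<Sum>w\<in>W \<times> W. s i j w * (f (fst w) * g (snd w)))"
    proof -
      have "f (X (p, i) (r, k)) * g (X (r, k) (q, j)) =
          (\<Sum>w\<in>W \<times> W. cf (X (p, i) (r, k)) (fst w) * cf (X (r, k) (q, j)) (snd w) * (f (fst w) * g (snd w)))"
        if "r \<in> {q<..<p}" "k < a (\<sigma> r)" for r k
      proof -
        have "X (p, i) (r, k) \<in> V.span W" "X (r, k) (q, j) \<in> V.span W" using inW ij that by auto
        then have "f (X (p, i) (r, k)) * g (X (r, k) (q, j)) =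
            (\<Sum>w\<in>W. cf (X (p, i) (r, k)) w * f w) * (\<Sum>w\<in>W. cf (X (r, k) (q, j)) w * g w)"
          using fcf fg by simp
        also have "\<dots> = (\<Sum>w\<in>W \<times> W. cf (X (p, i) (r, k)) (fst w) * cf (X (r, k) (q, j)) (snd w) * (f (fst w) * g (snd w)))"
          unfolding sum_product sum.cartesian_product by (simp add: case_prod_unfold mult_ac)
        finally show ?thesis .
      qed
      then have "(\<Sum>r\<in>{q<..<p}. h r) = (\<Sum>r\<in>{q<..<p}. \<Sum>k<a (\<sigma> r). \<Sum>w\<in>W \<times> W.
          cf (X (p, i) (r, k)) (fst w) * cf (X (r, k) (q, j)) (snd w) * (f (fst w) * g (snd w)))"
        unfolding h_def by simp
      also have "\<dots> = (\<Sum>r\<in>{q<..<p}. \<Sum>w\<in>W \<times> W. \<Sum>k<a (\<sigma> r).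
          cf (X (p, i) (r, k)) (fst w) * cf (X (r, k) (q, j)) (snd w) * (f (fst w) * g (snd w)))"
        by (rule sum.cong[OF refl], rule sum.swap)
      also have "\<dots> = (\<Sum>w\<in>W \<times> W. s i j w * (f (fst w) * g (snd w)))"
        unfolding s_def sum_distrib_right by (rule sum.swap)
      finally show ?thesis .
    qed
    finally show "convl C f g (X (p, i) (q, j)) = (\<Sum>k<a (\<sigma> p). f (A (\<sigma> p) i k) * g (X (p, k) (q, j))) +
        (\<Sum>k<a (\<sigma> q). f (X (p, i) (q, k)) * g (A (\<sigma> q) k j)) + (\<Sum>w\<in>W \<times> W. s i j w * (f (fst w) * g (snd w)))" .
  qed
  then show ?thesis by blast
qed

text \<open>Induction on the distance \<delta> below the diagonal. At distance zero an entry is zero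
  or belongs to one of finitely many diagonal blocks. The set W is uniform in the length n and in
  \<sigma>, so that it serves all comodules of one dimension vector.\<close>

lemma adapted_bounded:
  fixes C :: "('k::field, 'c::ab_group_add) coalg"
  assumes C: "coalgebra C"
    and Z: "\<And>\<kappa> \<kappa>'. \<kappa> < n0 \<Longrightarrow> \<kappa>' < n0 \<Longrightarrow> \<exists>W. finite W \<and> (\<forall>Y. extension C (a \<kappa>) (A \<kappa>) (a \<kappa>') (A \<kappa>') Y \<longrightarrow>
      (\<forall>i<a \<kappa>. \<forall>j<a \<kappa>'. Y i j \<in> module.span (cscale C) W))"
  shows "\<exists>W. finite W \<and> (\<forall>n \<sigma> X. adapted C n0 a A n \<sigma> X \<longrightarrow>
    (\<forall>p<n. \<forall>q<n. \<forall>i<a (\<sigma> p). \<forall>j<a (\<sigma> q). p \<le> q + \<delta> \<longrightarrow> X (p, i) (q, j) \<in> module.span (cscale C) W))"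
proof (induct \<delta>)
  case 0
  note cb = coalgebra_basic[OF C]
  interpret V: vector_space "cscale C" by (rule cb(1))
  let ?W = "\<Union>\<kappa>\<in>{..<n0}. \<Union>i\<in>{..<a \<kappa>}. \<Union>j\<in>{..<a \<kappa>}. {A \<kappa> i j}"
  have "X (p, i) (q, j) \<in> V.span ?W"
    if X: "adapted C n0 a A n \<sigma> X" and ij: "p < n" "q < n" "i < a (\<sigma> p)" "j < a (\<sigma> q)" "p \<le> q" for n \<sigma> X p q i j
  proof (cases "p = q")
    case True
    have "\<sigma> p < n0" "X (p, i) (p, j) = A (\<sigma> p) i j" using X ij True unfolding adapted_def by auto
    then have "X (p, i) (q, j) \<in> ?W" using ij True by blast
    then show ?thesis by (rule V.span_base)
  next
    case False
    then have "X (p, i) (q, j) = 0" using X ij unfolding adapted_def by auto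
    then show ?thesis by (simp add: V.span_zero)
  qed
  then show ?case by (intro exI[of _ ?W]) simp
next
  case (Suc \<delta>)
  note cb = coalgebra_basic[OF C]
  interpret V: vector_space "cscale C" by (rule cb(1))
  obtain W where W: "finite W" and "\<forall>n \<sigma> X. adapted C n0 a A n \<sigma> X \<longrightarrow>
    (\<forall>p<n. \<forall>q<n. \<forall>i<a (\<sigma> p). \<forall>j<a (\<sigma> q). p \<le> q + \<delta> \<longrightarrow> X (p, i) (q, j) \<in> V.span W)"
    using Suc by (elim exE conjE)
  then have bd: "\<And>n \<sigma> X p q i j. adapted C n0 a A n \<sigma> X \<Longrightarrow> p < n \<Longrightarrow> q < n \<Longrightarrow>
      i < a (\<sigma> p) \<Longrightarrow> j < a (\<sigma> q) \<Longrightarrow> p \<le> q + \<delta> \<Longrightarrow> X (p, i) (q, j) \<in> V.span W"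
    by simp
  have "\<exists>W'. finite W' \<and> (\<forall>Y. (\<exists>s. rel_extension C (a \<kappa>) (A \<kappa>) (a \<kappa>') (A \<kappa>') W s Y) \<longrightarrow>
    (\<forall>i<a \<kappa>. \<forall>j<a \<kappa>'. Y i j \<in> V.span W'))" if \<kappa>: "\<kappa> < n0" "\<kappa>' < n0" for \<kappa> \<kappa>'
  proof -
    obtain Z' where Z': "finite Z'" "\<forall>Y. extension C (a \<kappa>) (A \<kappa>) (a \<kappa>') (A \<kappa>') Y \<longrightarrow>
      (\<forall>i<a \<kappa>. \<forall>j<a \<kappa>'. Y i j \<in> V.span Z')"
      using Z[OF \<kappa>] by (elim exE conjE)
    from rel_extension_bounded[OF C W Z'] show ?thesis .
  qed
  then have "\<forall>\<kappa> \<kappa>'. \<exists>W'. \<kappa> < n0 \<longrightarrow> \<kappa>' < n0 \<longrightarrow> finite W' \<and> (\<forall>Y. (\<exists>s. rel_extension C (a \<kappa>) (A \<kappa>) (a \<kappa>') (A \<kappa>') W s Y) \<longrightarrow>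
    (\<forall>i<a \<kappa>. \<forall>j<a \<kappa>'. Y i j \<in> V.span W'))" by simp
  then obtain W' where W': "\<forall>\<kappa> \<kappa>'. \<kappa> < n0 \<longrightarrow> \<kappa>' < n0 \<longrightarrow> finite (W' \<kappa> \<kappa>') \<and>
    (\<forall>Y. (\<exists>s. rel_extension C (a \<kappa>) (A \<kappa>) (a \<kappa>') (A \<kappa>') W s Y) \<longrightarrow> (\<forall>i<a \<kappa>. \<forall>j<a \<kappa>'. Y i j \<in> V.span (W' \<kappa> \<kappa>')))"
    unfolding choice_iff by (elim exE)
  let ?W = "W \<union> (\<Union>\<kappa>\<in>{..<n0}. \<Union>\<kappa>'\<in>{..<n0}. W' \<kappa> \<kappa>')"
  have fin: "finite ?W" using W W' by simp
  have "X (p, i) (q, j) \<in> V.span ?W"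
    if X: "adapted C n0 a A n \<sigma> X" and ij: "p < n" "q < n" "i < a (\<sigma> p)" "j < a (\<sigma> q)" "p \<le> q + Suc \<delta>" for n \<sigma> X p q i j
  proof (cases "p \<le> q + \<delta>")
    case True
    have "V.span W \<subseteq> V.span ?W" by (rule V.span_mono) blast
    then show ?thesis using bd[OF X ij(1-4) True] by blast
  next
    case False
    have "\<exists>s. rel_extension C (a (\<sigma> p)) (A (\<sigma> p)) (a (\<sigma> q)) (A (\<sigma> q)) W s (\<lambda>i j. X (p, i) (q, j))"
    proof (rule adapted_rel_extension[OF C X W])
      show "q < p" using False by simp
      show "X (p, i) (r, j) \<in> V.span W" if "q < r" "r < p" "i < a (\<sigma> p)" "j < a (\<sigma> r)" for r i j
        by (rule bd[OF X]) (use that ij in auto)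
      show "X (r, i) (q, j) \<in> V.span W" if "q < r" "r < p" "i < a (\<sigma> r)" "j < a (\<sigma> q)" for r i j
        by (rule bd[OF X]) (use that ij in auto)
    qed (rule ij(1))
    moreover have \<sigma>: "\<sigma> p < n0" "\<sigma> q < n0" using X ij unfolding adapted_def by auto
    ultimately have "X (p, i) (q, j) \<in> V.span (W' (\<sigma> p) (\<sigma> q))" using W' ij(3,4) by blast
    moreover have "W' (\<sigma> p) (\<sigma> q) \<subseteq> ?W" using \<sigma> by blast
    ultimately show ?thesis using V.span_mono[of "W' (\<sigma> p) (\<sigma> q)" ?W] by blast
  qed
  then show ?case using fin by (intro exI[of _ ?W]) simp
qed

section \<open>Finite dimensional factors and adapted bases\<close>

lemma fin_dim_subspace:
  assumes "vector_space s" "module.subspace s N" "N \<subseteq> V" "fin_dim s V"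
  shows "fin_dim s N"
proof -
  interpret V: vector_space s by fact
  obtain F where F: "finite F" "V.span F = V" using assms(4) unfolding fin_dim_def by blast
  obtain B where B: "B \<subseteq> N" "V.independent B" "N \<subseteq> V.span B" by (rule V.maximal_independent_subset)
  have "finite B" using V.independent_span_bound[OF F(1) B(2)] B(1) assms(3) F(2) by blast
  moreover have "V.span B = N" using V.span_minimal[OF B(1) assms(2)] B(3) by blast
  ultimately show ?thesis unfolding fin_dim_def by blast
qed

lemma fin_dim_image:
  assumes "module s" "module s'" "module.subspace s V" "lin_on s s' V p" "fin_dim s V"
  shows "fin_dim s' (p ` V)"
proof -
  interpret V: module s by fact
  interpret U: module s' by fact
  obtain F where F: "finite F" "V.span F = V" using assms(5) unfolding fin_dim_def by blast
  have FV: "F \<subseteq> V" using V.span_superset[of F] F(2) by simp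
  have "p x \<in> U.span (p ` F)" if "x \<in> V" for x
  proof -
    have "x \<in> V.span F" using that F(2) by simp
    then obtain c where "x = (\<Sum>w\<in>F. s (c w) w)" unfolding V.span_finite[OF F(1)] by blast
    then have "p x = (\<Sum>w\<in>F. s' (c w) (p w))"
      using lin_on_lincomb[OF assms(4,1,2,3), of F "\<lambda>w. w" c] FV by auto
    then show ?thesis by (simp only:) (intro U.span_sum U.span_scale U.span_base imageI)
  qed
  moreover have "U.span (p ` F) \<subseteq> p ` V"
  proof (rule U.span_minimal)
    show "p ` F \<subseteq> p ` V" using FV by blast
    show "U.subspace (p ` V)"
    proof (rule U.subspaceI)
      have "p 0 = 0" by (rule lin_on_0[OF assms(4,1,2) V.subspace_0[OF assms(3)]])
      then show "0 \<in> p ` V" using V.subspace_0[OF assms(3)] by (metis imageI)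
    next
      fix x y assume "x \<in> p ` V" "y \<in> p ` V"
      then obtain x' y' where "x' \<in> V" "y' \<in> V" "x = p x'" "y = p y'" by blast
      then show "x + y \<in> p ` V" using lin_on_add[OF assms(4)] V.subspace_add[OF assms(3)] by (metis imageI)
    next
      fix r x assume "x \<in> p ` V"
      then obtain x' where "x' \<in> V" "x = p x'" by blast
      then show "s' r x \<in> p ` V" using lin_on_scale[OF assms(4)] V.subspace_scale[OF assms(3)] by (metis imageI)
    qed
  qed
  ultimately have "U.span (p ` F) = p ` V" by blast
  then show ?thesis using F(1) unfolding fin_dim_def by blast
qed

lemma jordan_hoelder_fin_dim:
  assumes C: "coalgebra C" and M: "comodule C M" and jh: "jordan_hoelder_series C M Ms Ss" and k: "k < length Ss"
    and fd: "fin_dim (mscale M) (mspace M)"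
  shows "fin_dim (mscale (Ss ! k)) (mspace (Ss ! k))"
proof -
  note c = jordan_hoelder_comodules[OF M jh]
  note m = comodule_basic[OF M]
  have cc: "comodule C (Ms ! Suc k)" "comodule C (Ss ! k)" using c k by simp_all
  obtain p where p: "p ` mspace (Ms ! Suc k) = mspace (Ss ! k)"
    "lin_on (mscale M) (mscale (Ss ! k)) (mspace (Ms ! Suc k)) p"
    using jordan_hoelder_quotient[OF C M jh k] by blast
  have ch: "mscale (Ms ! Suc k) = mscale M" "mspace (Ms ! Suc k) \<subseteq> mspace M"
    using jordan_hoelder_chain[OF C M jh, of "Suc k"] k by auto
  have sub: "module.subspace (mscale M) (mspace (Ms ! Suc k))" using comodule_basic(3)[OF cc(1)] ch(1) by simp
  show ?thesis
    unfolding p(1)[symmetric]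
    by (rule fin_dim_image[OF m(2) comodule_basic(2)[OF cc(2)] sub p(2) fin_dim_subspace[OF m(1) sub ch(2) fd]])
qed

text \<open>A basis of the kernel together with lifts of a basis of the image. One family e contains
  both, indexed by I and through \<iota>, which fits the growing index sets of an adapted
  basis.\<close>

lemma basis_fam_extend:
  assumes s: "module s" "module s'" and V: "module.subspace s V" and p: "lin_on s s' V p" "p ` V = U" "{x \<in> V. p x = 0} = N"
    and I: "basis_fam s I e N" and J: "basis_fam s' J u U" and inj: "inj_on \<iota> J" "\<iota> ` J \<inter> I = {}"
    and eJ: "\<And>j. j \<in> J \<Longrightarrow> e (\<iota> j) \<in> V \<and> p (e (\<iota> j)) = u j"
  shows "basis_fam s (I \<union> \<iota> ` J) e V"
proof -
  interpret V: module s by fact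
  interpret U: module s' by fact
  have fin: "finite I" "finite J" using I J by (simp_all add: basis_fam_def)
  have NV: "N \<subseteq> V" using p(3) by blast
  have eI: "e i \<in> N" if "i \<in> I" for i using I that unfolding basis_fam_def by blast
  have sum: "(\<Sum>i\<in>I \<union> \<iota> ` J. s (c i) (e i)) = (\<Sum>i\<in>I. s (c i) (e i)) + (\<Sum>j\<in>J. s (c (\<iota> j)) (e (\<iota> j)))" for c
  proof -
    have "(\<Sum>i\<in>I \<union> \<iota> ` J. s (c i) (e i)) = (\<Sum>i\<in>I. s (c i) (e i)) + (\<Sum>i\<in>\<iota> ` J. s (c i) (e i))"
      by (rule sum.union_disjoint) (use fin inj in auto)
    then show ?thesis by (simp add: sum.reindex[OF inj(1)])
  qed
  have pJ: "p (\<Sum>j\<in>J. s (c j) (e (\<iota> j))) = (\<Sum>j\<in>J. s' (c j) (u j))" for c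
    using lin_on_lincomb[OF p(1) s V, of J "\<lambda>j. e (\<iota> j)" c] eJ by simp
  have JV: "(\<Sum>j\<in>J. s (c j) (e (\<iota> j))) \<in> V" for c
    by (intro V.subspace_sum[OF V] V.subspace_scale[OF V]) (use eJ in blast)
  show ?thesis unfolding basis_fam_def
  proof (intro conjI ballI allI impI)
    show "finite (I \<union> \<iota> ` J)" using fin by simp
    show "e ` (I \<union> \<iota> ` J) \<subseteq> V" using eI NV eJ by blast
  next
    fix x assume x: "x \<in> V"
    then have "p x \<in> U" using p(2) by blast
    then obtain c where c: "p x = (\<Sum>j\<in>J. s' (c j) (u j))" using J unfolding basis_fam_def by blast
    \<comment> \<open>A lift of p x; subtracting it from x leaves an element of the kernel.\<close>
    let ?y = "\<Sum>j\<in>J. s (c j) (e (\<iota> j))"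
    have "p (x - ?y) = 0" using lin_on_diff[OF p(1) s V x JV] pJ c by simp
    then have "x - ?y \<in> N" using p(3) V.subspace_diff[OF V x JV] by blast
    then obtain d where d: "x - ?y = (\<Sum>i\<in>I. s (d i) (e i))" using I unfolding basis_fam_def by blast
    define c' where "c' k = (if k \<in> I then d k else c (inv_into J \<iota> k))" for k
    have "(\<Sum>i\<in>I. s (c' i) (e i)) = (\<Sum>i\<in>I. s (d i) (e i))" by (rule sum.cong) (simp_all add: c'_def)
    moreover have "(\<Sum>j\<in>J. s (c' (\<iota> j)) (e (\<iota> j))) = ?y"
    proof (rule sum.cong[OF refl])
      fix j assume j: "j \<in> J"
      then have "\<iota> j \<notin> I" using inj(2) by blast
      then show "s (c' (\<iota> j)) (e (\<iota> j)) = s (c j) (e (\<iota> j))" using inv_into_f_f[OF inj(1) j] by (simp add: c'_def)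
    qed
    ultimately have "x = (\<Sum>i\<in>I \<union> \<iota> ` J. s (c' i) (e i))" unfolding sum using d by (simp add: diff_eq_eq)
    then show "\<exists>c. x = (\<Sum>i\<in>I \<union> \<iota> ` J. s (c i) (e i))" by (intro exI[of _ c'])
  next
    fix c k assume *: "(\<Sum>i\<in>I \<union> \<iota> ` J. s (c i) (e i)) = 0" and k: "k \<in> I \<union> \<iota> ` J"
    let ?x = "\<Sum>i\<in>I. s (c i) (e i)" and ?y = "\<Sum>j\<in>J. s (c (\<iota> j)) (e (\<iota> j))"
    have N: "V.subspace N"
      unfolding p(3)[symmetric]
      by (rule V.subspaceI)
        (use V.subspace_0[OF V] V.subspace_add[OF V] V.subspace_scale[OF V] lin_on_0[OF p(1) s] lin_on_add[OF p(1)]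
          lin_on_scale[OF p(1)] in auto)
    have "?x \<in> N" by (intro V.subspace_sum[OF N] V.subspace_scale[OF N] eI)
    then have x: "?x \<in> V" "p ?x = 0" using p(3) by blast+
    have "p (?x + ?y) = p ?x + p ?y" by (rule lin_on_add[OF p(1) x(1) JV])
    moreover have xy: "?x + ?y = 0" using * sum by simp
    moreover have "p 0 = 0" by (rule lin_on_0[OF p(1) s V.subspace_0[OF V]])
    ultimately have "(\<Sum>j\<in>J. s' (c (\<iota> j)) (u j)) = 0" using x(2) pJ by simp
    then have cJ: "\<forall>j\<in>J. c (\<iota> j) = 0"
      using J unfolding basis_fam_def by (elim conjE allE[of _ "\<lambda>j. c (\<iota> j)"]) simp
    then have "?y = 0" by (intro sum.neutral) simp
    then have "?x = 0" using xy by simp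
    then have "\<forall>i\<in>I. c i = 0" using I unfolding basis_fam_def by blast
    then show "c k = 0" using k cJ by blast
  qed
qed

text \<open>Each projection of the series is composed with an isomorphism onto the chosen T
  (\<sigma> k), whose basis is then lifted. In this way the diagonal blocks are equal, and not only
  similar, to the fixed matrices A (\<sigma> k).\<close>

lemma ex_adapted:
  fixes T :: "nat \<Rightarrow> ('k::field, 'c::ab_group_add) std_comod" and M :: "('k, 'c) std_comod"
  assumes C: "coalgebra C" and M: "comodule C M" and jh: "jordan_hoelder_series C M Ms Ss"
    and T: "\<And>\<kappa>. \<kappa> < n0 \<Longrightarrow> comodule C (T \<kappa>)"
      "\<And>\<kappa>. \<kappa> < n0 \<Longrightarrow> basis_fam (mscale (T \<kappa>)) {..<a \<kappa>} (u \<kappa>) (mspace (T \<kappa>))"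
      "\<And>\<kappa>. \<kappa> < n0 \<Longrightarrow> matrix_of C (T \<kappa>) {..<a \<kappa>} (u \<kappa>) (A \<kappa>)"
    and \<sigma>: "\<And>k. k < length Ss \<Longrightarrow> \<sigma> k < n0 \<and> comod_iso C (Ss ! k) (T (\<sigma> k))"
  shows "\<exists>e X. basis_fam (mscale M) (index_set a \<sigma> (length Ss)) e (mspace M) \<and>
    matrix_of C M (index_set a \<sigma> (length Ss)) e X \<and> adapted C n0 a A (length Ss) \<sigma> X"
proof -
  define n where "n = length Ss"
  note m = comodule_basic[OF M] and cb = coalgebra_basic[OF C]
  interpret M: vector_space "mscale M" by (rule m(1))
  note c = jordan_hoelder_comodules[OF M jh, folded n_def]
  note ch = jordan_hoelder_chain[OF C M jh, folded n_def]
  have lfl: "lin_on (cscale C) (*) (cspace C) f" if "lfun (cscale C) f" for f by (rule lin_on_subset[OF that]) simp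
  have sub: "M.subspace (mspace (Ms ! k))" if "k \<le> n" for k
    using comodule_basic(3)[OF c(1)[OF that]] ch[OF that] by simp
  have "\<exists>p. p ` mspace (Ms ! Suc k) = mspace (T (\<sigma> k)) \<and>
      lin_on (mscale M) (mscale (T (\<sigma> k))) (mspace (Ms ! Suc k)) p \<and>
      (\<forall>f. lfun (cscale C) f \<longrightarrow> (\<forall>x\<in>mspace (Ms ! Suc k). p (cact M f x) = cact (T (\<sigma> k)) f (p x))) \<and>
      {x \<in> mspace (Ms ! Suc k). p x = 0} = mspace (Ms ! k)" if k: "k < n" for k
  proof -
    have kS: "k < length Ss" using k by (simp add: n_def)
    have \<sigma>k: "\<sigma> k < n0" using \<sigma>[OF kS] by simp
    note cS = c(2)[OF k] and cT = T(1)[OF \<sigma>k]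
    note sS = comodule_basic[OF cS] and sT = comodule_basic[OF cT]
    obtain p where p: "p ` mspace (Ms ! Suc k) = mspace (Ss ! k)"
      "lin_on (mscale M) (mscale (Ss ! k)) (mspace (Ms ! Suc k)) p"
      "\<forall>f. lfun (cscale C) f \<longrightarrow> (\<forall>x\<in>mspace (Ms ! Suc k). p (cact M f x) = cact (Ss ! k) f (p x))"
      "{x \<in> mspace (Ms ! Suc k). p x = 0} = mspace (Ms ! k)"
      using jordan_hoelder_quotient[OF C M jh kS] by (elim conjE exE)
    obtain g where g: "iso_by (cscale C) (Ss ! k) (T (\<sigma> k)) g"
      using \<sigma>[OF kS] unfolding comod_iso_iff[OF C cS cT] by blast
    have bij: "bij_betw g (mspace (Ss ! k)) (mspace (T (\<sigma> k)))"
      and lg: "lin_on (mscale (Ss ! k)) (mscale (T (\<sigma> k))) (mspace (Ss ! k)) g"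
      and cg: "\<And>f x. lfun (cscale C) f \<Longrightarrow> x \<in> mspace (Ss ! k) \<Longrightarrow> g (cact (Ss ! k) f x) = cact (T (\<sigma> k)) f (g x)"
      using g unfolding iso_by_def by blast+
    have pin: "p x \<in> mspace (Ss ! k)" if "x \<in> mspace (Ms ! Suc k)" for x using p(1) that by blast
    have g0: "g 0 = 0" by (rule lin_on_0[OF lg sS(2) sT(2) module.subspace_0[OF sS(2,3)]])
    have gz: "g y = 0 \<longleftrightarrow> y = 0" if "y \<in> mspace (Ss ! k)" for y
      using bij g0 that module.subspace_0[OF sS(2,3)] unfolding bij_betw_def inj_on_def by metis
    show ?thesis
    proof (intro exI[of _ "\<lambda>x. g (p x)"] conjI allI impI ballI)
      show "(\<lambda>x. g (p x)) ` mspace (Ms ! Suc k) = mspace (T (\<sigma> k))"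
        using p(1) bij unfolding bij_betw_def by (metis image_image)
      show "lin_on (mscale M) (mscale (T (\<sigma> k))) (mspace (Ms ! Suc k)) (\<lambda>x. g (p x))"
        by (rule lin_on_comp[OF p(2) lg]) (use p(1) in simp)
      show "g (p (cact M f x)) = cact (T (\<sigma> k)) f (g (p x))" if "lfun (cscale C) f" "x \<in> mspace (Ms ! Suc k)" for f x
        using p(3) cg[OF that(1) pin[OF that(2)]] that by simp
      show "{x \<in> mspace (Ms ! Suc k). g (p x) = 0} = mspace (Ms ! k)"
        unfolding p(4)[symmetric] using gz pin by blast
    qed
  qed
  then have "\<forall>k. \<exists>p. k < n \<longrightarrow> p ` mspace (Ms ! Suc k) = mspace (T (\<sigma> k)) \<and>
      lin_on (mscale M) (mscale (T (\<sigma> k))) (mspace (Ms ! Suc k)) p \<and>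
      (\<forall>f. lfun (cscale C) f \<longrightarrow> (\<forall>x\<in>mspace (Ms ! Suc k). p (cact M f x) = cact (T (\<sigma> k)) f (p x))) \<and>
      {x \<in> mspace (Ms ! Suc k). p x = 0} = mspace (Ms ! k)" by simp
  then obtain P where "\<forall>k. k < n \<longrightarrow> P k ` mspace (Ms ! Suc k) = mspace (T (\<sigma> k)) \<and>
      lin_on (mscale M) (mscale (T (\<sigma> k))) (mspace (Ms ! Suc k)) (P k) \<and>
      (\<forall>f. lfun (cscale C) f \<longrightarrow> (\<forall>x\<in>mspace (Ms ! Suc k). P k (cact M f x) = cact (T (\<sigma> k)) f (P k x))) \<and>
      {x \<in> mspace (Ms ! Suc k). P k x = 0} = mspace (Ms ! k)"
    unfolding choice_iff by (elim exE)
  then have P: "\<And>k. k < n \<Longrightarrow> P k ` mspace (Ms ! Suc k) = mspace (T (\<sigma> k))"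
    "\<And>k. k < n \<Longrightarrow> lin_on (mscale M) (mscale (T (\<sigma> k))) (mspace (Ms ! Suc k)) (P k)"
    "\<And>k f x. k < n \<Longrightarrow> lfun (cscale C) f \<Longrightarrow> x \<in> mspace (Ms ! Suc k) \<Longrightarrow> P k (cact M f x) = cact (T (\<sigma> k)) f (P k x)"
    "\<And>k. k < n \<Longrightarrow> {x \<in> mspace (Ms ! Suc k). P k x = 0} = mspace (Ms ! k)" by simp_all
  have \<sigma>n: "\<sigma> k < n0" if "k < n" for k using \<sigma>[of k] that by (simp add: n_def)
  define e where "e = (\<lambda>(k, i). inv_into (mspace (Ms ! Suc k)) (P k) (u (\<sigma> k) i))"
  have e: "e (k, i) \<in> mspace (Ms ! Suc k)" "P k (e (k, i)) = u (\<sigma> k) i" if "k < n" "i < a (\<sigma> k)" for k i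
  proof -
    have "u (\<sigma> k) i \<in> P k ` mspace (Ms ! Suc k)"
      using T(2)[OF \<sigma>n[OF that(1)]] that(2) P(1)[OF that(1)] unfolding basis_fam_def by auto
    then show "e (k, i) \<in> mspace (Ms ! Suc k)" "P k (e (k, i)) = u (\<sigma> k) i"
      unfolding e_def by (simp_all add: inv_into_into f_inv_into_f)
  qed
  have idx_Suc: "index_set a \<sigma> (Suc k) = index_set a \<sigma> k \<union> Pair k ` {..<a (\<sigma> k)}" for k
    by (auto simp: index_set_def less_Suc_eq)
  have bas: "basis_fam (mscale M) (index_set a \<sigma> k) e (mspace (Ms ! k))" if "k \<le> n" for k
    using that
  proof (induct k)
    case 0
    have "mspace (Ms ! 0) = {0}" using jh by (simp add: jordan_hoelder_series_def)
    then show ?case by (simp add: basis_fam_def index_set_def)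
  next
    case (Suc k)
    then have k: "k < n" by simp
    show ?case unfolding idx_Suc
      by (rule basis_fam_extend[OF m(2) comodule_basic(2)[OF T(1)[OF \<sigma>n[OF k]]] sub[OF Suc.prems] P(2)[OF k] P(1)[OF k]
            P(4)[OF k] Suc.hyps T(2)[OF \<sigma>n[OF k]]])
        (use k e in \<open>auto simp: inj_on_def index_set_def\<close>)
  qed
  have Mn: "Ms ! n = M" using jh by (simp add: jordan_hoelder_series_def n_def)
  have bM: "basis_fam (mscale M) (index_set a \<sigma> n) e (mspace M)" using bas[of n] Mn by simp
  obtain X where X: "matrix_of C M (index_set a \<sigma> n) e X" using comodule_matrix[OF C M bM] by blast
  have act: "cact M f (e (p, i)) = (\<Sum>k\<in>index_set a \<sigma> n. mscale M (f (X (p, i) k)) (e k))"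
    if "lfun (cscale C) f" "p < n" "i < a (\<sigma> p)" for f p i
    using X lfl[OF that(1)] that(2,3) unfolding matrix_of_def index_set_def by auto
  \<comment> \<open>The operators preserve \<open>Ms ! Suc p\<close>, which is spanned by the basis
    vectors in positions up to p, so coefficients in later positions vanish.\<close>
  have zero: "f (X (p, i) (q, j)) = 0"
    if f: "lfun (cscale C) f" and pq: "p < q" "q < n" and ij: "i < a (\<sigma> p)" "j < a (\<sigma> q)" for f p q i j
  proof -
    have p: "p < n" "Suc p \<le> n" using pq by auto
    have "cact (Ms ! Suc p) f (e (p, i)) \<in> mspace (Ms ! Suc p)" by (rule cact_in[OF c(1)[OF p(2)] e(1)[OF p(1) ij(1)]])
    then have "cact M f (e (p, i)) \<in> mspace (Ms ! Suc p)" using ch[OF p(2)] f e(1)[OF p(1) ij(1)] by simp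
    then obtain d where d: "cact M f (e (p, i)) = (\<Sum>k\<in>index_set a \<sigma> (Suc p). mscale M (d k) (e k))"
      using bas[OF p(2)] unfolding basis_fam_def by blast
    define d' where "d' k = (if k \<in> index_set a \<sigma> (Suc p) then d k else 0)" for k
    have sb: "index_set a \<sigma> (Suc p) \<subseteq> index_set a \<sigma> n" using p(2) by (auto simp: index_set_def)
    have "(\<Sum>k\<in>index_set a \<sigma> n. mscale M (d' k) (e k)) = (\<Sum>k\<in>index_set a \<sigma> (Suc p). mscale M (d' k) (e k))"
      by (rule sum.mono_neutral_right) (use sb bM in \<open>auto simp: d'_def basis_fam_def\<close>)
    also have "\<dots> = (\<Sum>k\<in>index_set a \<sigma> (Suc p). mscale M (d k) (e k))"
      by (rule sum.cong) (simp_all add: d'_def)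
    finally have "(\<Sum>k\<in>index_set a \<sigma> n. mscale M (f (X (p, i) k)) (e k)) = (\<Sum>k\<in>index_set a \<sigma> n. mscale M (d' k) (e k))"
      using act[OF f p(1) ij(1)] d by simp
    then have "f (X (p, i) (q, j)) = d' (q, j)"
      by (rule basis_fam_unique[OF bM m(2)]) (use pq ij in \<open>simp add: index_set_def\<close>)
    then show ?thesis using pq by (simp add: d'_def index_set_def)
  qed
  \<comment> \<open>Both sides are coefficients of the image under P p of the action on e (p, i);
    the part from earlier positions lies in the kernel of P p.\<close>
  have diag: "f (X (p, i) (p, j)) = f (A (\<sigma> p) i j)"
    if f: "lfun (cscale C) f" and p: "p < n" and ij: "i < a (\<sigma> p)" "j < a (\<sigma> p)" for f p i j
  proof -
    let ?I = "index_set a \<sigma> p"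
    let ?y = "\<Sum>k\<in>?I. mscale M (f (X (p, i) k)) (e k)" and ?z = "\<Sum>j<a (\<sigma> p). mscale M (f (X (p, i) (p, j))) (e (p, j))"
    note cT = T(1)[OF \<sigma>n[OF p]]
    note sT = comodule_basic[OF cT]
    have sb: "index_set a \<sigma> (Suc p) \<subseteq> index_set a \<sigma> n" using p by (auto simp: index_set_def)
    have "cact M f (e (p, i)) = (\<Sum>k\<in>index_set a \<sigma> (Suc p). mscale M (f (X (p, i) k)) (e k))"
      unfolding act[OF f p ij(1)]
    proof (rule sum.mono_neutral_right)
      show "finite (index_set a \<sigma> n)" using bM by (simp add: basis_fam_def)
      show "\<forall>k\<in>index_set a \<sigma> n - index_set a \<sigma> (Suc p). mscale M (f (X (p, i) k)) (e k) = 0"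
      proof
        fix k assume k: "k \<in> index_set a \<sigma> n - index_set a \<sigma> (Suc p)"
        obtain q j where qj: "k = (q, j)" by (cases k)
        then have "q < n" "j < a (\<sigma> q)" "p < q" using k by (auto simp: index_set_def)
        then show "mscale M (f (X (p, i) k)) (e k) = 0" using zero[OF f _ _ ij(1)] qj by simp
      qed
    qed (rule sb)
    also have "\<dots> = ?y + ?z"
    proof -
      have "(\<Sum>k\<in>?I \<union> Pair p ` {..<a (\<sigma> p)}. mscale M (f (X (p, i) k)) (e k)) =
          ?y + (\<Sum>k\<in>Pair p ` {..<a (\<sigma> p)}. mscale M (f (X (p, i) k)) (e k))"
        by (rule sum.union_disjoint) (auto simp: index_set_def)
      then show ?thesis unfolding idx_Suc by (simp add: sum.reindex inj_on_def)
    qed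
    finally have cy: "cact M f (e (p, i)) = ?y + ?z" .
    have pn: "p \<le> n" "Suc p \<le> n" using p by auto
    have eN: "e k \<in> mspace (Ms ! p)" if "k \<in> ?I" for k using bas[OF pn(1)] that unfolding basis_fam_def by blast
    have "?y \<in> mspace (Ms ! p)"
      by (intro M.subspace_sum[OF sub[OF pn(1)]] M.subspace_scale[OF sub[OF pn(1)]] eN)
    then have y: "?y \<in> mspace (Ms ! Suc p)" "P p ?y = 0" using P(4)[OF p] by blast+
    have z: "?z \<in> mspace (Ms ! Suc p)"
      by (intro M.subspace_sum[OF sub[OF pn(2)]] M.subspace_scale[OF sub[OF pn(2)]] e(1)[OF p]) simp
    have "P p ?z = (\<Sum>j<a (\<sigma> p). mscale (T (\<sigma> p)) (f (X (p, i) (p, j))) (P p (e (p, j))))"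
      by (rule lin_on_lincomb[OF P(2)[OF p] m(2) sT(2) sub[OF pn(2)]]) (use e(1)[OF p] in simp)
    also have "\<dots> = (\<Sum>j<a (\<sigma> p). mscale (T (\<sigma> p)) (f (X (p, i) (p, j))) (u (\<sigma> p) j))"
      using e(2)[OF p] by simp
    finally have "P p (cact M f (e (p, i))) = (\<Sum>j<a (\<sigma> p). mscale (T (\<sigma> p)) (f (X (p, i) (p, j))) (u (\<sigma> p) j))"
      unfolding cy using lin_on_add[OF P(2)[OF p] y(1) z] y(2) by simp
    moreover have "P p (cact M f (e (p, i))) = (\<Sum>j<a (\<sigma> p). mscale (T (\<sigma> p)) (f (A (\<sigma> p) i j)) (u (\<sigma> p) j))"
      unfolding P(3)[OF p f e(1)[OF p ij(1)]] e(2)[OF p ij(1)]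
      using T(3)[OF \<sigma>n[OF p]] lfl[OF f] ij(1) unfolding matrix_of_def by simp
    ultimately show ?thesis
      by (intro basis_fam_unique[OF T(2)[OF \<sigma>n[OF p]] sT(2)]) (use ij in simp_all)
  qed
  have "adapted C n0 a A n \<sigma> X"
    unfolding adapted_def
  proof (intro conjI allI impI)
    show "matrix_coalg C (index_set a \<sigma> n) X" by (rule matrix_of_coalg[OF C M bM X])
    show "\<sigma> p < n0" if "p < n" for p by (rule \<sigma>n[OF that])
    have z: "f 0 = 0" if "lfun (cscale C) f" for f using lin_on_0[OF that cb(2) module_times] by simp
    show "X (p, i) (q, j) = 0" if "p < n" "q < n" "i < a (\<sigma> p)" "j < a (\<sigma> q)" "p < q" for p q i j
      by (rule functional_eqI[OF cb(1)]) (simp only: zero[OF _ that(5,2,3,4)] z)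
    show "X (p, i) (p, j) = A (\<sigma> p) i j" if "p < n" "i < a (\<sigma> p)" "j < a (\<sigma> p)" for p i j
      by (rule functional_eqI[OF cb(1)]) (rule diag[OF _ that])
  qed
  then show ?thesis using bM X unfolding n_def by blast
qed

text \<open>Over a finite field the product of all T - x, plus 1, is a nonconstant polynomial
  without roots.\<close>

lemma infinite_alg_closed_field: "infinite (UNIV :: 'k::alg_closed_field set)"
proof
  assume fin: "finite (UNIV :: 'k set)"
  define p where "p = (\<Prod>x\<in>(UNIV :: 'k set). [:- x, 1:]) + 1"
  have d: "degree (\<Prod>x\<in>(UNIV :: 'k set). [:- x, 1:]) = card (UNIV :: 'k set)"
    by (subst degree_prod_eq_sum_degree) auto
  have "0 < card (UNIV :: 'k set)" using fin by (simp add: card_gt_0_iff)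
  then have "degree p = card (UNIV :: 'k set)" unfolding p_def d[symmetric] by (intro degree_add_eq_left) (simp add: d)
  then obtain z where "poly p z = 0" using alg_closed_imp_poly_has_root[of p] \<open>0 < card _\<close> by auto
  moreover have "poly p z = 1" using fin by (simp add: p_def poly_prod prod_zero_iff)
  ultimately show False by simp
qed

text \<open>M0 provides finite dimensional representatives, with fixed matrices, of all simple types
  occurring in v. Any M with this vector has factors isomorphic to these and therefore an adapted
  matrix with these diagonal blocks.\<close>

lemma ex_supporting_subcoalgebra:
  fixes C :: "('k::field, 'c::ab_group_add) coalg" and M0 :: "('k, 'c) std_comod"
  assumes inf: "infinite (UNIV :: 'k set)" and C: "coalgebra C"
    and tame: "\<And>H. subcoalgebra H C \<Longrightarrow> fin_dim (cscale H) (cspace H) \<Longrightarrow> tame H"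
    and M0: "comodule C M0" "fin_dim (mscale M0) (mspace M0)" "has_dim_vector C M0 v"
  shows "\<exists>H. subcoalgebra H C \<and> fin_dim (cscale H) (cspace H) \<and>
    (\<forall>M. comodule C M \<and> has_dim_vector C M v \<longrightarrow> supported_on H M)"
proof -
  note cb = coalgebra_basic[OF C]
  interpret V: vector_space "cscale C" by (rule cb(1))
  obtain Ms0 Ts where jh0: "jordan_hoelder_series C M0 Ms0 Ts"
    and v0: "\<And>i. i \<in> simple_types C \<Longrightarrow> Poly_Mapping.lookup v i = card {k. k < length Ts \<and> Ts ! k \<in> i}"
    using M0(3) unfolding has_dim_vector_def by blast
  define n0 where "n0 = length Ts"
  have simT: "simple_comodule C (Ts ! \<kappa>)" if "\<kappa> < n0" for \<kappa>
    using jh0 that by (simp add: jordan_hoelder_series_def n0_def)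
  have cT: "comodule C (Ts ! \<kappa>)" if "\<kappa> < n0" for \<kappa> using simT[OF that] by (simp add: simple_comodule_def)
  have "\<exists>d e. basis_fam (mscale (Ts ! \<kappa>)) {..<d::nat} e (mspace (Ts ! \<kappa>))" if "\<kappa> < n0" for \<kappa>
    by (rule fin_dim_basis_fam[OF comodule_basic(1)[OF cT[OF that]]
          jordan_hoelder_fin_dim[OF C M0(1) jh0 that[unfolded n0_def] M0(2)]])
  then have "\<forall>\<kappa>. \<exists>d::nat. \<exists>e. \<kappa> < n0 \<longrightarrow> basis_fam (mscale (Ts ! \<kappa>)) {..<d} e (mspace (Ts ! \<kappa>))" by blast
  then obtain a :: "nat \<Rightarrow> nat" and u where u: "\<forall>\<kappa>. \<kappa> < n0 \<longrightarrow> basis_fam (mscale (Ts ! \<kappa>)) {..<a \<kappa>} (u \<kappa>) (mspace (Ts ! \<kappa>))"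
    unfolding choice_iff by (elim exE) (rule that)
  then have "\<forall>\<kappa>. \<exists>A. \<kappa> < n0 \<longrightarrow> matrix_of C (Ts ! \<kappa>) {..<a \<kappa>} (u \<kappa>) A"
    using comodule_matrix[OF C cT] by blast
  then obtain A where A: "\<forall>\<kappa>. \<kappa> < n0 \<longrightarrow> matrix_of C (Ts ! \<kappa>) {..<a \<kappa>} (u \<kappa>) (A \<kappa>)"
    unfolding choice_iff by (elim exE)
  have Z: "\<exists>W. finite W \<and> (\<forall>Y. extension C (a \<kappa>) (A \<kappa>) (a \<kappa>') (A \<kappa>') Y \<longrightarrow>
      (\<forall>i<a \<kappa>. \<forall>j<a \<kappa>'. Y i j \<in> V.span W))" if "\<kappa> < n0" "\<kappa>' < n0" for \<kappa> \<kappa>'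
    by (rule extension_bounded[OF inf C tame simT[OF that(1)] simT[OF that(2)]
          u[rule_format, OF that(1)] u[rule_format, OF that(2)] A[rule_format, OF that(1)] A[rule_format, OF that(2)]])
  \<comment> \<open>Bounds the length of the series that witness the vector v; distance N from the
    diagonal then covers whole matrices.\<close>
  define N where "N = (\<Sum>i\<in>Poly_Mapping.keys v. Poly_Mapping.lookup v i)"
  have "\<exists>W. finite W \<and> (\<forall>n \<sigma> X. adapted C n0 a A n \<sigma> X \<longrightarrow>
    (\<forall>p<n. \<forall>q<n. \<forall>i<a (\<sigma> p). \<forall>j<a (\<sigma> q). p \<le> q + N \<longrightarrow> X (p, i) (q, j) \<in> V.span W))"
    by (rule adapted_bounded[OF C]) (rule Z)
  then obtain W where W: "finite W" "\<forall>n \<sigma> X. adapted C n0 a A n \<sigma> X \<longrightarrow>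
    (\<forall>p<n. \<forall>q<n. \<forall>i<a (\<sigma> p). \<forall>j<a (\<sigma> q). p \<le> q + N \<longrightarrow> X (p, i) (q, j) \<in> V.span W)"
    by (elim exE conjE)
  \<comment> \<open>All adapted matrices of length at most N at once. Their entries span a
    subcoalgebra, which is finite dimensional because they lie in the span of W.\<close>
  define R where "R = {(n, \<sigma>, X). n \<le> N \<and> adapted C n0 a A n \<sigma> X}"
  define I where "I r = (case r of (n, \<sigma>, X) \<Rightarrow> index_set a \<sigma> n)" for r :: "nat \<times> (nat \<Rightarrow> nat) \<times> (nat \<times> nat \<Rightarrow> nat \<times> nat \<Rightarrow> 'c)"
  define Xr where "Xr r = snd (snd r)" for r :: "nat \<times> (nat \<Rightarrow> nat) \<times> (nat \<times> nat \<Rightarrow> nat \<times> nat \<Rightarrow> 'c)"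
  define G where "G = (\<Union>r\<in>R. \<Union>i\<in>I r. \<Union>j\<in>I r. {Xr r i j})"
  have "\<exists>H. subcoalgebra H C \<and> cspace H = V.span G"
  proof (rule subcoalgebra_of_matrices[OF C _ _ G_def])
    show "matrix_coalg C (I r) (Xr r)" if "r \<in> R" for r
      using that unfolding R_def I_def Xr_def adapted_def by auto
    show "finite (I r)" for r by (cases r) (simp add: I_def index_set_def)
  qed
  then obtain H where H: "subcoalgebra H C" "cspace H = V.span G" by blast
  have GW: "G \<subseteq> V.span W"
  proof
    fix x assume "x \<in> G"
    then obtain n \<sigma> X k l where r: "n \<le> N" "adapted C n0 a A n \<sigma> X" "k \<in> index_set a \<sigma> n" "l \<in> index_set a \<sigma> n" "x = X k l"
      unfolding G_def R_def I_def Xr_def by auto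
    obtain p i q j where "k = (p, i)" "l = (q, j)" by (cases k, cases l)
    then show "x \<in> V.span W" using r W(2)[rule_format, OF r(2), of p q i j] by (simp add: index_set_def)
  qed
  have "fin_dim (cscale H) (cspace H)"
    unfolding subcoalgebra_basic(3)[OF H(1)] H(2)
    by (rule fin_dim_subspace[OF cb(1) V.subspace_span V.span_minimal[OF GW V.subspace_span]])
      (use W(1) in \<open>auto simp: fin_dim_def\<close>)
  moreover have "supported_on H M" if M: "comodule C M" "has_dim_vector C M v" for M
  proof -
    obtain Ms Ss where jh: "jordan_hoelder_series C M Ms Ss"
      and v: "\<And>i. i \<in> simple_types C \<Longrightarrow> Poly_Mapping.lookup v i = card {k. k < length Ss \<and> Ss ! k \<in> i}"
      using M(2) unfolding has_dim_vector_def by blast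
    have ty: "iso_class C (Ss ! k) \<in> simple_types C" "Ss ! k \<in> iso_class C (Ss ! k)" if k: "k < length Ss" for k
    proof -
      have "simple_comodule C (Ss ! k)" using jh k by (simp add: jordan_hoelder_series_def)
      then show "iso_class C (Ss ! k) \<in> simple_types C" unfolding simple_types_def by blast
      show "Ss ! k \<in> iso_class C (Ss ! k)" by (rule iso_class_self[OF C jordan_hoelder_comodules(2)[OF M(1) jh k]])
    qed
    have pos: "0 < Poly_Mapping.lookup v (iso_class C (Ss ! k))" if k: "k < length Ss" for k
      unfolding v[OF ty(1)[OF k]] card_gt_0_iff using k ty(2)[OF k] by auto
    have "\<exists>\<kappa>. \<kappa> < n0 \<and> comod_iso C (Ss ! k) (Ts ! \<kappa>)" if k: "k < length Ss" for k
    proof -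
      have "{\<kappa>. \<kappa> < length Ts \<and> Ts ! \<kappa> \<in> iso_class C (Ss ! k)} \<noteq> {}"
        using pos[OF k] unfolding v0[OF ty(1)[OF k]] card_gt_0_iff by blast
      then show ?thesis unfolding iso_class_def n0_def by blast
    qed
    then have "\<forall>k. \<exists>\<kappa>. k < length Ss \<longrightarrow> \<kappa> < n0 \<and> comod_iso C (Ss ! k) (Ts ! \<kappa>)" by blast
    then obtain \<sigma> where \<sigma>: "\<forall>k. k < length Ss \<longrightarrow> \<sigma> k < n0 \<and> comod_iso C (Ss ! k) (Ts ! \<sigma> k)"
      unfolding choice_iff by (elim exE)
    \<comment> \<open>Each factor is counted in the entry of v at its own type.\<close>
    have "{..<length Ss} \<subseteq> (\<Union>i\<in>Poly_Mapping.keys v. {k. k < length Ss \<and> Ss ! k \<in> i})"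
      using ty(2) pos by (auto simp: in_keys_iff intro!: bexI)
    then have "card {..<length Ss} \<le> card (\<Union>i\<in>Poly_Mapping.keys v. {k. k < length Ss \<and> Ss ! k \<in> i})"
      by (intro card_mono) auto
    also have "\<dots> \<le> (\<Sum>i\<in>Poly_Mapping.keys v. card {k. k < length Ss \<and> Ss ! k \<in> i})"
      by (rule card_UN_le) simp
    also have "\<dots> = N"
      unfolding N_def using v M(2) unfolding has_dim_vector_def by (intro sum.cong) auto
    finally have len: "length Ss \<le> N" by simp
    obtain e X where X: "basis_fam (mscale M) (index_set a \<sigma> (length Ss)) e (mspace M)"
      "matrix_of C M (index_set a \<sigma> (length Ss)) e X" "adapted C n0 a A (length Ss) \<sigma> X"
      using ex_adapted[OF C M(1) jh, of n0 "\<lambda>\<kappa>. Ts ! \<kappa>" a u A \<sigma>] cT u A \<sigma> by blast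
    show ?thesis
    proof (rule matrix_supported_on[OF C H(1) M(1) X(1,2)])
      fix i j assume ij: "i \<in> index_set a \<sigma> (length Ss)" "j \<in> index_set a \<sigma> (length Ss)"
      have "(length Ss, \<sigma>, X) \<in> R" using len X(3) by (simp add: R_def)
      then have "X i j \<in> G" unfolding G_def using ij by (intro UN_I[of "(length Ss, \<sigma>, X)"] UN_I[of i] UN_I[of j]) (simp_all add: I_def Xr_def)
      then show "X i j \<in> cspace H" unfolding H(2) by (rule V.span_base)
    qed
  qed
  ultimately show ?thesis using H(1) by blast
qed

lemma tame_if_subcoalgebras_tame:
  fixes C :: "('k::field, 'c::ab_group_add) coalg"
  assumes inf: "infinite (UNIV :: 'k set)" and C: "coalgebra C"
    and tame: "\<And>H. subcoalgebra H C \<Longrightarrow> fin_dim (cscale H) (cspace H) \<Longrightarrow> tame H"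
  shows "tame C"
  unfolding tame_iff[of C]
proof (intro allI impI)
  fix v :: "('k, 'c) std_comod set \<Rightarrow>\<^sub>0 nat" assume "Poly_Mapping.keys v \<subseteq> simple_types C"
  show "\<exists>Ls. finite Ls \<and> (\<forall>(L, act)\<in>Ls. free_poly_comodule C L act) \<and> finite (exceptional C v Ls)"
  proof (cases "\<exists>M :: ('k, 'c) std_comod. comodule C M \<and> fin_dim (mscale M) (mspace M) \<and> has_dim_vector C M v")
    case False
    \<comment> \<open>Without a finite dimensional comodule of this vector there are no classes to
      cover.\<close>
    then have "exceptional C v {} = {}" unfolding exceptional_def using indecomposable_comodule by blast
    then show ?thesis by (intro exI[of _ "{}"]) simp
  next
    case True
    then obtain M0 :: "('k, 'c) std_comod" where M0: "comodule C M0" "fin_dim (mscale M0) (mspace M0)" "has_dim_vector C M0 v"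
      by blast
    obtain H where H: "subcoalgebra H C" "fin_dim (cscale H) (cspace H)"
      and supp: "\<And>M. comodule C M \<Longrightarrow> has_dim_vector C M v \<Longrightarrow> supported_on H M"
      using ex_supporting_subcoalgebra[OF inf C tame M0] by blast
    note h = subcoalgebra_basic[OF H(1)]
    obtain Ls where Ls: "finite Ls" "\<forall>(L, act)\<in>Ls. free_poly_comodule H L act" "finite (exceptional H (down_vec C H v) Ls)"
      using tame[OF H] keys_down_vec[OF C H(1), of v] unfolding tame_iff[of H] by blast
    \<comment> \<open>The families over \<open>H\<close> serve over \<open>C\<close> without
      change.\<close>
    have freeC: "free_poly_comodule C L act" if "(L, act) \<in> Ls" for L act
    proof -
      have L: "free_poly_comodule H L act" using Ls(2) that by blast
      show ?thesis
        by (rule free_poly_same[OF h(1) L C h(3)[symmetric] comodule_lift[OF C H(1) free_poly_basic(1)[OF L]] same_refl])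
    qed
    \<comment> \<open>Every comodule of vector v is supported on \<open>H\<close>, so an exceptional
      class over \<open>C\<close> is the enlargement of an exceptional class over
      \<open>H\<close>.\<close>
    have "exceptional C v Ls \<subseteq> up_class C ` exceptional H (down_vec C H v) Ls"
    proof
      fix Y assume "Y \<in> exceptional C v Ls"
      then obtain M where M: "Y = iso_class C M" "indecomposable_comodule C M" "fin_dim (mscale M) (mspace M)"
        "has_dim_vector C M v" "\<not> (\<exists>(L, act)\<in>Ls. \<exists>lam. iso_to_specialization C M L act lam)"
        unfolding exceptional_def by blast
      have cM: "comodule C M" by (rule indecomposable_comodule[OF M(2)])
      have sM: "supported_on H M" by (rule supp[OF cM M(4)])
      note cv = conv[OF C H(1) cM sM, unfolded h(3)]
      have sp: "mspace (conv H M) = mspace M" "mscale (conv H M) = mscale M" using cv(2) by (simp_all add: same_def)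
      have "indecomposable_comodule H (conv H M)"
        using indecomposable_same[OF C cM h(1) cv(1) h(3) cv(2)] M(2) by blast
      moreover have "fin_dim (mscale (conv H M)) (mspace (conv H M))" unfolding sp by (rule M(3))
      moreover have "has_dim_vector H (conv H M) (down_vec C H v)"
        by (rule has_dim_vector_down[OF C H(1) cM M(4) sM])
      moreover have "\<not> iso_to_specialization H (conv H M) L act lam" if L: "(L, act) \<in> Ls" for L act lam
      proof -
        have LH: "free_poly_comodule H L act" using Ls(2) L by blast
        show ?thesis
          using iso_to_specialization_same[OF C cM freeC[OF L] h(1) cv(1) free_poly_basic(1)[OF LH] h(3) cv(2) same_refl]
            M(5) L by blast
      qed
      ultimately have "iso_class H (conv H M) \<in> exceptional H (down_vec C H v) Ls"
        unfolding exceptional_def by blast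
      moreover have "Y = up_class C (iso_class H (conv H M))"
        unfolding up_iso_class[OF C H(1) cv(1)] M(1)
        using iso_class_same[OF C cM comodule_lift[OF C H(1) cv(1)] cv(2)] by simp
      ultimately show "Y \<in> up_class C ` exceptional H (down_vec C H v) Ls" by blast
    qed
    then have "finite (exceptional C v Ls)" using Ls(3) finite_subset by blast
    then show ?thesis using Ls(1) freeC by blast
  qed
qed

theorem lemma2p8:
  fixes C :: "('k::alg_closed_field, 'c::ab_group_add) coalg"
  assumes "coalgebra C"
  shows "tame C \<longleftrightarrow> (\<forall>H. subcoalgebra H C \<and> fin_dim (cscale H) (cspace H) \<longrightarrow> tame H)"
  using tame_subcoalgebra[OF assms] tame_if_subcoalgebras_tame[OF infinite_alg_closed_field assms] by blast

end
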